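(* Let $k$ be a field and let $\Gamma$ be a finite simplicial graph. Suppose that the Bestvina-Brady Lie algebra $\mathscr B_\Gamma$ over $k$ is a quadratic $1$-relator Lie algebra. Then $\mathscr B_\Gamma$ decomposes as the free product of an abelian Lie algebra of dimension $2$ and a free Lie algebra. In particular, the fundamental group of an orientable closed surface of genus $\geq 2$ is not isomorphic to a Bestvina-Brady group.
   Context: For a simplicial graph $\Gamma=(V,E)$, the RAAG Lie algebra $\mathscr L_\Gamma$ over $k$ is the graded Lie $k$-algebra with presentation $\langle v\in V\mid [v,w]\text{ for }\{v,w\}\in E\rangle$, generators in degree $1$. The Bestvina-Brady Lie algebra $\mathscr B_\Gamma$ is the kernel of the Lie algebra homomorphism $\mathscr L_\Gamma\to k$ sending every vertex to $1$. The right-angled Artin group $G_\Gamma$ is the group with the same presentation, and the Bestvina-Brady group $B_\Gamma$ is the kernel of the homomorphism $G_\Gamma\to\mathbb Z$ sending every vertex to $1$; a Bestvina-Brady group is a group isomorphic to some $B_\Gamma$. A quadratic $1$-relator Lie algebra is a graded Lie algebra having a presentation with finitely many generators of degree $1$ and a single (nonzero) homogeneous relation of degree $2$. Free product means coproduct in the category of graded Lie algebras. *)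

theory Defs
  imports "HOL-Analysis.Analysis" "HOL-Algebra.Module" "HOL-Algebra.AbelCoset"
    "HOL-Algebra.Elementary_Groups"
begin

section \<open>Graded Lie algebras over a field\<close>

definition field_ring :: "'k::field ring"
  where "field_ring = \<lparr>carrier = UNIV, monoid.mult = (*), one = 1, ring.zero = 0, ring.add = (+)\<rparr>"

text \<open>
  As for modules in HOL-Algebra, the multiplicative fields \<open>mult\<close> and \<open>one\<close> inherited from the
  ring record are not used.
\<close>

record ('k, 'a) graded_lie = "('k, 'a) module" +
  bracket :: "'a \<Rightarrow> 'a \<Rightarrow> 'a"
  deg :: "nat \<Rightarrow> 'a set"

locale graded_lie_algebra = module field_ring L
  for L :: "('k::field, 'a, 'm) graded_lie_scheme" (structure) +
  assumes bracket_closed: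
      "\<And>x y. \<lbrakk>x \<in> carrier L; y \<in> carrier L\<rbrakk> \<Longrightarrow> bracket L x y \<in> carrier L"
    and bracket_add_left:
      "\<And>x y z. \<lbrakk>x \<in> carrier L; y \<in> carrier L; z \<in> carrier L\<rbrakk> \<Longrightarrow>
        bracket L (x \<oplus> y) z = bracket L x z \<oplus> bracket L y z"
    and bracket_add_right:
      "\<And>x y z. \<lbrakk>x \<in> carrier L; y \<in> carrier L; z \<in> carrier L\<rbrakk> \<Longrightarrow>
        bracket L x (y \<oplus> z) = bracket L x y \<oplus> bracket L x z"
    and bracket_smult_left:
      "\<And>c x y. \<lbrakk>x \<in> carrier L; y \<in> carrier L\<rbrakk> \<Longrightarrow>
        bracket L (c \<odot>\<^bsub>L\<^esub> x) y = c \<odot>\<^bsub>L\<^esub> bracket L x y"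
    and bracket_smult_right:
      "\<And>c x y. \<lbrakk>x \<in> carrier L; y \<in> carrier L\<rbrakk> \<Longrightarrow>
        bracket L x (c \<odot>\<^bsub>L\<^esub> y) = c \<odot>\<^bsub>L\<^esub> bracket L x y"
    and bracket_self: "\<And>x. x \<in> carrier L \<Longrightarrow> bracket L x x = \<zero>"
    and jacobi:
      "\<And>x y z. \<lbrakk>x \<in> carrier L; y \<in> carrier L; z \<in> carrier L\<rbrakk> \<Longrightarrow>
        bracket L x (bracket L y z) \<oplus> (bracket L y (bracket L z x) \<oplus> bracket L z (bracket L x y)) = \<zero>"
    and deg_submodule: "\<And>n. submodule (deg L n) field_ring L"
    and deg_decomposition:
      "\<And>x. x \<in> carrier L \<Longrightarrow> \<exists>!f. (\<forall>n. f n \<in> deg L n) \<and> finite {n. f n \<noteq> \<zero>} \<and>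
        x = finsum L f {n. f n \<noteq> \<zero>}"
    and bracket_deg:
      "\<And>m n x y. \<lbrakk>x \<in> deg L m; y \<in> deg L n\<rbrakk> \<Longrightarrow> bracket L x y \<in> deg L (m + n)"

definition graded_lie_hom ::
    "('k, 'a, 'm) graded_lie_scheme \<Rightarrow> ('k, 'b, 'n) graded_lie_scheme \<Rightarrow> ('a \<Rightarrow> 'b) set"
  where "graded_lie_hom L M = {h. h \<in> carrier L \<rightarrow> carrier M \<and>
    (\<forall>x\<in>carrier L. \<forall>y\<in>carrier L. h (x \<oplus>\<^bsub>L\<^esub> y) = h x \<oplus>\<^bsub>M\<^esub> h y) \<and>
    (\<forall>c. \<forall>x\<in>carrier L. h (c \<odot>\<^bsub>L\<^esub> x) = c \<odot>\<^bsub>M\<^esub> h x) \<and>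
    (\<forall>x\<in>carrier L. \<forall>y\<in>carrier L. h (bracket L x y) = bracket M (h x) (h y)) \<and>
    (\<forall>n. h ` deg L n \<subseteq> deg M n)}"

definition graded_lie_iso ::
    "('k, 'a, 'm) graded_lie_scheme \<Rightarrow> ('k, 'b, 'n) graded_lie_scheme \<Rightarrow> bool"  (infix \<open>\<cong>\<^sub>L\<close> 50)
  where "L \<cong>\<^sub>L M \<longleftrightarrow> (\<exists>h\<in>graded_lie_hom L M.
    bij_betw h (carrier L) (carrier M) \<and> (\<forall>n. h ` deg L n = deg M n))"

definition abelian_lie :: "('k, 'a, 'm) graded_lie_scheme \<Rightarrow> bool"
  where "abelian_lie L \<longleftrightarrow> (\<forall>x\<in>carrier L. \<forall>y\<in>carrier L. bracket L x y = \<zero>\<^bsub>L\<^esub>)"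

definition lie_basis :: "('k::field, 'a, 'm) graded_lie_scheme \<Rightarrow> 'a set \<Rightarrow> bool"
  where "lie_basis L B \<longleftrightarrow> finite B \<and> B \<subseteq> carrier L \<and>
    (\<forall>x\<in>carrier L. \<exists>!c :: 'a \<Rightarrow> 'k. (\<forall>b. b \<notin> B \<longrightarrow> c b = 0) \<and> x = finsum L (\<lambda>b. c b \<odot>\<^bsub>L\<^esub> b) B)"

definition has_dimension :: "('k::field, 'a, 'm) graded_lie_scheme \<Rightarrow> nat \<Rightarrow> bool"
  where "has_dimension L n \<longleftrightarrow> (\<exists>B. lie_basis L B \<and> card B = n)"


section \<open>Presentations of graded Lie algebras\<close>

datatype (dead 'k, lie_gens: 'x) lie_term =
    LGen 'x
  | LZero
  | LAdd "('k, 'x) lie_term" "('k, 'x) lie_term"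
  | LSmul 'k "('k, 'x) lie_term"
  | LBr "('k, 'x) lie_term" "('k, 'x) lie_term"

definition lie_terms :: "'x set \<Rightarrow> ('k, 'x) lie_term set"
  where "lie_terms X = {t. lie_gens t \<subseteq> X}"

inductive homogeneous :: "('x \<Rightarrow> nat) \<Rightarrow> nat \<Rightarrow> ('k, 'x) lie_term \<Rightarrow> bool" for d where
  "homogeneous d (d x) (LGen x)"
| "homogeneous d n LZero"
| "homogeneous d n s \<Longrightarrow> homogeneous d n t \<Longrightarrow> homogeneous d n (LAdd s t)"
| "homogeneous d n t \<Longrightarrow> homogeneous d n (LSmul c t)"
| "homogeneous d m s \<Longrightarrow> homogeneous d n t \<Longrightarrow> homogeneous d (m + n) (LBr s t)"

text \<open>
  The least congruence on the terms over \<open>X\<close> that contains the axioms of Lie algebras and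
  identifies each relator in \<open>R\<close> with zero.
\<close>

inductive lie_eq ::
    "'x set \<Rightarrow> ('k::field, 'x) lie_term set \<Rightarrow> ('k, 'x) lie_term \<Rightarrow> ('k, 'x) lie_term \<Rightarrow> bool"
  for X R where
  refl: "t \<in> lie_terms X \<Longrightarrow> lie_eq X R t t"
| sym: "lie_eq X R s t \<Longrightarrow> lie_eq X R t s"
| trans: "lie_eq X R s t \<Longrightarrow> lie_eq X R t u \<Longrightarrow> lie_eq X R s u"
| add_cong: "lie_eq X R s s' \<Longrightarrow> lie_eq X R t t' \<Longrightarrow> lie_eq X R (LAdd s t) (LAdd s' t')"
| smul_cong: "lie_eq X R t t' \<Longrightarrow> lie_eq X R (LSmul c t) (LSmul c t')"
| br_cong: "lie_eq X R s s' \<Longrightarrow> lie_eq X R t t' \<Longrightarrow> lie_eq X R (LBr s t) (LBr s' t')"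
| add_assoc: "\<lbrakk>s \<in> lie_terms X; t \<in> lie_terms X; u \<in> lie_terms X\<rbrakk> \<Longrightarrow>
    lie_eq X R (LAdd (LAdd s t) u) (LAdd s (LAdd t u))"
| add_comm: "\<lbrakk>s \<in> lie_terms X; t \<in> lie_terms X\<rbrakk> \<Longrightarrow> lie_eq X R (LAdd s t) (LAdd t s)"
| add_zero: "t \<in> lie_terms X \<Longrightarrow> lie_eq X R (LAdd LZero t) t"
| add_neg: "t \<in> lie_terms X \<Longrightarrow> lie_eq X R (LAdd (LSmul (- 1) t) t) LZero"
| smul_add_right: "\<lbrakk>s \<in> lie_terms X; t \<in> lie_terms X\<rbrakk> \<Longrightarrow>
    lie_eq X R (LSmul c (LAdd s t)) (LAdd (LSmul c s) (LSmul c t))"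
| smul_add_left: "t \<in> lie_terms X \<Longrightarrow> lie_eq X R (LSmul (b + c) t) (LAdd (LSmul b t) (LSmul c t))"
| smul_smul: "t \<in> lie_terms X \<Longrightarrow> lie_eq X R (LSmul (b * c) t) (LSmul b (LSmul c t))"
| smul_one: "t \<in> lie_terms X \<Longrightarrow> lie_eq X R (LSmul 1 t) t"
| br_add_left: "\<lbrakk>s \<in> lie_terms X; t \<in> lie_terms X; u \<in> lie_terms X\<rbrakk> \<Longrightarrow>
    lie_eq X R (LBr (LAdd s t) u) (LAdd (LBr s u) (LBr t u))"
| br_add_right: "\<lbrakk>s \<in> lie_terms X; t \<in> lie_terms X; u \<in> lie_terms X\<rbrakk> \<Longrightarrow>
    lie_eq X R (LBr s (LAdd t u)) (LAdd (LBr s t) (LBr s u))"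
| br_smul_left: "\<lbrakk>s \<in> lie_terms X; t \<in> lie_terms X\<rbrakk> \<Longrightarrow>
    lie_eq X R (LBr (LSmul c s) t) (LSmul c (LBr s t))"
| br_smul_right: "\<lbrakk>s \<in> lie_terms X; t \<in> lie_terms X\<rbrakk> \<Longrightarrow>
    lie_eq X R (LBr s (LSmul c t)) (LSmul c (LBr s t))"
| br_self: "t \<in> lie_terms X \<Longrightarrow> lie_eq X R (LBr t t) LZero"
| br_jacobi: "\<lbrakk>s \<in> lie_terms X; t \<in> lie_terms X; u \<in> lie_terms X\<rbrakk> \<Longrightarrow>
    lie_eq X R (LAdd (LBr s (LBr t u)) (LAdd (LBr t (LBr u s)) (LBr u (LBr s t)))) LZero"
| relator: "\<lbrakk>r \<in> R; r \<in> lie_terms X\<rbrakk> \<Longrightarrow> lie_eq X R r LZero"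

definition lie_class ::
    "'x set \<Rightarrow> ('k::field, 'x) lie_term set \<Rightarrow> ('k, 'x) lie_term \<Rightarrow> ('k, 'x) lie_term set"
  where "lie_class X R t = {s. lie_eq X R t s}"

text \<open>
  The Lie algebra presented by generators \<open>X\<close>, the generator \<open>x\<close> having degree \<open>d x\<close>, and relators
  \<open>R\<close>. It is graded by \<open>deg\<close> provided that the relators are homogeneous.
\<close>

definition presented_lie ::
    "'x set \<Rightarrow> ('x \<Rightarrow> nat) \<Rightarrow> ('k::field, 'x) lie_term set \<Rightarrow> ('k, ('k, 'x) lie_term set) graded_lie"
  where "presented_lie X d R =
    \<lparr>carrier = lie_class X R ` lie_terms X,
     monoid.mult = undefined,
     one = undefined,
     ring.zero = lie_class X R LZero,
     ring.add = (\<lambda>A B. {u. \<exists>s\<in>A. \<exists>t\<in>B. lie_eq X R (LAdd s t) u}),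
     module.smult = (\<lambda>c A. {u. \<exists>t\<in>A. lie_eq X R (LSmul c t) u}),
     bracket = (\<lambda>A B. {u. \<exists>s\<in>A. \<exists>t\<in>B. lie_eq X R (LBr s t) u}),
     deg = (\<lambda>n. lie_class X R ` {t \<in> lie_terms X. homogeneous d n t})\<rparr>"

definition free_lie :: "'x set \<Rightarrow> ('k::field, ('k, 'x) lie_term set) graded_lie"
  where "free_lie X = presented_lie X (\<lambda>_. 1) {}"

text \<open>Natural numbers suffice as names for the finitely many generators.\<close>

definition quadratic_one_relator :: "('k::field, 'a, 'm) graded_lie_scheme \<Rightarrow> bool"
  where "quadratic_one_relator L \<longleftrightarrow> (\<exists>(X :: nat set) (r :: ('k, nat) lie_term).
    finite X \<and> r \<in> lie_terms X \<and> homogeneous (\<lambda>_. 1) 2 r \<and> \<not> lie_eq X {} r LZero \<and>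
    L \<cong>\<^sub>L presented_lie X (\<lambda>_. 1) {r})"


section \<open>Free products of graded Lie algebras\<close>

text \<open>
  The coproduct of \<open>A\<close> and \<open>B\<close> is generated by the homogeneous elements of \<open>A\<close> and of \<open>B\<close>, subject
  to all relations that hold in \<open>A\<close> or in \<open>B\<close>. As zero lies in every degree, a homogeneous element
  is paired with a degree.
\<close>

definition homogeneous_elements :: "('k, 'a, 'm) graded_lie_scheme \<Rightarrow> (nat \<times> 'a) set"
  where "homogeneous_elements L = {(n, x). x \<in> deg L n}"

definition lie_minus :: "('k::field, 'x) lie_term \<Rightarrow> ('k, 'x) lie_term \<Rightarrow> ('k, 'x) lie_term"
  where "lie_minus s t = LAdd s (LSmul (- 1) t)"

definition table_relators ::
    "(nat \<times> 'a \<Rightarrow> 'x) \<Rightarrow> ('k::field, 'a, 'm) graded_lie_scheme \<Rightarrow> ('k, 'x) lie_term set"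
  where "table_relators i L =
    {lie_minus (LAdd (LGen (i (n, x))) (LGen (i (n, y)))) (LGen (i (n, x \<oplus>\<^bsub>L\<^esub> y))) | n x y.
       x \<in> deg L n \<and> y \<in> deg L n} \<union>
    {lie_minus (LSmul c (LGen (i (n, x)))) (LGen (i (n, c \<odot>\<^bsub>L\<^esub> x))) | c n x. x \<in> deg L n} \<union>
    {lie_minus (LBr (LGen (i (m, x))) (LGen (i (n, y)))) (LGen (i (m + n, bracket L x y))) | m n x y.
       x \<in> deg L m \<and> y \<in> deg L n}"

definition free_product_gens ::
    "('k, 'a, 'm) graded_lie_scheme \<Rightarrow> ('k, 'b, 'n) graded_lie_scheme \<Rightarrow> (nat \<times> 'a + nat \<times> 'b) set"
  where "free_product_gens A B = homogeneous_elements A <+> homogeneous_elements B"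

definition free_product_relators ::
    "('k::field, 'a, 'm) graded_lie_scheme \<Rightarrow> ('k, 'b, 'n) graded_lie_scheme \<Rightarrow>
      ('k, nat \<times> 'a + nat \<times> 'b) lie_term set"
  where "free_product_relators A B = table_relators Inl A \<union> table_relators Inr B"

definition free_product ::
    "('k::field, 'a, 'm) graded_lie_scheme \<Rightarrow> ('k, 'b, 'n) graded_lie_scheme \<Rightarrow>
      ('k, ('k, nat \<times> 'a + nat \<times> 'b) lie_term set) graded_lie"
  where "free_product A B =
    presented_lie (free_product_gens A B) (case_sum fst fst) (free_product_relators A B)"


section \<open>RAAG Lie algebras and Bestvina-Brady Lie algebras\<close>

definition simplicial_graph :: "'v set \<Rightarrow> 'v set set \<Rightarrow> bool"
  where "simplicial_graph V E \<longleftrightarrow> (\<forall>e\<in>E. e \<subseteq> V \<and> card e = 2)"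

definition raag_lie_relators :: "'v set set \<Rightarrow> ('k, 'v) lie_term set"
  where "raag_lie_relators E = {LBr (LGen v) (LGen w) | v w. {v, w} \<in> E}"

definition raag_lie :: "'v set \<Rightarrow> 'v set set \<Rightarrow> ('k::field, ('k, 'v) lie_term set) graded_lie"
  where "raag_lie V E = presented_lie V (\<lambda>_. 1) (raag_lie_relators E)"

text \<open>The ground field as an abelian Lie algebra concentrated in degree \<open>1\<close>.\<close>

definition ground_lie :: "('k::field, 'k) graded_lie"
  where "ground_lie =
    \<lparr>carrier = UNIV, monoid.mult = undefined, one = undefined, ring.zero = 0, ring.add = (+), module.smult = (*),
     bracket = (\<lambda>_ _. 0), deg = (\<lambda>n. if n = 1 then UNIV else {0})\<rparr>"

definition bb_lie_hom :: "'v set \<Rightarrow> 'v set set \<Rightarrow> ('k::field, 'v) lie_term set \<Rightarrow> 'k"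
  where "bb_lie_hom V E = (SOME h. h \<in> graded_lie_hom (raag_lie V E) ground_lie \<and>
    (\<forall>v\<in>V. h (lie_class V (raag_lie_relators E) (LGen v)) = 1))"

definition bb_lie :: "'v set \<Rightarrow> 'v set set \<Rightarrow> ('k::field, ('k, 'v) lie_term set) graded_lie"
  where "bb_lie V E =
    (let L = raag_lie V E; K = a_kernel L ground_lie (bb_lie_hom V E)
     in L\<lparr>carrier := K, deg := (\<lambda>n. deg L n \<inter> K)\<rparr>)"


section \<open>Right-angled Artin groups and Bestvina-Brady groups\<close>

text \<open>The letter \<open>(x, True)\<close> stands for the generator \<open>x\<close>, and \<open>(x, False)\<close> for its inverse.\<close>

inductive word_eq ::
    "'x set \<Rightarrow> ('x \<times> bool) list set \<Rightarrow> ('x \<times> bool) list \<Rightarrow> ('x \<times> bool) list \<Rightarrow> bool"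
  for X R where
  "w \<in> lists (X \<times> UNIV) \<Longrightarrow> word_eq X R w w"
| "word_eq X R u v \<Longrightarrow> word_eq X R v u"
| "word_eq X R u v \<Longrightarrow> word_eq X R v w \<Longrightarrow> word_eq X R u w"
| "\<lbrakk>u \<in> lists (X \<times> UNIV); v \<in> lists (X \<times> UNIV); x \<in> X\<rbrakk> \<Longrightarrow>
    word_eq X R (u @ [(x, b), (x, \<not> b)] @ v) (u @ v)"
| "\<lbrakk>u \<in> lists (X \<times> UNIV); v \<in> lists (X \<times> UNIV); r \<in> R; r \<in> lists (X \<times> UNIV)\<rbrakk> \<Longrightarrow>
    word_eq X R (u @ r @ v) (u @ v)"

definition word_class ::
    "'x set \<Rightarrow> ('x \<times> bool) list set \<Rightarrow> ('x \<times> bool) list \<Rightarrow> ('x \<times> bool) list set"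
  where "word_class X R w = {u. word_eq X R w u}"

definition presented_group :: "'x set \<Rightarrow> ('x \<times> bool) list set \<Rightarrow> ('x \<times> bool) list set monoid"
  where "presented_group X R =
    \<lparr>carrier = word_class X R ` lists (X \<times> UNIV),
     monoid.mult = (\<lambda>A B. {w. \<exists>u\<in>A. \<exists>v\<in>B. word_eq X R (u @ v) w}),
     one = word_class X R []\<rparr>"

definition raag_relators :: "'v set set \<Rightarrow> ('v \<times> bool) list set"
  where "raag_relators E =
    {[(v, True), (w, True), (v, False), (w, False)] | v w. {v, w} \<in> E}"

definition raag :: "'v set \<Rightarrow> 'v set set \<Rightarrow> ('v \<times> bool) list set monoid"
  where "raag V E = presented_group V (raag_relators E)"

definition bb_hom :: "'v set \<Rightarrow> 'v set set \<Rightarrow> ('v \<times> bool) list set \<Rightarrow> int"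
  where "bb_hom V E = (SOME h. h \<in> hom (raag V E) integer_group \<and>
    (\<forall>v\<in>V. h (word_class V (raag_relators E) [(v, True)]) = 1))"

definition bb_group :: "'v set \<Rightarrow> 'v set set \<Rightarrow> ('v \<times> bool) list set monoid"
  where "bb_group V E =
    (raag V E)\<lparr>carrier := kernel (raag V E) integer_group (bb_hom V E)\<rparr>"


section \<open>Fundamental groups of orientable closed surfaces\<close>

definition loops :: "'a topology \<Rightarrow> 'a \<Rightarrow> (real \<Rightarrow> 'a) set"
  where "loops S x = {p. pathin S p \<and> p 0 = x \<and> p 1 = x}"

definition loop_homotopic :: "'a topology \<Rightarrow> 'a \<Rightarrow> (real \<Rightarrow> 'a) \<Rightarrow> (real \<Rightarrow> 'a) \<Rightarrow> bool"
  where "loop_homotopic S x = homotopic_with (\<lambda>p. p 0 = x \<and> p 1 = x) (top_of_set {0..1}) S"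

definition loop_class :: "'a topology \<Rightarrow> 'a \<Rightarrow> (real \<Rightarrow> 'a) \<Rightarrow> (real \<Rightarrow> 'a) set"
  where "loop_class S x p = {q. loop_homotopic S x p q}"

text \<open>The same formula as \<open>joinpaths\<close>, which is restricted to types of class \<open>topological_space\<close>.\<close>

definition loop_join :: "(real \<Rightarrow> 'a) \<Rightarrow> (real \<Rightarrow> 'a) \<Rightarrow> real \<Rightarrow> 'a"
  where "loop_join p q = (\<lambda>t. if t \<le> 1/2 then p (2 * t) else q (2 * t - 1))"

definition fundamental_group :: "'a topology \<Rightarrow> 'a \<Rightarrow> (real \<Rightarrow> 'a) set monoid"
  where "fundamental_group S x =
    \<lparr>carrier = loop_class S x ` loops S x,
     monoid.mult = (\<lambda>A B. {r. \<exists>p\<in>A. \<exists>q\<in>B. loop_homotopic S x (loop_join p q) r}),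
     one = loop_class S x (\<lambda>_. x)\<rparr>"

text \<open>
  The orientable closed surface of genus \<open>g \<ge> 1\<close> is obtained from a disc whose boundary is divided
  into \<open>4 * g\<close> sides by identifying sides according to the word
  \<open>a\<^sub>1 b\<^sub>1 a\<^sub>1\<inverse> b\<^sub>1\<inverse> \<dots> a\<^sub>g b\<^sub>g a\<^sub>g\<inverse> b\<^sub>g\<inverse>\<close>.
\<close>

definition side :: "nat \<Rightarrow> nat \<Rightarrow> real \<Rightarrow> complex"
  where "side g j t = cis (2 * pi * (real j + t) / real (4 * g))"

definition side_glue :: "nat \<Rightarrow> complex \<Rightarrow> complex \<Rightarrow> bool"
  where "side_glue g z w \<longleftrightarrow> (\<exists>i<g. \<exists>t\<in>{0..1}.
    z = side g (4 * i) t \<and> w = side g (4 * i + 2) (1 - t) \<or>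
    z = side g (4 * i + 1) t \<and> w = side g (4 * i + 3) (1 - t))"

definition orientable_closed_surface :: "nat \<Rightarrow> 'a topology \<Rightarrow> bool"
  where "orientable_closed_surface g S \<longleftrightarrow> (\<exists>q :: complex \<Rightarrow> 'a.
    quotient_map (top_of_set (cball 0 1)) S q \<and>
    (\<forall>z\<in>cball 0 1. \<forall>w\<in>cball 0 1. q z = q w \<longleftrightarrow> equivclp (side_glue g) z w))"


section \<open>Universal properties\<close>

primrec lie_eval :: "('k, 'a, 'm) graded_lie_scheme \<Rightarrow> ('x \<Rightarrow> 'a) \<Rightarrow> ('k, 'x) lie_term \<Rightarrow> 'a" where
  "lie_eval M f (LGen x) = f x"
| "lie_eval M f LZero = \<zero>\<^bsub>M\<^esub>"
| "lie_eval M f (LAdd s t) = lie_eval M f s \<oplus>\<^bsub>M\<^esub> lie_eval M f t"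
| "lie_eval M f (LSmul c t) = c \<odot>\<^bsub>M\<^esub> lie_eval M f t"
| "lie_eval M f (LBr s t) = bracket M (lie_eval M f s) (lie_eval M f t)"

lemma lie_terms_simps [simp]:
  "LGen x \<in> lie_terms X \<longleftrightarrow> x \<in> X"
  "LZero \<in> lie_terms X"
  "LAdd s t \<in> lie_terms X \<longleftrightarrow> s \<in> lie_terms X \<and> t \<in> lie_terms X"
  "LSmul c t \<in> lie_terms X \<longleftrightarrow> t \<in> lie_terms X"
  "LBr s t \<in> lie_terms X \<longleftrightarrow> s \<in> lie_terms X \<and> t \<in> lie_terms X"
  by (auto simp: lie_terms_def)

lemma lie_eq_terms: "lie_eq X R s t \<Longrightarrow> s \<in> lie_terms X \<and> t \<in> lie_terms X"
  by (induction rule: lie_eq.induct) auto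

lemma lie_class_eq_iff:
  assumes "s \<in> lie_terms X"
  shows "lie_class X R s = lie_class X R t \<longleftrightarrow> lie_eq X R s t"
proof
  assume "lie_class X R s = lie_class X R t"
  then have "s \<in> lie_class X R t"
    using lie_eq.refl[OF assms] by (auto simp: lie_class_def)
  then show "lie_eq X R s t"
    by (auto simp: lie_class_def intro: lie_eq.sym)
next
  assume "lie_eq X R s t"
  then show "lie_class X R s = lie_class X R t"
    unfolding lie_class_def by (blast intro: lie_eq.sym lie_eq.trans)
qed

lemma field_ring_simps [simp]:
  "carrier field_ring = UNIV" "\<one>\<^bsub>field_ring\<^esub> = 1" "\<zero>\<^bsub>field_ring\<^esub> = 0"
  "a \<oplus>\<^bsub>field_ring\<^esub> b = a + b" "a \<otimes>\<^bsub>field_ring\<^esub> b = a * b"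
  by (simp_all add: field_ring_def)

lemma presented_lie_class:
  assumes "s \<in> lie_terms X" "t \<in> lie_terms X"
  shows "lie_class X R s \<oplus>\<^bsub>presented_lie X d R\<^esub> lie_class X R t = lie_class X R (LAdd s t)"
    and "c \<odot>\<^bsub>presented_lie X d R\<^esub> lie_class X R t = lie_class X R (LSmul c t)"
    and "bracket (presented_lie X d R) (lie_class X R s) (lie_class X R t) = lie_class X R (LBr s t)"
proof -
  note r = lie_eq.refl[OF assms(1), of R] lie_eq.refl[OF assms(2), of R]
  show "lie_class X R s \<oplus>\<^bsub>presented_lie X d R\<^esub> lie_class X R t = lie_class X R (LAdd s t)"
    using r by (auto simp: presented_lie_def lie_class_def intro: lie_eq.trans lie_eq.add_cong)
  show "c \<odot>\<^bsub>presented_lie X d R\<^esub> lie_class X R t = lie_class X R (LSmul c t)"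
    using r by (auto simp: presented_lie_def lie_class_def intro: lie_eq.trans lie_eq.smul_cong)
  show "bracket (presented_lie X d R) (lie_class X R s) (lie_class X R t) = lie_class X R (LBr s t)"
    using r by (auto simp: presented_lie_def lie_class_def intro: lie_eq.trans lie_eq.br_cong)
qed

lemma presented_lie_carrier:
  "carrier (presented_lie X d R) = lie_class X R ` lie_terms X"
  "deg (presented_lie X d R) n = lie_class X R ` {t \<in> lie_terms X. homogeneous d n t}"
  by (simp_all add: presented_lie_def)

context graded_lie_algebra
begin

lemma deg_carrier: "x \<in> deg L n \<Longrightarrow> x \<in> carrier L"
  using submodule.axioms(1)[OF deg_submodule, THEN subgroup.subset] by auto

lemma lie_eval_closed:
  assumes "f \<in> X \<rightarrow> carrier L" "t \<in> lie_terms X"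
  shows "lie_eval L f t \<in> carrier L"
  using assms(2)
proof (induction t)
  case (LSmul c t)
  then show ?case using smult_closed[of c "lie_eval L f t"] by simp
qed (use assms(1) in \<open>auto intro: bracket_closed\<close>)

lemma smult_minus_one: "x \<in> carrier L \<Longrightarrow> (- 1) \<odot>\<^bsub>L\<^esub> x \<oplus> x = \<zero>"
  using smult_l_distr[of "-1" 1 x] smult_one[of x] smult_l_null[of x] by simp

lemma lie_eval_eq:
  assumes f: "f \<in> X \<rightarrow> carrier L"
    and R: "\<And>r. r \<in> R \<Longrightarrow> r \<in> lie_terms X \<Longrightarrow> lie_eval L f r = \<zero>"
    and "lie_eq X R s t"
  shows "lie_eval L f s = lie_eval L f t"
  using assms(3)
proof (induction rule: lie_eq.induct)
  case (smul_add_right s t c)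
  then show ?case
    using smult_r_distr[of c "lie_eval L f s" "lie_eval L f t"] lie_eval_closed[OF f] by simp
next
  case (smul_add_left t b c)
  then show ?case
    using smult_l_distr[of b c "lie_eval L f t"] lie_eval_closed[OF f] by simp
next
  case (smul_smul t b c)
  then show ?case
    using smult_assoc1[of b c "lie_eval L f t"] lie_eval_closed[OF f] by simp
next
  case (smul_one t)
  then show ?case
    using smult_one[of "lie_eval L f t"] lie_eval_closed[OF f] by simp
next
  case (relator r)
  then show ?case using R by simp
next
  case (add_comm s t)
  then show ?case by (simp add: lie_eval_closed[OF f] a_comm)
qed (simp_all add: lie_eval_closed[OF f] a_assoc smult_minus_one bracket_add_left
      bracket_add_right bracket_smult_left bracket_smult_right bracket_self jacobi)

lemma lie_eval_deg:
  assumes f: "\<And>x. x \<in> X \<Longrightarrow> f x \<in> deg L (d x)" and "homogeneous d n t" "t \<in> lie_terms X"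
  shows "lie_eval L f t \<in> deg L n"
  using assms(2,3)
proof (induction rule: homogeneous.induct)
  case (2 n)
  show ?case
    using submodule.axioms(1)[OF deg_submodule, THEN subgroup.one_closed] by simp
next
  case (3 n s t)
  then show ?case
    using submodule.axioms(1)[OF deg_submodule, THEN subgroup.m_closed] by simp
next
  case (4 n t c)
  then show ?case
    using submodule.smult_closed[OF deg_submodule] by simp
qed (auto intro: f bracket_deg)

text \<open>The universal property of a presentation.\<close>

theorem presented_lie_universal:
  assumes f: "\<And>x. x \<in> X \<Longrightarrow> f x \<in> deg L (d x)"
    and R: "\<And>r. r \<in> R \<Longrightarrow> r \<in> lie_terms X \<Longrightarrow> lie_eval L f r = \<zero>"
  shows "\<exists>h \<in> graded_lie_hom (presented_lie X d R) L. \<forall>x\<in>X. h (lie_class X R (LGen x)) = f x"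
proof -
  have fc: "f \<in> X \<rightarrow> carrier L" using f deg_carrier by blast
  define h where "h = (\<lambda>A. lie_eval L f (SOME t. t \<in> A))"
  have h: "h (lie_class X R t) = lie_eval L f t" if "t \<in> lie_terms X" for t
  proof -
    have "t \<in> lie_class X R t" using lie_eq.refl[OF that] by (simp add: lie_class_def)
    then have "(SOME s. s \<in> lie_class X R t) \<in> lie_class X R t" by (rule someI)
    then show ?thesis
      using lie_eval_eq[OF fc R] by (simp add: h_def lie_class_def)
  qed
  have "h \<in> graded_lie_hom (presented_lie X d R) L"
    unfolding graded_lie_hom_def
    by (auto simp: presented_lie_carrier presented_lie_class h lie_eval_closed[OF fc]
        intro: lie_eval_deg[OF f])
  moreover have "\<forall>x\<in>X. h (lie_class X R (LGen x)) = f x" by (simp add: h)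
  ultimately show ?thesis by blast
qed

lemma presented_lie_hom_eval:
  assumes h: "h \<in> graded_lie_hom (presented_lie X d R) L"
    and t: "t \<in> lie_terms X"
  shows "h (lie_class X R t) = lie_eval L (\<lambda>x. h (lie_class X R (LGen x))) t"
  using t
proof (induction t)
  case LZero
  let ?P = "presented_lie X d R"
  have "lie_eq X R (LSmul 0 LZero) (LAdd (LSmul (-1) LZero) (LSmul 1 LZero))"
    using lie_eq.smul_add_left[of LZero X R "-1" 1] by simp
  moreover have "lie_eq X R (LAdd (LSmul (-1) LZero) (LSmul 1 LZero)) (LAdd (LSmul (-1) LZero) LZero)"
    by (intro lie_eq.add_cong lie_eq.refl lie_eq.smul_one) auto
  moreover have "lie_eq X R (LAdd (LSmul (-1) LZero) LZero) LZero"
    by (simp add: lie_eq.add_neg)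
  ultimately have "lie_eq X R (LSmul 0 LZero) LZero" by (blast intro: lie_eq.trans)
  then have z: "lie_class X R LZero = 0 \<odot>\<^bsub>?P\<^esub> lie_class X R LZero"
    by (simp add: presented_lie_class(2)[OF lie_terms_simps(2) lie_terms_simps(2)] lie_class_eq_iff lie_eq.sym)
  have c: "lie_class X R LZero \<in> carrier ?P"
    by (simp add: presented_lie_carrier)
  have "h (0 \<odot>\<^bsub>?P\<^esub> lie_class X R LZero) = 0 \<odot> h (lie_class X R LZero)"
    "h (lie_class X R LZero) \<in> carrier L"
    using h c by (auto simp: graded_lie_hom_def)
  with z show ?case using smult_l_null by simp
next
  case (LAdd s t)
  then have "h (lie_class X R s \<oplus>\<^bsub>presented_lie X d R\<^esub> lie_class X R t) =
      h (lie_class X R s) \<oplus> h (lie_class X R t)"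
    using h by (simp add: graded_lie_hom_def presented_lie_carrier)
  with LAdd show ?case by (simp add: presented_lie_class)
next
  case (LSmul c t)
  then have "h (c \<odot>\<^bsub>presented_lie X d R\<^esub> lie_class X R t) = c \<odot>\<^bsub>L\<^esub> h (lie_class X R t)"
    using h by (simp add: graded_lie_hom_def presented_lie_carrier)
  with LSmul show ?case by (simp add: presented_lie_class)
next
  case (LBr s t)
  then have "h (bracket (presented_lie X d R) (lie_class X R s) (lie_class X R t)) =
      bracket L (h (lie_class X R s)) (h (lie_class X R t))"
    using h by (simp add: graded_lie_hom_def presented_lie_carrier)
  with LBr show ?case by (simp add: presented_lie_class)
qed simp

lemma lie_eval_cong:
  "t \<in> lie_terms X \<Longrightarrow> (\<And>x. x \<in> X \<Longrightarrow> f x = g x) \<Longrightarrow> lie_eval L f t = lie_eval L g t"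
  by (induction t) auto

theorem presented_lie_hom_unique:
  assumes "g \<in> graded_lie_hom (presented_lie X d R) L"
    and "h \<in> graded_lie_hom (presented_lie X d R) L"
    and "\<And>x. x \<in> X \<Longrightarrow> g (lie_class X R (LGen x)) = h (lie_class X R (LGen x))"
    and "A \<in> carrier (presented_lie X d R)"
  shows "g A = h A"
proof -
  obtain t where t: "t \<in> lie_terms X" "A = lie_class X R t"
    using assms(4) by (auto simp: presented_lie_carrier)
  show ?thesis
    unfolding t(2) presented_lie_hom_eval[OF assms(1) t(1)] presented_lie_hom_eval[OF assms(2) t(1)]
    by (rule lie_eval_cong[OF t(1) assms(3)])
qed

lemma table_relators_zero:
  assumes h: "h \<in> graded_lie_hom A L" and A: "graded_lie_algebra A"
    and f: "\<And>n a. a \<in> deg A n \<Longrightarrow> f (i (n, a)) = h a"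
    and r: "r \<in> table_relators i A"
  shows "lie_eval L f r = \<zero>"
proof -
  interpret A: graded_lie_algebra A by (fact A)
  have minus: "x \<oplus> (- 1) \<odot>\<^bsub>L\<^esub> x = \<zero>" if "x \<in> carrier L" for x
    using smult_minus_one[OF that] smult_closed[of "-1" x] that by (simp add: a_comm)
  have hc: "h a \<in> carrier L" if "a \<in> deg A n" for a n
    using h A.deg_carrier[OF that] by (auto simp: graded_lie_hom_def)
  have add: "x \<oplus>\<^bsub>A\<^esub> y \<in> deg A n" if "x \<in> deg A n" "y \<in> deg A n" for x y n
    using submodule.axioms(1)[OF A.deg_submodule, THEN subgroup.m_closed] that by simp
  have smul: "c \<odot>\<^bsub>A\<^esub> x \<in> deg A n" if "x \<in> deg A n" for c x n
    using submodule.smult_closed[OF A.deg_submodule] that by simp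
  have "h (x \<oplus>\<^bsub>A\<^esub> y) = h x \<oplus> h y" "h (c \<odot>\<^bsub>A\<^esub> x) = c \<odot>\<^bsub>L\<^esub> h x"
    "h (bracket A x y) = bracket L (h x) (h y)" if "x \<in> deg A m" "y \<in> deg A n" for c x y m n
    using h A.deg_carrier that by (auto simp: graded_lie_hom_def)
  note hom = this
  show ?thesis
    using r unfolding table_relators_def lie_minus_def
  proof (elim UnE CollectE exE conjE, goal_cases)
    case (1 n x y)
    then show ?thesis
      by (simp add: f add hom(1)[symmetric] minus hc[OF add])
  next
    case (2 c n x)
    then show ?thesis
      by (simp add: f smul hom(2)[symmetric] minus hc[OF smul])
  next
    case (3 m n x y)
    then show ?thesis
      by (simp add: f A.bracket_deg hom(3)[symmetric] minus hc[OF A.bracket_deg])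
  qed
qed

text \<open>The universal property of the free product.\<close>

theorem free_product_universal:
  assumes A: "graded_lie_algebra A" and B: "graded_lie_algebra B"
    and f: "f \<in> graded_lie_hom A L" and g: "g \<in> graded_lie_hom B L"
  shows "\<exists>h \<in> graded_lie_hom (free_product A B) L.
    (\<forall>n. \<forall>a\<in>deg A n.
      h (lie_class (free_product_gens A B) (free_product_relators A B) (LGen (Inl (n, a)))) = f a) \<and>
    (\<forall>n. \<forall>b\<in>deg B n.
      h (lie_class (free_product_gens A B) (free_product_relators A B) (LGen (Inr (n, b)))) = g b)"
proof -
  let ?F = "case_sum (f \<circ> snd) (g \<circ> snd)"
  have "\<exists>h \<in> graded_lie_hom (free_product A B) L. \<forall>x\<in>free_product_gens A B.
      h (lie_class (free_product_gens A B) (free_product_relators A B) (LGen x)) = ?F x"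
    unfolding free_product_def
  proof (rule presented_lie_universal)
    show "?F x \<in> deg L (case_sum fst fst x)" if "x \<in> free_product_gens A B" for x
    proof -
      have "f ` deg A n \<subseteq> deg L n" "g ` deg B n \<subseteq> deg L n" for n
        using f g by (auto simp: graded_lie_hom_def)
      then show ?thesis
        using that unfolding free_product_gens_def homogeneous_elements_def by fastforce
    qed
    show "lie_eval L ?F r = \<zero>" if "r \<in> free_product_relators A B" for r
      using that table_relators_zero[OF f A, of ?F Inl] table_relators_zero[OF g B, of ?F Inr]
      by (auto simp: free_product_relators_def)
  qed
  then obtain h where h: "h \<in> graded_lie_hom (free_product A B) L"
    and F: "\<And>x. x \<in> free_product_gens A B \<Longrightarrow>
      h (lie_class (free_product_gens A B) (free_product_relators A B) (LGen x)) = ?F x"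
    by blast
  have "Inl (n, a) \<in> free_product_gens A B" if "a \<in> deg A n" for n a
    using that by (auto simp: free_product_gens_def homogeneous_elements_def)
  moreover have "Inr (n, b) \<in> free_product_gens A B" if "b \<in> deg B n" for n b
    using that by (auto simp: free_product_gens_def homogeneous_elements_def)
  ultimately show ?thesis
    using F by (intro bexI[OF _ h]) simp
qed

end

lemma cring_field_ring: "cring (field_ring :: 'k::field ring)"
proof (rule cringI)
  show "abelian_group (field_ring :: 'k ring)"
  proof (rule abelian_groupI)
    fix x :: 'k
    have "\<exists>y. y + x = 0"
      by (rule exI[of _ "- x"]) simp
    then show "\<exists>y\<in>carrier field_ring. y \<oplus>\<^bsub>field_ring\<^esub> x = \<zero>\<^bsub>field_ring\<^esub>"
      by simp
  qed (simp_all add: add.assoc add.commute)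
  show "comm_monoid (field_ring :: 'k ring)"
    by (rule comm_monoidI) (simp_all add: mult.assoc mult.commute)
qed (simp add: distrib_right)

lemma ground_lie_simps:
  "carrier ground_lie = UNIV" "\<zero>\<^bsub>ground_lie\<^esub> = 0" "x \<oplus>\<^bsub>ground_lie\<^esub> y = x + y"
  "x \<odot>\<^bsub>ground_lie\<^esub> y = x * y" "bracket ground_lie x y = 0"
  "deg ground_lie n = (if n = 1 then UNIV else {0})"
  by (simp_all add: ground_lie_def)

lemma abelian_group_ground: "abelian_group (ground_lie :: ('k::field, 'k) graded_lie)"
proof (rule abelian_groupI)
  fix x :: 'k
  have "\<exists>y. y + x = 0"
    by (rule exI[of _ "- x"]) simp
  then show "\<exists>y\<in>carrier ground_lie. y \<oplus>\<^bsub>ground_lie\<^esub> x = \<zero>\<^bsub>ground_lie :: ('k, 'k) graded_lie\<^esub>"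
    by (simp add: ground_lie_simps)
qed (simp_all add: ground_lie_simps add.assoc add.commute)

lemma module_ground: "Module.module field_ring (ground_lie :: ('k::field, 'k) graded_lie)"
  using cring_field_ring abelian_group_ground
  by (intro Module.module.intro Module.module_axioms.intro)
    (simp_all add: ground_lie_simps distrib_left distrib_right)

lemma finsum_ground:
  assumes "\<And>n. n \<noteq> 1 \<Longrightarrow> f n = 0"
  shows "finsum (ground_lie :: ('k::field, 'k) graded_lie) f {n::nat. f n \<noteq> 0} = f 1"
proof -
  interpret abelian_group "ground_lie :: ('k, 'k) graded_lie"
    by (fact abelian_group_ground)
  show ?thesis
  proof (cases "f 1 = 0")
    case True
    then have "f n = 0" for n
      using assms[of n] by (cases "n = 1") auto
    then show ?thesis by (simp add: ground_lie_simps)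
  next
    case False
    then have "{n. f n \<noteq> 0} = {1}"
      using assms by blast
    moreover have "finsum (ground_lie :: ('k, 'k) graded_lie) f {1} = f 1"
      using finsum_insert[of "{}" 1 f] by (simp add: ground_lie_simps)
    ultimately show ?thesis by simp
  qed
qed

lemma graded_lie_algebra_ground: "graded_lie_algebra (ground_lie :: ('k::field, 'k) graded_lie)"
proof (intro graded_lie_algebra.intro graded_lie_algebra_axioms.intro module_ground)
  fix n
  have neg: "\<ominus>\<^bsub>ground_lie\<^esub> x = - x" for x :: 'k
    by (rule abelian_group.minus_equality[OF abelian_group_ground]) (simp_all add: ground_lie_simps)
  show "submodule (deg ground_lie n) field_ring (ground_lie :: ('k, 'k) graded_lie)"
    by (rule Module.module.submoduleI[OF module_ground])
      (simp_all add: ground_lie_simps neg split: if_splits)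
next
  fix x :: 'k
  show "\<exists>!f. (\<forall>n. f n \<in> deg (ground_lie :: ('k, 'k) graded_lie) n) \<and>
      finite {n. f n \<noteq> \<zero>\<^bsub>ground_lie :: ('k, 'k) graded_lie\<^esub>} \<and>
      x = finsum (ground_lie :: ('k, 'k) graded_lie) f {n. f n \<noteq> \<zero>\<^bsub>ground_lie :: ('k, 'k) graded_lie\<^esub>}"
    (is "\<exists>!f. ?P f")
  proof (rule ex1I)
    let ?f = "\<lambda>n::nat. if n = 1 then x else 0"
    have "finite {n. ?f n \<noteq> 0}" by (rule finite_subset[of _ "{1}"]) auto
    then show "?P ?f"
      using finsum_ground[of ?f] by (simp add: ground_lie_simps)
    fix f assume P: "?P f"
    then have z: "f n = 0" if "n \<noteq> 1" for n
      using that by (auto simp: ground_lie_simps split: if_splits) 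
    then have "x = f 1"
      using P finsum_ground[of f] by (simp add: ground_lie_simps)
    then show "f = ?f" using z by auto
  qed
qed (simp_all add: ground_lie_simps split: if_splits)
text \<open>The homomorphisms chosen in \<open>bb_lie_hom_def\<close> and \<open>bb_hom_def\<close> exist.\<close>

theorem bb_lie_hom:
  shows "bb_lie_hom V E \<in> graded_lie_hom (raag_lie V E) (ground_lie :: ('k::field, 'k) graded_lie)"
    and "v \<in> V \<Longrightarrow> bb_lie_hom V E (lie_class V (raag_lie_relators E) (LGen v)) = (1 :: 'k)"
proof -
  interpret K: graded_lie_algebra "ground_lie :: ('k, 'k) graded_lie"
    by (fact graded_lie_algebra_ground)
  have "\<exists>h \<in> graded_lie_hom (raag_lie V E) (ground_lie :: ('k, 'k) graded_lie).
      \<forall>v\<in>V. h (lie_class V (raag_lie_relators E) (LGen v)) = 1"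
    unfolding raag_lie_def
    by (rule K.presented_lie_universal) (auto simp: raag_lie_relators_def ground_lie_simps)
  then have "\<exists>h. h \<in> graded_lie_hom (raag_lie V E) (ground_lie :: ('k, 'k) graded_lie) \<and>
      (\<forall>v\<in>V. h (lie_class V (raag_lie_relators E) (LGen v)) = 1)"
    by blast
  from someI_ex[OF this]
  show "bb_lie_hom V E \<in> graded_lie_hom (raag_lie V E) (ground_lie :: ('k, 'k) graded_lie)"
    and "v \<in> V \<Longrightarrow> bb_lie_hom V E (lie_class V (raag_lie_relators E) (LGen v)) = (1 :: 'k)"
    unfolding bb_lie_hom_def by auto
qed

primrec exponent_sum :: "('x \<times> bool) list \<Rightarrow> int" where
  "exponent_sum [] = 0"
| "exponent_sum (l # w) = (if snd l then 1 else - 1) + exponent_sum w"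

lemma exponent_sum_append [simp]: "exponent_sum (u @ v) = exponent_sum u + exponent_sum v"
  by (induction u) auto

theorem bb_hom:
  fixes V :: "'v set"
  shows "bb_hom V E \<in> hom (raag V E) integer_group"
    and "v \<in> V \<Longrightarrow> bb_hom V E (word_class V (raag_relators E) [(v, True)]) = 1"
proof -
  define R where "R = raag_relators E"
  have R: "word_eq V R u v \<Longrightarrow> exponent_sum u = exponent_sum v" for u v
    by (induction rule: word_eq.induct) (auto simp: R_def raag_relators_def)
  define h where "h = (\<lambda>A. exponent_sum (SOME w :: ('v \<times> bool) list. w \<in> A))"
  have mem: "w \<in> word_class V R w" if "w \<in> lists (V \<times> UNIV)" for w
    using word_eq.intros(1)[OF that] by (simp add: word_class_def)
  have h: "h A = exponent_sum w" if "w \<in> A" "\<And>u. u \<in> A \<Longrightarrow> exponent_sum u = exponent_sum w" for A w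
    unfolding h_def by (rule that(2), rule someI, rule that(1))
  have hw: "h (word_class V R w) = exponent_sum w" if "w \<in> lists (V \<times> UNIV)" for w
  proof (rule h[OF mem[OF that]])
    fix u assume "u \<in> word_class V R w"
    then have "word_eq V R w u" by (simp add: word_class_def)
    from R[OF this] show "exponent_sum u = exponent_sum w" by simp
  qed
  have "h \<in> hom (raag V E) integer_group"
  proof (rule homI)
    fix A B
    assume "A \<in> carrier (raag V E)" "B \<in> carrier (raag V E)"
    then obtain u v where uv: "A = word_class V R u" "B = word_class V R v"
      "u \<in> lists (V \<times> UNIV)" "v \<in> lists (V \<times> UNIV)"
      by (auto simp: raag_def presented_group_def R_def[symmetric])
    have "h (A \<otimes>\<^bsub>raag V E\<^esub> B) = exponent_sum (u @ v)"
    proof (rule h)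
      have "u @ v \<in> lists (V \<times> UNIV)" using uv by simp
      then have "word_eq V R (u @ v) (u @ v)" by (rule word_eq.intros(1))
      then show "u @ v \<in> A \<otimes>\<^bsub>raag V E\<^esub> B"
        using mem[OF uv(3)] mem[OF uv(4)] uv(1,2)
        by (simp add: raag_def presented_group_def R_def[symmetric]) blast
    next
      fix w assume "w \<in> A \<otimes>\<^bsub>raag V E\<^esub> B"
      then obtain u' v' where "word_eq V R u u'" "word_eq V R v v'" "word_eq V R (u' @ v') w"
        by (auto simp: raag_def presented_group_def uv word_class_def R_def[symmetric])
      then show "exponent_sum w = exponent_sum (u @ v)"
        using R[of u u'] R[of v v'] R[of "u' @ v'" w] by simp
    qed
    then show "h (A \<otimes>\<^bsub>raag V E\<^esub> B) = h A \<otimes>\<^bsub>integer_group\<^esub> h B"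
      using uv hw by (simp add: integer_group_def)
  qed (simp add: integer_group_def)
  moreover have "\<forall>v\<in>V. h (word_class V R [(v, True)]) = 1"
    using hw by simp
  ultimately have "\<exists>h. h \<in> hom (raag V E) integer_group \<and>
      (\<forall>v\<in>V. h (word_class V (raag_relators E) [(v, True)]) = 1)"
    unfolding R_def by blast
  from someI_ex[OF this] show "bb_hom V E \<in> hom (raag V E) integer_group"
    and "v \<in> V \<Longrightarrow> bb_hom V E (word_class V (raag_relators E) [(v, True)]) = 1"
    unfolding bb_hom_def by auto
qed

end

theory Submission
  imports Defs
begin

text \<open>
  In degree \<open>1\<close> the quadratic relator (for a surface group: the product of commutators) becomes an
  alternating form \<open>Q\<close>. Evaluating it on the functionals dual to the vertices gives an antisymmetric
  matrix that is supported on the edges, since non-adjacent vertices generate a free algebra, and has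
  zero row sums, since the generators lie in the kernel. It is not zero, so its support contains a
  cycle \<open>v\<^sub>0, \<dots>, v\<^sub>m\<^sub>-\<^sub>1\<close> of \<open>\<Gamma>\<close>. The elements \<open>p\<^sub>i = v\<^sub>i - v\<^sub>0\<close> of the kernel satisfy
  \<open>\<Sum>\<^sub>i [p\<^sub>i, p\<^sub>i\<^sub>+\<^sub>1] = 0\<close>, and as this is a consequence of the relator, evaluation in Heisenberg
  algebras shows that \<open>Q\<close> is a multiple of the form \<open>K\<close> defined by this sum. Bracketing with \<open>v\<^sub>0\<close>
  yields a relation of degree \<open>3\<close>, which for \<open>m \<ge> 4\<close> fails in a representation by strictly upper
  triangular matrices of size \<open>4\<close>. Hence \<open>m = 3\<close> and \<open>K\<close>, so also \<open>Q\<close>, is decomposable. The relator is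
  therefore a multiple of \<open>[\<xi>, \<eta>]\<close> with \<open>\<xi>\<close>, \<open>\<eta>\<close> linear, and a linear substitution splits off the
  abelian Lie algebra spanned by \<open>\<xi>\<close> and \<open>\<eta>\<close>. For groups the powers of the words
  \<open>v\<^sub>i v\<^sub>i\<^sub>+\<^sub>1\<inverse>\<close> play the role of the \<open>p\<^sub>i\<close>, and \<open>Q\<close> has rank \<open>2 g \<ge> 4\<close>, so it is not decomposable.

  All that is needed about the fundamental group of a surface is its set of homomorphisms into a group:
  they correspond to labels of the corners of the polygon that are compatible with the identification
  of sides. Such labels extend to a locally constant holonomy, which can be lifted along paths and
  homotopies.
\<close>

section \<open>Path homotopy in abstract topologies\<close>

text \<open>All relations used in the kernel come from cycles: adjacent x, y commute, so (x y^-1)^n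
  = x^n y^-n, and these quotients telescope around a cycle. A homomorphism is only partly known on
  the x y^-1. The cases n = 1 and n = -1 together cancel the unknown central coordinate in a
  Heisenberg group, and n = 2 supplies the further equations used in \<open>ut4\<close>. The targets
  match the obstructions: abelian groups see H^1, Heisenberg groups see cup products (two copies
  with one centre compare two of them), and 4 by 4 matrices see triple Massey products. On a cycle
  of length at least 4 there are three classes with vanishing products and nonzero triple product,
  whereas a single relator of degree 2 puts no obstruction in the way of the triple. In the group
  case the graph may be infinite and nothing is graded. Finite generation then forces the graph to
  be connected, and connectedness makes every rational homomorphism of the kernel extend to the
  right-angled Artin group, so it is given by values at vertices. In the Lie case the grading gives
  this: degree 1 of the kernel is spanned by differences of vertices.\<close>

definition path_htpy :: "'a topology \<Rightarrow> (real \<Rightarrow> 'a) \<Rightarrow> (real \<Rightarrow> 'a) \<Rightarrow> bool"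
  where "path_htpy S p q \<longleftrightarrow>
    homotopic_with (\<lambda>r. r 0 = p 0 \<and> r 1 = p 1) (top_of_set {0..1}) S p q"

definition rev_path :: "(real \<Rightarrow> 'a) \<Rightarrow> real \<Rightarrow> 'a"
  where "rev_path p = (\<lambda>t. p (1 - t))"

lemma loop_homotopic_iff_path_htpy:
  "p 0 = x \<Longrightarrow> p 1 = x \<Longrightarrow> loop_homotopic S x p q \<longleftrightarrow> path_htpy S p q"
  by (simp add: loop_homotopic_def path_htpy_def)

lemma path_htpy_ends:
  assumes "path_htpy S p q"
  shows "q 0 = p 0" "q 1 = p 1" "pathin S p" "pathin S q"
  using homotopic_with_imp_property[OF assms[unfolded path_htpy_def]]
    homotopic_with_imp_continuous_maps[OF assms[unfolded path_htpy_def]]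
  by (auto simp: pathin_def)

lemma path_htpy_refl: "pathin S p \<Longrightarrow> path_htpy S p p"
  by (simp add: path_htpy_def pathin_def)

lemma path_htpy_sym: "path_htpy S p q \<Longrightarrow> path_htpy S q p"
  using path_htpy_ends[of S p q] by (simp add: path_htpy_def homotopic_with_sym)

lemma path_htpy_trans [trans]: "path_htpy S p q \<Longrightarrow> path_htpy S q r \<Longrightarrow> path_htpy S p r"
  using path_htpy_ends[of S p q] by (auto simp: path_htpy_def elim: homotopic_with_trans)

lemma path_htpy_eq:
  assumes "pathin S p" "\<And>t. t \<in> {0..1} \<Longrightarrow> p t = q t"
  shows "path_htpy S p q"
  unfolding path_htpy_def
  by (rule homotopic_with_equal) (use assms in \<open>auto simp: pathin_def\<close>)

text \<open>The straight-line homotopy in \<open>K\<close>, pushed forward along \<open>Q\<close>.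
  Reparametrisation, cancellation, paths in the disc and the square of a contraction are all
  instances, with \<open>K\<close> an interval, the disc or a square.\<close>

lemma path_htpy_convex:
  fixes \<phi> \<psi> :: "real \<Rightarrow> 'b::real_normed_vector"
  assumes Q: "continuous_map (top_of_set K) S Q" and "convex K"
    and "path \<phi>" "path \<psi>" "path_image \<phi> \<subseteq> K" "path_image \<psi> \<subseteq> K" "\<phi> 0 = \<psi> 0" "\<phi> 1 = \<psi> 1"
  shows "path_htpy S (Q \<circ> \<phi>) (Q \<circ> \<psi>)"
proof -
  have "closed_segment (\<phi> t) (\<psi> t) \<subseteq> K" if "t \<in> {0..1}" for t
    using that assms by (intro closed_segment_subset) (auto simp: path_image_def)
  then have "homotopic_paths K \<phi> \<psi>"
    by (rule homotopic_paths_linear[rotated -1])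
      (use assms in \<open>auto simp: pathstart_def pathfinish_def\<close>)
  then show ?thesis
    unfolding path_htpy_def homotopic_paths_def
    by (rule homotopic_with_compose_continuous_map_left[OF _ Q])
      (auto simp: pathstart_def pathfinish_def)
qed

lemma pathin_comp:
  assumes "continuous_map (top_of_set K) S Q" "path \<phi>" "path_image \<phi> \<subseteq> K"
  shows "pathin S (Q \<circ> \<phi>)"
  unfolding pathin_def
  by (rule continuous_map_compose[OF _ assms(1)])
    (use assms in \<open>auto simp: path_def path_image_def\<close>)

text \<open>Concatenation of two families of paths indexed by \<open>A\<close>. With the homotopy
  parameter as index it shows that joining respects homotopy.\<close>

lemma continuous_map_halves:
  fixes F :: "real \<times> real \<Rightarrow> 'a"
  assumes "continuous_map (top_of_set (A \<times> {0..1})) S F" "continuous_map (top_of_set (A \<times> {0..1})) S G"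
    and "\<And>x. x \<in> A \<Longrightarrow> F (x, 1) = G (x, 0)"
  shows "continuous_map (top_of_set (A \<times> {0..1})) S
    (\<lambda>x. if snd x \<le> 1/2 then F (fst x, 2 * snd x) else G (fst x, 2 * snd x - 1))"
proof (rule continuous_map_cases_le)
  let ?X = "top_of_set (A \<times> {0..1::real})"
  show "continuous_map ?X euclideanreal snd" "continuous_map ?X euclideanreal (\<lambda>x. 1/2)"
    by (auto intro: continuous_intros)
  have 1: "continuous_map (top_of_set (A \<times> {0..1/2})) (top_of_set (A \<times> {0..1::real}))
      (\<lambda>x. (fst x, 2 * snd x))"
    by (auto intro!: continuous_intros)
  have 2: "continuous_map (top_of_set (A \<times> {1/2..1})) (top_of_set (A \<times> {0..1::real}))
      (\<lambda>x. (fst x, 2 * snd x - 1))"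
    by (auto intro!: continuous_intros)
  have e: "subtopology ?X {x \<in> topspace ?X. snd x \<le> 1/2} = top_of_set (A \<times> {0..1/2})"
    "subtopology ?X {x \<in> topspace ?X. 1/2 \<le> snd x} = top_of_set (A \<times> {1/2..1})"
    by (auto simp: subtopology_subtopology intro!: arg_cong[where f = "subtopology euclidean"])
  show "continuous_map (subtopology ?X {x \<in> topspace ?X. snd x \<le> 1/2}) S (\<lambda>x. F (fst x, 2 * snd x))"
    unfolding e using continuous_map_compose[OF 1 assms(1)] by (simp add: o_def)
  show "continuous_map (subtopology ?X {x \<in> topspace ?X. 1/2 \<le> snd x}) S (\<lambda>x. G (fst x, 2 * snd x - 1))"
    unfolding e using continuous_map_compose[OF 2 assms(2)] by (simp add: o_def)
  fix x assume "x \<in> topspace (top_of_set (A \<times> {0..1::real}))" "snd x = 1/2"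
  then show "F (fst x, 2 * snd x) = G (fst x, 2 * snd x - 1)"
    using assms(3)[of "fst x"] by (cases x) (simp add: mult.commute[of 2])
qed

lemma path_htpy_join:
  assumes p: "path_htpy S p p'" and q: "path_htpy S q q'" and pq: "p 1 = q 0"
  shows "path_htpy S (loop_join p q) (loop_join p' q')"
proof -
  obtain F :: "real \<times> real \<Rightarrow> 'a" where F: "continuous_map (top_of_set ({0..1} \<times> {0..1})) S F" "\<And>t. F (0, t) = p t" "\<And>t. F (1, t) = p' t"
    "\<And>s. s \<in> {0..1} \<Longrightarrow> F (s, 0) = p 0 \<and> F (s, 1) = p 1"
    using p unfolding path_htpy_def homotopic_with_def prod_topology_subtopology_eu by auto
  obtain G :: "real \<times> real \<Rightarrow> 'a" where G: "continuous_map (top_of_set ({0..1} \<times> {0..1})) S G" "\<And>t. G (0, t) = q t" "\<And>t. G (1, t) = q' t"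
    "\<And>s. s \<in> {0..1} \<Longrightarrow> G (s, 0) = q 0 \<and> G (s, 1) = q 1"
    using q unfolding path_htpy_def homotopic_with_def prod_topology_subtopology_eu by auto
  note [simp] = path_htpy_ends(1,2)[OF p] path_htpy_ends(1,2)[OF q] pq
  let ?H = "\<lambda>x. if snd x \<le> 1/2 then F (fst x, 2 * snd x) else G (fst x, 2 * snd x - 1)"
  have "continuous_map (top_of_set ({0..1} \<times> {0..1})) S ?H"
    by (rule continuous_map_halves) (use F G in auto)
  then show ?thesis
    unfolding path_htpy_def homotopic_with_def prod_topology_subtopology_eu
    by (intro exI[of _ ?H]) (use F G in \<open>auto simp: loop_join_def\<close>)
qed

lemma pathin_loop_join:
  assumes "pathin S p" "pathin S q" "p 1 = q 0"
  shows "pathin S (loop_join p q)"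
  using path_htpy_ends(3)[OF path_htpy_join[OF path_htpy_refl path_htpy_refl]] assms by blast

lemma loop_join_ends [simp]: "loop_join p q 0 = p 0" "loop_join p q 1 = q 1"
  by (auto simp: loop_join_def)

lemma rev_path_ends [simp]: "rev_path p 0 = p 1" "rev_path p 1 = p 0" "rev_path (rev_path p) = p"
  by (auto simp: rev_path_def)

lemma path_htpy_reparam:
  assumes p: "pathin S p" and "path \<phi>" "path_image \<phi> \<subseteq> {0..1}" "\<phi> 0 = 0" "\<phi> 1 = 1"
    and q: "\<And>t. t \<in> {0..1} \<Longrightarrow> q t = p (\<phi> t)"
  shows "path_htpy S q p"
proof -
  have Q: "continuous_map (top_of_set {0..1}) S p" using p by (simp add: pathin_def)
  have "path_htpy S (p \<circ> \<phi>) (p \<circ> id)"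
    by (rule path_htpy_convex[OF Q]) (use assms in \<open>auto simp: path_def path_image_def\<close>)
  moreover have "path_htpy S (p \<circ> \<phi>) q"
    by (rule path_htpy_eq) (use q pathin_comp[OF Q assms(2,3)] in auto)
  ultimately show ?thesis using path_htpy_trans path_htpy_sym by fastforce
qed

lemma path_htpy_assoc:
  assumes "pathin S p" "pathin S q" "pathin S r" "p 1 = q 0" "q 1 = r 0"
  shows "path_htpy S (loop_join (loop_join p q) r) (loop_join p (loop_join q r))"
proof (rule path_htpy_reparam)
  \<comment> \<open>Maps the pieces [0,1/4], [1/4,1/2], [1/2,1] on which the left side runs through
    \<open>p\<close>, \<open>q\<close>, \<open>r\<close> affinely onto the pieces [0,1/2],
    [1/2,3/4], [3/4,1] of the right side.\<close>
  let ?f = "\<lambda>t::real. if t \<le> 1/2 then (if t \<le> 1/4 then 2 * t else t + 1/4) else (t + 1) / 2"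
  show "path ?f"
    unfolding path_def by (intro continuous_on_cases_le continuous_intros) auto
  show "loop_join (loop_join p q) r t = loop_join p (loop_join q r) (?f t)" if "t \<in> {0..1}" for t
  proof -
    consider "t \<le> 1/4" | "1/4 < t" "t \<le> 1/2" | "1/2 < t" by linarith
    then show ?thesis
    proof cases
      case 2
      then have "2 * (2 * t) - 1 = 2 * (2 * (t + 1/4) - 1 / 2) - 1" "\<not> 2 * t \<le> 1/2"
        "\<not> t + 1/4 \<le> 1/2" "2 * (t + 1/4) - 1 \<le> 1/2" by auto
      moreover have "2 * (2 * (t + 1/4) - 1) = 2 * (2 * t) - 1" by simp
      ultimately show ?thesis using 2 by (simp add: loop_join_def)
    next
      case 3
      then have f: "?f t = (t + 1) / 2" and n: "\<not> t \<le> 1/2" "\<not> (t + 1) / 2 \<le> 1/2" by auto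
      have e: "2 * ((t + 1) / 2) - 1 = t" by (simp add: field_simps)
      show ?thesis unfolding f unfolding loop_join_def e using n by simp
    qed (simp add: loop_join_def)
  qed
qed (use assms in \<open>auto intro!: pathin_loop_join simp: path_image_def\<close>)

lemma path_htpy_rid:
  assumes "pathin S p" shows "path_htpy S (loop_join p (\<lambda>_. p 1)) p"
  using assms
proof (rule path_htpy_reparam)
  let ?f = "\<lambda>t::real. min 1 (2 * t)"
  show "path ?f" unfolding path_def by (intro continuous_intros)
  show "loop_join p (\<lambda>_. p 1) t = p (?f t)" if "t \<in> {0..1}" for t
  proof (cases "t \<le> 1/2")
    case False
    then have "?f t = 1" by auto
    with False show ?thesis by (simp add: loop_join_def)
  next
    case True
    then have "?f t = 2 * t" by auto
    with True show ?thesis by (simp add: loop_join_def)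
  qed
qed (auto simp: path_image_def)

lemma path_htpy_lid:
  assumes "pathin S p" shows "path_htpy S (loop_join (\<lambda>_. p 0) p) p"
  using assms
proof (rule path_htpy_reparam)
  let ?f = "\<lambda>t::real. max 0 (2 * t - 1)"
  show "path ?f" unfolding path_def by (intro continuous_intros)
  show "loop_join (\<lambda>_. p 0) p t = p (?f t)" if "t \<in> {0..1}" for t
  proof (cases "t \<le> 1/2")
    case True
    then have "?f t = 0" by auto
    with True show ?thesis by (simp add: loop_join_def)
  qed (auto simp: loop_join_def)
qed (auto simp: path_image_def)

lemma pathin_rev:
  assumes "pathin S p" shows "pathin S (rev_path p)"
proof -
  have "pathin S (p \<circ> (\<lambda>t. 1 - t))"
    by (rule pathin_comp[of "{0..1}"])
      (use assms in \<open>auto simp: pathin_def path_def path_image_def intro!: continuous_intros\<close>)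
  then show ?thesis by (simp add: rev_path_def o_def)
qed

lemma path_htpy_inv:
  assumes "pathin S p" shows "path_htpy S (loop_join p (rev_path p)) (\<lambda>_. p 0)"
proof -
  have Q: "continuous_map (top_of_set {0..1}) S p" using assms by (simp add: pathin_def)
  \<comment> \<open>Out and back in the parameter interval: a loop at 0, contracted inside the
    interval.\<close>
  let ?f = "\<lambda>t::real. if t \<le> 1/2 then 2 * t else 2 - 2 * t"
  have f: "path ?f" unfolding path_def by (intro continuous_on_cases_le continuous_intros) auto
  have "path_htpy S (p \<circ> ?f) (p \<circ> (\<lambda>_. 0))"
    by (rule path_htpy_convex[OF Q]) (use f in \<open>auto simp: path_image_def path_def\<close>)
  moreover have "loop_join p (rev_path p) = p \<circ> ?f"
    by (auto simp: loop_join_def rev_path_def fun_eq_iff)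
  ultimately show ?thesis by (simp add: o_def)
qed

lemma path_htpy_cancel:
  assumes "pathin S p" "pathin S g" "pathin S q" "p 1 = g 0" "g 0 = q 0"
  shows "path_htpy S (loop_join (loop_join p g) (loop_join (rev_path g) q)) (loop_join p q)"
proof -
  note [intro!] = pathin_loop_join pathin_rev path_htpy_refl path_htpy_join
  have g0: "pathin S (\<lambda>_. q 0)"
    using path_htpy_ends(4)[OF path_htpy_inv[OF assms(2)]] assms by simp
  have "path_htpy S (loop_join (loop_join p g) (loop_join (rev_path g) q))
      (loop_join p (loop_join g (loop_join (rev_path g) q)))"
    by (rule path_htpy_assoc) (use assms in auto)
  also have "path_htpy S \<dots> (loop_join p (loop_join (loop_join g (rev_path g)) q))"
    by (intro path_htpy_join path_htpy_refl path_htpy_sym[OF path_htpy_assoc]) (use assms in auto)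
  also have "path_htpy S \<dots> (loop_join p (loop_join (\<lambda>_. q 0) q))"
    by (intro path_htpy_join path_htpy_refl) (use assms path_htpy_inv[OF assms(2)] in auto)
  also have "path_htpy S \<dots> (loop_join p q)"
    by (intro path_htpy_join path_htpy_refl path_htpy_lid) (use assms in auto)
  finally show ?thesis .
qed

section \<open>Holonomy\<close>

text \<open>\<open>h s v\<close> is the transition of a flat bundle from \<open>s\<close> to a
  nearby \<open>v\<close>. The group is written additively but need not be commutative.
  \<open>B\<close> depends on \<open>u\<close> because \<open>h u v\<close> carries meaning only for
  \<open>v\<close> close to \<open>u\<close>.\<close>

locale flat_structure =
  fixes S :: "'a topology" and h :: "'a \<Rightarrow> 'a \<Rightarrow> 'n::group_add"
  assumes flat: "s \<in> topspace S \<Longrightarrow> \<exists>U. openin S U \<and> s \<in> U \<and>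
    (\<forall>u\<in>U. \<exists>B. openin S B \<and> u \<in> B \<and> (\<forall>v\<in>B. h s v = h s u + h u v))"
begin

text \<open>A flat section of the bundle pulled back along \<open>P\<close>: close to each point,
  its increments on the right are the transitions. Left translations therefore preserve
  lifts.\<close>

definition is_lift :: "'b::metric_space set \<Rightarrow> ('b \<Rightarrow> 'a) \<Rightarrow> ('b \<Rightarrow> 'n) \<Rightarrow> bool"
  where "is_lift T P l \<longleftrightarrow>
    (\<forall>a\<in>T. \<exists>d>0. \<forall>b\<in>T. dist b a < d \<longrightarrow> l b = l a + h (P a) (P b))"

lemma h_self:
  assumes "s \<in> topspace S" shows "h s s = 0"
proof -
  obtain U where "s \<in> U" and U: "\<forall>u\<in>U. \<exists>B. openin S B \<and> u \<in> B \<and> (\<forall>v\<in>B. h s v = h s u + h u v)"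
    using flat[OF assms] by (elim exE conjE) (rule that)
  then obtain B where "s \<in> B" and B: "\<forall>v\<in>B. h s v = h s s + h s v"
    using bspec[OF U \<open>s \<in> U\<close>] by (elim exE conjE) (rule that)
  have "h s s + 0 = h s s + h s s"
    by (rule HOL.trans[OF add_0_right bspec[OF B \<open>s \<in> B\<close>]])
  then show ?thesis unfolding add_left_cancel by (rule HOL.sym)
qed

text \<open>The increments act from the right, so they cancel in the difference
  \<open>l x - m x\<close>, which is locally constant.\<close>

lemma lift_unique:
  assumes "connected T" "is_lift T P l" "is_lift T P m" "a \<in> T" "b \<in> T"
  shows "l a - m a = l b - m b"
proof (rule connected_local_const[where f = "\<lambda>x. l x - m x", OF assms(1,4,5)], intro ballI)
  fix x assume x: "x \<in> T"
  obtain d e where d: "d > 0" "\<And>b. b \<in> T \<Longrightarrow> dist b x < d \<Longrightarrow> l b = l x + h (P x) (P b)"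
    and e: "e > 0" "\<And>b. b \<in> T \<Longrightarrow> dist b x < e \<Longrightarrow> m b = m x + h (P x) (P b)"
    using bspec[OF assms(2)[unfolded is_lift_def] x] bspec[OF assms(3)[unfolded is_lift_def] x]
    by (elim exE conjE) (rule that, assumption, drule (1) bspec, drule (1) mp, assumption+,
        drule (1) bspec, drule (1) mp)
  have "l x - m x = l b - m b" if "b \<in> T" "dist b x < min d e" for b
  proof -
    have "l b - m b = (l x + h (P x) (P b)) - (m x + h (P x) (P b))"
      using d(2)[of b] e(2)[of b] that by (simp only: min_less_iff_conj)
    then show ?thesis by (simp only: diff_conv_add_uminus minus_add add.assoc add_minus_cancel)
  qed
  then show "\<forall>\<^sub>F b in at x within T. l x - m x = l b - m b"
    unfolding eventually_at using d(1) e(1) by (intro exI[of _ "min d e"]) auto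
qed

lemma lift_add: "is_lift T P l \<Longrightarrow> is_lift T P (\<lambda>x. c + l x)"
  unfolding is_lift_def by (simp add: add.assoc)

lemma lift_compose:
  assumes l: "is_lift T P l" and f: "continuous_on T' f" "f ` T' \<subseteq> T"
  shows "is_lift T' (P \<circ> f) (l \<circ> f)"
  unfolding is_lift_def o_apply
proof
  fix a assume a: "a \<in> T'"
  then have "f a \<in> T" using f(2) by auto
  from bspec[OF l[unfolded is_lift_def] this] obtain d where d: "d > 0"
    "\<forall>b\<in>T. dist b (f a) < d \<longrightarrow> l b = l (f a) + h (P (f a)) (P b)"
    by (elim exE conjE) (rule that)
  obtain e where e: "e > 0" "\<And>b. b \<in> T' \<Longrightarrow> dist b a < e \<Longrightarrow> dist (f b) (f a) < d"
    using f(1) a d(1) unfolding continuous_on_iff by metis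
  show "\<exists>d>0. \<forall>b\<in>T'. dist b a < d \<longrightarrow> l (f b) = l (f a) + h (P (f a)) (P (f b))"
    by (intro exI[of _ e] conjI ballI impI e(1) d(2)[rule_format] e(2)) (use f(2) in auto)
qed

lemma lift_cong:
  assumes "is_lift T P l" "\<And>x. x \<in> T \<Longrightarrow> P x = Q x" "\<And>x. x \<in> T \<Longrightarrow> l x = m x"
  shows "is_lift T Q m"
  using assms unfolding is_lift_def by metis

lemma lift_subset: "is_lift T' P l \<Longrightarrow> T \<subseteq> T' \<Longrightarrow> is_lift T P l"
  unfolding is_lift_def by (meson subsetD)

text \<open>Closedness is what makes the pieces fit: a point outside one piece has a ball that
  misses it, so only pieces through the point impose a condition.\<close>

lemma lift_glue:
  assumes 1: "is_lift T1 P l" and 2: "is_lift T2 P m" and cl: "closed T1" "closed T2"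
    and eq: "\<And>x. x \<in> T1 \<Longrightarrow> x \<in> T2 \<Longrightarrow> l x = m x"
  shows "is_lift (T1 \<union> T2) P (\<lambda>x. if x \<in> T1 then l x else m x)" (is "is_lift _ _ ?l")
  unfolding is_lift_def
proof
  fix a assume a: "a \<in> T1 \<union> T2"
  define Q where "Q b \<longleftrightarrow> ?l b = ?l a + h (P a) (P b)" for b
  have *: "\<exists>d>0. \<forall>b\<in>T. dist b a < d \<longrightarrow> Q b" if T: "closed T" "is_lift T P ?l" for T
  proof (cases "a \<in> T")
    case True
    from bspec[OF T(2)[unfolded is_lift_def] this] show ?thesis unfolding Q_def .
  next
    case False
    then obtain d where "d > 0" "ball a d \<subseteq> - T"
      using T(1) by (metis ComplI open_Compl open_contains_ball)
    then show ?thesis by (intro exI[of _ d]) (auto simp: subset_eq dist_commute)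
  qed
  have "is_lift T1 P ?l" by (rule lift_cong[OF 1]) auto
  moreover have "is_lift T2 P ?l" by (rule lift_cong[OF 2]) (use eq in auto)
  ultimately obtain d1 d2 where d: "d1 > 0" "d2 > 0"
    "\<forall>b\<in>T1. dist b a < d1 \<longrightarrow> Q b" "\<forall>b\<in>T2. dist b a < d2 \<longrightarrow> Q b"
    using *[OF cl(1)] *[OF cl(2)] by blast
  have "\<exists>d>0. \<forall>b\<in>T1 \<union> T2. dist b a < d \<longrightarrow> Q b"
    by (rule exI[of _ "min d1 d2"]) (use d in auto)
  then show "\<exists>d>0. \<forall>b\<in>T1 \<union> T2. dist b a < d \<longrightarrow> ?l b = ?l a + h (P a) (P b)"
    unfolding Q_def .
qed

text \<open>On a connected overlap two lifts differ by one constant on the left, and translating the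
  second by it makes them agree.\<close>

lemma lift_exists_glue:
  assumes l: "is_lift T1 P l" and m: "is_lift T2 P m" and cl: "closed T1" "closed T2"
    and con: "connected (T1 \<inter> T2)"
  shows "\<exists>l. is_lift (T1 \<union> T2) P l"
proof (cases "T1 \<inter> T2 = {}")
  case True
  with lift_glue[OF l m cl] show ?thesis by blast
next
  case False
  then obtain a where a: "a \<in> T1 \<inter> T2" by blast
  define m' where "m' = (\<lambda>x. (l a - m a) + m x)"
  have "is_lift T2 P m'" unfolding m'_def by (rule lift_add[OF m])
  moreover have "l x = m' x" if "x \<in> T1" "x \<in> T2" for x
    using lift_unique[OF con lift_subset[OF l] lift_subset[OF m] a, of x] that by (simp add: m'_def)
  ultimately show ?thesis using lift_glue[OF l _ cl] by blast
qed

lemma lift_local: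
  assumes P: "continuous_map (top_of_set T) S P" and a: "a \<in> T"
  shows "\<exists>d>0. \<exists>l. is_lift (T \<inter> ball a d) P l"
proof -
  have near: "\<exists>d>0. \<forall>b\<in>T. dist b x < d \<longrightarrow> P b \<in> U" if "openin S U" "P x \<in> U" "x \<in> T" for x U
  proof -
    have "openin (top_of_set T) {y \<in> T. P y \<in> U}"
      using openin_continuous_map_preimage[OF P that(1)] by simp
    then show ?thesis using that unfolding openin_euclidean_subtopology_iff by force
  qed
  have PS: "P x \<in> topspace S" if "x \<in> T" for x
    using P that by (auto simp: continuous_map_def)
  obtain U where U: "openin S U" "P a \<in> U"
    "\<And>u. u\<in>U \<Longrightarrow> \<exists>B. openin S B \<and> u \<in> B \<and> (\<forall>v\<in>B. h (P a) v = h (P a) u + h u v)"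
    using flat[OF PS[OF a]] by (elim exE conjE) (rule that, assumption+, rule bspec)
  obtain d where d: "d > 0" "\<And>b. b \<in> T \<Longrightarrow> dist b a < d \<Longrightarrow> P b \<in> U"
    using near[OF U(1,2) a] by blast
  have "is_lift (T \<inter> ball a d) P (\<lambda>x. h (P a) (P x))"
    unfolding is_lift_def
  proof
    fix x assume x: "x \<in> T \<inter> ball a d"
    then have "P x \<in> U" using d by (simp add: dist_commute)
    from U(3)[OF this] obtain B where B: "openin S B" "P x \<in> B"
      and hB: "\<forall>v\<in>B. h (P a) v = h (P a) (P x) + h (P x) v"
      by (elim exE conjE) (rule that)
    obtain e where e: "e > 0" "\<And>y. y \<in> T \<Longrightarrow> dist y x < e \<Longrightarrow> P y \<in> B"
      using near[OF B] x by blast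
    show "\<exists>e>0. \<forall>y\<in>T \<inter> ball a d. dist y x < e \<longrightarrow> h (P a) (P y) = h (P a) (P x) + h (P x) (P y)"
      by (intro exI[of _ e] conjI ballI impI e(1) bspec[OF hB] e(2)) simp_all
  qed
  with d(1) show ?thesis by blast
qed

text \<open>Two subdivisions: thin strips of full width are assembled from small rectangles, then
  the square from strips. The overlaps are products of a point and an interval, hence
  connected.\<close>

lemma lift_square:
  fixes P :: "real \<times> real \<Rightarrow> 'a"
  assumes P: "continuous_map (top_of_set ({0..1} \<times> {0..1})) S P"
  shows "\<exists>l. is_lift ({0..1} \<times> {0..1}) P l"
proof -
  let ?I = "{0..1::real}"
  have row: "\<exists>d>0. \<exists>l. is_lift (?I \<times> (?I \<inter> {y-d..y+d})) P l" if y: "y \<in> ?I" for y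
  proof -
    have "a \<le> b \<Longrightarrow> 0 \<le> a \<Longrightarrow> b \<le> 1 \<Longrightarrow> \<exists>d>0. \<exists>l. is_lift ({a..b} \<times> (?I \<inter> {y-d..y+d})) P l" for a b
    proof (induction a b rule: Bolzano)
      case (trans a b c)
      then obtain d e l m where d: "d > 0" "is_lift ({a..b} \<times> (?I \<inter> {y-d..y+d})) P l"
        and e: "e > 0" "is_lift ({b..c} \<times> (?I \<inter> {y-e..y+e})) P m"
        by (smt (verit, best))
      let ?D = "?I \<inter> {y-min d e..y+min d e}"
      have "\<exists>l. is_lift (({a..b} \<times> ?D) \<union> ({b..c} \<times> ?D)) P l"
      proof (rule lift_exists_glue)
        show "is_lift ({a..b} \<times> ?D) P l" by (rule lift_subset[OF d(2)]) auto
        show "is_lift ({b..c} \<times> ?D) P m" by (rule lift_subset[OF e(2)]) auto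
        have "{a..b} \<times> ?D \<inter> {b..c} \<times> ?D = {b} \<times> ?D"
          using \<open>a \<le> b\<close> \<open>b \<le> c\<close> by auto
        moreover have "connected ({b} \<times> ?D)"
          by (intro connected_Times convex_connected convex_Int) auto
        ultimately show "connected ({a..b} \<times> ?D \<inter> {b..c} \<times> ?D)" by (simp only:)
      qed (auto intro!: closed_Times)
      moreover have "{a..c} = {a..b} \<union> {b..c}"
        using \<open>a \<le> b\<close> \<open>b \<le> c\<close> by (simp add: ivl_disj_un_two_touch(4))
      ultimately have "\<exists>l. is_lift ({a..c} \<times> ?D) P l" by (simp only: Sigma_Un_distrib1)
      then show ?case using d(1) e(1) by (intro exI[of _ "min d e"] conjI) simp_all
    next
      case (local x)
      show ?case
      proof (cases "x \<in> ?I")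
        case True
        then obtain d l where d: "d > 0" "is_lift ((?I \<times> ?I) \<inter> ball (x, y) d) P l"
          using lift_local[OF P SigmaI[OF True y]] by blast
        show ?thesis
        proof (rule exI[of _ "d/2"], intro conjI allI impI)
          fix a b assume ab: "a \<le> x \<and> x \<le> b \<and> b - a < d/2" "0 \<le> a" "b \<le> 1"
          \<comment> \<open>Width below d/2 and half-height d/3 keep the rectangle inside the ball
            of radius d, since the two distances add up to less than d.\<close>
          have "{a..b} \<times> (?I \<inter> {y-d/3..y+d/3}) \<subseteq> (?I \<times> ?I) \<inter> ball (x, y) d"
          proof
            fix z assume "z \<in> {a..b} \<times> (?I \<inter> {y-d/3..y+d/3})"
            then obtain s t where z: "z = (s, t)"
              and st: "a \<le> s" "s \<le> b" "0 \<le> t" "t \<le> 1" "y - d / 3 \<le> t" "t \<le> y + d / 3"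
              by auto
            have "dist (x,y) (s,t) \<le> dist x s + dist y t"
              unfolding dist_Pair_Pair by (rule sqrt_sum_squares_le_sum) auto
            also have "\<dots> < d/2 + d/2" using st ab d(1) by (auto simp: dist_real_def)
            finally show "z \<in> (?I \<times> ?I) \<inter> ball (x, y) d" using st ab z by auto
          qed
          then show "\<exists>d>0. \<exists>l. is_lift ({a..b} \<times> (?I \<inter> {y-d..y+d})) P l"
            using lift_subset[OF d(2)] d(1) by (metis zero_less_divide_iff zero_less_numeral)
        qed (use d in auto)
      next
        case False
        then show ?thesis by (intro exI[of _ 1]) auto
      qed
    qed
    note * = this
    show ?thesis by (rule *) simp_all
  qed
  have "a \<le> b \<Longrightarrow> 0 \<le> a \<Longrightarrow> b \<le> 1 \<Longrightarrow> \<exists>l. is_lift (?I \<times> {a..b}) P l" for a b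
  proof (induction a b rule: Bolzano)
    case (trans a b c)
    then obtain l m where lm: "is_lift (?I \<times> {a..b}) P l" "is_lift (?I \<times> {b..c}) P m" by auto
    have "\<exists>l. is_lift ((?I \<times> {a..b}) \<union> (?I \<times> {b..c})) P l"
    proof (rule lift_exists_glue[OF lm])
      have "?I \<times> {a..b} \<inter> ?I \<times> {b..c} = ?I \<times> {b}"
        using \<open>a \<le> b\<close> \<open>b \<le> c\<close> by auto
      then show "connected (?I \<times> {a..b} \<inter> ?I \<times> {b..c})"
        by (simp add: connected_Times)
    qed (auto intro!: closed_Times)
    moreover have "{a..c} = {a..b} \<union> {b..c}"
      using \<open>a \<le> b\<close> \<open>b \<le> c\<close> by (simp add: ivl_disj_un_two_touch(4))
    ultimately show ?case by (simp only: Sigma_Un_distrib2)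
  next
    case (local y)
    show ?case
    proof (cases "y \<in> ?I")
      case True
      then obtain d l where d: "d > 0" "is_lift (?I \<times> (?I \<inter> {y-d..y+d})) P l" using row by blast
      show ?thesis
      proof (intro exI[of _ d] conjI allI impI)
        fix a b assume "a \<le> y \<and> y \<le> b \<and> b - a < d" "0 \<le> a" "b \<le> 1"
        then have "{a..b} \<subseteq> ?I \<inter> {y-d..y+d}" by auto
        then have "?I \<times> {a..b} \<subseteq> ?I \<times> (?I \<inter> {y-d..y+d})" by (rule Sigma_mono[OF subset_refl])
        from lift_subset[OF d(2) this] show "\<exists>l. is_lift (?I \<times> {a..b}) P l" by (rule exI[of _ l])
      qed (use d in auto)
    next
      case False
      then show ?thesis by (intro exI[of _ 1]) auto
    qed
  qed
  note * = this
  show ?thesis by (rule *) simp_all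
qed

text \<open>The path is viewed as a map of the square that is constant in the second variable, and
  the lift is read off on one edge.\<close>

lemma lift_path:
  assumes "pathin S p"
  shows "\<exists>l. is_lift {0..1} p l"
proof -
  have "continuous_map (top_of_set ({0..1} \<times> {0..1::real})) S (p \<circ> fst)"
    using assms unfolding pathin_def
    by (rule continuous_map_compose[rotated]) (auto intro!: continuous_intros)
  then obtain l where l: "is_lift ({0..1} \<times> {0..1::real}) (p \<circ> fst) l" using lift_square by blast
  have "is_lift {0..1} (p \<circ> fst \<circ> (\<lambda>t. (t, 0::real))) (l \<circ> (\<lambda>t. (t, 0)))"
    by (rule lift_compose[OF l]) (auto intro!: continuous_intros)
  then show ?thesis by (auto simp: o_def)
qed

text \<open>The choice of lift is immaterial: a constant added on the left cancels in
  \<open>- l 0 + l 1\<close>, see \<open>hol_eqI\<close>.\<close>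

definition hol :: "(real \<Rightarrow> 'a) \<Rightarrow> 'n"
  where "hol p = (SOME y. \<exists>l. is_lift {0..1} p l \<and> y = - l 0 + l 1)"

lemma hol_eqI:
  assumes "is_lift {0..1} p l"
  shows "hol p = - l 0 + l 1"
proof -
  have "\<exists>m. is_lift {0..1} p m \<and> hol p = - m 0 + m 1"
    unfolding hol_def
    by (rule someI_ex[where P = "\<lambda>y. \<exists>m. is_lift {0..1} p m \<and> y = - m 0 + m 1"],
        intro exI conjI, rule assms, rule HOL.refl)
  then obtain m where m: "is_lift {0..1} p m" "hol p = - m 0 + m 1"
    by (elim exE conjE) (rule that)
  define c where "c = l 0 - m 0"
  have "l 0 - m 0 = l 1 - m 1"
    by (rule lift_unique[OF _ assms m(1)]) simp_all
  then have "c = l 1 - m 1" by (simp only: c_def)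
  then have "l 1 = c + m 1" by (simp only: diff_add_cancel)
  moreover have "l 0 = c + m 0" by (simp only: c_def diff_add_cancel)
  ultimately have "- l 0 + l 1 = - m 0 + m 1"
    by (simp only: minus_add add.assoc minus_add_cancel)
  then show ?thesis by (simp only: m(2))
qed

lemma hol_join:
  assumes "pathin S p" "pathin S q" "p 1 = q 0"
  shows "hol (loop_join p q) = hol p + hol q"
proof -
  obtain l where l: "is_lift {0..1} (loop_join p q) l"
    using lift_path[OF pathin_loop_join[OF assms]] by blast
  have "is_lift {0..1} (loop_join p q \<circ> (\<lambda>t. t/2)) (l \<circ> (\<lambda>t. t/2))"
    by (rule lift_compose[OF l]) (auto intro!: continuous_intros)
  then have 1: "is_lift {0..1} p (l \<circ> (\<lambda>t. t/2))"
    by (rule lift_cong) (auto simp: loop_join_def)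
  have "is_lift {0..1} (loop_join p q \<circ> (\<lambda>t. (t+1)/2)) (l \<circ> (\<lambda>t. (t+1)/2))"
    by (rule lift_compose[OF l]) (auto intro!: continuous_intros)
  then have 2: "is_lift {0..1} q (l \<circ> (\<lambda>t. (t+1)/2))"
    by (rule lift_cong) (use assms(3) in \<open>auto simp: loop_join_def field_simps\<close>)
  show ?thesis
    using hol_eqI[OF l] hol_eqI[OF 1] hol_eqI[OF 2] by (simp add: add.assoc)
qed

lemma lift_const:
  assumes "x \<in> topspace S" "is_lift {0..1::real} (\<lambda>_. x) l"
  shows "l 0 = l 1"
proof -
  have "is_lift {0..1::real} (\<lambda>_. x) (\<lambda>_. 0)"
    unfolding is_lift_def using h_self[OF assms(1)] by (auto intro: exI[of _ 1])
  from lift_unique[OF _ assms(2) this, of 0 1] show ?thesis by simp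
qed

text \<open>A lift of the homotopy over the square is constant along the two edges that lie over the
  fixed endpoints, so its increments along the two remaining edges coincide.\<close>

lemma hol_htpy:
  assumes "path_htpy S p q"
  shows "hol p = hol q"
proof -
  obtain F :: "real \<times> real \<Rightarrow> 'a" where F: "continuous_map (top_of_set ({0..1} \<times> {0..1})) S F" "\<And>t. F (0, t) = p t" "\<And>t. F (1, t) = q t"
    "\<And>s. s \<in> {0..1} \<Longrightarrow> F (s, 0) = p 0 \<and> F (s, 1) = p 1"
    using assms unfolding path_htpy_def homotopic_with_def prod_topology_subtopology_eu by auto
  obtain l where l: "is_lift ({0..1} \<times> {0..1}) F l" using lift_square[OF F(1)] by blast
  have side: "is_lift {0..1} (F \<circ> f) (l \<circ> f)" if "continuous_on {0..1} f" "f ` {0..1} \<subseteq> {0..1} \<times> {0..1}"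
    for f :: "real \<Rightarrow> _" by (rule lift_compose[OF l that])
  have 1: "is_lift {0..1} p (l \<circ> Pair 0)"
    by (rule lift_cong[OF side]) (auto intro!: continuous_intros simp: F)
  have 2: "is_lift {0..1} q (l \<circ> Pair 1)"
    by (rule lift_cong[OF side]) (auto intro!: continuous_intros simp: F)
  have 3: "is_lift {0..1} (\<lambda>_. p 0) (l \<circ> (\<lambda>s. (s, 0)))"
    by (rule lift_cong[OF side[of "\<lambda>s. (s, 0)"]]) (auto intro!: continuous_intros simp: F)
  have 4: "is_lift {0..1} (\<lambda>_. p 1) (l \<circ> (\<lambda>s. (s, 1)))"
    by (rule lift_cong[OF side[of "\<lambda>s. (s, 1)"]]) (auto intro!: continuous_intros simp: F)
  have "p 0 \<in> topspace S" "p 1 \<in> topspace S"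
    using path_htpy_ends(3)[OF assms] by (auto simp: pathin_def continuous_map_def)
  then show ?thesis
    using hol_eqI[OF 1] hol_eqI[OF 2] lift_const[OF _ 3] lift_const[OF _ 4] by simp
qed

end

section \<open>The closed surface as a quotient of the disc\<close>

text \<open>The index of the side glued to side \<open>j\<close>: within a block of four, 0 goes
  with 2 and 1 with 3.\<close>

definition partner :: "nat \<Rightarrow> nat"
  where "partner j = (if j mod 4 < 2 then j + 2 else j - 2)"

lemma partner_simps [simp]:
  "partner (4 * i) = 4 * i + 2" "partner (4 * i + 1) = 4 * i + 3"
  "partner (4 * i + 2) = 4 * i" "partner (4 * i + 3) = 4 * i + 1"
proof -
  have m: "(4 * i + r) mod 4 = r" if "r < 4" for r using that by simp
  show "partner (4 * i) = 4 * i + 2" "partner (4 * i + 1) = 4 * i + 3"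
    "partner (4 * i + 2) = 4 * i" "partner (4 * i + 3) = 4 * i + 1"
    unfolding partner_def using m[of 1] m[of 2] m[of 3] by simp_all
qed

lemma mod4_cases:
  fixes j :: nat
  obtains i where "j = 4 * i" | i where "j = 4 * i + 1" | i where "j = 4 * i + 2" | i where "j = 4 * i + 3"
proof -
  have "j = 4 * (j div 4) + j mod 4" by simp
  moreover have "j mod 4 = 0 \<or> j mod 4 = 1 \<or> j mod 4 = 2 \<or> j mod 4 = 3" by linarith
  ultimately show ?thesis using that by (metis add_0_right)
qed

lemma partner_less:
  assumes "j < 4 * g" shows "partner j < 4 * g"
proof (cases j rule: mod4_cases)
  case (1 i) show ?thesis using assms unfolding 1 partner_simps by presburger
next
  case (2 i) show ?thesis using assms unfolding 2 partner_simps by presburger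
next
  case (3 i) show ?thesis using assms unfolding 3 partner_simps by presburger
next
  case (4 i) show ?thesis using assms unfolding 4 partner_simps by presburger
qed

lemma partner_partner [simp]: "partner (partner j) = j"
proof (cases j rule: mod4_cases)
  case (1 i) show ?thesis unfolding 1 partner_simps by (rule HOL.refl)
next
  case (2 i) show ?thesis unfolding 2 partner_simps by (rule HOL.refl)
next
  case (3 i) show ?thesis unfolding 3 partner_simps by (rule HOL.refl)
next
  case (4 i) show ?thesis unfolding 4 partner_simps by (rule HOL.refl)
qed

lemma partner_mod: "partner j mod 4 < 2 \<longleftrightarrow> \<not> j mod 4 < 2"
proof -
  have m: "(4 * i + r) mod 4 = r" if "r < 4" for i r :: nat using that by simp
  have m': "(4 * i) mod 4 = 0" "(4 * i + 1) mod 4 = 1" "(4 * i + 2) mod 4 = 2" "(4 * i + 3) mod 4 = 3"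
    for i :: nat by (simp, (rule m, simp)+)
  show ?thesis
  proof (cases j rule: mod4_cases)
    case (1 i) show ?thesis unfolding 1 partner_simps m' by simp
  next
    case (2 i) show ?thesis unfolding 2 partner_simps m' by simp
  next
    case (3 i) show ?thesis unfolding 3 partner_simps m' by simp
  next
    case (4 i) show ?thesis unfolding 4 partner_simps m' by simp
  qed
qed

lemma cis_eqD:
  assumes "cis x = cis y" shows "\<exists>k::int. x = y + 2 * of_int k * pi"
proof -
  have "exp (\<i> * x) = exp (\<i> * y)" using assms by (simp add: cis_conv_exp)
  then obtain n :: int where n: "\<i> * x = \<i> * y + (of_int (2 * n) * pi) * \<i>"
    unfolding exp_eq by blast
  have "Im (\<i> * x) = Im (\<i> * y + (of_int (2 * n) * pi) * \<i>)" using n by (rule arg_cong)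
  then show ?thesis by (intro exI[of _ n]) simp
qed

section \<open>Explicit form of the identifications on the polygon\<close>

locale surface =
  fixes g :: nat and S :: "'a topology" and q :: "complex \<Rightarrow> 'a"
  assumes g: "1 \<le> g"
    and quot: "quotient_map (top_of_set (cball 0 1)) S q"
    and fibres: "\<And>z w. z \<in> cball 0 1 \<Longrightarrow> w \<in> cball 0 1 \<Longrightarrow> q z = q w \<longleftrightarrow> equivclp (side_glue g) z w"
begin

definition corner :: "complex \<Rightarrow> bool"
  where "corner z \<longleftrightarrow> (\<exists>j<4*g. z = side g j 0)"

lemma side_in [simp]: "side g j t \<in> cball 0 1" "norm (side g j t) = 1"
  by (simp_all add: side_def)

lemma side_eqD:
  assumes "side g j t = side g i s"
  shows "\<exists>k::int. real j + t = real i + s + 4 * real g * of_int k"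
proof -
  obtain k :: int where "2 * pi * (real j + t) / real (4 * g) = 2 * pi * (real i + s) / real (4 * g) + 2 * of_int k * pi"
    using assms cis_eqD unfolding side_def by blast
  then have "2 * pi * (real j + t) = 2 * pi * (real i + s + 4 * real g * of_int k)"
    using g by (simp add: field_simps)
  then show ?thesis by auto
qed

text \<open>Positions along the boundary are determined up to full turns of \<open>4 * g\<close>
  sides. Comparing the integer parts leaves equality or two ends of sides.\<close>

lemma side_eq:
  assumes e: "side g j t = side g i s" and j: "j < 4 * g" "i < 4 * g" and t: "0 \<le> t" "t \<le> 1" "0 \<le> s" "s \<le> 1"
  shows "(j = i \<and> t = s) \<or> (t \<in> {0, 1} \<and> s \<in> {0, 1})"
proof -
  obtain k :: int where k: "real j + t = real i + s + 4 * real g * of_int k"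
    using side_eqD[OF e] by blast
  have j': "real j + 1 \<le> 4 * real g" "real i + 1 \<le> 4 * real g" using j by linarith+
  consider "k = 0" | "k \<ge> 1" | "k \<le> -1" by linarith
  then show ?thesis
  proof cases
    case 1
    consider "j = i" | "j > i" | "j < i" by linarith
    then show ?thesis
    proof cases
      case 2
      then have "real j \<ge> real i + 1" by linarith
      then have "t = 0 \<and> s = 1" using k t 1 by auto
      then show ?thesis by simp
    next
      case 3
      then have "real i \<ge> real j + 1" by linarith
      then have "t = 1 \<and> s = 0" using k t 1 by auto
      then show ?thesis by simp
    qed (use k 1 in auto)
  next
    case 2
    then have "of_int k \<ge> (1 :: real)" by linarith
    then have "4 * real g * of_int k \<ge> 4 * real g * 1" by (intro mult_left_mono) auto
    then have "t = 1 \<and> s = 0" using k j' t by linarith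
    then show ?thesis by simp
  next
    case 3
    then have "of_int k \<le> (-1 :: real)" by linarith
    then have "4 * real g * of_int k \<le> 4 * real g * (-1)" by (intro mult_left_mono) auto
    then have "t = 0 \<and> s = 1" using k j' t by linarith
    then show ?thesis by simp
  qed
qed

lemma side_0_eq:
  assumes e: "side g j 0 = side g i 0" and j: "j < 4 * g" "i < 4 * g"
  shows "j = i"
proof -
  obtain k :: int where "real j + 0 = real i + 0 + 4 * real g * of_int k"
    using side_eqD[OF e] by blast
  then have "real_of_int (int j) = of_int (int i + 4 * int g * k)" by simp
  then have k: "int j = int i + 4 * int g * k" by linarith
  have "int j mod (4 * int g) = int i mod (4 * int g)" unfolding k by simp
  then show ?thesis using j by simp
qed

lemma side_1: "side g j 1 = side g (Suc j) 0"
  by (simp add: side_def add.commute)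

lemma side_last: "side g (4 * g) 0 = side g 0 0"
  using g by (simp add: side_def)

lemma corner_side:
  assumes "j < 4 * g" "t \<in> {0, 1}" shows "corner (side g j t)"
proof (cases "t = 0")
  case False
  then have t: "t = 1" using assms(2) by simp
  show ?thesis
  proof (cases "Suc j = 4 * g")
    case True
    then have "side g j t = side g 0 0" using t side_1[of j] side_last by simp
    then show ?thesis unfolding corner_def using g by (intro exI[of _ 0]) simp
  next
    case False
    then show ?thesis unfolding corner_def using t side_1[of j] assms(1) by (intro exI[of _ "Suc j"]) simp
  qed
qed (use assms in \<open>auto simp: corner_def\<close>)

lemma corner_sideD:
  assumes "corner (side g j t)" "j < 4 * g" "0 \<le> t" "t \<le> 1" shows "t \<in> {0, 1}"
  using assms side_eq[of j t _ 0] unfolding corner_def by fastforce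

text \<open>Closed form, on the disc, of the equivalence generated by \<open>side_glue\<close>: all
  corners make up one class, and any other boundary point is paired with one point of the partner
  side.\<close>

definition glue :: "complex \<Rightarrow> complex \<Rightarrow> bool"
  where "glue z w \<longleftrightarrow> z = w \<or> (corner z \<and> corner w) \<or>
    (\<exists>j<4*g. \<exists>t\<in>{0..1}. z = side g j t \<and> w = side g (partner j) (1 - t))"

lemma glue_side:
  assumes "j < 4 * g" "t \<in> {0..1}" shows "glue (side g j t) (side g (partner j) (1 - t))"
  using assms unfolding glue_def by blast

lemma glue_sym: "glue z w \<Longrightarrow> glue w z"
proof -
  assume "glue z w"
  then consider "z = w" | "corner z" "corner w"
    | j t where "j < 4*g" "t \<in> {0..1}" "z = side g j t" "w = side g (partner j) (1 - t)"
    unfolding glue_def by blast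
  then show ?thesis
  proof cases
    case (3 j t)
    have "glue (side g (partner j) (1 - t)) (side g (partner (partner j)) (1 - (1 - t)))"
      by (rule glue_side) (use 3 partner_less in auto)
    then show ?thesis using 3 by simp
  qed (auto simp: glue_def)
qed

lemma glue_corner: "glue z w \<Longrightarrow> corner z \<Longrightarrow> corner w"
proof -
  assume "glue z w" and c: "corner z"
  then consider "z = w" | "corner w"
    | j t where "j < 4*g" "t \<in> {0..1}" "z = side g j t" "w = side g (partner j) (1 - t)"
    unfolding glue_def by blast
  then show ?thesis
  proof cases
    case (3 j t)
    then have "t \<in> {0, 1}" using c corner_sideD by auto
    then show ?thesis using 3 corner_side[of "partner j" "1 - t"] partner_less[of j g] by auto
  qed (use c in auto)
qed

text \<open>If the middle point is not a corner, it lies on a single side with a single parameter,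
  so a second gluing along it leads back to the first point.\<close>

lemma glue_trans: "glue z w \<Longrightarrow> glue w v \<Longrightarrow> glue z v"
proof -
  assume zw: "glue z w" and wv: "glue w v"
  show ?thesis
  proof (cases "corner w")
    case True
    then have "corner z" "corner v" using glue_corner[OF wv] glue_corner[OF glue_sym[OF zw]] by auto
    then show ?thesis by (simp add: glue_def)
  next
    case False
    show ?thesis
    proof (cases "z = w \<or> w = v")
      case True
      then show ?thesis using zw wv by auto
    next
      case ne: False
      obtain j t where j: "j < 4*g" "t \<in> {0..1}" "z = side g j t" "w = side g (partner j) (1 - t)"
        using zw ne False unfolding glue_def by blast
      obtain i s where i: "i < 4*g" "s \<in> {0..1}" "w = side g i s" "v = side g (partner i) (1 - s)"
        using wv ne False unfolding glue_def by blast
      have "s \<notin> {0, 1}" using False i corner_side by blast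
      then have "partner j = i \<and> 1 - t = s"
        using side_eq[of "partner j" "1 - t" i s] i j partner_less[OF j(1)] by auto
      then have "i = partner j" "1 - s = t" by auto
      then have "v = z" using i(4) j(3) by simp
      then show ?thesis by (simp add: glue_def)
    qed
  qed
qed

lemma side_glue_glue: "side_glue g z w \<Longrightarrow> glue z w"
proof -
  assume "side_glue g z w"
  then obtain i t where i: "i < g" "t \<in> {0..1}"
    and c: "z = side g (4 * i) t \<and> w = side g (4 * i + 2) (1 - t) \<or>
      z = side g (4 * i + 1) t \<and> w = side g (4 * i + 3) (1 - t)"
    unfolding side_glue_def by blast
  then show ?thesis
    using glue_side[of "4 * i" t] glue_side[of "4 * i + 1" t] unfolding partner_simps by auto
qed

lemma q_glueD: "z \<in> cball 0 1 \<Longrightarrow> w \<in> cball 0 1 \<Longrightarrow> q z = q w \<Longrightarrow> glue z w"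
proof -
  assume "z \<in> cball 0 1" "w \<in> cball 0 1" "q z = q w"
  then have "equivclp (side_glue g) z w" using fibres by blast
  then show ?thesis
  proof (induction rule: equivclp_induct)
    case base
    then show ?case by (simp add: glue_def)
  next
    case (step y z)
    then have "glue y z" using side_glue_glue glue_sym by blast
    with step show ?case using glue_trans by blast
  qed
qed

lemma q_side:
  assumes "j < 4 * g" "t \<in> {0..1}"
  shows "q (side g j t) = q (side g (partner j) (1 - t))"
proof -
  have *: "q (side g j t) = q (side g (partner j) (1 - t))"
    if j: "j < 4 * g" "j mod 4 < 2" "t \<in> {0..1}" for j t
  proof -
    have m: "(4 * i + r) mod 4 = r" if "r < 4" for i r :: nat using that by simp
    obtain i where "j = 4 * i \<and> partner j = 4 * i + 2 \<or> j = 4 * i + 1 \<and> partner j = 4 * i + 3"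
      using j(2) m[of 2] m[of 3] by (cases j rule: mod4_cases) (auto simp del: One_nat_def)
    note ji = this
    then have "i < g" using j(1) by auto
    then have "side_glue g (side g j t) (side g (partner j) (1 - t))"
      unfolding side_glue_def using ji j(3) by (intro exI[of _ i] conjI bexI[of _ t]) auto
    then show ?thesis using fibres by (simp add: r_into_equivclp)
  qed
  show ?thesis
  proof (cases "j mod 4 < 2")
    case False
    then have "partner j mod 4 < 2" by (simp add: partner_mod)
    from *[OF partner_less[OF assms(1)] this, of "1 - t"] assms(2) show ?thesis by simp
  qed (use * assms in auto)
qed

text \<open>The ends of the sides \<open>4 * i\<close> and \<open>4 * i + 1\<close> are identified
  with ends of their partners, which links the corners from \<open>4 * i\<close> to
  \<open>4 * i + 4\<close>. Consecutive blocks share a corner, so all of them chain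
  together.\<close>

lemma q_corner:
  assumes "j \<le> 4 * g" shows "q (side g j 0) = q (side g 0 0)"
proof -
  have step: "q (side g (4*i+1) 0) = q (side g (4*i+2) 0)" "q (side g (4*i+2) 0) = q (side g (4*i+3) 0)"
    "q (side g (4*i) 0) = q (side g (4*i+3) 0)" "q (side g (4*i+1) 0) = q (side g (4*i+4) 0)" if "i < g" for i
  proof -
    have e: "side g (4*i) 1 = side g (4*i+1) 0" "side g (4*i+1) 1 = side g (4*i+2) 0"
      "side g (4*i+2) 1 = side g (4*i+3) 0" "side g (4*i+3) 1 = side g (4*i+4) 0"
      by (simp_all add: side_def algebra_simps)
    have l: "4 * i < 4 * g" "4 * i + 1 < 4 * g" using that by simp_all
    show "q (side g (4*i) 0) = q (side g (4*i+3) 0)" "q (side g (4*i+1) 0) = q (side g (4*i+2) 0)"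
      "q (side g (4*i+1) 0) = q (side g (4*i+4) 0)" "q (side g (4*i+2) 0) = q (side g (4*i+3) 0)"
      using q_side[OF l(1), of 0] q_side[OF l(1), of 1] q_side[OF l(2), of 0] q_side[OF l(2), of 1]
      unfolding partner_simps by (simp_all only: e diff_0_right diff_self) auto
  qed
  have all: "i \<le> g \<Longrightarrow> q (side g (4 * i) 0) = q (side g 0 0)" for i
  proof (induction i)
    case (Suc i)
    then show ?case using step[of i] by (simp add: algebra_simps)
  qed simp
  show ?thesis
  proof (cases "j = 4 * g")
    case False
    define i where "i = j div 4"
    have i: "i < g" using assms False unfolding i_def by linarith
    have "j = 4 * i \<or> j = 4 * i + 1 \<or> j = 4 * i + 2 \<or> j = 4 * i + 3"
      unfolding i_def by linarith
    then show ?thesis using step[OF i] all[of i] i by (auto simp del: One_nat_def)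
  qed (use side_last in auto)
qed

lemma q_glue: "z \<in> cball 0 1 \<Longrightarrow> w \<in> cball 0 1 \<Longrightarrow> q z = q w \<longleftrightarrow> glue z w"
proof
  assume "z \<in> cball 0 1" "w \<in> cball 0 1" "glue z w"
  then consider "z = w" | "corner z" "corner w"
    | j t where "j < 4*g" "t \<in> {0..1}" "z = side g j t" "w = side g (partner j) (1 - t)"
    unfolding glue_def by blast
  then show "q z = q w"
  proof cases
    case 2
    then obtain i j where "i < 4 * g" "j < 4 * g" "z = side g i 0" "w = side g j 0"
      unfolding corner_def by blast
    then show ?thesis using q_corner[of i] q_corner[of j] by simp
  qed (use q_side in auto)
qed (rule q_glueD)

lemma top_S: "topspace S = q ` cball 0 1"
  using quotient_imp_surjective_map[OF quot] by simp

lemma cont_side: "continuous_on A (side g j)"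
  unfolding side_def using g by (intro continuous_intros) auto

lemma finite_corners: "finite {z. corner z}"
  unfolding corner_def by simp

text \<open>Apart from \<open>C\<close>, the saturation consists of the finite set of corners, if
  \<open>C\<close> contains one, and of finitely many compact images under gluing maps. In other
  words, \<open>q\<close> is a closed map.\<close>

lemma closed_saturation:
  assumes C: "closed C" "C \<subseteq> cball 0 1"
  shows "closed {z \<in> cball 0 1. q z \<in> q ` C}"
proof -
  let ?A = "\<lambda>j. (\<lambda>t. side g (partner j) (1 - t)) ` ({0..1} \<inter> side g j -` C)"
  have *: "{z \<in> cball 0 1. q z \<in> q ` C} = C \<union> (if \<exists>c\<in>C. corner c then {z. corner z} else {}) \<union> (\<Union>j\<in>{..<4*g}. ?A j)"
    (is "?L = ?R")
  proof (intro equalityI subsetI)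
    fix z assume "z \<in> ?L"
    then obtain c where c: "c \<in> C" "z \<in> cball 0 1" "q c = q z" by auto
    then have "glue c z" using q_glueD C(2) by blast
    then show "z \<in> ?R" using c unfolding glue_def by auto
  next
    fix z assume z: "z \<in> ?R"
    have "\<exists>c\<in>C. glue c z \<and> z \<in> cball 0 1"
      using z C(2) unfolding glue_def by (auto simp: corner_def split: if_splits)
    then show "z \<in> ?L" using C(2) q_glue by (metis (mono_tags, lifting) imageI mem_Collect_eq subsetD)
  qed
  have "compact (?A j)" for j
  proof (intro compact_continuous_image continuous_intros)
    show "continuous_on ({0..1} \<inter> side g j -` C) (\<lambda>t. side g (partner j) (1 - t))"
      by (rule continuous_on_compose2[OF cont_side[of UNIV]]) (auto intro!: continuous_intros)
    have "closed ({0..1} \<inter> side g j -` C)"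
      by (rule continuous_closed_preimage[OF cont_side _ C(1)]) simp
    moreover have "bounded ({0..1} \<inter> side g j -` C)"
      by (rule bounded_subset[OF bounded_closed_interval[of 0 1]]) auto
    ultimately show "compact ({0..1} \<inter> side g j -` C)" by (simp add: compact_eq_bounded_closed)
  qed
  then have "closed (\<Union>j\<in>{..<4*g}. ?A j)" by (intro closed_UN ballI compact_imp_closed) auto
  moreover have "closed (if \<exists>c\<in>C. corner c then {z. corner z} else {})"
    using finite_corners by (simp add: finite_imp_closed)
  ultimately show ?thesis unfolding * by (intro closed_Un C(1))
qed

text \<open>The complement of the image of a closed set. This is how neighbourhoods on the surface
  are produced from open sets of the plane.\<close>

lemma openin_full_preimage:
  assumes "open U"
  shows "openin S {v \<in> topspace S. \<forall>z\<in>cball 0 1. q z = v \<longrightarrow> z \<in> U}"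
proof -
  let ?C = "cball 0 1 - U"
  have sub: "q ` ?C \<subseteq> topspace S" unfolding top_S by auto
  have "closed {z \<in> cball 0 1. q z \<in> q ` ?C}"
    by (rule closed_saturation) (use assms in \<open>auto intro: closed_Diff\<close>)
  then have "closedin (top_of_set (cball 0 1)) {z \<in> cball 0 1. q z \<in> q ` ?C}"
    by (intro closed_subset) auto
  then have "closedin (top_of_set (cball 0 1)) {z \<in> topspace (top_of_set (cball 0 1)). q z \<in> q ` ?C}"
    by (simp only: topspace_euclidean_subtopology)
  then have "closedin S (q ` ?C)"
    using quot sub unfolding quotient_map_closedin by blast
  then have "openin S (topspace S - q ` ?C)" by blast
  moreover have "topspace S - q ` ?C = {v \<in> topspace S. \<forall>z\<in>cball 0 1. q z = v \<longrightarrow> z \<in> U}" by auto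
  ultimately show ?thesis by simp
qed

section \<open>Neighbourhoods adapted to the gluing\<close>

definition fibre :: "'a \<Rightarrow> complex set"
  where "fibre s = {z \<in> cball 0 1. q z = s}"

lemma finite_fibre: "finite (fibre s)"
proof (cases "fibre s = {}")
  case False
  then obtain w where w: "w \<in> cball 0 1" "q w = s" unfolding fibre_def by auto
  let ?A = "\<lambda>j. (\<lambda>t. side g (partner j) (1 - t)) ` {t \<in> {0..1}. side g j t = w}"
  have "fibre s \<subseteq> {w} \<union> {z. corner z} \<union> (\<Union>j\<in>{..<4*g}. ?A j)"
  proof
    fix z assume "z \<in> fibre s"
    then have "glue w z" using w q_glueD unfolding fibre_def by auto
    then consider "z = w" | "corner z"
      | j t where "j < 4*g" "t \<in> {0..1}" "w = side g j t" "z = side g (partner j) (1 - t)"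
      unfolding glue_def by blast
    then show "z \<in> {w} \<union> {z. corner z} \<union> (\<Union>j\<in>{..<4*g}. ?A j)"
    proof cases
      case (3 j t)
      then have "z \<in> ?A j" by (intro image_eqI[of _ _ t]) simp_all
      then show ?thesis using 3(1) by blast
    qed simp_all
  qed
  moreover have "finite {t \<in> {0..1}. side g j t = w}" if "j < 4 * g" for j
  proof (rule finite_subset)
    \<comment> \<open>By \<open>side_eq\<close> a point has at most one parameter on a given side
      besides the two ends.\<close>
    show "{t \<in> {0..1}. side g j t = w} \<subseteq> {0, 1} \<union> {SOME t. t \<in> {0..1} \<and> side g j t = w}"
    proof
      fix t assume t: "t \<in> {t \<in> {0..1}. side g j t = w}"
      let ?s = "SOME t. t \<in> {0..1} \<and> side g j t = w"
      have "?s \<in> {0..1} \<and> side g j ?s = w" by (rule someI[of _ t]) (use t in simp)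
      then have s: "0 \<le> ?s" "?s \<le> 1" "side g j t = side g j ?s" and t': "0 \<le> t" "t \<le> 1"
        using t by simp_all
      show "t \<in> {0, 1} \<union> {?s}"
        using side_eq[OF s(3) that that t' s(1,2)] by blast
    qed
  qed simp
  then have "finite ({w} \<union> {z. corner z} \<union> (\<Union>j\<in>{..<4*g}. ?A j))"
    using finite_corners by (intro finite_UnI finite_UN_I finite_imageI) simp_all
  ultimately show ?thesis by (rule finite_subset)
qed simp

text \<open>Balls of radius \<open>e\<close> around the points \<open>w\<close> of the fibre are
  disjoint and avoid every side not through \<open>w\<close> and every corner other than
  \<open>w\<close>. The bound 1 keeps z / w in the right half-plane when \<open>w\<close> is on the
  circle, where the logarithm used in \<open>contract\<close> is continuous.\<close>

definition good :: "'a \<Rightarrow> real \<Rightarrow> bool"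
  where "good s e \<longleftrightarrow> 0 < e \<and> e \<le> 1 \<and> (\<forall>w\<in>fibre s.
    (\<forall>w'\<in>fibre s. w \<noteq> w' \<longrightarrow> 2 * e \<le> dist w w') \<and>
    (\<forall>j\<in>{..<4*g}. w \<notin> side g j ` {0..1} \<longrightarrow> (\<forall>t\<in>{0..1}. e \<le> dist w (side g j t))) \<and>
    (\<forall>c\<in>{c. corner c}. c \<noteq> w \<longrightarrow> e \<le> dist w c))"

lemma ev_small: "c > 0 \<Longrightarrow> eventually (\<lambda>e::real. 0 < e \<and> e \<le> c) (at_right 0)"
  unfolding eventually_at_right_field by (intro exI[of _ c]) auto

text \<open>Finitely many conditions, each of which holds for all sufficiently small positive
  radii.\<close>

lemma good_exists: "\<exists>e. good s e"
proof -
  have "eventually (good s) (at_right 0)"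
    unfolding good_def
  proof (intro eventually_conj eventually_ball_finite finite_fibre finite_corners ballI finite_lessThan)
    show "eventually (\<lambda>e::real. 0 < e) (at_right 0)" "eventually (\<lambda>e::real. e \<le> 1) (at_right 0)"
      by (auto intro: eventually_mono[OF ev_small[of 1]])
    fix w w' assume "w \<in> fibre s" "w' \<in> fibre s"
    show "\<forall>\<^sub>F x in at_right 0. w \<noteq> w' \<longrightarrow> 2 * x \<le> dist w w'"
    proof (cases "w = w'")
      case False
      then show ?thesis by (auto intro: eventually_mono[OF ev_small[of "dist w w' / 2"]])
    qed simp
  next
    fix w c assume "w \<in> fibre s"
    show "\<forall>\<^sub>F x in at_right 0. c \<noteq> w \<longrightarrow> x \<le> dist w c"
    proof (cases "w = c")
      case False
      then show ?thesis by (auto intro: eventually_mono[OF ev_small[of "dist w c"]])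
    qed simp
  next
    fix w j assume "w \<in> fibre s"
    show "\<forall>\<^sub>F x in at_right 0. w \<notin> side g j ` {0..1} \<longrightarrow> (\<forall>t\<in>{0..1}. x \<le> dist w (side g j t))"
    proof (cases "w \<in> side g j ` {0..1}")
      case False
      have "closed (side g j ` {0..1})"
        by (intro compact_imp_closed compact_continuous_image cont_side) simp
      then obtain d where "d > 0" "\<forall>x\<in>side g j ` {0..1}. d \<le> dist w x"
        using separate_point_closed[OF _ False] by blast
      then show ?thesis using False by (auto intro: eventually_mono[OF ev_small[of d]] order_trans)
    qed simp
  qed
  then show ?thesis using eventually_happens trivial_limit_at_right_real by blast
qed

definition eps :: "'a \<Rightarrow> real"
  where "eps s = (SOME e. good s e)"

lemma good_eps: "good s (eps s)"
  unfolding eps_def by (rule someI_ex[OF good_exists])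

text \<open>All sides are arcs of the same length, and chords depend only on the absolute angle, so
  the reversing identification is an isometry.\<close>

lemma dist_side:
  "dist (side g j t) (side g j s) = dist (side g i (1 - t)) (side g i (1 - s))"
proof -
  have 1: "dist (cis x) (cis y) = norm (cis (x - y) - 1)" for x y
  proof -
    have "cis x - cis y = cis y * (cis (x - y) - 1)" by (simp add: cis_mult algebra_simps)
    then show ?thesis by (simp add: dist_norm norm_mult)
  qed
  have 2: "norm (cis x - 1) = norm (cis (- x) - 1)" for x
    using complex_mod_cnj[of "cis x - 1"] by (simp add: cis_cnj)
  have "2 * pi * (real i + (1 - t)) / real (4 * g) - 2 * pi * (real i + (1 - s)) / real (4 * g)
     = - (2 * pi * (real j + t) / real (4 * g) - 2 * pi * (real j + s) / real (4 * g))"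
    using g by (simp add: field_simps)
  then show ?thesis unfolding side_def 1 using 2 by metis
qed

text \<open>Two identified points close to two points of one fibre are identified in the same manner
  as these. By this a construction on the disc that is compatible with gluing descends locally to
  the surface.\<close>

lemma local_compat:
  assumes w: "w \<in> fibre s" "w' \<in> fibre s" and z: "z \<in> cball 0 1" "z' \<in> cball 0 1"
    and d: "dist z w < eps s" "dist z' w' < eps s" and e: "q z = q z'"
  shows "(z = z' \<and> w = w') \<or> (z = w \<and> z' = w') \<or>
    (\<exists>j<4*g. \<exists>t\<in>{0..1}. \<exists>t0\<in>{0..1}. z = side g j t \<and> z' = side g (partner j) (1 - t) \<and>
      w = side g j t0 \<and> w' = side g (partner j) (1 - t0))"
proof -
  have G: "\<And>w w'. w \<in> fibre s \<Longrightarrow> w' \<in> fibre s \<Longrightarrow> w \<noteq> w' \<Longrightarrow> 2 * eps s \<le> dist w w'"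
    "\<And>w j t. w \<in> fibre s \<Longrightarrow> j < 4 * g \<Longrightarrow> w \<notin> side g j ` {0..1} \<Longrightarrow> t \<in> {0..1} \<Longrightarrow> eps s \<le> dist w (side g j t)"
    "\<And>w c. w \<in> fibre s \<Longrightarrow> corner c \<Longrightarrow> c \<noteq> w \<Longrightarrow> eps s \<le> dist w c"
    using good_eps[of s] unfolding good_def by auto
  have sep: "w1 = w2" if "w1 \<in> fibre s" "w2 \<in> fibre s" "dist y w1 < eps s" "dist y w2 < eps s" for y w1 w2
  proof (rule ccontr)
    assume "w1 \<noteq> w2"
    then have "2 * eps s \<le> dist w1 w2" using G(1) that by blast
    also have "\<dots> \<le> dist w1 y + dist y w2" by (rule dist_triangle)
    finally show False using that by (simp add: dist_commute)
  qed
  have "glue z z'" using q_glueD[OF z e] .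
  then consider "z = z'" | "corner z" "corner z'"
    | j t where "j < 4*g" "t \<in> {0..1}" "z = side g j t" "z' = side g (partner j) (1 - t)"
    unfolding glue_def by blast
  then show ?thesis
  proof cases
    case 1
    then show ?thesis using sep[OF w, of z] d by auto
  next
    case 2
    have "z = w" using G(3)[OF w(1) 2(1)] d(1) by (auto simp: dist_commute)
    moreover have "z' = w'" using G(3)[OF w(2) 2(2)] d(2) by (auto simp: dist_commute)
    ultimately show ?thesis by blast
  next
    case (3 j t)
    have "w \<in> side g j ` {0..1}"
      using G(2)[OF w(1) 3(1) _ 3(2)] d(1) 3(3) by (auto simp: dist_commute)
    then obtain t0 where t0: "t0 \<in> {0..1}" "w = side g j t0" by auto
    \<comment> \<open>The copy of \<open>w\<close> on the partner side belongs to the fibre and is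
      as close to \<open>z'\<close> as \<open>w\<close> is to \<open>z\<close>. Separation of the
      fibre then forces it to be \<open>w'\<close>.\<close>
    let ?w = "side g (partner j) (1 - t0)"
    have "?w \<in> fibre s" using q_side[OF 3(1) t0(1)] w(1) t0(2) unfolding fibre_def by simp
    moreover have "dist z' ?w < eps s" using d(1) 3 t0 dist_side by metis
    ultimately have "?w = w'" using sep w(2) d(2) by blast
    then show ?thesis using 3 t0 by blast
  qed
qed

definition nbhd :: "'a \<Rightarrow> 'a set"
  where "nbhd s = {v \<in> topspace S. \<forall>z\<in>cball 0 1. q z = v \<longrightarrow> z \<in> (\<Union>w\<in>fibre s. ball w (eps s))}"

lemma openin_nbhd: "openin S (nbhd s)"
  unfolding nbhd_def by (rule openin_full_preimage) auto

lemma eps_pos: "eps s > 0" "eps s \<le> 1"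
  using good_eps[of s] unfolding good_def by auto

lemma nbhd_self: "s \<in> topspace S \<Longrightarrow> s \<in> nbhd s"
  unfolding nbhd_def using eps_pos by (auto simp: fibre_def)

end

definition loop_hom :: "'a topology \<Rightarrow> 'a \<Rightarrow> ((real \<Rightarrow> 'a) \<Rightarrow> 'n::group_add) \<Rightarrow> bool"
  where "loop_hom S x f \<longleftrightarrow>
    (\<forall>p\<in>loops S x. \<forall>p'\<in>loops S x. f (loop_join p p') = f p + f p') \<and>
    (\<forall>p\<in>loops S x. \<forall>p'. path_htpy S p p' \<longrightarrow> f p = f p')"

text \<open>\<open>u j\<close> stands for the value of a homomorphism on
  \<open>corner_loop d j\<close>. A side and its partner run in opposite directions, so the
  condition says that the jump across the glued pair is the same at both ends.\<close>

definition surface_labels :: "nat \<Rightarrow> (nat \<Rightarrow> 'n::group_add) \<Rightarrow> bool"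
  where "surface_labels g u \<longleftrightarrow> u 0 = 0 \<and> u (4 * g) = 0 \<and>
    (\<forall>j<4*g. u j - u (Suc (partner j)) = u (Suc j) - u (partner j))"

lemma diff_eq_shift:
  fixes a b c d :: "'n::group_add"
  assumes "a - b = c - d" shows "- c + a = - d + b"
proof -
  have "a = (c - d) + b" using assms[symmetric] by (simp only: diff_add_cancel)
  then have "- c + a = - c + (c + (- d + b))" by (simp only: diff_conv_add_uminus add.assoc)
  then show ?thesis by (simp only: minus_add_cancel)
qed

section \<open>Holonomy with prescribed labels\<close>

context surface
begin

text \<open>Extends the labels from the corners to the disc. The values on open sides are arranged
  so that the jump across a gluing is constant on the whole closed side (\<open>nu_glue\<close>).
  The function is not continuous; its jumps are what defines the flat structure.\<close>

definition nu :: "(nat \<Rightarrow> 'n::group_add) \<Rightarrow> complex \<Rightarrow> 'n"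
  where "nu u z =
    (if corner z then u (THE j. j < 4*g \<and> z = side g j 0)
     else if \<exists>j<4*g. \<exists>t\<in>{0<..<1}. z = side g j t
       then (let j = THE j. j < 4*g \<and> (\<exists>t\<in>{0<..<1}. z = side g j t)
             in if j mod 4 < 2 then u j else u (Suc j))
     else 0)"

lemma nu_corner:
  assumes u: "surface_labels g u" and j: "j \<le> 4 * g"
  shows "nu u (side g j 0) = u j"
proof -
  have *: "nu u (side g j 0) = u j" if j: "j < 4 * g" for j
  proof -
    have "corner (side g j 0)" using j corner_side by blast
    moreover have "(THE i. i < 4*g \<and> side g j 0 = side g i 0) = j"
      by (rule the_equality) (use j side_0_eq[of j] in auto)
    ultimately show ?thesis by (simp add: nu_def)
  qed
  show ?thesis
  proof (cases "j = 4 * g")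
    case True
    have "nu u (side g 0 0) = u 0" by (rule *) (use g in simp)
    then show ?thesis using u True side_last by (simp add: surface_labels_def)
  qed (use * j in auto)
qed

lemma nu_side:
  assumes j: "j < 4 * g" and t: "0 < t" "t < 1"
  shows "nu u (side g j t) = (if j mod 4 < 2 then u j else u (Suc j))"
proof -
  have "\<not> corner (side g j t)" using corner_sideD[of j t] j t by auto
  moreover have "(THE i. i < 4*g \<and> (\<exists>s\<in>{0<..<1}. side g j t = side g i s)) = j"
  proof (rule the_equality)
    fix i assume "i < 4*g \<and> (\<exists>s\<in>{0<..<1}. side g j t = side g i s)"
    then obtain s where i: "i < 4 * g" "s \<in> {0<..<1}" "side g j t = side g i s" by blast
    have "(j = i \<and> t = s) \<or> (t \<in> {0, 1} \<and> s \<in> {0, 1})"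
      by (rule side_eq[OF i(3) j i(1)]) (use t i in auto)
    then show "i = j" using t by auto
  qed (use j t in auto)
  moreover have "\<exists>i<4*g. \<exists>s\<in>{0<..<1}. side g j t = side g i s"
    using j t by (intro exI[of _ j] conjI bexI[of _ t]) simp_all
  ultimately show ?thesis unfolding nu_def by (simp only: if_False if_True Let_def)
qed

lemma nu_glue:
  assumes u: "surface_labels g u" and j: "j < 4 * g" and t: "t \<in> {0..1}"
  shows "nu u (side g j t) - nu u (side g (partner j) (1 - t)) = u j - u (Suc (partner j))"
proof -
  have p: "partner j < 4 * g" using j by (rule partner_less)
  have r: "u j - u (Suc (partner j)) = u (Suc j) - u (partner j)"
    using u j by (simp add: surface_labels_def)
  consider "t = 0" | "t = 1" | "0 < t" "t < 1" using t by fastforce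
  then show ?thesis
  proof cases
    case 1
    have "nu u (side g j 0) = u j" "nu u (side g (Suc (partner j)) 0) = u (Suc (partner j))"
      using nu_corner[OF u] j p by simp_all
    then show ?thesis using 1 side_1[of "partner j"] by simp
  next
    case 2
    have "nu u (side g (partner j) 0) = u (partner j)" "nu u (side g (Suc j) 0) = u (Suc j)"
      using nu_corner[OF u] j p by simp_all
    then show ?thesis using 2 r side_1[of j] by simp
  next
    case 3
    then show ?thesis
      using nu_side[OF j 3, of u] nu_side[OF p, of "1 - t" u] partner_mod[of j] r
      by (cases "j mod 4 < 2") (simp_all only: if_True if_False not_True_eq_False not_False_eq_True diff_gt_0_iff_gt diff_less_eq less_add_same_cancel1)
  qed
qed

definition transition :: "(nat \<Rightarrow> 'n::group_add) \<Rightarrow> 'a \<Rightarrow> 'a \<Rightarrow> 'n"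
  where "transition u s v = (let p = SOME p. fst p \<in> fibre s \<and> snd p \<in> cball 0 1 \<and> q (snd p) = v \<and>
      dist (snd p) (fst p) < eps s
    in - nu u (fst p) + nu u (snd p))"

text \<open>Any other admissible pair arises by moving both points across the same glued side. There
  \<open>nu\<close> changes by the same amount on the left at both points, and this cancels in
  \<open>- nu u w + nu u z\<close>.\<close>

lemma transition_eq:
  assumes u: "surface_labels g u" and w: "w \<in> fibre s" and z: "z \<in> cball 0 1" "dist z w < eps s"
  shows "transition u s (q z) = - nu u w + nu u z"
proof -
  define P where "P p \<longleftrightarrow> fst p \<in> fibre s \<and> snd p \<in> cball 0 1 \<and> q (snd p) = q z \<and>
      dist (snd p) (fst p) < eps s" for p
  define w' where "w' = fst (SOME p. P p)"
  define z' where "z' = snd (SOME p. P p)"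
  have "P (SOME p. P p)" by (rule someI[of _ "(w, z)"]) (use w z in \<open>simp add: P_def\<close>)
  then have P: "w' \<in> fibre s" "z' \<in> cball 0 1" "q z = q z'" "dist z' w' < eps s"
    by (simp_all add: P_def w'_def z'_def)
  have t: "transition u s (q z) = - nu u w' + nu u z'"
    unfolding transition_def P_def[symmetric] w'_def z'_def by (simp only: Let_def)
  consider "z = z'" "w = w'" | "z = w" "z' = w'"
    | j t t0 where "j < 4 * g" "t \<in> {0..1}" "t0 \<in> {0..1}" "z = side g j t" "z' = side g (partner j) (1 - t)"
      "w = side g j t0" "w' = side g (partner j) (1 - t0)"
    using local_compat[OF w P(1) z(1) P(2) z(2) P(4) P(3)] by blast
  then show ?thesis
  proof cases
    case (3 j t t0)
    have "nu u z - nu u z' = nu u w - nu u w'"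
      unfolding 3 nu_glue[OF u 3(1,2)] nu_glue[OF u 3(1,3)] by (rule HOL.refl)
    then show ?thesis unfolding t by (rule diff_eq_shift[symmetric])
  next
    case 1
    then show ?thesis unfolding t by (simp only:)
  next
    case 2
    then show ?thesis unfolding t by (simp only: left_minus)
  qed
qed

lemma flat_transition:
  assumes u: "surface_labels g u"
  shows "flat_structure S (transition u)"
proof
  fix s assume s: "s \<in> topspace S"
  show "\<exists>U. openin S U \<and> s \<in> U \<and> (\<forall>y\<in>U. \<exists>B. openin S B \<and> y \<in> B \<and>
    (\<forall>v\<in>B. transition u s v = transition u s y + transition u y v))"
  proof (rule exI[of _ "nbhd s"], intro conjI openin_nbhd nbhd_self[OF s] ballI)
    fix y assume y: "y \<in> nbhd s"
    \<comment> \<open>Points close to some \<open>w0\<close> over \<open>y\<close> and also to some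
      \<open>w\<close> over \<open>s\<close> that is itself close to \<open>w0\<close>. For these
      the cocycle identity is the cancellation of \<open>nu u w0\<close>.\<close>
    define W where "W = (\<Union>w0\<in>fibre y. \<Union>w\<in>{w \<in> fibre s. dist w0 w < eps s}. ball w0 (eps y) \<inter> ball w (eps s))"
    define B where "B = {v \<in> topspace S. \<forall>z\<in>cball 0 1. q z = v \<longrightarrow> z \<in> W}"
    have "openin S B" unfolding B_def by (rule openin_full_preimage) (auto simp: W_def)
    moreover have "y \<in> B"
    proof -
      have "z \<in> W" if z: "z \<in> cball 0 1" "q z = y" for z
      proof -
        obtain w where w: "w \<in> fibre s" "z \<in> ball w (eps s)"
          using y z unfolding nbhd_def by blast
        moreover have "z \<in> fibre y" "z \<in> ball z (eps y)" using z eps_pos by (auto simp: fibre_def)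
        ultimately show ?thesis unfolding W_def
          by (intro UN_I[of z] UN_I[of w]) (auto simp: dist_commute)
      qed
      then show ?thesis using y unfolding B_def nbhd_def by blast
    qed
    moreover have "transition u s v = transition u s y + transition u y v" if v: "v \<in> B" for v
    proof -
      obtain z where z: "z \<in> cball 0 1" "q z = v" using v unfolding B_def top_S by auto
      then have "z \<in> W" using v unfolding B_def by blast
      then obtain w0 w where w: "w0 \<in> fibre y" "w \<in> fibre s" "dist w0 w < eps s" "dist z w0 < eps y" "dist z w < eps s"
        unfolding W_def by (auto simp: dist_commute)
      have y': "w0 \<in> cball 0 1" "q w0 = y" using w(1) by (auto simp: fibre_def)
      show ?thesis
        unfolding z(2)[symmetric] transition_eq[OF u w(2) z(1) w(5)] transition_eq[OF u w(1) z(1) w(4)]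
          transition_eq[OF u w(2) y'(1) w(3), unfolded y'(2)]
        by (simp only: add.assoc add_minus_cancel)
    qed
    ultimately show "\<exists>B. openin S B \<and> y \<in> B \<and> (\<forall>v\<in>B. transition u s v = transition u s y + transition u y v)"
      by (intro exI[of _ B] conjI ballI)
  qed
qed

lemma cont_q: "continuous_map (top_of_set (cball 0 1)) S q"
  using quot by (rule quotient_imp_continuous_map)

text \<open>\<open>nu u\<close> along the path is itself a lift, so the holonomy of a path that
  comes from the disc depends on its ends only.\<close>

lemma hol_disc:
  assumes u: "surface_labels g u" and f: "path f" "path_image f \<subseteq> cball 0 1"
  shows "flat_structure.hol (transition u) (q \<circ> f) = - nu u (f 0) + nu u (f 1)"
proof -
  interpret F: flat_structure S "transition u" by (rule flat_transition[OF u])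
  have "F.is_lift {0..1} (q \<circ> f) (nu u \<circ> f)"
    unfolding F.is_lift_def o_apply
  proof
    fix a :: real assume a: "a \<in> {0..1}"
    then have fa: "f a \<in> cball 0 1" using f(2) unfolding path_image_def by blast
    obtain e where e: "e > 0" "\<And>b. b \<in> {0..1} \<Longrightarrow> dist b a < e \<Longrightarrow> dist (f b) (f a) < eps (q (f a))"
      using f(1) a eps_pos(1) unfolding path_def continuous_on_iff by metis
    have "nu u (f b) = nu u (f a) + transition u (q (f a)) (q (f b))"
      if b: "b \<in> {0..1}" "dist b a < e" for b
    proof -
      have fb: "f b \<in> cball 0 1" using f(2) b unfolding path_image_def by blast
      have w: "f a \<in> fibre (q (f a))" using fa by (simp add: fibre_def)
      show ?thesis unfolding transition_eq[OF u w fb e(2)[OF b]] by (simp only: add_minus_cancel)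
    qed
    then show "\<exists>d>0. \<forall>b\<in>{0..1}. dist b a < d \<longrightarrow>
        nu u (f b) = nu u (f a) + transition u (q (f a)) (q (f b))"
      using e(1) by (intro exI[of _ e] conjI ballI impI)
  qed
  from F.hol_eqI[OF this] show ?thesis unfolding o_apply .
qed

definition seg :: "complex \<Rightarrow> complex \<Rightarrow> real \<Rightarrow> 'a"
  where "seg z w = q \<circ> linepath z w"

text \<open>Out to corner \<open>j\<close> and back from corner 0; it is a path because all corners
  are the same point of the surface.\<close>

definition corner_loop :: "complex \<Rightarrow> nat \<Rightarrow> real \<Rightarrow> 'a"
  where "corner_loop d j = loop_join (seg d (side g j 0)) (seg (side g 0 0) d)"

lemma seg_ends [simp]: "seg z w 0 = q z" "seg z w 1 = q w"
  by (simp_all add: seg_def linepath_def)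

lemma linepath_disc: "z \<in> cball 0 1 \<Longrightarrow> w \<in> cball 0 1 \<Longrightarrow> path_image (linepath z w) \<subseteq> cball 0 (1::real)"
  unfolding path_image_linepath by (intro closed_segment_subset) auto

lemma pathin_seg: "z \<in> cball 0 1 \<Longrightarrow> w \<in> cball 0 1 \<Longrightarrow> pathin S (seg z w)"
  unfolding seg_def by (rule pathin_comp[OF cont_q]) (simp_all only: path_linepath linepath_disc)

lemma corner_loop_in:
  assumes "d \<in> cball 0 1" "j \<le> 4 * g" shows "corner_loop d j \<in> loops S (q d)"
proof -
  have "pathin S (corner_loop d j)"
    unfolding corner_loop_def
    by (intro pathin_loop_join pathin_seg assms side_in(1)) (simp add: q_corner[OF assms(2)])
  then show ?thesis by (simp add: loops_def corner_loop_def)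
qed

theorem loop_hom_exists:
  assumes u: "surface_labels g u" and d: "d \<in> cball 0 1"
  shows "\<exists>f. loop_hom S (q d) f \<and> (\<forall>j\<le>4*g. f (corner_loop d j) = u j)"
proof -
  interpret F: flat_structure S "transition u" by (rule flat_transition[OF u])
  \<comment> \<open>Conjugation by \<open>nu u d\<close> moves the reference value to the base
    point, which may lie on the boundary, where \<open>nu\<close> need not be zero.\<close>
  define f where "f p = nu u d + F.hol p - nu u d" for p
  have "loop_hom S (q d) f"
    unfolding loop_hom_def
  proof (intro conjI ballI allI impI)
    fix p p' assume "p \<in> loops S (q d)" "p' \<in> loops S (q d)"
    then have "F.hol (loop_join p p') = F.hol p + F.hol p'"
      by (intro F.hol_join) (simp_all add: loops_def)
    then show "f (loop_join p p') = f p + f p'"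
      unfolding f_def by (simp only: diff_conv_add_uminus add.assoc minus_add_cancel)
  next
    fix p p' assume "path_htpy S p p'"
    then have "F.hol p = F.hol p'" by (rule F.hol_htpy)
    then show "f p = f p'" by (simp only: f_def)
  qed
  moreover have "f (corner_loop d j) = u j" if j: "j \<le> 4 * g" for j
  proof -
    have "F.hol (corner_loop d j) = F.hol (seg d (side g j 0)) + F.hol (seg (side g 0 0) d)"
      unfolding corner_loop_def
      by (intro F.hol_join pathin_seg d side_in(1)) (simp add: q_corner[OF j])
    also have "\<dots> = (- nu u d + nu u (side g j 0)) + (- nu u (side g 0 0) + nu u d)"
      unfolding seg_def hol_disc[OF u path_linepath linepath_disc[OF d side_in(1)]]
        hol_disc[OF u path_linepath linepath_disc[OF side_in(1) d]]
      by (simp only: linepath_0' linepath_1')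
    finally have *: "F.hol (corner_loop d j) = (- nu u d + nu u (side g j 0)) + (- nu u (side g 0 0) + nu u d)" .
    have "u 0 = 0" using u by (simp add: surface_labels_def)
    then show ?thesis
      unfolding f_def * nu_corner[OF u j] nu_corner[OF u le0]
      by (simp only: diff_conv_add_uminus add.assoc add_minus_cancel minus_zero add_0_left add_0_right right_minus)
  qed
  ultimately show ?thesis by blast
qed

end

lemma group_idem_zero:
  fixes a :: "'n::group_add"
  assumes "a + a = a" shows "a = 0"
proof -
  have "a + a = a + 0" unfolding assms add_0_right by (rule HOL.refl)
  then show ?thesis unfolding add_left_cancel .
qed

section \<open>Homomorphisms on loops and their labels\<close>

locale surface_hom = surface g S q
  for g :: nat and S :: "'a topology" and q :: "complex \<Rightarrow> 'a" +
  fixes d :: complex and f :: "(real \<Rightarrow> 'a) \<Rightarrow> 'n::group_add"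
  assumes d: "d \<in> cball 0 1" and hom: "loop_hom S (q d) f"
begin

lemma loopsI: "pathin S p \<Longrightarrow> p 0 = q d \<Longrightarrow> p 1 = q d \<Longrightarrow> p \<in> loops S (q d)"
  by (simp add: loops_def)

lemma f_htpy: "path_htpy S p p' \<Longrightarrow> p 0 = q d \<Longrightarrow> p 1 = q d \<Longrightarrow> f p = f p'"
  using hom path_htpy_ends(3)[of S p p'] loopsI[of p] unfolding loop_hom_def by blast

lemma f_join: "p \<in> loops S (q d) \<Longrightarrow> p' \<in> loops S (q d) \<Longrightarrow> f (loop_join p p') = f p + f p'"
  using hom unfolding loop_hom_def by blast

text \<open>The jump of \<open>f\<close> across a gluing: the loop runs inside the disc to
  \<open>z\<close>, continues from the identified point \<open>z'\<close> and returns inside the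
  disc.\<close>

definition lam :: "complex \<Rightarrow> complex \<Rightarrow> 'n"
  where "lam z z' = f (loop_join (seg d z) (seg z' d))"

lemma rev_seg: "rev_path (seg z w) = seg w z"
  by (simp add: rev_path_def seg_def linepath_def fun_eq_iff add.commute)

lemma lam_loop:
  assumes "z \<in> cball 0 1" "z' \<in> cball 0 1" "q z = q z'"
  shows "loop_join (seg d z) (seg z' d) \<in> loops S (q d)"
  using assms d by (intro loopsI pathin_loop_join pathin_seg) simp_all

lemma lam_add:
  assumes "z \<in> cball 0 1" "z' \<in> cball 0 1" "z'' \<in> cball 0 1" "q z = q z'" "q z' = q z''"
  shows "lam z z' + lam z' z'' = lam z z''"
proof -
  have "lam z z' + lam z' z'' = f (loop_join (loop_join (seg d z) (seg z' d)) (loop_join (seg d z') (seg z'' d)))"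
    unfolding lam_def using assms by (intro f_join[symmetric] lam_loop)
  also have "\<dots> = lam z z''"
    unfolding lam_def rev_seg[of z' d, symmetric]
    by (intro f_htpy path_htpy_cancel pathin_seg) (use assms d in simp_all)
  finally show ?thesis .
qed

lemma lam_self: "z \<in> cball 0 1 \<Longrightarrow> lam z z = 0"
  by (rule group_idem_zero, rule lam_add) simp_all

lemma lam_swap:
  assumes "z \<in> cball 0 1" "z' \<in> cball 0 1" "q z = q z'"
  shows "lam z' z = - lam z z'"
proof -
  have "lam z z' + lam z' z = 0"
    using lam_add[OF assms(1,2,1) assms(3) assms(3)[symmetric]] lam_self[OF assms(1)] by (rule HOL.trans)
  then show ?thesis by (rule minus_unique[symmetric])
qed

lemma lam_corner: "lam (side g j 0) (side g 0 0) = f (corner_loop d j)"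
  by (simp only: lam_def corner_loop_def)

lemma lam_corners:
  assumes "i \<le> 4 * g" "j \<le> 4 * g"
  shows "lam (side g i 0) (side g j 0) = f (corner_loop d i) - f (corner_loop d j)"
proof -
  have "lam (side g i 0) (side g j 0) = lam (side g i 0) (side g 0 0) + lam (side g 0 0) (side g j 0)"
    by (intro lam_add[symmetric] side_in(1)) (simp_all only: q_corner[OF assms(1)] q_corner[OF assms(2)])
  also have "lam (side g 0 0) (side g j 0) = - lam (side g j 0) (side g 0 0)"
    by (intro lam_swap side_in(1)) (simp_all only: q_corner[OF assms(1)] q_corner[OF assms(2)])
  finally show ?thesis unfolding lam_corner by (simp only: diff_conv_add_uminus)
qed

lemma disc_htpy:
  assumes "path \<phi>" "path \<psi>" "path_image \<phi> \<subseteq> cball 0 1" "path_image \<psi> \<subseteq> cball 0 1" "\<phi> 0 = \<psi> 0" "\<phi> 1 = \<psi> 1"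
  shows "path_htpy S (q \<circ> \<phi>) (q \<circ> \<psi>)"
  by (rule path_htpy_convex[OF cont_q _ assms]) simp

lemma loop_join_disc: "\<phi> 1 = \<psi> 0 \<Longrightarrow> loop_join (q \<circ> \<phi>) (q \<circ> \<psi>) = q \<circ> (\<phi> +++ \<psi>)"
  by (auto simp: loop_join_def joinpaths_def fun_eq_iff)

lemma seg_disc:
  assumes "path \<phi>" "path_image \<phi> \<subseteq> cball 0 1"
  shows "path_htpy S (q \<circ> \<phi>) (seg (\<phi> 0) (\<phi> 1))"
proof -
  have "\<phi> 0 \<in> cball 0 1" "\<phi> 1 \<in> cball 0 1"
    using assms(2) by (auto simp: path_image_def image_subset_iff)
  then show ?thesis
    unfolding seg_def using assms
    by (intro disc_htpy path_linepath linepath_disc) (simp_all add: linepath_0' linepath_1')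
qed

lemma seg_join_disc:
  assumes "path \<phi>" "path_image \<phi> \<subseteq> cball 0 1" "path \<psi>" "path_image \<psi> \<subseteq> cball 0 1" "\<phi> 1 = \<psi> 0"
  shows "path_htpy S (loop_join (q \<circ> \<phi>) (q \<circ> \<psi>)) (seg (\<phi> 0) (\<psi> 1))"
proof -
  have "path_htpy S (q \<circ> (\<phi> +++ \<psi>)) (seg ((\<phi> +++ \<psi>) 0) ((\<phi> +++ \<psi>) 1))"
    by (rule seg_disc)
      (use assms in \<open>auto simp: path_join pathstart_def pathfinish_def path_image_join\<close>)
  then show ?thesis using assms(5) by (simp add: loop_join_disc joinpaths_def)
qed

lemma seg_join:
  assumes "z \<in> cball 0 1" "w \<in> cball 0 1" "v \<in> cball 0 1"
  shows "path_htpy S (loop_join (seg z w) (seg w v)) (seg z v)"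
  using seg_join_disc[of "linepath z w" "linepath w v"] assms
  by (simp only: seg_def linepath_0' linepath_1' path_linepath linepath_disc)

text \<open>The crossing point is slid along the glued sides to their ends. The arcs
  \<open>?A\<close> and \<open>?B\<close> that it covers become mutually inverse paths on the
  surface and cancel.\<close>

lemma lam_side:
  assumes j: "j < 4 * g" and t: "t \<in> {0..1}"
  shows "lam (side g j t) (side g (partner j) (1 - t)) = lam (side g j 0) (side g (partner j) 1)"
proof -
  let ?A = "\<lambda>\<tau>. side g j (\<tau> * t)"
  let ?B = "\<lambda>\<tau>. side g (partner j) (1 - t * (1 - \<tau>))"
  let ?z = "side g j t" and ?z' = "side g (partner j) (1 - t)"
  let ?c = "side g j 0" and ?c' = "side g (partner j) 1"
  have pA: "path ?A"
    unfolding path_def by (rule continuous_on_compose2[OF cont_side[of UNIV]]) (auto intro!: continuous_intros)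
  have pB: "path ?B"
    unfolding path_def by (rule continuous_on_compose2[OF cont_side[of UNIV]]) (auto intro!: continuous_intros)
  have iA: "path_image ?A \<subseteq> cball 0 1"
    unfolding path_image_def by (rule image_subsetI, rule side_in(1))
  have iB: "path_image ?B \<subseteq> cball 0 1"
    unfolding path_image_def by (rule image_subsetI, rule side_in(1))
  note A = pathin_comp[OF cont_q pA iA] and B = pathin_comp[OF cont_q pB iB]
  have BA: "path_htpy S (q \<circ> ?B) (rev_path (q \<circ> ?A))"
  proof (rule path_htpy_eq[OF B])
    fix \<tau> :: real assume tau: "\<tau> \<in> {0..1}"
    have "(1 - \<tau>) * t \<in> {0..1}" using tau t by (auto simp: mult_le_one)
    from q_side[OF j this] show "(q \<circ> ?B) \<tau> = rev_path (q \<circ> ?A) \<tau>"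
      by (simp add: rev_path_def mult.commute)
  qed
  have c: "q ?c = q ?c'" using q_side[OF j, of 0] by simp
  have z: "q ?z = q ?z'" using q_side[OF j t] .
  have 1: "path_htpy S (seg d ?z) (loop_join (seg d ?c) (q \<circ> ?A))"
  proof (rule path_htpy_sym)
    have "path_htpy S (loop_join (q \<circ> linepath d ?c) (q \<circ> ?A)) (seg (linepath d ?c 0) (?A 1))"
      by (rule seg_join_disc) (use pA iA d in \<open>simp_all add: linepath_1' linepath_disc del: path_image_linepath\<close>)
    then show "path_htpy S (loop_join (seg d ?c) (q \<circ> ?A)) (seg d ?z)"
      by (simp add: seg_def linepath_0')
  qed
  have 2: "path_htpy S (seg ?z' d) (loop_join (q \<circ> ?B) (seg ?c' d))"
  proof (rule path_htpy_sym)
    have "path_htpy S (loop_join (q \<circ> ?B) (q \<circ> linepath ?c' d)) (seg (?B 0) (linepath ?c' d 1))"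
      by (rule seg_join_disc) (use pB iB d in \<open>simp_all add: linepath_0' linepath_disc del: path_image_linepath\<close>)
    then show "path_htpy S (loop_join (q \<circ> ?B) (seg ?c' d)) (seg ?z' d)"
      by (simp add: seg_def linepath_1')
  qed
  have 3: "path_htpy S (loop_join (q \<circ> ?B) (seg ?c' d)) (loop_join (rev_path (q \<circ> ?A)) (seg ?c' d))"
    by (intro path_htpy_join BA path_htpy_refl pathin_seg side_in(1) d) simp
  have "path_htpy S (loop_join (seg d ?z) (seg ?z' d))
      (loop_join (loop_join (seg d ?c) (q \<circ> ?A)) (loop_join (rev_path (q \<circ> ?A)) (seg ?c' d)))"
    by (rule path_htpy_join[OF 1 path_htpy_trans[OF 2 3]]) (simp add: z)
  also have "path_htpy S \<dots> (loop_join (seg d ?c) (seg ?c' d))"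
    by (intro path_htpy_cancel pathin_seg side_in(1) d A) (simp_all add: c)
  finally show ?thesis unfolding lam_def by (rule f_htpy) simp_all
qed

lemma lam_partner:
  assumes j: "j < 4 * g" and t: "t \<in> {0..1}"
  shows "lam (side g j t) (side g (partner j) (1 - t)) =
    f (corner_loop d j) - f (corner_loop d (Suc (partner j)))"
  using lam_side[OF assms] lam_corners[of j "Suc (partner j)"] partner_less[OF j] j side_1[of "partner j"]
  by simp

text \<open>The jump across a pair of sides is the same at \<open>t = 0\<close> and at
  \<open>t = 1\<close>, and at either end it is a difference of two corner values.\<close>

theorem corner_loop_labels: "surface_labels g (\<lambda>j. f (corner_loop d j))"
  unfolding surface_labels_def
proof (intro conjI allI impI)
  show 0: "f (corner_loop d 0) = 0"
    unfolding lam_corner[symmetric] by (rule lam_self[OF side_in(1)])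
  then show "f (corner_loop d (4 * g)) = 0"
    by (simp add: corner_loop_def side_last)
  fix j assume j: "j < 4 * g"
  have p: "partner j < 4 * g" by (rule partner_less[OF j])
  have "f (corner_loop d j) - f (corner_loop d (Suc (partner j))) = lam (side g j 1) (side g (partner j) (1 - 1))"
    by (rule lam_partner[OF j, symmetric]) simp
  also have "\<dots> = f (corner_loop d (Suc j)) - f (corner_loop d (partner j))"
    using lam_corners[of "Suc j" "partner j"] j p by (simp add: side_1)
  finally show "f (corner_loop d j) - f (corner_loop d (Suc (partner j))) =
    f (corner_loop d (Suc j)) - f (corner_loop d (partner j))" .
qed

text \<open>The base point is lifted to \<open>d\<close> itself, so that \<open>fh\<close> takes the
  same values as \<open>f\<close> on loops.\<close>

definition lft :: "'a \<Rightarrow> complex"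
  where "lft s = (if s = q d then d else SOME z. z \<in> cball 0 1 \<and> q z = s)"

lemma lft:
  assumes "s \<in> topspace S" shows "lft s \<in> cball 0 1" "q (lft s) = s"
proof -
  have "\<exists>z. z \<in> cball 0 1 \<and> q z = s" using assms unfolding top_S by blast
  from someI_ex[OF this] show "lft s \<in> cball 0 1" "q (lft s) = s"
    using d by (auto simp: lft_def)
qed

lemma pathin_ends: "pathin S p \<Longrightarrow> p 0 \<in> topspace S" "pathin S p \<Longrightarrow> p 1 \<in> topspace S"
  by (auto simp: pathin_def continuous_map_def)

text \<open>Extends \<open>f\<close> from loops to paths, closing a path by segments in the disc.
  This allows a loop to be cut into short pieces.\<close>

definition fh :: "(real \<Rightarrow> 'a) \<Rightarrow> 'n"
  where "fh p = f (loop_join (seg d (lft (p 0))) (loop_join p (seg (lft (p 1)) d)))"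

lemma fh_loop:
  assumes "pathin S p"
  shows "loop_join (seg d (lft (p 0))) (loop_join p (seg (lft (p 1)) d)) \<in> loops S (q d)"
  using assms lft pathin_ends d by (intro loopsI pathin_loop_join pathin_seg) simp_all

lemma fh_htpy:
  assumes "path_htpy S p p'" shows "fh p = fh p'"
proof -
  note e = path_htpy_ends[OF assms]
  have "path_htpy S (loop_join (seg d (lft (p 0))) (loop_join p (seg (lft (p 1)) d)))
     (loop_join (seg d (lft (p 0))) (loop_join p' (seg (lft (p 1)) d)))"
    using e lft pathin_ends[OF e(3)] d by (intro path_htpy_join assms path_htpy_refl pathin_seg) simp_all
  then show ?thesis unfolding fh_def e(1,2) by (rule f_htpy) simp_all
qed

lemma fh_join:
  assumes p: "pathin S p" "pathin S p'" "p 1 = p' 0"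
  shows "fh (loop_join p p') = fh p + fh p'"
proof -
  let ?a = "seg d (lft (p 0))" and ?b = "seg (lft (p 1)) d" and ?b' = "seg d (lft (p 1))"
  let ?c = "seg (lft (p' 1)) d"
  have pa: "pathin S ?a" "pathin S ?b" "pathin S ?b'" "pathin S ?c"
    using lft pathin_ends[OF p(1)] pathin_ends[OF p(2)] d by (auto intro!: pathin_seg)
  have e: "?a 1 = p 0" "?b 0 = p 1" "?b' 1 = p 1" "?c 0 = p' 1"
    using lft pathin_ends[OF p(1)] pathin_ends[OF p(2)] by simp_all
  have "fh p + fh p' = f (loop_join (loop_join ?a (loop_join p ?b)) (loop_join ?b' (loop_join p' ?c)))"
    unfolding fh_def p(3)[symmetric]
    using fh_loop[OF p(1)] fh_loop[OF p(2)] by (intro f_join[symmetric]) (simp_all add: p(3))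
  also have "\<dots> = f (loop_join ?a (loop_join (loop_join p p') ?c))"
  proof (rule f_htpy)
    have "path_htpy S (loop_join (loop_join ?a (loop_join p ?b)) (loop_join ?b' (loop_join p' ?c)))
       (loop_join (loop_join (loop_join ?a p) ?b) (loop_join ?b' (loop_join p' ?c)))"
      by (rule path_htpy_join[OF path_htpy_sym[OF path_htpy_assoc] path_htpy_refl])
        (use pa p e in \<open>simp_all add: pathin_loop_join\<close>)
    also have "path_htpy S \<dots> (loop_join (loop_join ?a p) (loop_join p' ?c))"
    proof -
      have "path_htpy S (loop_join (loop_join (loop_join ?a p) ?b) (loop_join (rev_path ?b) (loop_join p' ?c)))
          (loop_join (loop_join ?a p) (loop_join p' ?c))"
        by (rule path_htpy_cancel) (use pa p e in \<open>simp_all add: pathin_loop_join\<close>)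
      then show ?thesis by (simp only: rev_seg)
    qed
    also have "path_htpy S \<dots> (loop_join ?a (loop_join p (loop_join p' ?c)))"
      by (rule path_htpy_assoc) (use pa p e in \<open>simp_all add: pathin_loop_join\<close>)
    also have "path_htpy S \<dots> (loop_join ?a (loop_join (loop_join p p') ?c))"
      by (rule path_htpy_join[OF path_htpy_refl path_htpy_sym[OF path_htpy_assoc]])
        (use pa p e in \<open>simp_all add: pathin_loop_join\<close>)
    finally show "path_htpy S (loop_join (loop_join ?a (loop_join p ?b)) (loop_join ?b' (loop_join p' ?c)))
      (loop_join ?a (loop_join (loop_join p p') ?c))" .
  qed simp_all
  also have "\<dots> = fh (loop_join p p')" by (simp add: fh_def)
  finally show ?thesis by (rule HOL.sym)
qed

lemma fh_seg:
  assumes zw: "z \<in> cball 0 1" "w \<in> cball 0 1"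
  shows "fh (seg z w) = lam (lft (q z)) z + lam w (lft (q w))"
proof -
  have t: "q z \<in> topspace S" "q w \<in> topspace S" using zw unfolding top_S by auto
  let ?z = "lft (q z)" and ?w = "lft (q w)"
  have l: "?z \<in> cball 0 1" "?w \<in> cball 0 1" "q ?z = q z" "q ?w = q w" using lft t by auto
  note pa = pathin_seg[OF d l(1)] pathin_seg[OF l(2) d] pathin_seg[OF zw(1) d] pathin_seg[OF d zw(2)]
    pathin_seg[OF zw]
  have "lam ?z z + lam w ?w = f (loop_join (loop_join (seg d ?z) (seg z d)) (loop_join (seg d w) (seg ?w d)))"
    unfolding lam_def using zw l by (intro f_join[symmetric] lam_loop) simp_all
  also have "\<dots> = f (loop_join (seg d ?z) (loop_join (seg z w) (seg ?w d)))"
  proof (rule f_htpy)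
    have "path_htpy S (loop_join (loop_join (seg d ?z) (seg z d)) (loop_join (seg d w) (seg ?w d)))
       (loop_join (seg d ?z) (loop_join (seg z d) (loop_join (seg d w) (seg ?w d))))"
      by (intro path_htpy_assoc pathin_loop_join pa) (simp_all add: l)
    also have "path_htpy S \<dots> (loop_join (seg d ?z) (loop_join (loop_join (seg z d) (seg d w)) (seg ?w d)))"
      by (rule path_htpy_join[OF path_htpy_refl path_htpy_sym[OF path_htpy_assoc]])
        (use pa l in \<open>simp_all add: pathin_loop_join\<close>)
    also have "path_htpy S \<dots> (loop_join (seg d ?z) (loop_join (seg z w) (seg ?w d)))"
      by (rule path_htpy_join[OF path_htpy_refl path_htpy_join[OF seg_join path_htpy_refl]])
        (use pa l zw d in simp_all)
    finally show "path_htpy S (loop_join (loop_join (seg d ?z) (seg z d)) (loop_join (seg d w) (seg ?w d)))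
       (loop_join (seg d ?z) (loop_join (seg z w) (seg ?w d)))" .
  qed simp_all
  finally show ?thesis by (simp add: fh_def)
qed

lemma fh_const:
  assumes "x \<in> topspace S" shows "fh (\<lambda>_. x) = 0"
proof -
  have "loop_join (\<lambda>_. x) (\<lambda>_. x) = (\<lambda>_. x)" by (simp add: loop_join_def)
  then have "fh (\<lambda>_. x) + fh (\<lambda>_. x) = fh (\<lambda>_. x)"
    using fh_join[OF iffD2[OF pathin_const assms] iffD2[OF pathin_const assms]] by simp
  then show ?thesis by (rule group_idem_zero)
qed

lemma fh_rev:
  assumes "pathin S p" shows "fh (rev_path p) = - fh p"
proof -
  have "fh p + fh (rev_path p) = fh (\<lambda>_. p 0)"
    using fh_join[OF assms pathin_rev[OF assms]] fh_htpy[OF path_htpy_inv[OF assms]] by simp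
  then have "fh p + fh (rev_path p) = 0" using fh_const pathin_ends assms by simp
  then show ?thesis by (rule minus_unique[symmetric])
qed

lemma fh_loop_eq:
  assumes "p \<in> loops S (q d)" shows "fh p = f p"
proof -
  have p: "pathin S p" "p 0 = q d" "p 1 = q d" using assms by (auto simp: loops_def)
  have s: "seg d d = (\<lambda>_. q d)" by (simp add: seg_def o_def linepath_refl)
  have "path_htpy S (loop_join (seg d d) (loop_join p (seg d d))) p"
  proof -
    have r: "path_htpy S (loop_join p (seg d d)) p"
      using path_htpy_rid[OF p(1)] p(3) s by simp
    have "path_htpy S (loop_join (seg d d) (loop_join p (seg d d))) (loop_join (seg d d) p)"
      by (intro path_htpy_join r path_htpy_refl pathin_seg d) (simp add: p)
    also have "path_htpy S \<dots> p" using path_htpy_lid[OF p(1)] p(2) s by simp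
    finally show ?thesis .
  qed
  from f_htpy[OF this] show ?thesis by (simp add: fh_def p lft_def)
qed

end

section \<open>Local contractions, and uniqueness of homomorphisms with given labels\<close>

context surface
begin

text \<open>From \<open>z\<close> at time 0 to \<open>w\<close> at time 1. Around a boundary point a
  straight segment would leave the circle; scaling the logarithm of z / w instead keeps arcs of the
  circle on the circle and is affine in the side parameter (\<open>contract_side\<close>), hence
  commutes with gluing.\<close>

definition contract :: "complex \<Rightarrow> complex \<Rightarrow> real \<Rightarrow> complex"
  where "contract w z \<tau> = (if norm w = 1 then w * exp (of_real (1 - \<tau>) * Ln (z / w))
    else of_real (1 - \<tau>) * z + of_real \<tau> * w)"

lemma contract_boundary:
  "norm w = 1 \<Longrightarrow> contract w z \<tau> = w * exp (of_real (1 - \<tau>) * Ln (z / w))"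
  by (simp add: contract_def)

lemma contract_interior:
  "norm w \<noteq> 1 \<Longrightarrow> contract w z \<tau> = of_real (1 - \<tau>) * z + of_real \<tau> * w"
  by (simp add: contract_def)

lemma near_unit:
  assumes "norm w = 1" "dist z w < 1"
  shows "0 < Re (z / w)" "z \<noteq> 0" "w \<noteq> 0"
proof -
  show w: "w \<noteq> 0" using assms(1) by auto
  have "z / w - 1 = (z - w) / w" using w by (simp add: field_simps)
  then have "norm (z / w - 1) < 1" using assms by (simp add: norm_divide dist_norm)
  moreover have "\<bar>Re (z / w - 1)\<bar> \<le> norm (z / w - 1)" by (rule abs_Re_le_cmod)
  ultimately show "0 < Re (z / w)" by simp
  then show "z \<noteq> 0" by auto
qed

lemma contract_0:
  assumes "norm w = 1 \<Longrightarrow> dist z w < 1" shows "contract w z 0 = z"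
  using near_unit[of w z] assms unfolding contract_def by auto

lemma contract_1: "contract w z 1 = w"
  by (simp add: contract_def)

lemma contract_self: "contract w w \<tau> = w"
proof (cases "norm w = 1")
  case True
  then have "w \<noteq> 0" by auto
  then show ?thesis by (simp add: contract_boundary[OF True])
next
  case False
  then show ?thesis by (simp add: contract_interior algebra_simps)
qed

text \<open>For \<open>w\<close> on the circle the modulus at time \<tau> is the power of
  \<open>norm (z / w)\<close> with exponent \<open>1 - \<tau>\<close>, and this norm is at most 1.
  In the interior, convexity suffices.\<close>

lemma contract_in:
  assumes z: "z \<in> cball 0 1" "w \<in> cball 0 1" and "norm w = 1 \<Longrightarrow> dist z w < 1" and t: "\<tau> \<in> {0..1}"
  shows "contract w z \<tau> \<in> cball 0 1"
proof (cases "norm w = 1")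
  case True
  then have n: "z \<noteq> 0" "w \<noteq> 0" using near_unit assms by blast+
  then have "norm (z / w) \<le> 1" "norm (z / w) > 0" using True z by (auto simp: norm_divide)
  then have "(1 - \<tau>) * ln (norm (z / w)) \<le> 0"
    using t by (intro mult_nonneg_nonpos) auto
  then have "exp (Re (of_real (1 - \<tau>) * Ln (z / w))) \<le> 1" using n by simp
  then show ?thesis using True by (simp add: contract_def norm_mult norm_exp_eq_Re)
next
  case False
  have "convex (cball (0::complex) 1)" by simp
  then have "(1 - \<tau>) *\<^sub>R z + \<tau> *\<^sub>R w \<in> cball 0 1"
    by (rule convexD) (use z t in auto)
  then show ?thesis using False by (simp add: contract_def scaleR_conv_of_real)
qed

text \<open>A side subtends an angle of at most a quarter turn, so the principal logarithm of the
  quotient is exactly the difference of the angles.\<close>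

lemma contract_side:
  assumes t: "t \<in> {0..1}" "t0 \<in> {0..1}"
  shows "contract (side g j t0) (side g j t) \<tau> = side g j ((1 - \<tau>) * t + \<tau> * t0)"
proof -
  let ?c = "2 * pi / real (4 * g)"
  let ?a = "2 * pi * (real j + t) / real (4 * g)" and ?b = "2 * pi * (real j + t0) / real (4 * g)"
  have c: "0 < ?c" "?c < pi" using g by (auto simp: field_simps)
  have ab: "?a - ?b = ?c * (t - t0)" using g by (simp add: field_simps)
  have "\<bar>?c * (t - t0)\<bar> \<le> ?c * 1"
    unfolding abs_mult using c t by (intro mult_mono) auto
  then have lt: "\<bar>?a - ?b\<bar> < pi" using c unfolding ab by linarith
  have "side g j t / side g j t0 = exp (\<i> * of_real (?a - ?b))"
    unfolding side_def cis_divide cis_conv_exp[symmetric] by (rule HOL.refl)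
  moreover have "Ln (exp (\<i> * of_real (?a - ?b))) = \<i> * of_real (?a - ?b)"
    by (rule Ln_exp) (use lt in \<open>auto simp: abs_less_iff\<close>)
  ultimately have L: "Ln (side g j t / side g j t0) = \<i> * of_real (?a - ?b)" by (simp only:)
  have "contract (side g j t0) (side g j t) \<tau> = cis ?b * exp (of_real (1 - \<tau>) * (\<i> * of_real (?a - ?b)))"
    unfolding contract_boundary[OF side_in(2)] L by (simp only: side_def)
  also have "exp (of_real (1 - \<tau>) * (\<i> * of_real (?a - ?b))) = cis ((1 - \<tau>) * (?a - ?b))"
    unfolding cis_conv_exp by (simp add: mult_ac)
  also have "cis ?b * cis ((1 - \<tau>) * (?a - ?b)) = cis (?b + (1 - \<tau>) * (?a - ?b))"
    by (rule cis_mult)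
  also have "?b + (1 - \<tau>) * (?a - ?b) = 2 * pi * (real j + ((1 - \<tau>) * t + \<tau> * t0)) / real (4 * g)"
    unfolding ab using g by (simp add: field_simps)
  finally show ?thesis by (simp only: side_def)
qed

lemma continuous_contract:
  assumes "e \<le> 1"
  shows "continuous_on (UNIV \<times> ball w e) (\<lambda>p. contract w (snd p) (fst p))"
proof (cases "norm w = 1")
  case True
  have "snd p / w \<notin> \<real>\<^sub>\<le>\<^sub>0" "w \<noteq> 0" if "p \<in> UNIV \<times> ball w e" for p :: "real \<times> complex"
  proof -
    have "dist (snd p) w < 1" using that assms by (auto simp: dist_commute)
    from near_unit[OF True this] show "snd p / w \<notin> \<real>\<^sub>\<le>\<^sub>0" "w \<noteq> 0"
      by (auto simp: complex_nonpos_Reals_iff)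
  qed
  then show ?thesis unfolding contract_boundary[OF True]
    by (intro continuous_intros) auto
next
  case False
  show ?thesis unfolding contract_interior[OF False]
    by (intro continuous_intros)
qed

text \<open>The contractions around the points of a fibre agree on identified points and so descend
  to one contraction of \<open>nbhd s\<close>.\<close>

lemma contraction_exists:
  assumes s: "s \<in> topspace S"
  shows "\<exists>H. continuous_map (prod_topology (top_of_set {0..1::real}) (subtopology S (nbhd s))) S H \<and>
    (\<forall>w\<in>fibre s. \<forall>z\<in>cball 0 1. \<forall>\<tau>\<in>{0..1}. q z \<in> nbhd s \<longrightarrow> dist z w < eps s \<longrightarrow>
      H (\<tau>, q z) = q (contract w z \<tau>))"
proof -
  let ?D = "{z \<in> cball 0 1. q z \<in> nbhd s}"
  let ?I = "top_of_set {0..1::real}"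
  define C where "C p = contract (THE w. w \<in> fibre s \<and> dist (snd p) w < eps s) (snd p) (fst p)" for p
  have uniq: "w = w'" if "w \<in> fibre s" "w' \<in> fibre s" "dist z w < eps s" "dist z w' < eps s" for w w' z
  proof (rule ccontr)
    assume "w \<noteq> w'"
    then have "2 * eps s \<le> dist w w'" using good_eps[of s] that unfolding good_def by blast
    also have "\<dots> \<le> dist w z + dist z w'" by (rule dist_triangle)
    finally show False using that by (simp add: dist_commute)
  qed
  have C: "C (\<tau>, z) = contract w z \<tau>" if "w \<in> fibre s" "dist z w < eps s" for w z \<tau>
  proof -
    have "(THE w. w \<in> fibre s \<and> dist z w < eps s) = w"
      by (rule the_equality) (use that uniq in blast)+
    then show ?thesis by (simp add: C_def)
  qed
  have fib: "w \<in> cball 0 1" "q w = s" if "w \<in> fibre s" for w using that by (auto simp: fibre_def)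
  have near: "\<exists>w\<in>fibre s. dist z w < eps s" if "z \<in> ?D" for z
    using that unfolding nbhd_def by (force simp: dist_commute)
  have "continuous_on (\<Union>w\<in>fibre s. UNIV \<times> ball w (eps s)) C"
  proof (rule continuous_on_open_UN)
    fix w assume w: "w \<in> fibre s"
    show "open ((UNIV :: real set) \<times> ball w (eps s))" by (intro open_Times) auto
    have "continuous_on (UNIV \<times> ball w (eps s)) (\<lambda>p. contract w (snd p) (fst p))"
      by (rule continuous_contract) (rule eps_pos)
    then show "continuous_on (UNIV \<times> ball w (eps s)) C"
      by (rule continuous_on_eq) (use C[OF w] in \<open>auto simp: dist_commute\<close>)
  qed
  then have "continuous_on ({0..1} \<times> ?D) C"
    by (rule continuous_on_subset) (use near in \<open>fastforce simp: dist_commute\<close>)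
  moreover have Cin: "C (\<tau>, z) \<in> cball 0 1" if tz: "\<tau> \<in> {0..1}" "z \<in> ?D" for \<tau> z
  proof -
    obtain w where w: "w \<in> fibre s" "dist z w < eps s" using near[OF tz(2)] by blast
    have "dist z w < 1" using w(2) eps_pos(2)[of s] by linarith
    then show ?thesis unfolding C[OF w] using tz fib[OF w(1)] by (intro contract_in) auto
  qed
  ultimately have "continuous_map (top_of_set ({0..1} \<times> ?D)) (top_of_set (cball 0 1)) C"
    by (auto simp: image_subset_iff)
  from continuous_map_compose[OF this cont_q]
  have qC: "continuous_map (prod_topology ?I (top_of_set ?D)) S (q \<circ> C)"
    by (simp only: prod_topology_subtopology_eu)
  have "quotient_map (subtopology (top_of_set (cball 0 1)) ?D) (subtopology S (nbhd s)) q"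
    by (rule quotient_map_restriction[OF quot]) (auto simp: openin_nbhd)
  moreover have "subtopology (top_of_set (cball 0 1)) ?D = top_of_set ?D"
    unfolding subtopology_subtopology by (rule arg_cong[where f = "subtopology euclidean"]) auto
  ultimately have "quotient_map (top_of_set ?D) (subtopology S (nbhd s)) q" by (simp only:)
  \<comment> \<open>Joint continuity in time and point: the product of a quotient map with the
    locally compact unit interval is again a quotient map.\<close>
  then have Q: "quotient_map (prod_topology ?I (top_of_set ?D)) (prod_topology ?I (subtopology S (nbhd s))) (\<lambda>(x,y). (x, q y))"
  proof (rule quotient_map_prod_right[rotated 2])
    show "locally_compact_space ?I"
      by (rule compact_imp_locally_compact_space) (simp add: compact_space_subtopology)
    show "Hausdorff_space ?I \<or> regular_space ?I" by (simp add: Hausdorff_space_subtopology)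
  qed
  define H where "H p = q (C (fst p, SOME z. z \<in> ?D \<and> q z = snd p))" for p
  have compat: "q (C (\<tau>, z)) = q (C (\<tau>, z'))" if z: "z \<in> ?D" "z' \<in> ?D" "q z = q z'" and t: "\<tau> \<in> {0..1}" for z z' \<tau>
  proof -
    obtain w w' where w: "w \<in> fibre s" "dist z w < eps s" "w' \<in> fibre s" "dist z' w' < eps s"
      using near z by blast
    consider "z = z'" "w = w'" | "z = w" "z' = w'"
      | j t t0 where "j < 4 * g" "t \<in> {0..1}" "t0 \<in> {0..1}" "z = side g j t" "z' = side g (partner j) (1 - t)"
        "w = side g j t0" "w' = side g (partner j) (1 - t0)"
      using local_compat[OF w(1,3) _ _ w(2,4) z(3)] z by blast
    then have "q (contract w z \<tau>) = q (contract w' z' \<tau>)"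
    proof cases
      case 2
      then show ?thesis using fib w by (simp add: contract_self)
    next
      case (3 j t t0)
      let ?t = "(1 - \<tau>) * t + \<tau> * t0"
      have "(1 - \<tau>) *\<^sub>R t + \<tau> *\<^sub>R t0 \<in> {0..1}"
        by (rule convexD[OF convex_real_interval(5)]) (use 3 t in auto)
      then have t': "?t \<in> {0..1}" by simp
      have "contract w' z' \<tau> = side g (partner j) ((1 - \<tau>) * (1 - t) + \<tau> * (1 - t0))"
        unfolding 3(5,7) by (rule contract_side) (use 3(2,3) in auto)
      also have "(1 - \<tau>) * (1 - t) + \<tau> * (1 - t0) = 1 - ?t" by (simp add: algebra_simps)
      finally have "contract w' z' \<tau> = side g (partner j) (1 - ?t)" .
      moreover have "contract w z \<tau> = side g j ?t"
        unfolding 3(4,6) by (rule contract_side) (use 3(2,3) in auto)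
      ultimately show ?thesis using q_side[OF 3(1) t'] by simp
    qed simp
    then show ?thesis unfolding C[OF w(1,2)] C[OF w(3,4)] .
  qed
  have H: "H (\<tau>, q z) = q (C (\<tau>, z))" if "z \<in> ?D" "\<tau> \<in> {0..1}" for \<tau> z
  proof -
    let ?z = "SOME z'. z' \<in> ?D \<and> q z' = q z"
    have "?z \<in> ?D \<and> q ?z = q z" by (rule someI[of _ z]) (use that in simp)
    then show ?thesis unfolding H_def fst_conv snd_conv using compat[of ?z z \<tau>] that by blast
  qed
  have "continuous_map (prod_topology ?I (top_of_set ?D)) S (H \<circ> (\<lambda>(x,y). (x, q y)))"
    by (rule continuous_map_eq[OF qC]) (auto simp: H)
  then have "continuous_map (prod_topology ?I (subtopology S (nbhd s))) S H"
    by (rule continuous_compose_quotient_map[OF Q])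
  moreover have "H (\<tau>, q z) = q (contract w z \<tau>)"
    if "w \<in> fibre s" "z \<in> cball 0 1" "\<tau> \<in> {0..1}" "q z \<in> nbhd s" "dist z w < eps s" for w z \<tau>
    using H[of z \<tau>] C[of w z \<tau>] that by simp
  ultimately show ?thesis by blast
qed

lemma path_contract: "path (contract w z)"
proof (cases "norm w = 1")
  case True
  show ?thesis unfolding path_def contract_boundary[OF True]
    by (intro continuous_intros)
next
  case False
  show ?thesis unfolding path_def contract_interior[OF False]
    by (intro continuous_intros)
qed

text \<open>Contracting \<open>nbhd s\<close> deforms the path into the track of its initial point.
  That track comes from a path in the disc, where it can be straightened.\<close>

lemma short_path:
  assumes r: "pathin S r" "\<And>t. t \<in> {0..1} \<Longrightarrow> r t \<in> nbhd s" "r 1 = s"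
  shows "\<exists>z\<in>cball 0 1. \<exists>w\<in>cball 0 1. path_htpy S r (seg z w)"
proof -
  have s: "s \<in> topspace S" using r(1,3) by (auto simp: pathin_def continuous_map_def)
  obtain H where H: "continuous_map (prod_topology (top_of_set {0..1::real}) (subtopology S (nbhd s))) S H"
    and Hq: "\<And>w z \<tau>. w\<in>fibre s \<Longrightarrow> z\<in>cball 0 1 \<Longrightarrow> \<tau>\<in>{0..1} \<Longrightarrow> q z \<in> nbhd s \<Longrightarrow> dist z w < eps s \<Longrightarrow>
      H (\<tau>, q z) = q (contract w z \<tau>)"
    using contraction_exists[OF s] by blast
  have lift: "\<exists>z\<in>cball 0 1. \<exists>w\<in>fibre s. q z = v \<and> dist z w < eps s" if "v \<in> nbhd s" for v
    using that unfolding nbhd_def top_S by (force simp: dist_commute)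
  have fib: "w \<in> cball 0 1" "q w = s" if "w \<in> fibre s" for w using that by (auto simp: fibre_def)
  have close: "dist z w < 1" if "dist z w < eps s" for z w :: complex
    using that eps_pos(2)[of s] by linarith
  have H0: "H (0, v) = v" and H1: "H (1, v) = s" if "v \<in> nbhd s" for v
  proof -
    obtain z w where zw: "z \<in> cball 0 1" "w \<in> fibre s" "q z = v" "dist z w < eps s" using lift[OF \<open>v \<in> nbhd s\<close>] by blast
    show "H (0, v) = v" "H (1, v) = s"
      using Hq[OF zw(2,1) _ _ zw(4), of 0] Hq[OF zw(2,1) _ _ zw(4), of 1] zw that fib close
      by (simp_all add: contract_0 contract_1)
  qed
  have Hs: "H (\<tau>, s) = s" if "\<tau> \<in> {0..1}" for \<tau>
  proof -
    obtain w where w: "w \<in> fibre s" using s unfolding top_S fibre_def by blast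
    show ?thesis
      using Hq[OF w fib(1)[OF w] that] fib[OF w] nbhd_self[OF s] eps_pos(1)[of s] by (simp add: contract_self)
  qed
  let ?K = "{0..1::real} \<times> {0..1::real}"
  let ?Q = "\<lambda>p. H (snd p, r (fst p))"
  have r': "continuous_map (top_of_set {0..1}) (subtopology S (nbhd s)) r"
    using r(1,2) unfolding pathin_def by (auto simp: continuous_map_in_subtopology)
  have "continuous_map (top_of_set ?K) (prod_topology (top_of_set {0..1}) (subtopology S (nbhd s))) (\<lambda>p. (snd p, r (fst p)))"
    unfolding continuous_map_pairwise o_def fst_conv snd_conv
  proof
    show "continuous_map (top_of_set ?K) (top_of_set {0..1}) snd"
      by (auto intro!: continuous_intros)
    have "continuous_map (top_of_set ?K) (top_of_set {0..1}) fst"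
      by (auto intro!: continuous_intros)
    from continuous_map_compose[OF this r']
    show "continuous_map (top_of_set ?K) (subtopology S (nbhd s)) (\<lambda>p. r (fst p))" by (simp add: o_def)
  qed
  from continuous_map_compose[OF this H]
  have Q: "continuous_map (top_of_set ?K) S ?Q" by (simp add: o_def)
  \<comment> \<open>On the square with coordinates (time along \<open>r\<close>, time of the
    contraction), one way round the boundary gives \<open>r\<close> followed by a constant, the
    other gives the track of \<open>r 0\<close> followed by a constant.\<close>
  let ?\<phi> = "linepath (0,0) (1,0) +++ linepath (1,0) (1::real,1::real)"
  let ?\<psi> = "linepath (0,0) (0,1) +++ linepath (0,1) (1::real,1::real)"
  have seg_sub: "closed_segment a b \<subseteq> ?K" if "a \<in> ?K" "b \<in> ?K" for a b :: "real \<times> real"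
    by (rule closed_segment_subset[OF that]) (intro convex_Times convex_real_interval)
  have "path_htpy S (?Q \<circ> ?\<phi>) (?Q \<circ> ?\<psi>)"
  proof (rule path_htpy_convex[OF Q])
    show "convex ?K" by (intro convex_Times convex_real_interval)
    show "path ?\<phi>" "path ?\<psi>" by (rule path_join_imp; simp)+
    show "path_image ?\<phi> \<subseteq> ?K"
      by (intro subset_path_image_join; simp only: path_image_linepath; rule seg_sub; simp)
    show "path_image ?\<psi> \<subseteq> ?K"
      by (intro subset_path_image_join; simp only: path_image_linepath; rule seg_sub; simp)
  qed (simp_all add: joinpaths_def linepath_0' linepath_1')
  moreover have "path_htpy S (?Q \<circ> ?\<phi>) (loop_join r (\<lambda>_. s))"
  proof (rule path_htpy_eq)
    show "pathin S (?Q \<circ> ?\<phi>)" using path_htpy_ends(3)[OF calculation] .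
    fix t :: real assume "t \<in> {0..1}"
    then show "(?Q \<circ> ?\<phi>) t = loop_join r (\<lambda>_. s) t"
      using r(2,3) H0 Hs[of "2 * t - 1"]
      by (auto simp: loop_join_def joinpaths_def linepath_def)
  qed
  moreover have "path_htpy S (?Q \<circ> ?\<psi>) (loop_join (\<lambda>\<tau>. H (\<tau>, r 0)) (\<lambda>_. s))"
  proof (rule path_htpy_eq)
    show "pathin S (?Q \<circ> ?\<psi>)" using path_htpy_ends(4)[OF calculation(1)] .
    fix t :: real assume "t \<in> {0..1}"
    then show "(?Q \<circ> ?\<psi>) t = loop_join (\<lambda>\<tau>. H (\<tau>, r 0)) (\<lambda>_. s) t"
      using r(2) H1
      by (auto simp: loop_join_def joinpaths_def linepath_def)
  qed
  ultimately have 1: "path_htpy S (loop_join r (\<lambda>_. s)) (loop_join (\<lambda>\<tau>. H (\<tau>, r 0)) (\<lambda>_. s))"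
    using path_htpy_trans path_htpy_sym by blast
  have 2: "path_htpy S r (loop_join r (\<lambda>_. s))" using path_htpy_sym[OF path_htpy_rid[OF r(1)]] r(3) by simp
  have r0: "r 0 \<in> nbhd s" using r(2) by simp
  obtain z w where zw: "z \<in> cball 0 1" "w \<in> fibre s" "q z = r 0" "dist z w < eps s" using lift[OF r0] by blast
  have c: "path (contract w z)" "path_image (contract w z) \<subseteq> cball 0 1"
    using zw fib(1)[OF zw(2)] close[OF zw(4)]
    by (auto simp del: mem_cball simp: path_image_def intro!: path_contract contract_in)
  have c': "contract w z 0 = z" "contract w z 1 = w"
    using close[OF zw(4)] by (simp_all add: contract_0 contract_1)
  note pc = pathin_comp[OF cont_q c]
  have 3: "path_htpy S (q \<circ> contract w z) (\<lambda>\<tau>. H (\<tau>, r 0))"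
    by (rule path_htpy_eq[OF pc]) (use Hq[OF zw(2,1) _ _ zw(4)] zw(3) r0 in auto)
  have e: "H (0, r 0) = r 0" "H (1, r 0) = s" using H0[OF r0] H1[OF r0] by auto
  have 4: "path_htpy S (loop_join (\<lambda>\<tau>. H (\<tau>, r 0)) (\<lambda>_. s)) (\<lambda>\<tau>. H (\<tau>, r 0))"
    using path_htpy_rid[OF path_htpy_ends(4)[OF 3]] e by simp
  have 5: "path_htpy S (q \<circ> contract w z) (seg z w)"
  proof -
    have "path_htpy S (q \<circ> contract w z) (q \<circ> linepath z w)"
      by (rule path_htpy_convex[OF cont_q])
        (use c c' zw(1) fib(1)[OF zw(2)] linepath_disc in \<open>auto simp del: path_image_linepath mem_cball simp: linepath_0' linepath_1'\<close>)
    then show ?thesis by (simp only: seg_def)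
  qed
  have "path_htpy S r (seg z w)"
    using path_htpy_trans[OF path_htpy_trans[OF path_htpy_trans[OF path_htpy_trans[OF 2 1] 4] path_htpy_sym[OF 3]] 5] .
  then show ?thesis using zw(1) fib(1)[OF zw(2)] by blast
qed

text \<open>The corner loops generate, in the form needed here: their values fix all jumps, hence
  the values of \<open>fh\<close> on segments, on short paths, and by subdivision on every
  loop.\<close>

theorem loop_hom_unique:
  fixes f f' :: "(real \<Rightarrow> 'a) \<Rightarrow> 'n::group_add"
  assumes d: "d \<in> cball 0 1" and f: "loop_hom S (q d) f" "loop_hom S (q d) f'"
    and eq: "\<And>j. j < 4 * g \<Longrightarrow> f (corner_loop d j) = f' (corner_loop d j)"
    and p: "p \<in> loops S (q d)"
  shows "f p = f' p"
proof -
  interpret A: surface_hom g S q d f by unfold_locales (use d f in auto)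
  interpret B: surface_hom g S q d f' by unfold_locales (use d f in auto)
  have eq': "f (corner_loop d j) = f' (corner_loop d j)" if "j \<le> 4 * g" for j
  proof (cases "j = 4 * g")
    case True
    then show ?thesis
      using A.corner_loop_labels B.corner_loop_labels by (simp add: surface_labels_def)
  qed (use eq that in auto)
  have lam: "A.lam z z' = B.lam z z'" if z: "z \<in> cball 0 1" "z' \<in> cball 0 1" "q z = q z'" for z z'
  proof -
    consider "z = z'" | "corner z" "corner z'"
      | j t where "j < 4*g" "t \<in> {0..1}" "z = side g j t" "z' = side g (partner j) (1 - t)"
      using q_glueD[OF z] unfolding glue_def by blast
    then show ?thesis
    proof cases
      case 1
      then show ?thesis using z A.lam_self B.lam_self by simp
    next
      case 2
      then obtain i j where ij: "i < 4 * g" "j < 4 * g" "z = side g i 0" "z' = side g j 0"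
        unfolding corner_def by blast
      then show ?thesis using A.lam_corners[of i j] B.lam_corners[of i j] eq' by simp
    next
      case (3 j t)
      have "partner j < 4 * g" by (rule partner_less[OF 3(1)])
      then show ?thesis
        using A.lam_partner[OF 3(1,2)] B.lam_partner[OF 3(1,2)] eq'[of j] eq'[of "Suc (partner j)"] 3 by simp
    qed
  qed
  have seg: "A.fh (seg z w) = B.fh (seg z w)" if z: "z \<in> cball 0 1" "w \<in> cball 0 1" for z w
  proof -
    have "q z \<in> topspace S" "q w \<in> topspace S" using z unfolding top_S by auto
    note l = A.lft[OF this(1)] A.lft[OF this(2)]
    show ?thesis
      unfolding A.fh_seg[OF z] B.fh_seg[OF z]
      using lam[OF l(1) z(1) l(2)] lam[OF z(2) l(3) l(4)[symmetric]] by simp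
  qed
  have short: "A.fh r = B.fh r" if "pathin S r" "\<And>t. t \<in> {0..1} \<Longrightarrow> r t \<in> nbhd (r 1)" for r
    using short_path[OF that HOL.refl] A.fh_htpy B.fh_htpy seg by metis
  have p': "pathin S p" "p 0 = q d" using p by (auto simp: loops_def)
  define sub where "sub a b = (\<lambda>t::real. p (a + t * (b - a)))" for a b
  have sub: "pathin S (sub a b)" if "a \<in> {0..1}" "b \<in> {0..1}" for a b
  proof -
    have "pathin S (p \<circ> linepath a b)"
      by (rule pathin_comp[of "{0..1}"])
        (use p'(1) that in \<open>auto simp: pathin_def closed_segment_eq_real_ivl\<close>)
    moreover have "p \<circ> linepath a b = sub a b"
      by (simp add: sub_def fun_eq_iff linepath_def algebra_simps)
    ultimately show ?thesis by simp
  qed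
  have sub_join: "path_htpy S (loop_join (sub a b) (sub b c)) (sub a c)"
    if abc: "a \<in> {0..1}" "b \<in> {0..1}" "c \<in> {0..1}" for a b c
  proof -
    have seg: "path_image (linepath u v) \<subseteq> {0..1}" if "u \<in> {0..1}" "v \<in> {0..1}" for u v :: real
      unfolding path_image_linepath by (rule closed_segment_subset[OF that]) simp
    have "path_htpy S (p \<circ> (linepath a b +++ linepath b c)) (p \<circ> linepath a c)"
    proof (rule path_htpy_convex[where K = "{0..1}"])
      show "continuous_map (top_of_set {0..1}) S p" using p'(1) by (simp add: pathin_def)
      show "path_image (linepath a b +++ linepath b c) \<subseteq> {0..1}"
        by (intro subset_path_image_join seg abc)
      show "path_image (linepath a c) \<subseteq> {0..1}" by (intro seg abc)
      show "path (linepath a b +++ linepath b c)" by (rule path_join_imp) simp_all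
    qed (simp_all add: joinpaths_def linepath_0' linepath_1')
    moreover have "p \<circ> (linepath a b +++ linepath b c) = loop_join (sub a b) (sub b c)"
      by (auto simp: sub_def fun_eq_iff linepath_def algebra_simps joinpaths_def loop_join_def)
    moreover have "p \<circ> linepath a c = sub a c"
      by (simp add: sub_def fun_eq_iff linepath_def algebra_simps)
    ultimately show ?thesis by (simp only:)
  qed
  have "a \<le> b \<Longrightarrow> 0 \<le> a \<longrightarrow> b \<le> 1 \<longrightarrow> A.fh (sub a b) = B.fh (sub a b)" for a b
  proof (induction a b rule: Bolzano)
    case (trans a b c)
    show ?case
    proof (intro impI)
      assume ac: "0 \<le> a" "c \<le> 1"
      have ab: "a \<in> {0..1}" "b \<in> {0..1}" "c \<in> {0..1}" using trans(3,4) ac by auto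
      have e: "sub a b 1 = sub b c 0" by (simp add: sub_def)
      have "path_htpy S (loop_join (sub a b) (sub b c)) (sub a c)" by (rule sub_join[OF ab])
      then show "A.fh (sub a c) = B.fh (sub a c)"
        using A.fh_htpy B.fh_htpy A.fh_join[OF sub sub e] B.fh_join[OF sub sub e] ab trans(1,2) ac
        by (metis atLeastAtMost_iff)
    qed
  next
    case (local x)
    show ?case
    proof (cases "x \<in> {0..1}")
      case True
      then have px: "p x \<in> topspace S" using p'(1) by (auto simp: pathin_def continuous_map_def)
      have "openin (top_of_set {0..1}) {t \<in> topspace (top_of_set {0..1}). p t \<in> nbhd (p x)}"
        by (rule openin_continuous_map_preimage[OF p'(1)[unfolded pathin_def] openin_nbhd])
      moreover have "x \<in> {t \<in> topspace (top_of_set {0..1}). p t \<in> nbhd (p x)}"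
        using True nbhd_self[OF px] by simp
      ultimately obtain e where e: "e > 0" "\<And>t. t \<in> {0..1} \<Longrightarrow> dist t x < e \<Longrightarrow> p t \<in> nbhd (p x)"
        unfolding openin_euclidean_subtopology_iff by force
      \<comment> \<open>\<open>short\<close> concerns paths that end at the centre of the
        neighbourhood, so pieces are first taken towards \<open>x\<close>; a piece that starts at
        \<open>x\<close> is obtained by reversal.\<close>
      have one: "A.fh (sub y x) = B.fh (sub y x)" if y: "y \<in> {0..1}" "dist y x < e" for y
      proof (rule short[OF sub[OF y(1) True]])
        fix t :: real assume t: "t \<in> {0..1}"
        have seg: "y + t * (x - y) = linepath y x t" by (simp add: linepath_def algebra_simps)
        have "y + t * (x - y) \<in> closed_segment y x"
          unfolding seg using linepath_in_path[OF t] by blast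
        then have "y + t * (x - y) \<in> {0..1}" "dist (y + t * (x - y)) x < e"
          using y True by (auto simp: closed_segment_eq_real_ivl dist_real_def split: if_splits)
        then show "sub y x t \<in> nbhd (sub y x 1)" using e(2) by (simp add: sub_def)
      qed
      show ?thesis
      proof (rule exI[of _ e], intro conjI e(1) allI impI)
        fix a b assume ab: "a \<le> x \<and> x \<le> b \<and> b - a < e" "0 \<le> a" "b \<le> 1"
        have I: "a \<in> {0..1}" "b \<in> {0..1}" using ab True by auto
        have 1: "A.fh (sub a x) = B.fh (sub a x)" by (rule one) (use ab True in \<open>auto simp: dist_real_def\<close>)
        have 2: "A.fh (sub b x) = B.fh (sub b x)" by (rule one) (use ab True in \<open>auto simp: dist_real_def\<close>)
        have r: "rev_path (sub b x) = sub x b" by (simp add: rev_path_def sub_def fun_eq_iff algebra_simps)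
        have 3: "A.fh (sub x b) = B.fh (sub x b)"
          using A.fh_rev[OF sub[OF I(2) True]] B.fh_rev[OF sub[OF I(2) True]] 2 r by simp
        have e: "sub a x 1 = sub x b 0" by (simp add: sub_def)
        note h = sub_join[OF I(1) True I(2)]
        show "A.fh (sub a b) = B.fh (sub a b)"
          unfolding A.fh_htpy[OF h, symmetric] B.fh_htpy[OF h, symmetric]
            A.fh_join[OF sub[OF I(1) True] sub[OF True I(2)] e] B.fh_join[OF sub[OF I(1) True] sub[OF True I(2)] e] 1 3
          by (rule HOL.refl)
      qed
    next
      case False
      then show ?thesis by (intro exI[of _ 1]) auto
    qed
  qed
  from this[of 0 1] have "A.fh (sub 0 1) = B.fh (sub 0 1)" by simp
  moreover have "sub 0 1 = p" by (simp add: sub_def)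
  ultimately show ?thesis using A.fh_loop_eq[OF p] B.fh_loop_eq[OF p] by simp
qed

end

section \<open>Cycles in graphs\<close>

text \<open>A longest path cannot be extended, so a second neighbour of its last vertex already lies
  on it and closes a cycle.\<close>

lemma graph_cycle:
  fixes adj :: "'v \<Rightarrow> 'v \<Rightarrow> bool"
  assumes U: "finite U" "\<And>v w. adj v w \<Longrightarrow> v \<in> U"
    and adj: "\<And>v w. adj v w \<Longrightarrow> adj w v" "\<And>v. \<not> adj v v"
    and ex: "adj a b" and two: "\<And>v w. adj v w \<Longrightarrow> \<exists>w'. adj v w' \<and> w' \<noteq> w"
  shows "\<exists>xs. distinct xs \<and> 3 \<le> length xs \<and> set xs \<subseteq> U \<and>
    (\<forall>i<length xs. adj (xs ! i) (xs ! (Suc i mod length xs)))"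
proof -
  define P where "P xs \<longleftrightarrow> distinct xs \<and> set xs \<subseteq> U \<and> 2 \<le> length xs \<and>
    (\<forall>i. Suc i < length xs \<longrightarrow> adj (xs ! i) (xs ! Suc i))" for xs
  have ab: "a \<noteq> b" using adj(2) ex by auto
  then have Pab: "P [a, b]" using U(2)[OF ex] U(2)[OF adj(1)[OF ex]] ex by (auto simp: P_def less_Suc_eq)
  have bound: "\<forall>xs. P xs \<longrightarrow> length xs \<le> card U"
    using U(1) unfolding P_def by (metis card_mono distinct_card)
  obtain xs where xs: "P xs" "\<And>ys. P ys \<Longrightarrow> length ys \<le> length xs"
    using ex_has_greatest_nat[where P = P and k = "[a, b]" and f = length and b = "Suc (card U)"] Pab bound
    by (metis less_Suc_eq_le)
  define n where "n = length xs"
  have n: "2 \<le> n" using xs(1) by (simp add: P_def n_def)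
  have adjs: "adj (xs ! i) (xs ! Suc i)" if "Suc i < n" for i using xs(1) that by (simp add: P_def n_def)
  have "adj (xs ! (n - 2)) (xs ! (n - 1))" using adjs[of "n - 2"] n by (simp add: numeral_2_eq_2 Suc_diff_Suc)
  from two[OF adj(1)[OF this]] obtain w where w: "adj (xs ! (n - 1)) w" "w \<noteq> xs ! (n - 2)" by blast
  have "w \<in> set xs"
  proof (rule ccontr)
    assume nw: "w \<notin> set xs"
    have "P (xs @ [w])"
      unfolding P_def
    proof (intro conjI allI impI)
      fix i assume i: "Suc i < length (xs @ [w])"
      show "adj ((xs @ [w]) ! i) ((xs @ [w]) ! Suc i)"
      proof (cases "Suc i < n")
        case True
        then show ?thesis using adjs by (simp add: nth_append n_def)
      next
        case False
        then have "i = n - 1" "Suc i = n" using i n by (simp_all add: n_def)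
        then show ?thesis using w(1) n by (simp add: nth_append n_def del: One_nat_def)
      qed
    qed (use xs(1) nw U(2)[OF adj(1)[OF w(1)]] in \<open>auto simp: P_def\<close>)
    from xs(2)[OF this] show False by simp
  qed
  then obtain j where j: "j < n" "xs ! j = w" by (auto simp: in_set_conv_nth n_def)
  \<comment> \<open>The neighbour \<open>w\<close> is neither the last vertex nor the one before it,
    so the cycle from \<open>w\<close> onwards has at least three vertices.\<close>
  have "j \<noteq> n - 1" using j(2) w(1) adj(2) by auto
  moreover have "j \<noteq> n - 2" using j(2) w(2) by auto
  ultimately have j3: "j + 3 \<le> n" using j(1) by linarith
  let ?ys = "drop j xs"
  have len: "length ?ys = n - j" by (simp add: n_def)
  have "adj (?ys ! i) (?ys ! (Suc i mod length ?ys))" if i: "i < length ?ys" for i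
  proof (cases "Suc i < n - j")
    case True
    then show ?thesis using adjs[of "j + i"] by (simp add: len) (simp add: n_def)
  next
    case False
    then have "Suc i = n - j" using i len by linarith
    moreover from this have "j + i = n - 1" by linarith
    ultimately show ?thesis using w(1) j j3 by (simp add: len) (simp add: n_def)
  qed
  moreover have "distinct ?ys" "set ?ys \<subseteq> U" using xs(1) set_drop_subset[of j xs] by (auto simp: P_def)
  ultimately show ?thesis using j3 len by (intro exI[of _ ?ys]) auto
qed

text \<open>In a row with sum zero a nonzero entry is never alone, so in the support graph no vertex
  has exactly one neighbour.\<close>

lemma antisymmetric_cycle:
  fixes R :: "'v \<Rightarrow> 'v \<Rightarrow> 'a::ab_group_add"
  assumes U: "finite U" and out: "\<And>v w. v \<notin> U \<Longrightarrow> R v w = 0"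
    and R: "\<And>v w. R w v = - R v w" "\<And>v. R v v = 0"
    and row: "\<And>v. (\<Sum>w\<in>U. R v w) = 0" and nz: "R a b \<noteq> 0"
  shows "\<exists>xs. distinct xs \<and> 3 \<le> length xs \<and> set xs \<subseteq> U \<and>
    (\<forall>i<length xs. R (xs ! i) (xs ! (Suc i mod length xs)) \<noteq> 0)"
proof (rule graph_cycle[where adj = "\<lambda>v w. R v w \<noteq> 0" and a = a and b = b])
  fix v w assume vw: "R v w \<noteq> 0"
  show "v \<in> U" using out vw by blast
  show "\<exists>w'. R v w' \<noteq> 0 \<and> w' \<noteq> w"
  proof (rule ccontr)
    assume "\<not> ?thesis"
    then have z: "R v w' = 0" if "w' \<noteq> w" for w' using that by blast
    have "R w v \<noteq> 0" unfolding R(1)[of w v] using vw by simp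
    then have "w \<in> U" using out by blast
    then have "(\<Sum>w\<in>U. R v w) = R v w"
      using z by (subst sum.remove[OF U, of w]) (auto intro!: sum.neutral)
    then show False using row vw by simp
  qed
next
  fix v w assume "R v w \<noteq> 0"
  then show "R w v \<noteq> 0" unfolding R(1)[of w v] by simp
qed (use U R(2) nz in simp_all)

section \<open>Words and homomorphisms from the Bestvina-Brady group\<close>

primrec word_eval :: "('v \<Rightarrow> 'n::group_add) \<Rightarrow> ('v \<times> bool) list \<Rightarrow> 'n" where
  "word_eval e [] = 0"
| "word_eval e (l # w) = (if snd l then e (fst l) else - e (fst l)) + word_eval e w"

lemma word_eval_append [simp]: "word_eval e (u @ v) = word_eval e u + word_eval e v"
  by (induction u) (simp_all add: add.assoc)

lemma word_eq_lists:
  "word_eq X R u v \<Longrightarrow> u \<in> lists (X \<times> UNIV) \<and> v \<in> lists (X \<times> UNIV)"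
  by (induction rule: word_eq.induct) auto

lemma word_eval_eq:
  assumes "word_eq V (raag_relators E) u v" and e: "\<And>v w. {v, w} \<in> E \<Longrightarrow> e v + e w = e w + e v"
  shows "word_eval e u = word_eval e v"
  using assms(1)
proof (induction rule: word_eq.induct)
  case (4 u v x b)
  then show ?case by (cases b) (simp_all add: add.assoc[symmetric])
next
  case (5 u v r)
  then obtain a b where r: "r = [(a, True), (b, True), (a, False), (b, False)]" "{a, b} \<in> E"
    by (auto simp: raag_relators_def)
  have "e a + (e b + (- e a + (- e b + 0))) = (e a + e b) - (e b + e a)"
    by (simp only: diff_conv_add_uminus minus_add add.assoc add_0_right)
  also have "\<dots> = 0" unfolding e[OF r(2)] by (rule diff_self)
  finally have "word_eval e r = 0" by (simp add: r(1) del: add_uminus_conv_diff)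
  then show ?case by simp
qed auto

lemma word_eq_append:
  assumes "word_eq X R u v" "x \<in> lists (X \<times> UNIV)" "y \<in> lists (X \<times> UNIV)"
  shows "word_eq X R (x @ u @ y) (x @ v @ y)"
  using assms(1)
proof (induction rule: word_eq.induct)
  case (1 w)
  then show ?case using assms by (intro word_eq.intros(1)) auto
next
  case (2 u v)
  then show ?case by (blast intro: word_eq.intros(2))
next
  case (3 u v w)
  then show ?case by (blast intro: word_eq.intros(3))
next
  case (4 u v z b)
  have "word_eq X R ((x @ u) @ [(z, b), (z, \<not> b)] @ (v @ y)) ((x @ u) @ (v @ y))"
    by (rule word_eq.intros(4)) (use 4 assms in auto)
  then show ?case by simp
next
  case (5 u v r)
  have "word_eq X R ((x @ u) @ r @ (v @ y)) ((x @ u) @ (v @ y))"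
    by (rule word_eq.intros(5)) (use 5 assms in auto)
  then show ?case by simp
qed

section \<open>Words of exponent sum zero\<close>

definition word_inv :: "('v \<times> bool) list \<Rightarrow> ('v \<times> bool) list"
  where "word_inv w = rev (map (\<lambda>(x, b). (x, \<not> b)) w)"

lemma word_inv_simps [simp]:
  "word_inv [] = []" "word_inv (u @ v) = word_inv v @ word_inv u"
  "word_inv ((x, b) # w) = word_inv w @ [(x, \<not> b)]"
  by (simp_all add: word_inv_def)

lemma word_inv_inv [simp]: "word_inv (word_inv w) = w"
  by (induction w) auto

lemma word_inv_lists [simp]: "w \<in> lists (X \<times> UNIV) \<Longrightarrow> word_inv w \<in> lists (X \<times> UNIV)"
  by (induction w) auto

lemma word_eq_inv:
  assumes "w \<in> lists (X \<times> UNIV)" shows "word_eq X R (w @ word_inv w) []"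
  using assms
proof (induction w rule: list.induct)
  case Nil
  then show ?case using word_eq.intros(1)[of "[]" X R] by simp
next
  case (Cons l w)
  obtain x b where l: "l = (x, b)" by (cases l)
  have x: "x \<in> X" "w \<in> lists (X \<times> UNIV)" using Cons.prems l by (simp_all only: Cons_in_lists_iff mem_Times_iff fst_conv)
  have "word_eq X R ([l] @ (w @ word_inv w) @ [(x, \<not> b)]) ([l] @ [] @ [(x, \<not> b)])"
    using Cons x l by (intro word_eq_append) auto
  moreover have "word_eq X R ([] @ [(x, b), (x, \<not> b)] @ []) ([] @ [])"
    using x by (intro word_eq.intros(4)) auto
  ultimately show ?case using l by (auto intro: word_eq.intros(3))
qed

text \<open>The words that represent elements of the Bestvina-Brady group, see
  \<open>bb_group_carrier\<close>.\<close>

definition words0 :: "'v set \<Rightarrow> ('v \<times> bool) list set"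
  where "words0 V = {w \<in> lists (V \<times> UNIV). exponent_sum w = 0}"

lemma exponent_sum_inv [simp]: "exponent_sum (word_inv w) = - exponent_sum w"
  by (induction w) auto

lemma words0_closed [simp]:
  "[] \<in> words0 V" "u \<in> words0 V \<Longrightarrow> v \<in> words0 V \<Longrightarrow> u @ v \<in> words0 V"
  "u \<in> words0 V \<Longrightarrow> word_inv u \<in> words0 V"
  by (auto simp: words0_def)

text \<open>A homomorphism from the Bestvina-Brady group, kept as a function on representing
  words.\<close>

definition word_hom :: "'v set \<Rightarrow> 'v set set \<Rightarrow> (('v \<times> bool) list \<Rightarrow> 'n::group_add) \<Rightarrow> bool"
  where "word_hom V E f \<longleftrightarrow>
    (\<forall>u\<in>words0 V. \<forall>v\<in>words0 V. f (u @ v) = f u + f v) \<and>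
    (\<forall>u\<in>words0 V. \<forall>v. word_eq V (raag_relators E) u v \<longrightarrow> f u = f v)"

lemma word_homD:
  assumes "word_hom V E f"
  shows "u \<in> words0 V \<Longrightarrow> v \<in> words0 V \<Longrightarrow> f (u @ v) = f u + f v"
    and "u \<in> words0 V \<Longrightarrow> word_eq V (raag_relators E) u v \<Longrightarrow> f u = f v"
  using assms unfolding word_hom_def by blast+


lemma word_hom_nil:
  assumes "word_hom V E f" shows "f [] = 0"
proof -
  have "f [] + f [] = f ([] @ [])" by (rule word_homD(1)[OF assms, symmetric]) simp_all
  then show ?thesis by (intro group_idem_zero) (simp only: append_Nil)
qed

lemma word_hom_inv:
  assumes f: "word_hom V E f" and w: "w \<in> words0 V"
  shows "f (word_inv w) = - f w"
proof -
  have "f w + f (word_inv w) = f (w @ word_inv w)" using word_homD(1)[OF f] w by simp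
  also have "\<dots> = f []" by (rule word_homD(2)[OF f]) (use w in \<open>auto simp: words0_def intro: word_eq_inv\<close>)
  finally have "f w + f (word_inv w) = 0" using word_hom_nil[OF f] by simp
  then show ?thesis by (rule minus_unique[symmetric])
qed

lemma word_hom_eval:
  assumes "\<And>v w. {v, w} \<in> E \<Longrightarrow> e v + e w = e w + e v"
  shows "word_hom V E (word_eval e)"
  unfolding word_hom_def using word_eval_eq[OF _ assms] by auto

lemma word_hom_zero: "word_hom V E (\<lambda>_. 0)"
  by (simp add: word_hom_def)

lemma word_hom_concat:
  assumes f: "word_hom V E f" and "set ws \<subseteq> words0 V"
  shows "f (concat ws) = sum_list (map f ws) \<and> concat ws \<in> words0 V"
  using assms(2)
proof (induction ws)
  case Nil
  then show ?case using word_hom_nil[OF f] by simp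
next
  case (Cons w ws)
  then show ?case using word_homD(1)[OF f, of w "concat ws"] by simp
qed

lemma word_eq_telescope:
  assumes "\<And>i. p i \<in> lists (X \<times> UNIV)"
  shows "word_eq X R (concat (map (\<lambda>i. p i @ word_inv (p (Suc i))) [0..<m])) (p 0 @ word_inv (p m))"
proof (induction m)
  case 0
  then show ?case using word_eq.intros(2)[OF word_eq_inv[OF assms[of 0]]] by simp
next
  case (Suc m)
  let ?c = "concat (map (\<lambda>i. p i @ word_inv (p (Suc i))) [0..<m])"
  have "word_eq X R ([] @ ?c @ (p m @ word_inv (p (Suc m)))) ([] @ (p 0 @ word_inv (p m)) @ (p m @ word_inv (p (Suc m))))"
    using assms by (intro word_eq_append Suc) auto
  moreover have "word_eq X R (p 0 @ (word_inv (p m) @ word_inv (word_inv (p m))) @ word_inv (p (Suc m)))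
     (p 0 @ [] @ word_inv (p (Suc m)))"
    using assms by (intro word_eq_append word_eq_inv) auto
  ultimately show ?case using word_eq.intros(3) by fastforce
qed

text \<open>The quotients telescope and the sequence closes up. With \<open>p i\<close> the n-th
  power of the i-th vertex of a cycle these are the Dicks-Leary relations.\<close>

lemma word_hom_cycle:
  assumes f: "word_hom V E f" and p: "\<And>i. p i \<in> lists (V \<times> UNIV)" "\<And>i. exponent_sum (p i) = n" and m: "p m = p 0"
  shows "(\<Sum>i\<leftarrow>[0..<m]. f (p i @ word_inv (p (Suc i)))) = 0"
proof -
  let ?ws = "map (\<lambda>i. p i @ word_inv (p (Suc i))) [0..<m]"
  have "p i @ word_inv (p j) \<in> words0 V" for i j
    unfolding words0_def using p(1)[of i] word_inv_lists[OF p(1)[of j]] p(2)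
    by (simp only: append_in_lists_conv mem_Collect_eq exponent_sum_append exponent_sum_inv) simp
  then have "set ?ws \<subseteq> words0 V" by auto
  from word_hom_concat[OF f this]
  have "(\<Sum>i\<leftarrow>[0..<m]. f (p i @ word_inv (p (Suc i)))) = f (concat ?ws)" "concat ?ws \<in> words0 V"
    by (simp_all add: o_def)
  moreover have "word_eq V (raag_relators E) (concat ?ws) []"
    using word_eq_telescope[of p V "raag_relators E" m, OF p(1)] word_eq_inv[of "p 0"] p(1)
    unfolding m by (blast intro: word_eq.intros(3))
  ultimately show ?thesis using word_homD(2)[OF f] word_hom_nil[OF f] by metis
qed

text \<open>For adjacent \<open>v\<close> and \<open>w\<close>, the \<open>n\<close>-th power of \<open>v w\<inverse>\<close> is \<open>v\<^sup>n w\<^sup>-\<^sup>n\<close>; only \<open>n = -1\<close> and \<open>n = 2\<close> are needed.\<close>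

lemma word_eq_commute:
  assumes vw: "{v, w} \<in> E" "v \<in> V" "w \<in> V"
  shows "word_eq V (raag_relators E) [(v, True), (w, True)] [(w, True), (v, True)]"
    and "word_eq V (raag_relators E) [(w, True), (v, False)] [(v, False), (w, True)]"
    and "word_eq V (raag_relators E) [(w, False), (v, True)] [(v, True), (w, False)]"
proof -
  let ?R = "raag_relators E" and ?r = "[(v, True), (w, True), (v, False), (w, False)]"
  have r: "?r \<in> ?R" "?r \<in> lists (V \<times> UNIV)" using vw by (auto simp: raag_relators_def)
  have L: "[(v, b)] \<in> lists (V \<times> UNIV)" "[(w, b)] \<in> lists (V \<times> UNIV)" for b using vw by auto
  have c: "word_eq V ?R (x @ [(z, b), (z, \<not> b)] @ y) (x @ y)" if "z \<in> V" "x \<in> lists (V \<times> UNIV)" "y \<in> lists (V \<times> UNIV)" for x y z b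
    using that by (intro word_eq.intros(4))
  note tr = word_eq.intros(3) and sy = word_eq.intros(2)
  have 0: "word_eq V ?R (x @ ?r @ y) (x @ y)" if "x \<in> lists (V \<times> UNIV)" "y \<in> lists (V \<times> UNIV)" for x y
    using that r by (intro word_eq.intros(5))
  show 1: "word_eq V ?R [(v, True), (w, True)] [(w, True), (v, True)]"
  proof -
    have A: "word_eq V ?R [(v, True), (w, True), (v, False), (w, False), (w, True), (v, True)] [(v, True), (w, True), (v, False), (v, True)]"
      using c[of w "[(v, True), (w, True), (v, False)]" "[(v, True)]" False] vw by simp
    have B: "word_eq V ?R [(v, True), (w, True), (v, False), (v, True)] [(v, True), (w, True)]"
      using c[of v "[(v, True), (w, True)]" "[]" False] vw by simp
    have C: "word_eq V ?R [(v, True), (w, True), (v, False), (w, False), (w, True), (v, True)] [(w, True), (v, True)]"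
      using 0[of "[]" "[(w, True), (v, True)]"] vw by simp
    show ?thesis by (rule tr[OF sy[OF B] tr[OF sy[OF A] C]])
  qed
  show "word_eq V ?R [(w, True), (v, False)] [(v, False), (w, True)]"
  proof -
    have A: "word_eq V ?R [(v, False), (v, True), (w, True), (v, False)] [(v, False), (w, True), (v, True), (v, False)]"
      using word_eq_append[OF 1 L(1)[of False] L(1)[of False]] by simp
    have B: "word_eq V ?R [(v, False), (v, True), (w, True), (v, False)] [(w, True), (v, False)]"
      using c[of v "[]" "[(w, True), (v, False)]" False] vw by simp
    have C: "word_eq V ?R [(v, False), (w, True), (v, True), (v, False)] [(v, False), (w, True)]"
      using c[of v "[(v, False), (w, True)]" "[]" True] vw by simp
    show ?thesis by (rule tr[OF sy[OF B] tr[OF A C]])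
  qed
  show "word_eq V ?R [(w, False), (v, True)] [(v, True), (w, False)]"
  proof -
    have A: "word_eq V ?R [(w, False), (v, True), (w, True), (w, False)] [(w, False), (w, True), (v, True), (w, False)]"
      using word_eq_append[OF 1 L(2)[of False] L(2)[of False]] by simp
    have B: "word_eq V ?R [(w, False), (v, True), (w, True), (w, False)] [(w, False), (v, True)]"
      using c[of w "[(w, False), (v, True)]" "[]" True] vw by simp
    have C: "word_eq V ?R [(w, False), (w, True), (v, True), (w, False)] [(v, True), (w, False)]"
      using c[of w "[]" "[(v, True), (w, False)]" False] vw by simp
    show ?thesis by (rule tr[OF sy[OF B] tr[OF A C]])
  qed
qed

text \<open>Telescoping for the exponents 1, -1 and 2. Along an edge the vertices commute, so the
  quotient of inverses is the inverse of \<open>P i\<close> and the quotient of squares is its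
  double.\<close>

lemma cycle_sums:
  assumes f: "word_hom V E f" and xs: "set xs \<subseteq> V" "xs \<noteq> []"
    and adj: "\<And>i. i < length xs \<Longrightarrow> {xs ! i, xs ! (Suc i mod length xs)} \<in> E"
  defines "P \<equiv> \<lambda>i. f [(xs ! i, True), (xs ! (Suc i mod length xs), False)]"
  shows "(\<Sum>i\<leftarrow>[0..<length xs]. P i) = 0" "(\<Sum>i\<leftarrow>[0..<length xs]. - P i) = 0"
    "(\<Sum>i\<leftarrow>[0..<length xs]. P i + P i) = 0"
proof -
  let ?m = "length xs"
  define x where "x i = xs ! (i mod ?m)" for i
  have xV: "x i \<in> V" for i using xs unfolding x_def by (meson length_greater_0_conv mod_less_divisor nth_mem subsetD)
  have xm: "x ?m = x 0" by (simp add: x_def)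
  have adjx: "{x i, x (Suc i)} \<in> E" for i
    using adj[of "i mod ?m"] xs(2) unfolding x_def by (simp add: mod_Suc_eq)
  have P: "P i = f [(x i, True), (x (Suc i), False)]" if "i < ?m" for i
    using that by (simp add: P_def x_def)
  have w0: "[(x i, b), (x j, \<not> b)] \<in> words0 V" for i j b using xV by (cases b) (auto simp: words0_def)
  have cong: "(\<Sum>i\<leftarrow>[0..<?m]. F i) = (\<Sum>i\<leftarrow>[0..<?m]. G i)" if "\<And>i. i < ?m \<Longrightarrow> F i = G i" for F G :: "nat \<Rightarrow> 'b"
    using that by (intro arg_cong[where f = sum_list] map_cong) auto
  have "(\<Sum>i\<leftarrow>[0..<?m]. f ([(x i, True)] @ word_inv [(x (Suc i), True)])) = 0"
    by (rule word_hom_cycle[OF f, where n = 1]) (use xV xm in auto)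
  then show "(\<Sum>i\<leftarrow>[0..<?m]. P i) = 0" using cong[OF P] by simp
  have "(\<Sum>i\<leftarrow>[0..<?m]. f ([(x i, False)] @ word_inv [(x (Suc i), False)])) = 0"
    by (rule word_hom_cycle[OF f, where n = "-1"]) (use xV xm in auto)
  moreover have "- P i = f ([(x i, False)] @ word_inv [(x (Suc i), False)])" if "i < ?m" for i
  proof -
    have "- P i = f (word_inv [(x i, True), (x (Suc i), False)])"
      using word_hom_inv[OF f w0[of i True "Suc i"]] P[OF that] by simp
    also have "\<dots> = f [(x i, False), (x (Suc i), True)]"
      using word_eq_commute(2)[OF adjx[of i] xV xV] w0[of "Suc i" True i]
      by (simp add: word_homD(2)[OF f])
    finally show ?thesis by simp
  qed
  ultimately show "(\<Sum>i\<leftarrow>[0..<?m]. - P i) = 0" using cong[of "\<lambda>i. - P i"] by simp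
  have "(\<Sum>i\<leftarrow>[0..<?m]. f ([(x i, True), (x i, True)] @ word_inv [(x (Suc i), True), (x (Suc i), True)])) = 0"
    by (rule word_hom_cycle[OF f, where n = 2]) (use xV xm in auto)
  moreover have "P i + P i = f ([(x i, True), (x i, True)] @ word_inv [(x (Suc i), True), (x (Suc i), True)])"
    if "i < ?m" for i
  proof -
    let ?v = "x i" and ?w = "x (Suc i)"
    have "P i + P i = f ([(?v, True), (?w, False)] @ [(?v, True), (?w, False)])"
      unfolding P[OF that] by (rule word_homD(1)[OF f, symmetric]) (use w0[of i True "Suc i"] in simp_all)
    also have "\<dots> = f ([(?v, True)] @ [(?v, True), (?w, False)] @ [(?w, False)])"
    proof (rule word_homD(2)[OF f])
      show "[(?v, True), (?w, False)] @ [(?v, True), (?w, False)] \<in> words0 V"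
        using xV by (auto simp: words0_def)
      have "word_eq V (raag_relators E) ([(?v, True)] @ [(?w, False), (?v, True)] @ [(?w, False)])
          ([(?v, True)] @ [(?v, True), (?w, False)] @ [(?w, False)])"
        using xV by (intro word_eq_append word_eq_commute(3) adjx) auto
      then show "word_eq V (raag_relators E) ([(?v, True), (?w, False)] @ [(?v, True), (?w, False)])
         ([(?v, True)] @ [(?v, True), (?w, False)] @ [(?w, False)])" by simp
    qed
    finally show ?thesis by simp
  qed
  ultimately show "(\<Sum>i\<leftarrow>[0..<?m]. P i + P i) = 0" using cong[of "\<lambda>i. P i + P i"] by simp
qed

lemma word_eq_cancel:
  assumes "x \<in> lists (X \<times> UNIV)" "w \<in> lists (X \<times> UNIV)" "y \<in> lists (X \<times> UNIV)"
  shows "word_eq X R (x @ w @ word_inv w @ y) (x @ y)" "word_eq X R (x @ word_inv w @ w @ y) (x @ y)"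
  using word_eq_append[OF word_eq_inv[OF assms(2)] assms(1,3)]
    word_eq_append[OF word_eq_inv[OF word_inv_lists[OF assms(2)]] assms(1,3)] by simp_all

lemma word_eq_commute':
  assumes vw: "{v, w} \<in> E" "v \<in> V" "w \<in> V"
  shows "word_eq V (raag_relators E) [(v, b), (w, False)] [(w, False), (v, b)]"
proof (cases b)
  case True
  then show ?thesis using word_eq_commute(3)[OF vw] word_eq.intros(2) by auto
next
  case False
  let ?R = "raag_relators E"
  have L: "[(v, c)] \<in> lists (V \<times> UNIV)" for c using vw by auto
  have "word_eq V ?R [(w, False), (v, True)] [(v, True), (w, False)]" by (rule word_eq_commute(3)[OF vw])
  from word_eq_append[OF this L[of False] L[of False]]
  have A: "word_eq V ?R [(v, False), (w, False), (v, True), (v, False)] [(v, False), (v, True), (w, False), (v, False)]" by simp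
  have B: "word_eq V ?R [(v, False), (w, False), (v, True), (v, False)] [(v, False), (w, False)]"
    using word_eq_cancel(1)[of "[(v, False), (w, False)]" V "[(v, True)]" "[]" ?R] vw by simp
  have C: "word_eq V ?R [(v, False), (v, True), (w, False), (v, False)] [(w, False), (v, False)]"
    using word_eq_cancel(1)[of "[]" V "[(v, False)]" "[(w, False), (v, False)]" ?R] vw by simp
  have b: "b = False" using False by simp
  show ?thesis unfolding b
    by (rule word_eq.intros(3)[OF word_eq.intros(2)[OF B] word_eq.intros(3)[OF A C]])
qed

lemma word_eq_power_commute:
  assumes vw: "{v, w} \<in> E" "v \<in> V" "w \<in> V"
  shows "word_eq V (raag_relators E) (replicate n (v, b) @ [(w, False)]) ([(w, False)] @ replicate n (v, b))"
proof (induction n)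
  case 0
  then show ?case using vw by (auto intro!: word_eq.intros(1))
next
  case (Suc n)
  let ?R = "raag_relators E"
  have rep: "replicate n (v, b) \<in> lists (V \<times> UNIV)" using vw by (auto simp: in_lists_conv_set)
  have "word_eq V ?R ([(v, b)] @ (replicate n (v, b) @ [(w, False)]) @ []) ([(v, b)] @ ([(w, False)] @ replicate n (v, b)) @ [])"
    using vw by (intro word_eq_append Suc) auto
  moreover have "word_eq V ?R ([] @ [(v, b), (w, False)] @ replicate n (v, b)) ([] @ [(w, False), (v, b)] @ replicate n (v, b))"
    using rep by (intro word_eq_append word_eq_commute' vw) auto
  ultimately show ?case using word_eq.intros(3) by fastforce
qed

text \<open>The surface relator, a product of commutators, in additive notation.\<close>

primrec comm_sum :: "(nat \<Rightarrow> 'n::group_add) \<Rightarrow> (nat \<Rightarrow> 'n) \<Rightarrow> nat \<Rightarrow> 'n" where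
  "comm_sum A B 0 = 0"
| "comm_sum A B (Suc i) = comm_sum A B i + (A i + B i - A i - B i)"

text \<open>Words \<open>a\<^sub>i, b\<^sub>i\<close> that behave like the standard generators of the surface group, as far as
  homomorphisms to the group \<open>'n\<close> can tell.\<close>

definition surface_model :: "'n::group_add itself \<Rightarrow> 'v set \<Rightarrow> 'v set set \<Rightarrow> nat \<Rightarrow>
    (nat \<Rightarrow> ('v \<times> bool) list) \<Rightarrow> (nat \<Rightarrow> ('v \<times> bool) list) \<Rightarrow> bool"
  where "surface_model T V E g a b \<longleftrightarrow>
    (\<forall>i<g. a i \<in> words0 V \<and> b i \<in> words0 V) \<and>
    (\<forall>f::('v \<times> bool) list \<Rightarrow> 'n. word_hom V E f \<longrightarrow> comm_sum (\<lambda>i. f (a i)) (\<lambda>i. f (b i)) g = 0) \<and>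
    (\<forall>(A :: nat \<Rightarrow> 'n) B. comm_sum A B g = 0 \<longrightarrow>
      (\<exists>f. word_hom V E f \<and> (\<forall>i<g. f (a i) = A i \<and> f (b i) = B i))) \<and>
    (\<forall>f f'::('v \<times> bool) list \<Rightarrow> 'n. word_hom V E f \<longrightarrow> word_hom V E f' \<longrightarrow>
      (\<forall>i<g. f (a i) = f' (a i) \<and> f (b i) = f' (b i)) \<longrightarrow> (\<forall>w\<in>words0 V. f w = f' w))"

lemma surface_modelD:
  fixes f f' :: "_ \<Rightarrow> 'n::group_add"
  assumes "surface_model TYPE('n) V E g a b"
  shows "i < g \<Longrightarrow> a i \<in> words0 V" "i < g \<Longrightarrow> b i \<in> words0 V"
    "word_hom V E f \<Longrightarrow> comm_sum (\<lambda>i. f (a i)) (\<lambda>i. f (b i)) g = 0"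
    "comm_sum A B g = (0::'n) \<Longrightarrow> \<exists>f. word_hom V E f \<and> (\<forall>i<g. f (a i) = A i \<and> f (b i) = B i)"
    "word_hom V E f \<Longrightarrow> word_hom V E f' \<Longrightarrow> \<forall>i<g. f (a i) = f' (a i) \<and> f (b i) = f' (b i) \<Longrightarrow>
      w \<in> words0 V \<Longrightarrow> f w = f' w"
proof -
  note A = assms[unfolded surface_model_def]
  note A1 = A[THEN conjunct1] and A2 = A[THEN conjunct2, THEN conjunct1]
    and A3 = A[THEN conjunct2, THEN conjunct2, THEN conjunct1]
    and A4 = A[THEN conjunct2, THEN conjunct2, THEN conjunct2]
  show "i < g \<Longrightarrow> a i \<in> words0 V" "i < g \<Longrightarrow> b i \<in> words0 V" using A1 by blast+
  show "word_hom V E f \<Longrightarrow> comm_sum (\<lambda>i. f (a i)) (\<lambda>i. f (b i)) g = 0"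
    by (rule A2[THEN spec, THEN mp])
  show "comm_sum A B g = (0::'n) \<Longrightarrow> \<exists>f. word_hom V E f \<and> (\<forall>i<g. f (a i) = A i \<and> f (b i) = B i)"
    by (rule A3[THEN spec, THEN spec, THEN mp])
  show "word_hom V E f \<Longrightarrow> word_hom V E f' \<Longrightarrow> \<forall>i<g. f (a i) = f' (a i) \<and> f (b i) = f' (b i) \<Longrightarrow>
      w \<in> words0 V \<Longrightarrow> f w = f' w"
    by (rule A4[THEN spec, THEN spec, THEN mp, THEN mp, THEN mp, THEN bspec])
qed

text \<open>A sum of two Heisenberg groups with identified centres.\<close>

datatype heis = Heis (h1: rat) (h2: rat) (h3: rat) (h4: rat) (hz: rat)

instantiation heis :: group_add
begin
definition "0 = Heis 0 0 0 0 0"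
definition "p + q = Heis (h1 p + h1 q) (h2 p + h2 q) (h3 p + h3 q) (h4 p + h4 q)
  (hz p + hz q + h1 p * h2 q + h3 p * h4 q)"
definition "- p = Heis (- h1 p) (- h2 p) (- h3 p) (- h4 p) (- hz p + h1 p * h2 p + h3 p * h4 p)"
definition "(p::heis) - q = p + - q"
instance
  by standard (simp_all add: zero_heis_def plus_heis_def uminus_heis_def minus_heis_def algebra_simps)
end

lemma heis_simps [simp]:
  "h1 0 = 0" "h2 0 = 0" "h3 0 = 0" "h4 0 = 0" "hz 0 = 0"
  "h1 (p + q) = h1 p + h1 q" "h2 (p + q) = h2 p + h2 q" "h3 (p + q) = h3 p + h3 q" "h4 (p + q) = h4 p + h4 q"
  "hz (p + q) = hz p + hz q + h1 p * h2 q + h3 p * h4 q"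
  "h1 (- p) = - h1 p" "h2 (- p) = - h2 p" "h3 (- p) = - h3 p" "h4 (- p) = - h4 p"
  "hz (- p) = - hz p + h1 p * h2 p + h3 p * h4 p"
  "h1 (p - q) = h1 p - h1 q" "h2 (p - q) = h2 p - h2 q" "h3 (p - q) = h3 p - h3 q" "h4 (p - q) = h4 p - h4 q"
  "hz (p - q) = hz p + (- hz q + h1 q * h2 q + h3 q * h4 q) - h1 p * h2 q - h3 p * h4 q"
  by (simp_all add: zero_heis_def plus_heis_def uminus_heis_def minus_heis_def)

lemma heis_eqI: "h1 p = h1 q \<Longrightarrow> h2 p = h2 q \<Longrightarrow> h3 p = h3 q \<Longrightarrow> h4 p = h4 q \<Longrightarrow> hz p = hz q \<Longrightarrow> p = q"
  by (cases p; cases q) simp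

text \<open>Unitriangular matrices of size four with rows \<open>(1, a, x, z)\<close>, \<open>(0, 1, b, y)\<close>, \<open>(0, 0, 1, c)\<close>.\<close>

datatype ut4 = UT4 (ua: rat) (ub: rat) (uc: rat) (ux: rat) (uy: rat) (uz: rat)

instantiation ut4 :: group_add
begin
definition "0 = UT4 0 0 0 0 0 0"
definition "p + q = UT4 (ua p + ua q) (ub p + ub q) (uc p + uc q)
  (ux p + ux q + ua p * ub q) (uy p + uy q + ub p * uc q) (uz p + uz q + ua p * uy q + ux p * uc q)"
definition "- p = UT4 (- ua p) (- ub p) (- uc p) (- ux p + ua p * ub p) (- uy p + ub p * uc p)
  (- uz p + ua p * uy p + ux p * uc p - ua p * ub p * uc p)"
definition "(p::ut4) - q = p + - q"
instance
proof
  fix p q r :: ut4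
  show "p + q + r = p + (q + r)" by (simp add: plus_ut4_def distrib_left distrib_right mult.assoc)
  show "0 + p = p" "p + 0 = p" by (simp_all add: zero_ut4_def plus_ut4_def)
  show "- p + p = 0" by (simp add: zero_ut4_def plus_ut4_def uminus_ut4_def algebra_simps)
  show "p + - q = p - q" by (simp add: minus_ut4_def)
qed
end

lemma ut4_simps [simp]:
  "ua 0 = 0" "ub 0 = 0" "uc 0 = 0" "ux 0 = 0" "uy 0 = 0" "uz 0 = 0"
  "ua (p + q) = ua p + ua q" "ub (p + q) = ub p + ub q" "uc (p + q) = uc p + uc q"
  "ux (p + q) = ux p + ux q + ua p * ub q" "uy (p + q) = uy p + uy q + ub p * uc q"
  "uz (p + q) = uz p + uz q + ua p * uy q + ux p * uc q"
  "ua (- p) = - ua p" "ub (- p) = - ub p" "uc (- p) = - uc p"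
  "ux (- p) = - ux p + ua p * ub p" "uy (- p) = - uy p + ub p * uc p"
  "uz (- p) = - uz p + ua p * uy p + ux p * uc p - ua p * ub p * uc p"
  unfolding zero_ut4_def plus_ut4_def uminus_ut4_def ut4.sel by (rule HOL.refl)+

lemma ut4_diff: "(p::ut4) - q = p + - q"
  by (rule minus_ut4_def)

lemma ut4_eqI: "ua p = ua q \<Longrightarrow> ub p = ub q \<Longrightarrow> uc p = uc q \<Longrightarrow> ux p = ux q \<Longrightarrow> uy p = uy q \<Longrightarrow>
    uz p = uz q \<Longrightarrow> p = q"
  by (cases p; cases q) simp

text \<open>The lamplighter-like group \<open>\<rat>[t, t\<inverse>] \<rtimes> \<int>\<close>, where Laurent polynomials are replaced by arbitrary functions.\<close>

datatype lamp = Lamp (lamps: "int \<Rightarrow> rat") (pos: int)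

instantiation lamp :: group_add
begin
definition "0 = Lamp (\<lambda>_. 0) 0"
definition "p + q = Lamp (\<lambda>i. lamps p i + lamps q (i - pos p)) (pos p + pos q)"
definition "- p = Lamp (\<lambda>i. - lamps p (i + pos p)) (- pos p)"
definition "(p::lamp) - q = p + - q"
instance
  by standard (simp_all add: zero_lamp_def plus_lamp_def uminus_lamp_def minus_lamp_def algebra_simps)
end

lemma lamp_simps [simp]:
  "lamps 0 i = 0" "pos 0 = 0" "lamps (p + q) i = lamps p i + lamps q (i - pos p)" "pos (p + q) = pos p + pos q"
  "lamps (- p) i = - lamps p (i + pos p)" "pos (- p) = - pos p"
  by (simp_all add: zero_lamp_def plus_lamp_def uminus_lamp_def)

text \<open>The sum over pairs i before j of \<open>A i * B j - B i * A j\<close>. If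
  \<open>A\<close>, \<open>B\<close> are the differences a_i - a_(i+1), b_i - b_(i+1) around a cycle
  and a_0 = b_0 = 0, summation by parts turns it into the cyclic sum of a_i b_(i+1) - a_(i+1)
  b_i.\<close>

primrec cross_sum :: "(nat \<Rightarrow> rat) \<Rightarrow> (nat \<Rightarrow> rat) \<Rightarrow> nat list \<Rightarrow> rat" where
  "cross_sum A B [] = 0"
| "cross_sum A B (i # is) = A i * (\<Sum>j\<leftarrow>is. B j) - B i * (\<Sum>j\<leftarrow>is. A j) + cross_sum A B is"

lemma cross_sum_scale: "cross_sum (\<lambda>i. c * A i) B is = c * cross_sum A B is"
  by (induction "is") (simp_all add: sum_list_const_mult algebra_simps)

lemma cross_sum_cong:
  "(\<And>i. i \<in> set is \<Longrightarrow> A i = A' i) \<Longrightarrow> (\<And>i. i \<in> set is \<Longrightarrow> B i = B' i) \<Longrightarrow> cross_sum A B is = cross_sum A' B' is"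
  by (induction "is") (auto cong: map_cong)

lemma cross_sum_zero:
  assumes "\<And>i. i \<in> set js \<Longrightarrow> A i = 0" "\<And>i. i \<in> set js \<Longrightarrow> B i = 0"
  shows "cross_sum A B js = 0" "(\<Sum>j\<leftarrow>js. A j) = 0"
  using assms by (induction js) auto

lemma heis_sum_list:
  fixes P :: "nat \<Rightarrow> heis"
  shows "h1 (\<Sum>i\<leftarrow>is. P i) = (\<Sum>i\<leftarrow>is. h1 (P i))" "h2 (\<Sum>i\<leftarrow>is. P i) = (\<Sum>i\<leftarrow>is. h2 (P i))"
    "h3 (\<Sum>i\<leftarrow>is. P i) = (\<Sum>i\<leftarrow>is. h3 (P i))" "h4 (\<Sum>i\<leftarrow>is. P i) = (\<Sum>i\<leftarrow>is. h4 (P i))"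
  by (induction "is") simp_all

lemma sum_list_minus: "(\<Sum>i\<leftarrow>is. - f i) = - (\<Sum>i\<leftarrow>is. f i :: rat)"
  by (induction "is") simp_all

text \<open>Adding the relations for exponents 1 and -1 eliminates the unknown entries
  \<open>hz (P i)\<close>. The surviving terms are bilinear: the product of the totals and the
  antisymmetric part.\<close>

lemma heis_sum_list_z:
  fixes P :: "nat \<Rightarrow> heis"
  shows "hz (\<Sum>i\<leftarrow>is. P i) + hz (\<Sum>i\<leftarrow>is. - P i) =
    (\<Sum>i\<leftarrow>is. h1 (P i)) * (\<Sum>i\<leftarrow>is. h2 (P i)) + (\<Sum>i\<leftarrow>is. h3 (P i)) * (\<Sum>i\<leftarrow>is. h4 (P i)) +
    cross_sum (\<lambda>i. h1 (P i)) (\<lambda>i. h2 (P i)) is + cross_sum (\<lambda>i. h3 (P i)) (\<lambda>i. h4 (P i)) is"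
proof (induction "is")
  case (Cons i js)
  have "h2 (\<Sum>i\<leftarrow>js. - P i) = - (\<Sum>i\<leftarrow>js. h2 (P i))" "h4 (\<Sum>i\<leftarrow>js. - P i) = - (\<Sum>i\<leftarrow>js. h4 (P i))"
    by (simp_all add: heis_sum_list sum_list_minus)
  then show ?case using Cons.IH by (simp add: heis_sum_list algebra_simps)
qed simp

lemma heis_commutator:
  fixes A B :: heis
  shows "h1 (A + B - A - B) = 0" "h2 (A + B - A - B) = 0" "h3 (A + B - A - B) = 0" "h4 (A + B - A - B) = 0"
    "hz (A + B - A - B) = (h1 A * h2 B - h1 B * h2 A) + (h3 A * h4 B - h3 B * h4 A)"
  by (simp, simp, simp, simp) (simp add: algebra_simps)

text \<open>Commutators are central in \<open>heis\<close>, so their determinants simply add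
  up.\<close>

lemma comm_sum_heis:
  "h1 (comm_sum A B n) = 0" "h2 (comm_sum A B n) = 0" "h3 (comm_sum A B n) = 0" "h4 (comm_sum A B n) = 0"
  "hz (comm_sum A B n) = (\<Sum>i<n. h1 (A i) * h2 (B i) - h1 (B i) * h2 (A i)) + (\<Sum>i<n. h3 (A i) * h4 (B i) - h3 (B i) * h4 (A i))"
proof -
  show 0: "h1 (comm_sum A B n) = 0" "h2 (comm_sum A B n) = 0" "h3 (comm_sum A B n) = 0" "h4 (comm_sum A B n) = 0" for n
    by (induction n) (simp_all only: comm_sum.simps heis_simps heis_commutator add_0_left add_0_right)
  show "hz (comm_sum A B n) = (\<Sum>i<n. h1 (A i) * h2 (B i) - h1 (B i) * h2 (A i)) + (\<Sum>i<n. h3 (A i) * h4 (B i) - h3 (B i) * h4 (A i))"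
  proof (induction n)
    case (Suc n)
    have "hz (comm_sum A B (Suc n)) = hz (comm_sum A B n) + hz (A n + B n - A n - B n)"
      unfolding comm_sum.simps heis_simps(10) 0 by simp
    then show ?case unfolding heis_commutator(5) Suc by simp
  qed simp
qed

lemma ut4_commutator:
  fixes A B :: ut4
  shows "ua (A + B - A - B) = 0" "ub (A + B - A - B) = 0" "uc (A + B - A - B) = 0"
    "ux (A + B - A - B) = ua A * ub B - ua B * ub A" "uy (A + B - A - B) = ub A * uc B - ub B * uc A"
  unfolding ut4_diff by (simp_all only: ut4_simps) (simp_all add: algebra_simps)

lemma comm_sum_ut4:
  "ua (comm_sum A B n) = 0" "ub (comm_sum A B n) = 0" "uc (comm_sum A B n) = 0"
  "ux (comm_sum A B n) = (\<Sum>i<n. ua (A i) * ub (B i) - ua (B i) * ub (A i))"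
  "uy (comm_sum A B n) = (\<Sum>i<n. ub (A i) * uc (B i) - ub (B i) * uc (A i))"
  "uz (comm_sum A B n) = (\<Sum>i<n. uz (A i + B i - A i - B i))"
proof -
  show 0: "ua (comm_sum A B n) = 0" "ub (comm_sum A B n) = 0" "uc (comm_sum A B n) = 0" for n
    by (induction n) (simp_all only: comm_sum.simps ut4_simps ut4_commutator add_0_left add_0_right)
  show "ux (comm_sum A B n) = (\<Sum>i<n. ua (A i) * ub (B i) - ua (B i) * ub (A i))"
    by (induction n) (simp_all only: comm_sum.simps ut4_simps ut4_commutator 0, simp_all)
  show "uy (comm_sum A B n) = (\<Sum>i<n. ub (A i) * uc (B i) - ub (B i) * uc (A i))"
    by (induction n) (simp_all only: comm_sum.simps ut4_simps ut4_commutator 0, simp_all)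
  show "uz (comm_sum A B n) = (\<Sum>i<n. uz (A i + B i - A i - B i))"
  proof (induction n)
    case (Suc n)
    have "uz (comm_sum A B (Suc n)) = uz (comm_sum A B n) + uz (A n + B n - A n - B n)"
      unfolding comm_sum.simps ut4_simps(12) 0 ut4_commutator by simp
    then show ?case unfolding Suc by simp
  qed simp
qed

lemma comm_sum_rat: "comm_sum A B n = (0::rat)"
  by (induction n) simp_all

text \<open>The graph may be infinite. The surface group enters through its homomorphisms into three
  groups: abelian, Heisenberg and unitriangular of size 4.\<close>

locale bb_surface =
  fixes V :: "'v set" and E :: "'v set set" and g :: nat and a b :: "nat \<Rightarrow> ('v \<times> bool) list"
  assumes graph: "simplicial_graph V E" and g: "2 \<le> g"
    and mr: "surface_model TYPE(rat) V E g a b"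
    and mh: "surface_model TYPE(heis) V E g a b"
    and mu_ut: "surface_model TYPE(ut4) V E g a b"
begin

lemma gens: "i < g \<Longrightarrow> a i \<in> words0 V" "i < g \<Longrightarrow> b i \<in> words0 V"
  using surface_modelD(1,2)[OF mr] by blast+

lemma rat_ext: "\<exists>f :: _ \<Rightarrow> rat. word_hom V E f \<and> (\<forall>i<g. f (a i) = A i \<and> f (b i) = B i)"
  by (rule surface_modelD(4)[OF mr comm_sum_rat])

lemma rat_unique:
  fixes f f' :: "_ \<Rightarrow> rat"
  assumes "word_hom V E f" "word_hom V E f'" "\<And>i. i < g \<Longrightarrow> f (a i) = f' (a i)" "\<And>i. i < g \<Longrightarrow> f (b i) = f' (b i)"
    and "w \<in> words0 V"
  shows "f w = f' w"
  by (rule surface_modelD(5)[OF mr assms(1,2) _ assms(5)]) (simp add: assms(3,4))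

lemma edgeD:
  assumes "{v, w} \<in> E" shows "v \<in> V" "w \<in> V" "v \<noteq> w"
proof -
  have *: "{v, w} \<subseteq> V \<and> card {v, w} = 2" by (rule bspec[OF graph[unfolded simplicial_graph_def] assms])
  then show "v \<in> V" "w \<in> V" by auto
  show "v \<noteq> w"
  proof
    assume "v = w"
    with * show False by simp
  qed
qed

text \<open>If the graph is disconnected, then the Bestvina-Brady group maps onto \<open>\<rat>[t, t\<inverse>]\<close>, so it is not finitely generated.\<close>

lemma connected:
  assumes V1: "v1 \<in> V1" "V1 \<subseteq> V" and closed: "\<And>v w. {v, w} \<in> E \<Longrightarrow> v \<in> V1 \<Longrightarrow> w \<in> V1"
  shows "V1 = V"
proof (rule ccontr)
  assume "V1 \<noteq> V"
  then obtain v2 where v2: "v2 \<in> V" "v2 \<notin> V1" using V1 by blast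
  \<comment> \<open>Vertices of \<open>V1\<close> become the bare translation, all others carry in
    addition the value 1 at position 0. Adjacent vertices have the same image, so all relations
    hold.\<close>
  define e where "e v = Lamp (\<lambda>i. if v \<notin> V1 \<and> i = 0 then 1 else 0) 1" for v
  have "e v = e w" if "{v, w} \<in> E" for v w
    using closed[of v w] closed[of w v] that by (auto simp: e_def insert_commute)
  then have hom: "word_hom V E (word_eval e)" by (intro word_hom_eval) simp
  have pos: "pos (word_eval e w) = exponent_sum w" for w
    by (induction w) (auto simp: e_def)
  have fin: "finite {i. lamps (word_eval e w) i \<noteq> 0}" for w
  proof (induction w)
    case (Cons l w)
    obtain v c where l: "l = (v, c)" by (cases l)
    let ?n = "if c then 1 else - 1 :: int"
    have "{i. lamps (word_eval e (l # w)) i \<noteq> 0} \<subseteq> {0, -1} \<union> (\<lambda>i. i + ?n) ` {i. lamps (word_eval e w) i \<noteq> 0}"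
    proof
      fix i assume i: "i \<in> {i. lamps (word_eval e (l # w)) i \<noteq> 0}"
      show "i \<in> {0, -1} \<union> (\<lambda>i. i + ?n) ` {i. lamps (word_eval e w) i \<noteq> 0}"
      proof (cases "i \<in> {0, -1}")
        case False
        then have "lamps (word_eval e w) (i - ?n) \<noteq> 0" using i l by (auto simp: e_def split: if_splits)
        then show ?thesis by (intro UnI2 image_eqI[of _ _ "i - ?n"]) auto
      qed blast
    qed
    then show ?case using Cons.IH finite_subset by fastforce
  qed simp
  have "finite (\<Union>i\<in>{..<g}. {n. lamps (word_eval e (a i)) n \<noteq> 0} \<union> {n. lamps (word_eval e (b i)) n \<noteq> 0})"
    using fin by auto
  moreover have "infinite (range int)" by (simp add: finite_image_iff)
  ultimately obtain N where "N \<in> range int"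
      "N \<notin> (\<Union>i\<in>{..<g}. {n. lamps (word_eval e (a i)) n \<noteq> 0} \<union> {n. lamps (word_eval e (b i)) n \<noteq> 0})"
    by (meson finite_subset subsetI)
  then obtain n :: nat where n: "\<And>i. i < g \<Longrightarrow> lamps (word_eval e (a i)) (int n) = 0 \<and> lamps (word_eval e (b i)) (int n) = 0"
    by auto
  \<comment> \<open>On words of exponent sum 0 the translation part is trivial, so a single
    coordinate is additive. Position \<open>n\<close> lies outside the supports of the images of all
    \<open>a i\<close> and \<open>b i\<close>.\<close>
  let ?f = "\<lambda>w. lamps (word_eval e w) (int n)"
  have f: "word_hom V E ?f"
    unfolding word_hom_def
  proof (intro conjI ballI allI impI)
    fix u v assume "u \<in> words0 V" "v \<in> words0 V"
    then show "?f (u @ v) = ?f u + ?f v" by (simp add: pos words0_def)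
  next
    fix u v assume "u \<in> words0 V" "word_eq V (raag_relators E) u v"
    then show "?f u = ?f v" using word_homD(2)[OF hom] by simp
  qed
  \<comment> \<open>v1^n v2 v1^-(n+1) carries the value 1 at position \<open>n\<close>, although the
    coordinate vanishes on all \<open>a i\<close> and \<open>b i\<close>.\<close>
  let ?w = "replicate n (v1, True) @ [(v2, True)] @ replicate (Suc n) (v1, False)"
  have ex: "exponent_sum (replicate k (v, c)) = (if c then int k else - int k)" for k v c
    by (induction k) auto
  have w: "?w \<in> words0 V" using V1 v2 by (auto simp: words0_def ex in_lists_conv_set)
  have z: "lamps (word_eval e (replicate k (v1, c))) i = 0" for k c i
    using V1(1) by (induction k arbitrary: i) (auto simp: e_def)
  have "?f ?w = 1"
    using z v2 by (simp add: pos ex e_def del: replicate.simps)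
  moreover have "?f ?w = 0"
    by (rule rat_unique[OF f word_hom_zero _ _ w]) (use n in auto)
  ultimately show False by simp
qed

text \<open>A rational homomorphism extends to the whole right-angled Artin group, because
  conjugation by that group leaves it unchanged. For the quotient of two adjacent vertices one can
  conjugate by a power of one of them, which commutes with it; connectedness spreads this to all
  quotients by \<open>v0\<close>.\<close>

lemma rat_hom_eval:
  fixes f :: "_ \<Rightarrow> rat"
  assumes f: "word_hom V E f" and v0: "v0 \<in> V" and w: "w \<in> words0 V"
  shows "f w = word_eval (\<lambda>v. f [(v, True), (v0, False)]) w"
proof -
  define F where "F v = f [(v, True), (v0, False)]" for v
  define D where "D w = f w - word_eval F w" for w
  have hF: "word_hom V E (word_eval F)" by (rule word_hom_eval) simp
  have D: "word_hom V E D"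
    unfolding word_hom_def D_def using word_homD[OF f] word_homD[OF hF] by auto
  note D1 = word_homD(1)[OF D] and D2 = word_homD(2)[OF D] and Dinv = word_hom_inv[OF D]
  let ?R = "raag_relators E" and ?L = "lists (V \<times> UNIV)"
  have L0: "x \<in> words0 V \<longleftrightarrow> x \<in> ?L \<and> exponent_sum x = 0" for x by (simp add: words0_def)
  \<comment> \<open>Two conjugators with the same exponent sum differ by an element of the kernel,
    and conjugation inside the kernel is invisible to an additive \<open>D\<close>.\<close>
  have conj: "D (x @ y @ word_inv x) = D (x' @ y @ word_inv x')"
    if x: "x \<in> ?L" "x' \<in> ?L" "exponent_sum x = exponent_sum x'" and y: "y \<in> words0 V" for x x' y
  proof -
    let ?z = "x' @ word_inv x"
    have z: "?z \<in> words0 V" using x word_inv_lists[OF x(1)] by (simp only: L0 append_in_lists_conv) simp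
    have yL: "y \<in> ?L" using y L0 by blast
    have xL: "word_inv x \<in> ?L" "word_inv x' \<in> ?L" using x by (auto simp del: in_lists_conv_set)
    have y': "x @ y @ word_inv x \<in> words0 V" using x y xL yL by (simp only: L0 append_in_lists_conv) simp
    have zi: "word_inv ?z \<in> words0 V" using z by (rule words0_closed(3))
    have "D (?z @ (x @ y @ word_inv x) @ word_inv ?z) = D ?z + (D (x @ y @ word_inv x) + D (word_inv ?z))"
      unfolding D1[OF z words0_closed(2)[OF y' zi]] D1[OF y' zi] by (rule HOL.refl)
    also have "\<dots> = D (x @ y @ word_inv x)" using Dinv[OF z] by simp
    finally have "D (x @ y @ word_inv x) = D (?z @ (x @ y @ word_inv x) @ word_inv ?z)" by simp
    also have "\<dots> = D (x' @ y @ word_inv x')"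
    proof (rule D2)
      show "?z @ (x @ y @ word_inv x) @ word_inv ?z \<in> words0 V"
        by (rule words0_closed(2)[OF z words0_closed(2)[OF y' zi]])
      have 1: "word_eq V ?R (x' @ word_inv x @ x @ (y @ word_inv x @ x @ word_inv x')) (x' @ (y @ word_inv x @ x @ word_inv x'))"
        by (rule word_eq_cancel(2)) (use x xL yL in \<open>simp_all only: append_in_lists_conv\<close>)
      have 2: "word_eq V ?R ((x' @ y) @ word_inv x @ x @ word_inv x') ((x' @ y) @ word_inv x')"
        by (rule word_eq_cancel(2)) (use x xL yL in \<open>simp_all only: append_in_lists_conv\<close>)
      show "word_eq V ?R (?z @ (x @ y @ word_inv x) @ word_inv ?z) (x' @ y @ word_inv x')"
        using word_eq.intros(3)[OF 1] 2 by simp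
    qed
    finally show ?thesis .
  qed
  have e0: "[(u, True), (v, False)] \<in> words0 V" if "u \<in> V" "v \<in> V" for u v
    using that by (simp add: words0_def)
  have edge: "D (x @ [(u, True), (v, False)] @ word_inv x) = D [(u, True), (v, False)]"
    if uv: "{u, v} \<in> E" and x: "x \<in> ?L" for u v x
  proof -
    define n where "n = exponent_sum x"
    \<comment> \<open>The power of \<open>u\<close> with the exponent sum of \<open>x\<close>; it
      commutes with both letters of the quotient.\<close>
    define r where "r = replicate (nat \<bar>n\<bar>) (u, 0 \<le> n)"
    note V = edgeD[OF uv]
    have r: "r \<in> ?L" "exponent_sum r = n"
    proof -
      show "r \<in> ?L" using V by (auto simp: r_def in_lists_conv_set)
      have "exponent_sum (replicate k (u, c)) = (if c then int k else - int k)" for k c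
        by (induction k) auto
      then show "exponent_sum r = n" by (simp add: r_def)
    qed
    have "D (x @ [(u, True), (v, False)] @ word_inv x) = D (r @ [(u, True), (v, False)] @ word_inv r)"
      by (rule conj) (use x r V in \<open>simp_all add: n_def e0\<close>)
    also have "\<dots> = D [(u, True), (v, False)]"
    proof (rule D2)
      show "r @ [(u, True), (v, False)] @ word_inv r \<in> words0 V"
        using r e0[OF V(1,2)] word_inv_lists[OF r(1)] by (simp only: L0 append_in_lists_conv) simp
      have 1: "word_eq V ?R ((r @ [(u, True)]) @ [(v, False)] @ word_inv r) ([(u, True)] @ [(v, False)] @ r @ word_inv r)"
      proof -
        have A: "word_eq V ?R (r @ [(u, True)]) ([(u, True)] @ r)"
        proof (cases "0 \<le> n")
          case True
          then have "r @ [(u, True)] = [(u, True)] @ r" by (simp add: r_def replicate_append_same)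
          then show ?thesis using r V by (simp add: word_eq.intros(1) del: in_lists_conv_set)
        next
          case False
          have "word_eq V ?R (replicate k (u, False) @ [(u, True)]) ([(u, True)] @ replicate k (u, False))" for k
          proof (cases k)
            case 0
            then show ?thesis using V by (auto intro!: word_eq.intros(1))
          next
            case (Suc m)
            have rep: "replicate m (u, False) \<in> ?L" using V by (auto simp: in_lists_conv_set)
            have "word_eq V ?R (replicate m (u, False) @ [(u, False)] @ word_inv [(u, False)] @ []) (replicate m (u, False) @ [])"
              by (rule word_eq_cancel) (use rep V in auto)
            moreover have "word_eq V ?R ([] @ [(u, True)] @ word_inv [(u, True)] @ replicate m (u, False)) ([] @ replicate m (u, False))"
              by (rule word_eq_cancel) (use rep V in auto)
            moreover have "replicate (Suc m) (u, False) @ [(u, True)] = replicate m (u, False) @ [(u, False), (u, True)]"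
              by (simp add: replicate_append_same[symmetric])
            ultimately show ?thesis unfolding Suc using word_eq.intros(2,3) by fastforce
          qed
          then show ?thesis using False by (simp add: r_def)
        qed
        have B: "word_eq V ?R (r @ [(v, False)]) ([(v, False)] @ r)"
          unfolding r_def by (rule word_eq_power_commute[OF uv V(1,2)])
        have LL: "[(u, True)] \<in> ?L" "[(v, False)] \<in> ?L" "word_inv r \<in> ?L" "[] \<in> ?L"
          using V word_inv_lists[OF r(1)] by (auto simp del: in_lists_conv_set)
        have A': "word_eq V ?R ([] @ (r @ [(u, True)]) @ ([(v, False)] @ word_inv r)) ([] @ ([(u, True)] @ r) @ ([(v, False)] @ word_inv r))"
          by (rule word_eq_append[OF A]) (use LL in \<open>simp_all only: append_in_lists_conv\<close>)
        have B': "word_eq V ?R ([(u, True)] @ (r @ [(v, False)]) @ word_inv r) ([(u, True)] @ ([(v, False)] @ r) @ word_inv r)"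
          by (rule word_eq_append[OF B]) (use LL in simp_all)
        show ?thesis using word_eq.intros(3)[OF A'] B' by simp
      qed
      have 2: "word_eq V ?R ([(u, True), (v, False)] @ r @ word_inv r @ []) ([(u, True), (v, False)] @ [])"
        by (rule word_eq_cancel) (use r V in auto)
      show "word_eq V ?R (r @ [(u, True), (v, False)] @ word_inv r) [(u, True), (v, False)]"
        using word_eq.intros(3)[OF 1] 2 by simp
    qed
    finally show ?thesis .
  qed
  \<comment> \<open>u v^-1 is u v0^-1 times the inverse of v v0^-1, and \<open>F\<close> was defined
    from the values of \<open>f\<close> on these.\<close>
  have base: "D [(u, True), (v, False)] = 0" if V: "u \<in> V" "v \<in> V" for u v
  proof -
    have b: "D [(u, True), (v0, False)] = 0" if "u \<in> V" for u
    proof -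
      have "F v0 = f [(v0, True), (v0, False)]" by (simp add: F_def)
      also have "\<dots> = f []"
        by (rule word_homD(2)[OF f]) (use e0[OF v0 v0] word_eq_inv[of "[(v0, True)]" V] v0 in auto)
      finally have "F v0 = 0" using word_hom_nil[OF f] by simp
      then show ?thesis by (simp add: D_def F_def)
    qed
    have "D ([(u, True), (v0, False)] @ word_inv [(v, True), (v0, False)]) = D [(u, True), (v, False)]"
    proof (rule D2)
      show "[(u, True), (v0, False)] @ word_inv [(v, True), (v0, False)] \<in> words0 V"
        using e0 V v0 by (intro words0_closed) auto
      show "word_eq V ?R ([(u, True), (v0, False)] @ word_inv [(v, True), (v0, False)]) [(u, True), (v, False)]"
        using word_eq_cancel(1)[of "[(u, True)]" V "[(v0, False)]" "[(v, False)]" ?R] V v0 by simp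
    qed
    moreover have "D ([(u, True), (v0, False)] @ word_inv [(v, True), (v0, False)]) = 0"
      using D1[of "[(u, True), (v0, False)]" "word_inv [(v, True), (v0, False)]"]
        Dinv[of "[(v, True), (v0, False)]"] b V v0 e0 by (simp del: word_inv_simps)
    ultimately show ?thesis by simp
  qed
  have all: "D (x @ [(v, True), (v0, False)] @ word_inv x) = 0" if "v \<in> V" "x \<in> ?L" for v x
  proof -
    \<comment> \<open>Vertices whose quotient by \<open>v0\<close> is killed together with all its
      conjugates. By \<open>edge\<close> and \<open>base\<close> this set contains the neighbours of
      its members.\<close>
    define V1 where "V1 = {v \<in> V. \<forall>x\<in>?L. D (x @ [(v, True), (v0, False)] @ word_inv x) = 0}"
    have "V1 = V"
    proof (rule connected)
      show "v0 \<in> V1"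
      proof -
        have "D (x @ [(v0, True), (v0, False)] @ word_inv x) = 0" if x: "x \<in> ?L" for x
        proof -
          have "D (x @ [(v0, True), (v0, False)] @ word_inv x) = D []"
          proof (rule D2)
            show "x @ [(v0, True), (v0, False)] @ word_inv x \<in> words0 V"
              using x e0[OF v0 v0] word_inv_lists[OF x] by (simp only: L0 append_in_lists_conv) simp
            have "word_eq V ?R (x @ [(v0, True)] @ word_inv [(v0, True)] @ word_inv x) (x @ word_inv x)"
              by (rule word_eq_cancel) (use x v0 in auto)
            then show "word_eq V ?R (x @ [(v0, True), (v0, False)] @ word_inv x) []"
              using word_eq.intros(3) word_eq_inv[OF x] by fastforce
          qed
          then show ?thesis using word_hom_nil[OF D] by simp
        qed
        then show ?thesis using v0 by (simp add: V1_def)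
      qed
      show "V1 \<subseteq> V" by (auto simp: V1_def)
      fix u v assume uv: "{u, v} \<in> E" "u \<in> V1"
      note V = edgeD[OF uv(1)]
      have "D (x @ [(v, True), (v0, False)] @ word_inv x) = 0" if x: "x \<in> ?L" for x
      proof -
        have xi: "word_inv x \<in> ?L" using x by (rule word_inv_lists)
        let ?y = "x @ [(v, True), (u, False)] @ word_inv x" and ?z = "x @ [(u, True), (v0, False)] @ word_inv x"
        have y: "?y \<in> words0 V" and z: "?z \<in> words0 V"
          using x xi e0[OF V(2,1)] e0[OF V(1) v0] by (simp_all only: L0 append_in_lists_conv) simp_all
        have "D (?y @ ?z) = 0"
          using D1[OF y z] edge[of v u x] x uv base[OF V(2,1)] by (simp add: V1_def insert_commute)
        moreover have "D (?y @ ?z) = D (x @ [(v, True), (v0, False)] @ word_inv x)"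
        proof (rule D2)
          show "?y @ ?z \<in> words0 V" using y z by (rule words0_closed)
          have l: "[(v, True), (u, False)] \<in> ?L" "[(u, True), (v0, False)] \<in> ?L" "[(v, True)] \<in> ?L" "[(u, False)] \<in> ?L" "[(v0, False)] \<in> ?L"
            using V v0 by auto
          have 1: "word_eq V ?R ((x @ [(v, True), (u, False)]) @ word_inv x @ x @ ([(u, True), (v0, False)] @ word_inv x))
             ((x @ [(v, True), (u, False)]) @ ([(u, True), (v0, False)] @ word_inv x))"
            by (rule word_eq_cancel) (use x xi l in \<open>simp_all only: append_in_lists_conv\<close>)
          have 2: "word_eq V ?R ((x @ [(v, True)]) @ [(u, False)] @ word_inv [(u, False)] @ ([(v0, False)] @ word_inv x))
             ((x @ [(v, True)]) @ ([(v0, False)] @ word_inv x))"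
            by (rule word_eq_cancel) (use x xi l in \<open>simp_all only: append_in_lists_conv\<close>)
          show "word_eq V ?R (?y @ ?z) (x @ [(v, True), (v0, False)] @ word_inv x)"
            using word_eq.intros(3)[OF 1] 2 by simp
        qed
        ultimately show ?thesis by simp
      qed
      then show "v \<in> V1" using V by (simp add: V1_def)
    qed
    then show ?thesis using that by (auto simp: V1_def simp del: in_lists_conv_set)
  qed
  define c where "c n = (if 0 \<le> n then replicate (nat n) (v0, True) else replicate (nat (- n)) (v0, False))" for n :: int
  have cL: "c n \<in> ?L" and ce: "exponent_sum (c n) = n" for n
  proof -
    show "c n \<in> ?L" using v0 by (auto simp: c_def in_lists_conv_set)
    have "exponent_sum (replicate k (v0, b)) = (if b then int k else - int k)" for k b
      by (induction k) auto
    then show "exponent_sum (c n) = n" by (simp add: c_def)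
  qed
  have cS: "word_eq V ?R (c (n + 1)) (c n @ [(v0, True)])" for n
  proof (cases "0 \<le> n")
    case True
    then have "c (n + 1) = c n @ [(v0, True)]"
      by (simp add: c_def nat_add_distrib replicate_append_same)
    then show ?thesis using cL[of "n + 1"] by (simp add: word_eq.intros(1) del: in_lists_conv_set)
  next
    case False
    then have "c n = c (n + 1) @ [(v0, False)]"
    proof -
      have "nat (- n) = Suc (nat (- (n + 1)))" using False by simp
      then show ?thesis using False by (auto simp: c_def replicate_append_same)
    qed
    then have "word_eq V ?R (c n @ [(v0, True)]) (c (n + 1) @ [])"
      using word_eq_cancel(1)[of "c (n + 1)" V "[(v0, False)]" "[]" ?R] cL[of "n + 1"] v0 by simp
    then show ?thesis using word_eq.intros(2) by fastforce
  qed
  have inv_cong: "word_eq V ?R (word_inv x) (word_inv y)" if "word_eq V ?R x y" for x y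
  proof -
    have L: "x \<in> ?L" "y \<in> ?L" "word_inv x \<in> ?L" "word_inv y \<in> ?L" using word_eq_lists[OF that] by auto
    have 1: "word_eq V ?R (word_inv x @ x @ word_inv y) (word_inv x @ y @ word_inv y)"
      by (rule word_eq_append[OF that L(3,4)])
    have 2: "word_eq V ?R ([] @ word_inv x @ x @ word_inv y) ([] @ word_inv y)"
      by (rule word_eq_cancel) (use L in auto)
    have 3: "word_eq V ?R (word_inv x @ y @ word_inv y @ []) (word_inv x @ [])"
      by (rule word_eq_cancel) (use L in auto)
    show ?thesis using 1 2 3 word_eq.intros(2,3) by (metis append_Nil append_Nil2)
  qed
  \<comment> \<open>\<open>c n\<close> is the n-th power of \<open>v0\<close>. Letters of
    \<open>x\<close> are replaced by \<open>v0\<close> one at a time, and each replacement costs a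
    conjugate of some v v0^-1 or the inverse of one.\<close>
  have main: "D (x @ word_inv (c (exponent_sum x))) = 0" if "x \<in> ?L" for x
    using that
  proof (induction x rule: rev_induct)
    case Nil
    then show ?case using word_hom_nil[OF D] by (simp add: c_def)
  next
    case (snoc l x)
    obtain v b where l: "l = (v, b)" by (cases l)
    have x: "x \<in> ?L" "v \<in> V" using snoc.prems l by auto
    define n where "n = exponent_sum x"
    have IH: "D (x @ word_inv (c n)) = 0" using snoc.IH x by (simp add: n_def)
    have wi: "word_inv x \<in> ?L" "word_inv (c k) \<in> ?L" for k using x cL by (auto simp del: in_lists_conv_set)
    have xc: "x @ word_inv (c n) \<in> words0 V"
      using x wi ce by (simp only: L0 append_in_lists_conv) (simp add: n_def)
    show ?case
    proof (cases b)
      case True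
      let ?y = "x @ [(v, True), (v0, False)] @ word_inv x"
      have y: "?y \<in> words0 V" using x wi e0[OF x(2) v0] by (simp only: L0 append_in_lists_conv) simp
      have "0 = D (?y @ x @ word_inv (c n))" using D1[OF y xc] IH all[OF x(2,1)] by simp
      also have "\<dots> = D ((x @ [l]) @ word_inv (c (exponent_sum (x @ [l]))))"
      proof (rule D2)
        show "?y @ x @ word_inv (c n) \<in> words0 V" using y xc by (rule words0_closed)
        have lL: "[(v, True), (v0, False)] \<in> ?L" "[(v, True)] \<in> ?L" using x v0 by auto
        have 1: "word_eq V ?R ((x @ [(v, True), (v0, False)]) @ word_inv x @ x @ word_inv (c n)) ((x @ [(v, True), (v0, False)]) @ word_inv (c n))"
          by (rule word_eq_cancel) (use x wi lL in \<open>simp_all only: append_in_lists_conv\<close>)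
        have "word_eq V ?R (word_inv (c (n + 1))) (word_inv (c n @ [(v0, True)]))" by (rule inv_cong[OF cS])
        from word_eq_append[OF this, of "x @ [(v, True)]" "[]"]
        have 2: "word_eq V ?R ((x @ [(v, True)]) @ word_inv (c (n + 1)) @ []) ((x @ [(v, True)]) @ word_inv (c n @ [(v0, True)]) @ [])"
          using x lL by (simp only: append_in_lists_conv lists.Nil)
        show "word_eq V ?R (?y @ x @ word_inv (c n)) ((x @ [l]) @ word_inv (c (exponent_sum (x @ [l]))))"
          using word_eq.intros(3)[OF 1] word_eq.intros(2)[OF 2] by (simp add: l True n_def)
      qed
      finally show ?thesis by simp
    next
      case False
      let ?x = "x @ [(v, False)]"
      have xl: "?x \<in> ?L" using x by auto
      have xli: "word_inv ?x \<in> ?L" using xl by (rule word_inv_lists)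
      let ?y = "?x @ [(v, True), (v0, False)] @ word_inv ?x"
      have y: "?y \<in> words0 V" using xl xli e0[OF x(2) v0] by (simp only: L0 append_in_lists_conv) simp
      have "0 = D (word_inv ?y @ x @ word_inv (c n))"
        using D1[OF words0_closed(3)[OF y] xc] Dinv[OF y] IH all[OF x(2) xl] by simp
      also have "\<dots> = D ((x @ [l]) @ word_inv (c (exponent_sum (x @ [l]))))"
      proof (rule D2)
        show "word_inv ?y @ x @ word_inv (c n) \<in> words0 V"
          by (rule words0_closed(2)[OF words0_closed(3)[OF y] xc])
        have lL: "[(v0, True), (v, False)] \<in> ?L" "[(v, True)] \<in> ?L" "[(v, False)] \<in> ?L" "[(v0, True)] \<in> ?L" using x v0 by auto
        have yi: "word_inv ?y = x @ [(v, False), (v0, True), (v, False), (v, True)] @ word_inv x" by simp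
        have 1: "word_eq V ?R ((x @ [(v, False), (v0, True), (v, False), (v, True)]) @ word_inv x @ x @ word_inv (c n))
            ((x @ [(v, False), (v0, True), (v, False), (v, True)]) @ word_inv (c n))"
          by (rule word_eq_cancel) (use x wi v0 in \<open>simp_all add: append_in_lists_conv del: in_lists_conv_set\<close>)
        have 2: "word_eq V ?R ((x @ [(v, False), (v0, True)]) @ [(v, False)] @ word_inv [(v, False)] @ word_inv (c n))
            ((x @ [(v, False), (v0, True)]) @ word_inv (c n))"
          by (rule word_eq_cancel) (use x wi v0 in \<open>simp_all add: append_in_lists_conv del: in_lists_conv_set\<close>)
        have "word_eq V ?R (word_inv (c (n - 1 + 1))) (word_inv (c (n - 1) @ [(v0, True)]))" by (rule inv_cong[OF cS])
        then have 3: "word_eq V ?R (word_inv (c n)) ([(v0, False)] @ word_inv (c (n - 1)))" by simp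
        have "word_eq V ?R ((x @ [(v, False), (v0, True)]) @ word_inv (c n) @ [])
            ((x @ [(v, False), (v0, True)]) @ ([(v0, False)] @ word_inv (c (n - 1))) @ [])"
          by (rule word_eq_append[OF 3]) (use x v0 in \<open>simp_all add: append_in_lists_conv del: in_lists_conv_set\<close>)
        then have 4: "word_eq V ?R ((x @ [(v, False), (v0, True)]) @ word_inv (c n))
            ((x @ [(v, False)]) @ [(v0, True)] @ word_inv [(v0, True)] @ word_inv (c (n - 1)))" by simp
        have 5: "word_eq V ?R ((x @ [(v, False)]) @ [(v0, True)] @ word_inv [(v0, True)] @ word_inv (c (n - 1)))
            ((x @ [(v, False)]) @ word_inv (c (n - 1)))"
          by (rule word_eq_cancel) (use x wi v0 in \<open>simp_all add: append_in_lists_conv del: in_lists_conv_set\<close>)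
        have 12: "word_eq V ?R (word_inv ?y @ x @ word_inv (c n)) ((x @ [(v, False), (v0, True)]) @ word_inv (c n))"
          unfolding yi using word_eq.intros(3)[OF 1] 2 by simp
        have lF: "l = (v, False)" using l False by simp
        have e: "exponent_sum (x @ [l]) = n - 1" by (simp add: l False n_def)
        show "word_eq V ?R (word_inv ?y @ x @ word_inv (c n)) ((x @ [l]) @ word_inv (c (exponent_sum (x @ [l]))))"
          unfolding e unfolding lF by (rule word_eq.intros(3)[OF 12 word_eq.intros(3)[OF 4 5]])
      qed
      finally show ?thesis by simp
    qed
  qed
  have "D (w @ word_inv (c (exponent_sum w))) = 0" by (rule main) (use w L0 in blast)
  then have "D w = 0" using w by (simp add: words0_def c_def)
  then show ?thesis by (simp add: D_def F_def[abs_def])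
qed

end

section \<open>The intersection form, a cycle, and the contradiction\<close>

context bb_surface
begin

text \<open>The intersection form on rational classes; by \<open>comm_sum_heis\<close> it is also
  the central coordinate of the surface relator in a Heisenberg group.\<close>

definition br :: "(('v \<times> bool) list \<Rightarrow> rat) \<Rightarrow> (('v \<times> bool) list \<Rightarrow> rat) \<Rightarrow> rat"
  where "br \<alpha> \<beta> = (\<Sum>i<g. \<alpha> (a i) * \<beta> (b i) - \<alpha> (b i) * \<beta> (a i))"

definition letter_count :: "'v \<Rightarrow> ('v \<times> bool) list \<Rightarrow> rat"
  where "letter_count v = word_eval (\<lambda>u. if u = v then 1 else 0)"

lemma word_eval_count:
  fixes F :: "'v \<Rightarrow> rat"
  assumes "finite U" "fst ` set w \<subseteq> U"
  shows "word_eval F w = (\<Sum>v\<in>U. F v * letter_count v w)"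
  using assms(2)
proof (induction w)
  case (Cons l w)
  have *: "(\<Sum>v\<in>U. F v * (if fst l = v then 1 else 0)) = F (fst l)"
    using Cons.prems assms(1) by (subst sum.cong[OF HOL.refl, of _ _ "\<lambda>v. if v = fst l then F v else 0"]) auto
  have "(\<Sum>v\<in>U. F v * letter_count v (l # w)) =
      (\<Sum>v\<in>U. F v * (if snd l then (if fst l = v then 1 else 0) else - (if fst l = v then 1 else 0)) + F v * letter_count v w)"
    by (intro sum.cong) (auto simp: letter_count_def algebra_simps)
  also have "\<dots> = (if snd l then F (fst l) else - F (fst l)) + (\<Sum>v\<in>U. F v * letter_count v w)"
    using * by (simp add: sum.distrib sum_negf)
  finally show ?case using Cons by simp
qed (simp add: letter_count_def)

lemma word_eval_one: "word_eval (\<lambda>_. 1 :: rat) w = of_int (exponent_sum w)"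
  by (induction w) auto

lemma vertex_exists: "\<exists>v. v \<in> V"
proof (rule ccontr)
  assume n: "\<nexists>v. v \<in> V"
  obtain f :: "_ \<Rightarrow> rat" where f: "word_hom V E f" "\<forall>i<g. f (a i) = 1 \<and> f (b i) = 1"
    using rat_ext[of "\<lambda>_. 1" "\<lambda>_. 1"] by blast
  have "0 < g" using g by simp
  then have "a 0 \<in> words0 V" "f (a 0) = 1" using gens f by auto
  moreover have "a 0 = []" using calculation(1) n by (cases "a 0") (auto simp: words0_def)
  ultimately show False using word_hom_nil[OF f(1)] by simp
qed

lemma cycle_exists:
  "\<exists>xs. distinct xs \<and> 3 \<le> length xs \<and> set xs \<subseteq> V \<and>
    (\<forall>i<length xs. {xs ! i, xs ! (Suc i mod length xs)} \<in> E)"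
proof -
  obtain v0 where v0: "v0 \<in> V" using vertex_exists by blast
  \<comment> \<open>The vertices that occur in the words \<open>a i\<close> and \<open>b i\<close>:
    a finite set, even if \<open>V\<close> is infinite.\<close>
  define U where "U = (\<Union>i<g. fst ` set (a i) \<union> fst ` set (b i))"
  have U: "finite U" "\<And>i. i < g \<Longrightarrow> fst ` set (a i) \<subseteq> U" "\<And>i. i < g \<Longrightarrow> fst ` set (b i) \<subseteq> U"
    unfolding U_def by auto
  define R where "R v w = (\<Sum>i<g. letter_count v (a i) * letter_count w (b i) - letter_count v (b i) * letter_count w (a i))" for v w
  have UV: "U \<subseteq> V"
  proof
    fix u assume "u \<in> U"
    then obtain i where "i < g" "u \<in> fst ` set (a i) \<or> u \<in> fst ` set (b i)" unfolding U_def by blast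
    moreover from this have "a i \<in> lists (V \<times> UNIV)" "b i \<in> lists (V \<times> UNIV)"
      using gens[of i] unfolding words0_def by blast+
    ultimately show "u \<in> V" unfolding in_lists_conv_set by auto
  qed
  have out: "letter_count v w = 0" if "v \<notin> fst ` set w" for v w
    using that unfolding letter_count_def by (induction w) auto
  have sum0: "(\<Sum>v\<in>U. letter_count v w) = 0" if "w \<in> words0 V" "fst ` set w \<subseteq> U" for w
    using word_eval_count[OF U(1) that(2), of "\<lambda>_. 1"] that(1) by (simp add: word_eval_one words0_def)
  have anti: "R w v = - R v w" for v w
    unfolding R_def sum_negf[symmetric] by (intro sum.cong) (auto simp: algebra_simps)
  have diag: "R v v = 0" for v unfolding R_def by (simp add: mult.commute)
  have outR: "R v w = 0" if "v \<notin> U" for v w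
    unfolding R_def using out[of v] that U(2,3) by (intro sum.neutral ballI) (metis diff_zero lessThan_iff mult_zero_left subsetD)
  have row: "(\<Sum>w\<in>U. R v w) = 0" for v
  proof -
    have "(\<Sum>w\<in>U. R v w) = (\<Sum>i<g. \<Sum>w\<in>U. letter_count v (a i) * letter_count w (b i) - letter_count v (b i) * letter_count w (a i))"
      unfolding R_def by (rule sum.swap)
    also have "\<dots> = (\<Sum>i<g. letter_count v (a i) * (\<Sum>w\<in>U. letter_count w (b i)) - letter_count v (b i) * (\<Sum>w\<in>U. letter_count w (a i)))"
      by (simp add: sum_subtractf sum_distrib_left)
    also have "\<dots> = 0" using sum0 gens U by (intro sum.neutral) simp
    finally show ?thesis .
  qed
  have nz: "\<exists>v w. R v w \<noteq> 0"
  proof (rule ccontr)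
    assume "\<not> ?thesis"
    then have R0: "R v w = 0" for v w by blast
    \<comment> \<open>The classes dual to the words \<open>a 0\<close> and \<open>b 0\<close>, on
      which \<open>br\<close> is 1. Expanding both in vertex coordinates expresses this value
      through the entries of \<open>R\<close>.\<close>
    obtain f :: "_ \<Rightarrow> rat" where f: "word_hom V E f" "\<forall>i<g. f (a i) = (if i = 0 then 1 else 0) \<and> f (b i) = 0"
      using rat_ext[of "\<lambda>i. if i = 0 then 1 else 0" "\<lambda>_. 0"] by blast
    obtain f' :: "_ \<Rightarrow> rat" where f': "word_hom V E f'" "\<forall>i<g. f' (a i) = 0 \<and> f' (b i) = (if i = 0 then 1 else 0)"
      using rat_ext[of "\<lambda>_. 0" "\<lambda>i. if i = 0 then 1 else 0"] by blast
    define F where "F v = f [(v, True), (v0, False)]" for v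
    define F' where "F' v = f' [(v, True), (v0, False)]" for v
    have e: "f w = (\<Sum>v\<in>U. F v * letter_count v w)" "f' w = (\<Sum>v\<in>U. F' v * letter_count v w)"
      if "w \<in> words0 V" "fst ` set w \<subseteq> U" for w
      using rat_hom_eval[OF f(1) v0 that(1)] rat_hom_eval[OF f'(1) v0 that(1)] word_eval_count[OF U(1) that(2)]
      unfolding F_def[abs_def] F'_def[abs_def] by simp_all
    have p: "(\<Sum>v\<in>U. F v * letter_count v x) * (\<Sum>w\<in>U. F' w * letter_count w y) =
        (\<Sum>v\<in>U. \<Sum>w\<in>U. F v * F' w * (letter_count v x * letter_count w y))" for x y
      unfolding sum_product by (intro sum.cong HOL.refl) (simp add: mult_ac)
    have "br f f' = (\<Sum>i<g. \<Sum>v\<in>U. \<Sum>w\<in>U. F v * F' w * (letter_count v (a i) * letter_count w (b i) - letter_count v (b i) * letter_count w (a i)))"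
      unfolding br_def
      by (intro sum.cong HOL.refl) (simp add: e gens U p sum_subtractf right_diff_distrib)
    also have "\<dots> = (\<Sum>v\<in>U. \<Sum>i<g. \<Sum>w\<in>U. F v * F' w * (letter_count v (a i) * letter_count w (b i) - letter_count v (b i) * letter_count w (a i)))"
      by (rule sum.swap)
    also have "\<dots> = (\<Sum>v\<in>U. \<Sum>w\<in>U. \<Sum>i<g. F v * F' w * (letter_count v (a i) * letter_count w (b i) - letter_count v (b i) * letter_count w (a i)))"
      by (intro sum.cong HOL.refl) (rule sum.swap)
    also have "\<dots> = (\<Sum>v\<in>U. \<Sum>w\<in>U. F v * F' w * R v w)"
      unfolding R_def by (simp add: sum_distrib_left)
    also have "\<dots> = 0" by (simp add: R0)
    finally have "br f f' = 0" .
    moreover have "br f f' = (\<Sum>i<g. if i = 0 then 1 else 0)"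
      unfolding br_def using f(2) f'(2) by (intro sum.cong) auto
    ultimately show False using g by (simp add: sum.delta)
  qed
  have edge: "{v, w} \<in> E" if "R v w \<noteq> 0" for v w
  proof (rule ccontr)
    assume ne: "{v, w} \<notin> E"
    have vw: "v \<noteq> w" using that diag by auto
    \<comment> \<open>\<open>v\<close> and \<open>w\<close> go to two noncommuting elements and all
      other vertices to 0, which respects the relations because \<open>v\<close>, \<open>w\<close>
      are not adjacent. The surface relator then has central coordinate
      \<open>R v w\<close>.\<close>
    define e where "e u = Heis (if u = v then 1 else 0) (if u = w then 1 else 0) 0 0 0" for u
    have "e x + e y = e y + e x" if "{x, y} \<in> E" for x y
    proof -
      have "h1 (e x) * h2 (e y) = 0" "h1 (e y) * h2 (e x) = 0"
        using that ne by (auto simp: e_def insert_commute split: if_splits)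
      then have "h1 (e x) * h2 (e y) = h1 (e y) * h2 (e x)" by (simp only:)
      moreover have "h3 (e x) = 0" "h3 (e y) = 0" by (simp_all add: e_def)
      ultimately show ?thesis by (intro heis_eqI) simp_all
    qed
    then have hom: "word_hom V E (word_eval e)" by (rule word_hom_eval)
    have c: "h1 (word_eval e x) = letter_count v x" "h2 (word_eval e x) = letter_count w x"
      "h3 (word_eval e x) = 0" for x
      unfolding letter_count_def by (induction x) (auto simp: e_def)
    have "hz (comm_sum (\<lambda>i. word_eval e (a i)) (\<lambda>i. word_eval e (b i)) g) = R v w"
      unfolding comm_sum_heis c R_def by simp
    moreover have "comm_sum (\<lambda>i. word_eval e (a i)) (\<lambda>i. word_eval e (b i)) g = 0"
      by (rule surface_modelD(3)[OF mh hom])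
    ultimately show False using that by simp
  qed
  obtain v w where "R v w \<noteq> 0" using nz by blast
  from antisymmetric_cycle[of U R, OF U(1) outR anti diag row this]
  obtain xs where xs: "distinct xs" "3 \<le> length xs" "set xs \<subseteq> U"
    "\<forall>i<length xs. R (xs ! i) (xs ! (Suc i mod length xs)) \<noteq> 0" by blast
  then show ?thesis using edge UV by blast
qed

lemma word_hom_heis_comps:
  fixes f :: "_ \<Rightarrow> heis"
  assumes "word_hom V E f"
  shows "word_hom V E (\<lambda>w. h1 (f w))" "word_hom V E (\<lambda>w. h2 (f w))"
    "word_hom V E (\<lambda>w. h3 (f w))" "word_hom V E (\<lambda>w. h4 (f w))"
  using assms unfolding word_hom_def by simp_all

lemma word_hom_ut4_comps:
  fixes f :: "_ \<Rightarrow> ut4"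
  assumes "word_hom V E f"
  shows "word_hom V E (\<lambda>w. ua (f w))" "word_hom V E (\<lambda>w. ub (f w))" "word_hom V E (\<lambda>w. uc (f w))"
  using assms unfolding word_hom_def by simp_all

lemma word_hom_scale:
  fixes f :: "_ \<Rightarrow> rat"
  assumes "word_hom V E f" shows "word_hom V E (\<lambda>w. c * f w)"
  using assms unfolding word_hom_def by (simp add: distrib_left)

text \<open>Matrices that vanish next to the diagonal form an abelian subgroup on which the
  operations are entrywise. It contains the tail of the cycle from index 4 on.\<close>

lemma ut4_level2:
  fixes P :: "nat \<Rightarrow> ut4"
  assumes "\<forall>i\<in>set js. ua (P i) = 0 \<and> ub (P i) = 0 \<and> uc (P i) = 0"
  shows "ua (\<Sum>i\<leftarrow>js. P i) = 0" "ub (\<Sum>i\<leftarrow>js. P i) = 0" "uc (\<Sum>i\<leftarrow>js. P i) = 0"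
    "ua (\<Sum>i\<leftarrow>js. - P i) = 0" "ub (\<Sum>i\<leftarrow>js. - P i) = 0" "uc (\<Sum>i\<leftarrow>js. - P i) = 0"
    "ua (\<Sum>i\<leftarrow>js. P i + P i) = 0" "ub (\<Sum>i\<leftarrow>js. P i + P i) = 0" "uc (\<Sum>i\<leftarrow>js. P i + P i) = 0"
    "ux (\<Sum>i\<leftarrow>js. - P i) = - ux (\<Sum>i\<leftarrow>js. P i)" "uy (\<Sum>i\<leftarrow>js. - P i) = - uy (\<Sum>i\<leftarrow>js. P i)"
    "uz (\<Sum>i\<leftarrow>js. - P i) = - uz (\<Sum>i\<leftarrow>js. P i)"
    "ux (\<Sum>i\<leftarrow>js. P i + P i) = 2 * ux (\<Sum>i\<leftarrow>js. P i)" "uy (\<Sum>i\<leftarrow>js. P i + P i) = 2 * uy (\<Sum>i\<leftarrow>js. P i)"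
    "uz (\<Sum>i\<leftarrow>js. P i + P i) = 2 * uz (\<Sum>i\<leftarrow>js. P i)"
  using assms by (induction js) simp_all

lemma uz_commutator_shift:
  "uz (UT4 a1 b1 c1 0 0 0 + UT4 a2 b2 c2 s 0 0 - UT4 a1 b1 c1 0 0 0 - UT4 a2 b2 c2 s 0 0) =
    uz (UT4 a1 b1 c1 0 0 0 + UT4 a2 b2 c2 0 0 0 - UT4 a1 b1 c1 0 0 0 - UT4 a2 b2 c2 0 0 0) - s * c1"
  "uz (UT4 a1 b1 c1 s 0 0 + UT4 a2 b2 c2 0 0 0 - UT4 a1 b1 c1 s 0 0 - UT4 a2 b2 c2 0 0 0) =
    uz (UT4 a1 b1 c1 0 0 0 + UT4 a2 b2 c2 0 0 0 - UT4 a1 b1 c1 0 0 0 - UT4 a2 b2 c2 0 0 0) + s * c2"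
  by (simp_all only: ut4_simps ut4.sel ut4_diff) (simp_all add: algebra_simps)

theorem contradiction: False
proof -
  obtain xs where xs: "distinct xs" "3 \<le> length xs" "set xs \<subseteq> V"
    and edges: "\<And>i. i < length xs \<Longrightarrow> {xs ! i, xs ! (Suc i mod length xs)} \<in> E"
    using cycle_exists by blast
  define m where "m = length xs"
  have m: "3 \<le> m" "xs \<noteq> []" using xs(2) by (auto simp: m_def)
  define e where "e i = [(xs ! i, True), (xs ! (Suc i mod m), False)]" for i
  have e0: "e i \<in> words0 V" if "i < m" for i
  proof -
    have "Suc i mod m < m" using m by simp
    then show ?thesis using that xs(3) by (auto simp: e_def words0_def m_def intro: nth_mem subsetD)
  qed
  note cyc = cycle_sums[where V = V and E = E and xs = xs, OF _ xs(3) m(2) edges, folded m_def, folded e_def]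
  define K where "K \<alpha> \<beta> = cross_sum (\<lambda>i. \<alpha> (e i)) (\<lambda>i. \<beta> (e i)) [0..<m]" for \<alpha> \<beta> :: "('v \<times> bool) list \<Rightarrow> rat"
  \<comment> \<open>The hypothesis makes the surface relator vanish in \<open>heis\<close>, so a
    homomorphism with these coordinates on generators exists. Uniqueness over the rationals
    identifies its first four coordinates on all words, and the cycle relations for exponents 1 and
    -1 apply.\<close>
  have K_br: "K \<alpha> \<beta> + K \<gamma> \<delta> = 0"
    if h: "word_hom V E \<alpha>" "word_hom V E \<beta>" "word_hom V E \<gamma>" "word_hom V E \<delta>"
      and z: "br \<alpha> \<beta> + br \<gamma> \<delta> = 0" for \<alpha> \<beta> \<gamma> \<delta>
  proof -
    let ?A = "\<lambda>i. Heis (\<alpha> (a i)) (\<beta> (a i)) (\<gamma> (a i)) (\<delta> (a i)) 0"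
    let ?B = "\<lambda>i. Heis (\<alpha> (b i)) (\<beta> (b i)) (\<gamma> (b i)) (\<delta> (b i)) 0"
    have "comm_sum ?A ?B g = 0"
      by (rule heis_eqI) (use z in \<open>simp_all add: comm_sum_heis br_def\<close>)
    from surface_modelD(4)[OF mh this] obtain f :: "_ \<Rightarrow> heis"
      where f: "word_hom V E f" "\<forall>i<g. f (a i) = ?A i \<and> f (b i) = ?B i" by blast
    note c = word_hom_heis_comps[OF f(1)]
    have comps: "h1 (f w) = \<alpha> w" "h2 (f w) = \<beta> w" "h3 (f w) = \<gamma> w" "h4 (f w) = \<delta> w" if "w \<in> words0 V" for w
      using rat_unique[OF c(1) h(1) _ _ that] rat_unique[OF c(2) h(2) _ _ that]
        rat_unique[OF c(3) h(3) _ _ that] rat_unique[OF c(4) h(4) _ _ that] f(2) by simp_all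
    let ?P = "\<lambda>i. f (e i)"
    have S: "(\<Sum>i\<leftarrow>[0..<m]. ?P i) = 0" "(\<Sum>i\<leftarrow>[0..<m]. - ?P i) = 0" using cyc(1,2)[OF f(1)] by simp_all
    have s: "(\<Sum>i\<leftarrow>[0..<m]. h1 (?P i)) = 0" "(\<Sum>i\<leftarrow>[0..<m]. h3 (?P i)) = 0"
      using heis_sum_list(1,3)[of ?P "[0..<m]"] S(1) by simp_all
    have "cross_sum (\<lambda>i. h1 (?P i)) (\<lambda>i. h2 (?P i)) [0..<m] + cross_sum (\<lambda>i. h3 (?P i)) (\<lambda>i. h4 (?P i)) [0..<m] = 0"
      using heis_sum_list_z[of ?P "[0..<m]"] S s by simp
    moreover have "cross_sum (\<lambda>i. h1 (?P i)) (\<lambda>i. h2 (?P i)) [0..<m] = K \<alpha> \<beta>"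
      "cross_sum (\<lambda>i. h3 (?P i)) (\<lambda>i. h4 (?P i)) [0..<m] = K \<gamma> \<delta>"
      unfolding K_def by (rule cross_sum_cong; simp add: comps e0)+
    ultimately show ?thesis by simp
  qed
  \<comment> \<open>\<open>A k\<close> and, below, \<open>B k\<close> are the classes dual to the
    words \<open>a k\<close> and \<open>b k\<close>.\<close>
  have "\<exists>A. \<forall>k. word_hom V E (A k) \<and> (\<forall>i<g. A k (a i) = (if i = k then 1 else 0 :: rat) \<and> A k (b i) = 0)"
    by (intro choice allI rat_ext)
  then obtain A :: "nat \<Rightarrow> _" where A: "\<And>k. word_hom V E (A k) \<and>
      (\<forall>i<g. A k (a i) = (if i = k then 1 else 0 :: rat) \<and> A k (b i) = 0)" by blast
  have "\<exists>B. \<forall>k. word_hom V E (B k) \<and> (\<forall>i<g. B k (a i) = 0 \<and> B k (b i) = (if i = k then 1 else 0 :: rat))"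
    by (intro choice allI rat_ext)
  then obtain B :: "nat \<Rightarrow> _" where B: "\<And>k. word_hom V E (B k) \<and>
      (\<forall>i<g. B k (a i) = 0 \<and> B k (b i) = (if i = k then 1 else 0 :: rat))" by blast
  have brAB: "br (A 0) (B 0) = 1" "br (A 1) (B 1) = 1" "br (A 0) (A 1) = 0" "br (A 0) (B 1) = 0" "br (B 0) (A 1) = 0"
  proof -
    have "br (A k) (B k) = (\<Sum>i<g. if i = k then 1 else 0)" for k
      unfolding br_def using A B by (intro sum.cong) auto
    then show "br (A 0) (B 0) = 1" "br (A 1) (B 1) = 1" using g by simp_all
    show "br (A 0) (A 1) = 0" "br (A 0) (B 1) = 0" "br (B 0) (A 1) = 0"
      unfolding br_def using A B by (auto intro!: sum.neutral)
  qed
  define \<mu> where "\<mu> = K (A 0) (B 0)"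
  have K: "K \<alpha> \<beta> = br \<alpha> \<beta> * \<mu>" if h: "word_hom V E \<alpha>" "word_hom V E \<beta>" for \<alpha> \<beta>
  proof -
    \<comment> \<open>With \<open>A 0\<close> scaled by this factor and paired with
      \<open>B 0\<close>, the two forms cancel on the relator. Hence \<open>K\<close> is the
      multiple \<mu> of \<open>br\<close>.\<close>
    let ?c = "- br \<alpha> \<beta>"
    have "br (\<lambda>w. c * A 0 w) (B 0) = c * br (A 0) (B 0)" for c
      unfolding br_def by (simp add: sum_distrib_left right_diff_distrib mult.assoc)
    from this[of ?c] have "K \<alpha> \<beta> + K (\<lambda>w. ?c * A 0 w) (B 0) = 0"
      using A B brAB(1) by (intro K_br h word_hom_scale) auto
    moreover have "K (\<lambda>w. ?c * A 0 w) (B 0) = ?c * \<mu>" unfolding K_def \<mu>_def by (rule cross_sum_scale)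
    ultimately show ?thesis by simp
  qed
  define wt :: "(nat \<Rightarrow> rat) \<Rightarrow> 'v \<Rightarrow> rat"
    where "wt c u = (if u \<in> set xs then c (THE i. i < m \<and> xs ! i = u) else 0)" for c u
  have wt: "wt c (xs ! i) = c i" if "i < m" for c i
  proof -
    have "(THE j. j < m \<and> xs ! j = xs ! i) = i"
      by (rule the_equality) (use that xs(1) in \<open>auto simp: m_def nth_eq_iff_index_eq\<close>)
    then show ?thesis using that by (simp add: wt_def m_def)
  qed
  have hwt: "word_hom V E (word_eval (wt c))" for c by (rule word_hom_eval) simp
  have ev: "word_eval (wt c) (e i) = c i - c (Suc i mod m)" if "i < m" for c i
    using wt[OF that] wt[of "Suc i mod m"] m by (simp add: e_def)
  have mu: "\<mu> \<noteq> 0"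
  proof -
    \<comment> \<open>Indicators of two consecutive vertices away from the start of the cycle;
      \<open>K\<close> is 1 on this pair, so it is not the zero form.\<close>
    let ?c1 = "\<lambda>i::nat. if i = 1 then 1 else 0 :: rat" and ?c2 = "\<lambda>i::nat. if i = 2 then 1 else 0 :: rat"
    have l: "[0..<m] = [0, 1, 2] @ [3..<m]"
      using m(1) by (simp add: upt_conv_Cons numeral_2_eq_2 numeral_3_eq_3)
    have "K (word_eval (wt ?c1)) (word_eval (wt ?c2)) =
        cross_sum (\<lambda>i. ?c1 i - ?c1 (Suc i mod m)) (\<lambda>i. ?c2 i - ?c2 (Suc i mod m)) [0..<m]"
      unfolding K_def by (rule cross_sum_cong) (simp_all add: ev)
    also have "\<dots> = 1"
    proof -
      have t: "?c1 i - ?c1 (Suc i mod m) = 0" "?c2 i - ?c2 (Suc i mod m) = 0" if "i \<in> set [3..<m]" for i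
        using that by (cases "Suc i = m"; auto)+
      have n: "Suc 0 mod m = 1" "Suc 1 mod m = 2" "Suc (Suc 0) mod m = 2" "Suc 2 mod m = (if m = 3 then 0 else 3)"
        "3 mod m = (if m = 3 then 0 else 3)" using m(1) by auto
      have z: "cross_sum (\<lambda>i. ?c1 i - ?c1 (Suc i mod m)) (\<lambda>i. ?c2 i - ?c2 (Suc i mod m)) [3..<m] = 0"
        by (rule cross_sum_zero) (simp_all only: t)
      have z': "(\<Sum>j\<leftarrow>[3..<m]. ?c1 j - ?c1 (Suc j mod m)) = 0"
        by (rule cross_sum_zero(2)[where B = "\<lambda>_. 0"]) (simp_all only: t)
      have z'': "(\<Sum>j\<leftarrow>[3..<m]. ?c2 j - ?c2 (Suc j mod m)) = 0"
        by (rule cross_sum_zero(2)[where B = "\<lambda>_. 0"]) (simp_all only: t)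
      show ?thesis
        unfolding l cross_sum.simps append.simps sum_list.Cons list.map z z' z'' by (simp add: n)
    qed
    finally have "br (word_eval (wt ?c1)) (word_eval (wt ?c2)) * \<mu> = 1" unfolding K[OF hwt hwt] .
    then show ?thesis by auto
  qed
  show False
  proof (cases "m = 3")
    case True
    have K3: "K \<alpha> \<beta> = \<alpha> (e 0) * \<beta> (e 1) - \<alpha> (e 1) * \<beta> (e 0)" if h: "word_hom V E \<alpha>" "word_hom V E \<beta>" for \<alpha> \<beta>
    proof -
      have l: "[0..<m] = [0, 1, 2]" using True by (simp add: upt_conv_Cons numeral_2_eq_2 numeral_3_eq_3)
      have e2: "\<alpha> (e 2) = - \<alpha> (e 0) - \<alpha> (e 1)" "\<beta> (e 2) = - \<beta> (e 0) - \<beta> (e 1)"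
        using cyc(1)[OF h(1)] cyc(1)[OF h(2)] by (simp_all add: l)
      show ?thesis
        unfolding K_def l cross_sum.simps list.map sum_list.Cons sum_list.Nil e2 by (simp add: algebra_simps)
    qed
    \<comment> \<open>The Pluecker expression vanishes for the decomposable form \<open>K\<close>,
      but on the four dual classes with indices 0 and 1, which exist as the genus is at least 2, it
      is the square of \<mu>.\<close>
    have "\<mu> * \<mu> = K (A 0) (B 0) * K (A 1) (B 1) - K (A 0) (A 1) * K (B 0) (B 1) + K (A 0) (B 1) * K (B 0) (A 1)"
      using K[of "A 1" "B 1"] K[of "A 0" "A 1"] K[of "A 0" "B 1"] A B brAB by (simp add: \<mu>_def)
    also have "\<dots> = 0" using A B by (simp add: K3 algebra_simps)
    finally show False using mu by simp
  next
    case False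
    then have m4: "4 \<le> m" using m(1) by simp
    have l: "[0..<m] = [0, 1, 2, 3] @ [4..<m]"
      using m4 by (simp add: upt_conv_Cons eval_nat_numeral)
    \<comment> \<open>A triple whose two consecutive products vanish on the cycle while its triple
      product does not. In the product of \<open>?c2\<close> with \<open>?c3\<close> the vertices 1
      and 3 on either side of 2 cancel; \<open>?c1\<close> and \<open>?c2\<close> share the vertex 3
      and no neighbouring pair.\<close>
    let ?c1 = "\<lambda>i::nat. if i = 3 then - 1 else 0 :: rat"
      and ?c2 = "\<lambda>i::nat. if i = 1 \<or> i = 3 then 1 else 0 :: rat"
      and ?c3 = "\<lambda>i::nat. if i = 2 then 1 else 0 :: rat"
    define \<alpha> where "\<alpha> = word_eval (wt ?c1)"
    define \<beta> where "\<beta> = word_eval (wt ?c2)"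
    define \<gamma> where "\<gamma> = word_eval (wt ?c3)"
    have h: "word_hom V E \<alpha>" "word_hom V E \<beta>" "word_hom V E \<gamma>" by (simp_all add: \<alpha>_def \<beta>_def \<gamma>_def hwt)
    have n: "Suc 0 mod m = 1" "Suc 1 mod m = 2" "Suc 2 mod m = 3" "Suc 3 mod m = (if m = 4 then 0 else 4)"
      "4 mod m = (if m = 4 then 0 else 4)" using m4 by auto
    have v: "\<alpha> (e 0) = 0" "\<alpha> (e 1) = 0" "\<alpha> (e 2) = 1" "\<alpha> (e 3) = - 1"
      "\<beta> (e 0) = - 1" "\<beta> (e 1) = 1" "\<beta> (e 2) = - 1" "\<beta> (e 3) = 1"
      "\<gamma> (e 0) = 0" "\<gamma> (e 1) = - 1" "\<gamma> (e 2) = 1" "\<gamma> (e 3) = 0"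
      unfolding \<alpha>_def \<beta>_def \<gamma>_def using m4 by (simp_all add: ev n)
    have t: "\<alpha> (e i) = 0" "\<beta> (e i) = 0" "\<gamma> (e i) = 0" if "i \<in> set [4..<m]" for i
      using that unfolding \<alpha>_def \<beta>_def \<gamma>_def by (cases "Suc i = m"; auto simp: ev)+
    have tz: "cross_sum (\<lambda>i. \<alpha> (e i)) (\<lambda>i. \<beta> (e i)) [4..<m] = 0" "cross_sum (\<lambda>i. \<beta> (e i)) (\<lambda>i. \<gamma> (e i)) [4..<m] = 0"
      by (rule cross_sum_zero; simp only: t)+
    have ts: "(\<Sum>j\<leftarrow>[4..<m]. \<alpha> (e j)) = 0" "(\<Sum>j\<leftarrow>[4..<m]. \<beta> (e j)) = 0" "(\<Sum>j\<leftarrow>[4..<m]. \<gamma> (e j)) = 0"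
      by (rule cross_sum_zero(2)[where B = "\<lambda>_. 0"]; simp only: t)+
    have "K \<alpha> \<beta> = 0" "K \<beta> \<gamma> = 0"
      unfolding K_def l cross_sum.simps append.simps list.map sum_list.Cons tz ts v by simp_all
    then have b0: "br \<alpha> \<beta> = 0" "br \<beta> \<gamma> = 0" using K[OF h(1,2)] K[OF h(2,3)] mu by simp_all
    define A0 where "A0 i = UT4 (\<alpha> (a i)) (\<beta> (a i)) (\<gamma> (a i)) 0 0 0" for i
    define B0 where "B0 i = UT4 (\<alpha> (b i)) (\<beta> (b i)) (\<gamma> (b i)) 0 0 0" for i
    define z where "z = uz (comm_sum A0 B0 g)"
    have "\<exists>k<g. \<gamma> (a k) \<noteq> 0 \<or> \<gamma> (b k) \<noteq> 0"
    proof (rule ccontr)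
      assume "\<not> ?thesis"
      then have n: "\<gamma> (a k) = 0" "\<gamma> (b k) = 0" if "k < g" for k using that by blast+
      have "1 < m" using m4 by simp
      have "\<gamma> (e 1) = 0"
        by (rule rat_unique[OF h(3) word_hom_zero _ _ e0[OF \<open>1 < m\<close>]]) (simp_all only: n)
      then show False unfolding v by simp
    qed
    then obtain k where k: "k < g" "\<gamma> (a k) \<noteq> 0 \<or> \<gamma> (b k) \<noteq> 0" by blast
    \<comment> \<open>The corner entry \<open>z\<close> of the relator is removed by altering the
      \<open>ux\<close> entry of one generator. By \<open>uz_commutator_shift\<close> this changes
      the corner entry by a multiple of a value of \<open>\<gamma>\<close>, and one such value is
      nonzero.\<close>
    define s where "s = (if \<gamma> (a k) \<noteq> 0 then z / \<gamma> (a k) else 0)"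
    define s' where "s' = (if \<gamma> (a k) \<noteq> 0 then 0 else - z / \<gamma> (b k))"
    define A1 where "A1 i = UT4 (\<alpha> (a i)) (\<beta> (a i)) (\<gamma> (a i)) (if i = k then s' else 0) 0 0" for i
    define B1 where "B1 i = UT4 (\<alpha> (b i)) (\<beta> (b i)) (\<gamma> (b i)) (if i = k then s else 0) 0 0" for i
    have "comm_sum A1 B1 g = 0"
    proof (rule ut4_eqI)
      have "uz (comm_sum A1 B1 g) = (\<Sum>i<g. uz (A0 i + B0 i - A0 i - B0 i) + (if i = k then - z else 0))"
        unfolding comm_sum_ut4
      proof (rule sum.cong[OF HOL.refl])
        fix i
        show "uz (A1 i + B1 i - A1 i - B1 i) = uz (A0 i + B0 i - A0 i - B0 i) + (if i = k then - z else 0)"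
        proof (cases "i = k")
          case True
          show ?thesis
          proof (cases "\<gamma> (a k) \<noteq> 0")
            case t: True
            then have s: "s = z / \<gamma> (a k)" "s' = 0" by (simp_all only: s_def s'_def if_True not_False_eq_True)
            have "s * \<gamma> (a k) = z" using t by (simp only: s nonzero_eq_divide_eq) simp
            then show ?thesis
              unfolding True A1_def B1_def A0_def B0_def s(2) by (simp only: if_True if_cancel) (subst uz_commutator_shift(1), simp)
          next
            case f: False
            then have s: "s = 0" "s' = - z / \<gamma> (b k)" by (simp_all only: s_def s'_def if_False)
            have "s' * \<gamma> (b k) = - z" using f k(2) by (simp only: s) simp
            then show ?thesis
              unfolding True A1_def B1_def A0_def B0_def s(1) by (simp only: if_True if_cancel) (subst uz_commutator_shift(2), simp)
          qed
        qed (simp add: A1_def B1_def A0_def B0_def)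
      qed
      also have "\<dots> = z + (\<Sum>i<g. if i = k then - z else 0)"
        unfolding z_def comm_sum_ut4 by (simp only: sum.distrib)
      also have "\<dots> = 0" using k(1) by simp
      finally show "uz (comm_sum A1 B1 g) = uz 0" by simp
    qed (use b0 in \<open>simp_all add: comm_sum_ut4 br_def A1_def B1_def\<close>)
    from surface_modelD(4)[OF mu_ut this] obtain f :: "_ \<Rightarrow> ut4"
      where f: "word_hom V E f" "\<forall>i<g. f (a i) = A1 i \<and> f (b i) = B1 i" by blast
    note c = word_hom_ut4_comps[OF f(1)]
    have comps: "ua (f w) = \<alpha> w" "ub (f w) = \<beta> w" "uc (f w) = \<gamma> w" if "w \<in> words0 V" for w
      using rat_unique[OF c(1) h(1) _ _ that] rat_unique[OF c(2) h(2) _ _ that] rat_unique[OF c(3) h(3) _ _ that]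
        f(2) by (simp_all add: A1_def B1_def)
    define P where "P i = f (e i)" for i
    have i4: "0 < m" "1 < m" "2 < m" "3 < m" using m4 by auto
    have cP: "ua (P 0) = 0" "ua (P 1) = 0" "ua (P 2) = 1" "ua (P 3) = - 1"
      "ub (P 0) = - 1" "ub (P 1) = 1" "ub (P 2) = - 1" "ub (P 3) = 1"
      "uc (P 0) = 0" "uc (P 1) = - 1" "uc (P 2) = 1" "uc (P 3) = 0"
      unfolding P_def by (simp_all only: comps e0 i4 v)
    have tP: "\<forall>i\<in>set [4..<m]. ua (P i) = 0 \<and> ub (P i) = 0 \<and> uc (P i) = 0"
      using t by (simp add: P_def comps e0)
    note L2 = ut4_level2[where js = "[4..<m]", OF tP]
    let ?T = "\<Sum>i\<leftarrow>[4..<m]. P i" and ?T' = "\<Sum>i\<leftarrow>[4..<m]. - P i" and ?T'' = "\<Sum>i\<leftarrow>[4..<m]. P i + P i"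
    have "(\<Sum>i\<leftarrow>[0..<m]. P i) = 0" "(\<Sum>i\<leftarrow>[0..<m]. - P i) = 0" "(\<Sum>i\<leftarrow>[0..<m]. P i + P i) = 0"
      using cyc[OF f(1)] by (simp_all add: P_def)
    then have S: "P 0 + (P 1 + (P 2 + (P 3 + ?T))) = 0" "- P 0 + (- P 1 + (- P 2 + (- P 3 + ?T'))) = 0"
      "(P 0 + P 0) + ((P 1 + P 1) + ((P 2 + P 2) + ((P 3 + P 3) + ?T''))) = 0"
      unfolding l map_append sum_list_append list.map sum_list.Cons sum_list.Nil add_0_left add.assoc by (simp_all only:)
    have "ux (P 0 + (P 1 + (P 2 + (P 3 + ?T)))) = 0" "uy (P 0 + (P 1 + (P 2 + (P 3 + ?T)))) = 0"
      "uz (P 0 + (P 1 + (P 2 + (P 3 + ?T)))) = 0" unfolding S(1) by simp_all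
    note E1 = this[unfolded ut4_simps cP L2]
    have "ux (- P 0 + (- P 1 + (- P 2 + (- P 3 + ?T')))) = 0" "uy (- P 0 + (- P 1 + (- P 2 + (- P 3 + ?T')))) = 0"
      "uz (- P 0 + (- P 1 + (- P 2 + (- P 3 + ?T')))) = 0" unfolding S(2) by simp_all
    note E2 = this[unfolded ut4_simps cP L2]
    have "ux ((P 0 + P 0) + ((P 1 + P 1) + ((P 2 + P 2) + ((P 3 + P 3) + ?T'')))) = 0"
      "uy ((P 0 + P 0) + ((P 1 + P 1) + ((P 2 + P 2) + ((P 3 + P 3) + ?T'')))) = 0"
      "uz ((P 0 + P 0) + ((P 1 + P 1) + ((P 2 + P 2) + ((P 3 + P 3) + ?T'')))) = 0" unfolding S(3) by simp_all
    note E3 = this[unfolded ut4_simps cP L2]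
    \<comment> \<open>The entries next to the diagonal are known, so all nine equations are linear
      in the remaining entries of the \<open>P i\<close> and of the tail. Together they are
      inconsistent.\<close>
    show False using E1 E2 E3 by (simp add: algebra_simps)
  qed
qed

end

section \<open>Surface groups are not Bestvina-Brady groups\<close>

lemmas group_word_simps = diff_conv_add_uminus minus_add minus_minus add.assoc add_minus_cancel
  minus_add_cancel left_minus right_minus add_0_left add_0_right minus_zero

text \<open>Take the increments along the first two sides of a block as generators. The gluing
  conditions then determine the two other sides, and running around the block adds the
  commutator.\<close>

lemma surface_labels_step:
  fixes u :: "nat \<Rightarrow> 'n::group_add"
  assumes u: "surface_labels g u" and i: "i < g"
  shows "u (4 * i + 3) = u (4 * i + 2) - u (4 * i + 1) + u (4 * i)"
    and "u (4 * i + 4) = u (4 * i) + ((- u (4 * i) + u (4 * i + 1)) + (- u (4 * i + 1) + u (4 * i + 2))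
      - (- u (4 * i) + u (4 * i + 1)) - (- u (4 * i + 1) + u (4 * i + 2)))"
proof -
  have l: "4 * i < 4 * g" "4 * i + 1 < 4 * g" using i by auto
  have L: "u j - u (Suc (partner j)) = u (Suc j) - u (partner j)" if "j < 4 * g" for j
    using u that by (simp add: surface_labels_def)
  have s: "Suc (4 * i + 2) = 4 * i + 3" "Suc (4 * i) = 4 * i + 1" "Suc (4 * i + 3) = 4 * i + 4"
    "Suc (4 * i + 1) = 4 * i + 2" by simp_all
  have 1: "u (4 * i) - u (4 * i + 3) = u (4 * i + 1) - u (4 * i + 2)"
    using L[OF l(1)] unfolding partner_simps s .
  have 2: "u (4 * i + 1) - u (4 * i + 4) = u (4 * i + 2) - u (4 * i + 3)"
    using L[OF l(2)] unfolding partner_simps s .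
  have r: "z = (d - c) + x" if "x - z = c - d" for x z c d :: 'n
  proof -
    have "- (x - z) = - (c - d)" by (rule arg_cong[OF that])
    then have "z - x = d - c" by (simp only: minus_diff_eq)
    then have "z - x + x = (d - c) + x" by (rule arg_cong)
    then show ?thesis by (simp only: diff_add_cancel)
  qed
  show 3: "u (4 * i + 3) = u (4 * i + 2) - u (4 * i + 1) + u (4 * i)" by (rule r[OF 1])
  show "u (4 * i + 4) = u (4 * i) + ((- u (4 * i) + u (4 * i + 1)) + (- u (4 * i + 1) + u (4 * i + 2))
      - (- u (4 * i) + u (4 * i + 1)) - (- u (4 * i + 1) + u (4 * i + 2)))"
    unfolding r[OF 2] 3 by (simp only: group_word_simps)
qed

lemma surface_labels_comm_sum:
  assumes u: "surface_labels g u" and "i \<le> g"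
  shows "u (4 * i) = comm_sum (\<lambda>i. - u (4 * i) + u (4 * i + 1)) (\<lambda>i. - u (4 * i + 1) + u (4 * i + 2)) i"
  using assms(2)
proof (induction i)
  case 0
  then show ?case using u by (simp add: surface_labels_def)
next
  case (Suc i)
  have e: "4 * Suc i = 4 * i + 4" by simp
  have IH: "u (4 * i) = comm_sum (\<lambda>i. - u (4 * i) + u (4 * i + 1)) (\<lambda>i. - u (4 * i + 1) + u (4 * i + 2)) i"
    using Suc by simp
  show ?case
    unfolding e comm_sum.simps IH[symmetric] by (rule surface_labels_step(2)[OF u]) (use Suc in simp)
qed

lemma comm_sum_cong:
  "(\<And>i. i < n \<Longrightarrow> A i = A' i) \<Longrightarrow> (\<And>i. i < n \<Longrightarrow> B i = B' i) \<Longrightarrow> comm_sum A B n = comm_sum A' B' n"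
  by (induction n) simp_all

lemma surface_labels_unique:
  fixes u u' :: "nat \<Rightarrow> 'n::group_add"
  assumes u: "surface_labels g u" "surface_labels g u'"
    and a: "\<And>i. i < g \<Longrightarrow> - u (4 * i) + u (4 * i + 1) = - u' (4 * i) + u' (4 * i + 1)"
    and b: "\<And>i. i < g \<Longrightarrow> - u (4 * i + 1) + u (4 * i + 2) = - u' (4 * i + 1) + u' (4 * i + 2)"
    and j: "j < 4 * g"
  shows "u j = u' j"
proof -
  have u0: "u (4 * i) = u' (4 * i)" if "i \<le> g" for i
    unfolding surface_labels_comm_sum[OF u(1) that] surface_labels_comm_sum[OF u(2) that]
    by (rule comm_sum_cong) (use a b that in auto)
  have u1: "u (4 * i + 1) = u' (4 * i + 1)" if "i < g" for i
    using a[OF that] u0[of i] that by simp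
  have u2: "u (4 * i + 2) = u' (4 * i + 2)" if "i < g" for i
    using b[OF that] u1[OF that] by simp
  show ?thesis
  proof (cases j rule: mod4_cases)
    case (1 i)
    then have "i \<le> g" using j by simp
    then show ?thesis unfolding 1 by (rule u0)
  next
    case (2 i)
    then have "i < g" using j by simp
    then show ?thesis unfolding 2 by (rule u1)
  next
    case (3 i)
    then have "i < g" using j by simp
    then show ?thesis unfolding 3 by (rule u2)
  next
    case (4 i)
    then have i: "i < g" using j by simp
    then have "i \<le> g" by simp
    note e = u0[OF this] u1[OF i]
      u2[OF i]
    show ?thesis
      unfolding 4 surface_labels_step(1)[OF u(1) i] surface_labels_step(1)[OF u(2) i] e by (rule HOL.refl)
  qed
qed

lemma surface_labels_exist:
  fixes A B :: "nat \<Rightarrow> 'n::group_add"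
  assumes z: "comm_sum A B g = 0"
  shows "\<exists>u. surface_labels g u \<and> (\<forall>i<g. - u (4 * i) + u (4 * i + 1) = A i \<and> - u (4 * i + 1) + u (4 * i + 2) = B i)"
proof -
  \<comment> \<open>The partial products of the boundary word up to corner \<open>j\<close>.\<close>
  define u where "u j = comm_sum A B (j div 4) + (if j mod 4 = 0 then 0 else if j mod 4 = 1 then A (j div 4)
     else if j mod 4 = 2 then A (j div 4) + B (j div 4) else A (j div 4) + B (j div 4) - A (j div 4))" for j
  have m: "(4 * i + r) mod 4 = r" "(4 * i + r) div 4 = i" if "r < 4" for i r :: nat using that by simp_all
  have u0: "u (4 * i) = comm_sum A B i" for i unfolding u_def using m[of 0 i] by simp
  have u1: "u (4 * i + 1) = comm_sum A B i + A i" for i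
    unfolding u_def using m[of 1 i] by simp
  have u2: "u (4 * i + 2) = comm_sum A B i + (A i + B i)" for i
    unfolding u_def using m[of 2 i] by simp
  have u3: "u (4 * i + 3) = comm_sum A B i + (A i + B i - A i)" for i
    unfolding u_def using m[of 3 i] by simp
  have u4: "u (4 * i + 4) = comm_sum A B i + (A i + B i - A i - B i)" for i
    using u0[of "Suc i"] by (simp add: add.commute)
  have s: "Suc (4 * i + 2) = 4 * i + 3" "Suc (4 * i) = 4 * i + 1" "Suc (4 * i + 3) = 4 * i + 4"
    "Suc (4 * i + 1) = 4 * i + 2" for i by simp_all
  have "u j - u (Suc (partner j)) = u (Suc j) - u (partner j)" if "j < 4 * g" for j
  proof (cases j rule: mod4_cases)
    case (1 i)
    show ?thesis unfolding 1 partner_simps s u0 u1 u2 u3 by (simp only: group_word_simps)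
  next
    case (2 i)
    show ?thesis unfolding 2 partner_simps s u0 u1 u2 u3 u4 by (simp only: group_word_simps)
  next
    case (3 i)
    show ?thesis unfolding 3 partner_simps s u0 u1 u2 u3 by (simp only: group_word_simps)
  next
    case (4 i)
    show ?thesis unfolding 4 partner_simps s u0 u1 u2 u3 u4 by (simp only: group_word_simps)
  qed
  moreover have "u 0 = 0" "u (4 * g) = 0" using u0[of 0] u0[of g] z by simp_all
  ultimately have "surface_labels g u" unfolding surface_labels_def by blast
  moreover have "- u (4 * i) + u (4 * i + 1) = A i" "- u (4 * i + 1) + u (4 * i + 2) = B i" for i
    unfolding u0 u1 u2 by (simp_all only: group_word_simps)
  ultimately show ?thesis by blast
qed

section \<open>Group structure on classes of words and of loops\<close>

lemma word_class_eq:
  assumes "u \<in> lists (X \<times> UNIV)"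
  shows "word_class X R u = word_class X R v \<longleftrightarrow> word_eq X R u v"
proof
  assume "word_class X R u = word_class X R v"
  then have "u \<in> word_class X R v" using word_eq.intros(1)[OF assms] by (auto simp: word_class_def)
  then show "word_eq X R u v" by (auto simp: word_class_def intro: word_eq.intros(2))
next
  assume "word_eq X R u v"
  then show "word_class X R u = word_class X R v"
    unfolding word_class_def by (blast intro: word_eq.intros(2,3))
qed

lemma word_eq_append2:
  assumes "word_eq X R u u'" "word_eq X R v v'"
  shows "word_eq X R (u @ v) (u' @ v')"
proof -
  note L = word_eq_lists[OF assms(1)] word_eq_lists[OF assms(2)]
  have "word_eq X R ([] @ u @ v) ([] @ u' @ v)" using L by (intro word_eq_append assms) auto
  moreover have "word_eq X R (u' @ v @ []) (u' @ v' @ [])" using L by (intro word_eq_append assms) auto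
  ultimately show ?thesis using word_eq.intros(3) by fastforce
qed

lemma presented_group_mult:
  assumes "u \<in> lists (X \<times> UNIV)" "v \<in> lists (X \<times> UNIV)"
  shows "word_class X R u \<otimes>\<^bsub>presented_group X R\<^esub> word_class X R v = word_class X R (u @ v)"
proof -
  have "word_class X R u \<otimes>\<^bsub>presented_group X R\<^esub> word_class X R v =
      {w. \<exists>u'. word_eq X R u u' \<and> (\<exists>v'. word_eq X R v v' \<and> word_eq X R (u' @ v') w)}"
    by (auto simp: presented_group_def word_class_def)
  also have "\<dots> = {w. word_eq X R (u @ v) w}"
    using word_eq.intros(1)[OF assms(1), of R] word_eq.intros(1)[OF assms(2), of R] word_eq_append2
    by (blast intro: word_eq.intros(3))
  finally show ?thesis by (simp add: word_class_def)
qed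

text \<open>The chosen homomorphism is prescribed on generators only; additivity fixes it on inverse
  letters and then on all words.\<close>

lemma bb_hom_class:
  assumes "w \<in> lists (V \<times> UNIV)"
  shows "bb_hom V E (word_class V (raag_relators E) w) = exponent_sum w"
proof -
  let ?h = "bb_hom V E" and ?c = "word_class V (raag_relators E)"
  have add: "?h (?c (u @ v)) = ?h (?c u) + ?h (?c v)" if "u \<in> lists (V \<times> UNIV)" "v \<in> lists (V \<times> UNIV)" for u v
  proof -
    have "?c u \<in> carrier (raag V E)" "?c v \<in> carrier (raag V E)"
      using that by (auto simp: raag_def presented_group_def)
    then have "?h (?c u \<otimes>\<^bsub>raag V E\<^esub> ?c v) = ?h (?c u) \<otimes>\<^bsub>integer_group\<^esub> ?h (?c v)"
      using bb_hom(1)[of V E] by (simp add: hom_def)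
    then show ?thesis unfolding raag_def presented_group_mult[OF that] by (simp add: integer_group_def)
  qed
  have nil: "?h (?c []) = 0" using add[of "[]" "[]"] by simp
  have one: "?h (?c [(v, b)]) = (if b then 1 else - 1)" if v: "v \<in> V" for v b
  proof (cases b)
    case True
    then show ?thesis using bb_hom(2)[OF v] by simp
  next
    case False
    have "word_eq V (raag_relators E) ([] @ [(v, True), (v, \<not> True)] @ []) ([] @ [])"
      by (rule word_eq.intros(4)) (use v in auto)
    then have "?c ([(v, True)] @ [(v, False)]) = ?c []"
      using v by (subst word_class_eq) auto
    then have "?h (?c [(v, True)]) + ?h (?c [(v, False)]) = 0"
      using add[of "[(v, True)]" "[(v, False)]"] v nil by simp
    then show ?thesis using bb_hom(2)[OF v, of E] False by simp
  qed
  show ?thesis using assms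
  proof (induction w rule: list.induct)
    case (Cons l w)
    obtain v b where l: "l = (v, b)" by (cases l)
    have v: "v \<in> V" "w \<in> lists (V \<times> UNIV)" using Cons.prems l by (simp_all del: in_lists_conv_set)
    then show ?case using add[of "[l]" w] one[OF v(1), of b] Cons l by simp
  qed (use nil in simp)
qed

lemma bb_group_carrier: "carrier (bb_group V E) = word_class V (raag_relators E) ` words0 V"
proof -
  have "carrier (bb_group V E) = {x \<in> word_class V (raag_relators E) ` lists (V \<times> UNIV). bb_hom V E x = 0}"
    by (simp add: bb_group_def kernel_def raag_def presented_group_def integer_group_def)
  also have "\<dots> = word_class V (raag_relators E) ` {w \<in> lists (V \<times> UNIV). bb_hom V E (word_class V (raag_relators E) w) = 0}"
    by (rule Compr_image_eq)
  also have "{w \<in> lists (V \<times> UNIV). bb_hom V E (word_class V (raag_relators E) w) = 0} = words0 V"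
    unfolding words0_def by (rule Collect_cong, rule conj_cong[OF HOL.refl], subst bb_hom_class) (rule TrueI | simp only:)+
  finally show ?thesis .
qed

lemma bb_group_mult:
  "u \<in> words0 V \<Longrightarrow> v \<in> words0 V \<Longrightarrow> word_class V (raag_relators E) u \<otimes>\<^bsub>bb_group V E\<^esub> word_class V (raag_relators E) v =
    word_class V (raag_relators E) (u @ v)"
  using presented_group_mult[of u V v "raag_relators E"] by (simp add: bb_group_def raag_def words0_def)

lemma loop_class_eq:
  assumes "p \<in> loops S x" "p' \<in> loops S x"
  shows "loop_class S x p = loop_class S x p' \<longleftrightarrow> path_htpy S p p'"
proof
  assume e: "loop_class S x p = loop_class S x p'"
  have "p' \<in> loop_class S x p'"
    using assms path_htpy_refl by (auto simp: loop_class_def loops_def loop_homotopic_iff_path_htpy)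
  with e show "path_htpy S p p'"
    using assms by (auto simp: loop_class_def loops_def loop_homotopic_iff_path_htpy)
next
  assume "path_htpy S p p'"
  then show "loop_class S x p = loop_class S x p'"
    using assms by (auto simp: loop_class_def loops_def loop_homotopic_iff_path_htpy
      intro: path_htpy_trans path_htpy_sym)
qed

lemma loops_join: "p \<in> loops S x \<Longrightarrow> p' \<in> loops S x \<Longrightarrow> loop_join p p' \<in> loops S x"
  by (auto simp: loops_def intro: pathin_loop_join)

lemma loops_htpy: "p \<in> loops S x \<Longrightarrow> path_htpy S p p' \<Longrightarrow> p' \<in> loops S x"
  using path_htpy_ends[of S p p'] by (auto simp: loops_def)

lemma fundamental_group_mult:
  assumes p: "p \<in> loops S x" "p' \<in> loops S x"
  shows "loop_class S x p \<otimes>\<^bsub>fundamental_group S x\<^esub> loop_class S x p' = loop_class S x (loop_join p p')"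
proof -
  have h: "loop_homotopic S x r r' \<longleftrightarrow> path_htpy S r r'" if "r \<in> loops S x" for r r'
    using that by (auto simp: loops_def loop_homotopic_iff_path_htpy)
  have "r \<in> loop_class S x p \<otimes>\<^bsub>fundamental_group S x\<^esub> loop_class S x p' \<longleftrightarrow> path_htpy S (loop_join p p') r" for r
  proof
    assume "r \<in> loop_class S x p \<otimes>\<^bsub>fundamental_group S x\<^esub> loop_class S x p'"
    then obtain s s' where s: "path_htpy S p s" "path_htpy S p' s'" "loop_homotopic S x (loop_join s s') r"
      by (auto simp: fundamental_group_def loop_class_def h[OF p(1)] h[OF p(2)])
    have "path_htpy S (loop_join s s') r"
      using s(3) h[OF loops_join[OF loops_htpy[OF p(1) s(1)] loops_htpy[OF p(2) s(2)]]] by simp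
    moreover have "path_htpy S (loop_join p p') (loop_join s s')"
      using s p by (intro path_htpy_join) (auto simp: loops_def)
    ultimately show "path_htpy S (loop_join p p') r" by (blast intro: path_htpy_trans)
  next
    assume "path_htpy S (loop_join p p') r"
    then have "loop_homotopic S x (loop_join p p') r" using h[OF loops_join[OF p]] by simp
    moreover have "loop_homotopic S x p p" "loop_homotopic S x p' p'"
      using h p path_htpy_refl by (auto simp: loops_def)
    ultimately show "r \<in> loop_class S x p \<otimes>\<^bsub>fundamental_group S x\<^esub> loop_class S x p'"
      by (auto simp: fundamental_group_def loop_class_def)
  qed
  then show ?thesis using h[OF loops_join[OF p]] by (auto simp: loop_class_def)
qed

section \<open>Transport along an isomorphism\<close>

locale surface_iso = surface g S q
  for g :: nat and S :: "'a topology" and q :: "complex \<Rightarrow> 'a" +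
  fixes d :: complex and V :: "'v set" and E :: "'v set set" and \<theta> :: "(real \<Rightarrow> 'a) set \<Rightarrow> ('v \<times> bool) list set"
  assumes d: "d \<in> cball 0 1" and theta: "\<theta> \<in> iso (fundamental_group S (q d)) (bb_group V E)"
begin

definition word_of :: "(real \<Rightarrow> 'a) \<Rightarrow> ('v \<times> bool) list"
  where "word_of p = (SOME w. w \<in> words0 V \<and> \<theta> (loop_class S (q d) p) = word_class V (raag_relators E) w)"

definition loop_of :: "('v \<times> bool) list \<Rightarrow> real \<Rightarrow> 'a"
  where "loop_of w = (SOME p. p \<in> loops S (q d) \<and> \<theta> (loop_class S (q d) p) = word_class V (raag_relators E) w)"

lemma theta_bij: "bij_betw \<theta> (loop_class S (q d) ` loops S (q d)) (word_class V (raag_relators E) ` words0 V)"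
  using theta by (simp add: iso_def bb_group_carrier fundamental_group_def)

lemma word_of:
  assumes "p \<in> loops S (q d)"
  shows "word_of p \<in> words0 V" "\<theta> (loop_class S (q d) p) = word_class V (raag_relators E) (word_of p)"
proof -
  have "\<theta> (loop_class S (q d) p) \<in> word_class V (raag_relators E) ` words0 V"
    using theta_bij assms unfolding bij_betw_def by blast
  then have "\<exists>w. w \<in> words0 V \<and> \<theta> (loop_class S (q d) p) = word_class V (raag_relators E) w" by blast
  from someI_ex[OF this] show "word_of p \<in> words0 V"
    "\<theta> (loop_class S (q d) p) = word_class V (raag_relators E) (word_of p)"
    unfolding word_of_def by blast+
qed

lemma loop_of:
  assumes "w \<in> words0 V"
  shows "loop_of w \<in> loops S (q d)" "\<theta> (loop_class S (q d) (loop_of w)) = word_class V (raag_relators E) w"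
proof -
  have "word_class V (raag_relators E) w \<in> \<theta> ` loop_class S (q d) ` loops S (q d)"
    using theta_bij assms unfolding bij_betw_def by blast
  then have "\<exists>p. p \<in> loops S (q d) \<and> \<theta> (loop_class S (q d) p) = word_class V (raag_relators E) w" by auto
  from someI_ex[OF this] show "loop_of w \<in> loops S (q d)"
    "\<theta> (loop_class S (q d) (loop_of w)) = word_class V (raag_relators E) w"
    unfolding loop_of_def by blast+
qed

lemma theta_join:
  assumes p: "p \<in> loops S (q d)" "p' \<in> loops S (q d)"
  shows "\<theta> (loop_class S (q d) (loop_join p p')) = word_class V (raag_relators E) (word_of p @ word_of p')"
proof -
  have "loop_class S (q d) r \<in> carrier (fundamental_group S (q d))" if "r \<in> loops S (q d)" for r
    using that by (simp add: fundamental_group_def)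
  then have "\<theta> (loop_class S (q d) p \<otimes>\<^bsub>fundamental_group S (q d)\<^esub> loop_class S (q d) p') =
      \<theta> (loop_class S (q d) p) \<otimes>\<^bsub>bb_group V E\<^esub> \<theta> (loop_class S (q d) p')"
    using theta p by (simp add: iso_def hom_def)
  then show ?thesis
    unfolding fundamental_group_mult[OF p] word_of(2)[OF p(1)] word_of(2)[OF p(2)]
      bb_group_mult[OF word_of(1)[OF p(1)] word_of(1)[OF p(2)]] .
qed

lemma words0_lists: "w \<in> words0 V \<Longrightarrow> w \<in> lists (V \<times> UNIV)"
  by (simp add: words0_def)

lemma word_hom_word_of:
  assumes f: "word_hom V E f" shows "loop_hom S (q d) (\<lambda>p. f (word_of p))"
  unfolding loop_hom_def
proof (intro conjI ballI allI impI)
  fix p p' assume p: "p \<in> loops S (q d)" "p' \<in> loops S (q d)"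
  have w: "word_of p @ word_of p' \<in> words0 V" using word_of(1)[OF p(1)] word_of(1)[OF p(2)] by (rule words0_closed)
  have "word_class V (raag_relators E) (word_of p @ word_of p') = word_class V (raag_relators E) (word_of (loop_join p p'))"
    using theta_join[OF p] word_of(2)[OF loops_join[OF p]] by simp
  then have "word_eq V (raag_relators E) (word_of p @ word_of p') (word_of (loop_join p p'))"
    using word_class_eq[OF words0_lists[OF w]] by blast
  then have "f (word_of p @ word_of p') = f (word_of (loop_join p p'))" by (rule word_homD(2)[OF f w])
  then show "f (word_of (loop_join p p')) = f (word_of p) + f (word_of p')"
    unfolding word_homD(1)[OF f word_of(1)[OF p(1)] word_of(1)[OF p(2)]] by (rule HOL.sym)
next
  fix p p' assume p: "p \<in> loops S (q d)" "path_htpy S p p'"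
  have p': "p' \<in> loops S (q d)" using p by (rule loops_htpy)
  have "loop_class S (q d) p = loop_class S (q d) p'" using loop_class_eq[OF p(1) p'] p(2) by blast
  then have "word_class V (raag_relators E) (word_of p) = word_class V (raag_relators E) (word_of p')"
    using word_of(2)[OF p(1)] word_of(2)[OF p'] by simp
  then have "word_eq V (raag_relators E) (word_of p) (word_of p')"
    using word_class_eq[OF words0_lists[OF word_of(1)[OF p(1)]]] by blast
  then show "f (word_of p) = f (word_of p')" by (rule word_homD(2)[OF f word_of(1)[OF p(1)]])
qed

lemma theta_inj:
  assumes "p \<in> loops S (q d)" "p' \<in> loops S (q d)" "\<theta> (loop_class S (q d) p) = \<theta> (loop_class S (q d) p')"
  shows "path_htpy S p p'"
proof -
  have "inj_on \<theta> (loop_class S (q d) ` loops S (q d))" using theta_bij by (simp add: bij_betw_def)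
  then have "loop_class S (q d) p = loop_class S (q d) p'"
    using assms by (meson imageI inj_onD)
  then show ?thesis by (rule loop_class_eq[OF assms(1,2), THEN iffD1])
qed

lemma word_of_loop_of:
  assumes "w \<in> words0 V" shows "word_eq V (raag_relators E) w (word_of (loop_of w))"
  using loop_of[OF assms] word_of[OF loop_of(1)[OF assms]] word_class_eq[OF words0_lists[OF assms]] by metis

lemma loop_hom_loop_of:
  assumes f: "loop_hom S (q d) f" shows "word_hom V E (\<lambda>w. f (loop_of w))"
  unfolding word_hom_def
proof (intro conjI ballI allI impI)
  fix u v assume w: "u \<in> words0 V" "v \<in> words0 V"
  note L = loop_of[OF w(1)] loop_of[OF w(2)]
  have "word_eq V (raag_relators E) (u @ v) (word_of (loop_of u) @ word_of (loop_of v))"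
    by (rule word_eq_append2[OF word_of_loop_of[OF w(1)] word_of_loop_of[OF w(2)]])
  then have "\<theta> (loop_class S (q d) (loop_of (u @ v))) = \<theta> (loop_class S (q d) (loop_join (loop_of u) (loop_of v)))"
    unfolding theta_join[OF L(1,3)] loop_of(2)[OF words0_closed(2)[OF w]]
    using word_class_eq[OF words0_lists[OF words0_closed(2)[OF w]]] by blast
  then have "path_htpy S (loop_of (u @ v)) (loop_join (loop_of u) (loop_of v))"
    by (rule theta_inj[OF loop_of(1)[OF words0_closed(2)[OF w]] loops_join[OF L(1,3)]])
  then have "f (loop_of (u @ v)) = f (loop_join (loop_of u) (loop_of v))"
    using f loop_of(1)[OF words0_closed(2)[OF w]] unfolding loop_hom_def by blast
  also have "\<dots> = f (loop_of u) + f (loop_of v)" using f L(1,3) unfolding loop_hom_def by blast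
  finally show "f (loop_of (u @ v)) = f (loop_of u) + f (loop_of v)" .
next
  fix u v assume w: "u \<in> words0 V" "word_eq V (raag_relators E) u v"
  have c: "word_class V (raag_relators E) u = word_class V (raag_relators E) v"
    using word_class_eq[OF words0_lists[OF w(1)]] w(2) by blast
  then have "loop_of u = loop_of v" by (simp only: loop_of_def)
  then show "f (loop_of u) = f (loop_of v)" by simp
qed

text \<open>The increment between the corner loops at the two ends of side \<open>4 * i\<close>: the
  standard generator belonging to that side.\<close>

definition a_word :: "nat \<Rightarrow> ('v \<times> bool) list"
  where "a_word i = word_inv (word_of (corner_loop d (4 * i))) @ word_of (corner_loop d (4 * i + 1))"

definition b_word :: "nat \<Rightarrow> ('v \<times> bool) list"
  where "b_word i = word_inv (word_of (corner_loop d (4 * i + 1))) @ word_of (corner_loop d (4 * i + 2))"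

lemma corner_word: "j \<le> 4 * g \<Longrightarrow> word_of (corner_loop d j) \<in> words0 V"
  by (intro word_of(1) corner_loop_in d)

lemma ab_word:
  assumes i: "i < g"
  shows "a_word i \<in> words0 V" "b_word i \<in> words0 V"
    and "word_hom V E f \<Longrightarrow> f (a_word i) = - f (word_of (corner_loop d (4 * i))) + f (word_of (corner_loop d (4 * i + 1)))"
    and "word_hom V E f \<Longrightarrow> f (b_word i) = - f (word_of (corner_loop d (4 * i + 1))) + f (word_of (corner_loop d (4 * i + 2)))"
proof -
  have w: "word_of (corner_loop d (4 * i)) \<in> words0 V" "word_of (corner_loop d (4 * i + 1)) \<in> words0 V"
    "word_of (corner_loop d (4 * i + 2)) \<in> words0 V" by (rule corner_word; use i in simp)+
  show "a_word i \<in> words0 V" "b_word i \<in> words0 V"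
    unfolding a_word_def b_word_def by (intro words0_closed(2,3) w)+
  assume f: "word_hom V E f"
  show "f (a_word i) = - f (word_of (corner_loop d (4 * i))) + f (word_of (corner_loop d (4 * i + 1)))"
    "f (b_word i) = - f (word_of (corner_loop d (4 * i + 1))) + f (word_of (corner_loop d (4 * i + 2)))"
    unfolding a_word_def b_word_def word_homD(1)[OF f words0_closed(3)[OF w(1)] w(2)]
      word_homD(1)[OF f words0_closed(3)[OF w(2)] w(3)] word_hom_inv[OF f w(1)] word_hom_inv[OF f w(2)]
    by (rule HOL.refl)+
qed

lemma word_hom_labels:
  assumes f: "word_hom V E f" shows "surface_labels g (\<lambda>j. f (word_of (corner_loop d j)))"
proof -
  interpret H: surface_hom g S q d "\<lambda>p. f (word_of p)"
    by unfold_locales (use d word_hom_word_of[OF f] in auto)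
  show ?thesis by (rule H.corner_loop_labels)
qed

text \<open>Each clause translates a fact on labels: homomorphisms have labels, labels are realised
  by holonomy, and labels determine the homomorphism. The increments of labels are the values on
  \<open>a_word\<close> and \<open>b_word\<close>.\<close>

theorem surface_model_words: "surface_model TYPE('n::group_add) V E g a_word b_word"
  unfolding surface_model_def
proof (intro conjI allI impI ballI)
  fix i assume "i < g"
  then show "a_word i \<in> words0 V" "b_word i \<in> words0 V" by (rule ab_word)+
next
  fix f :: "_ \<Rightarrow> 'n" assume f: "word_hom V E f"
  note l = word_hom_labels[OF f]
  have "comm_sum (\<lambda>i. f (a_word i)) (\<lambda>i. f (b_word i)) g = f (word_of (corner_loop d (4 * g)))"
    unfolding surface_labels_comm_sum[OF l order_refl]
    by (rule comm_sum_cong) (simp_all only: ab_word(3,4)[OF _ f])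
  also have "\<dots> = 0" using l by (simp add: surface_labels_def)
  finally show "comm_sum (\<lambda>i. f (a_word i)) (\<lambda>i. f (b_word i)) g = 0" .
next
  fix A B :: "nat \<Rightarrow> 'n" assume "comm_sum A B g = 0"
  from surface_labels_exist[OF this] obtain u where u: "surface_labels g u"
    "\<forall>i<g. - u (4 * i) + u (4 * i + 1) = A i \<and> - u (4 * i + 1) + u (4 * i + 2) = B i" by (elim exE conjE) (rule that)
  from loop_hom_exists[OF u(1) d] obtain f where f: "loop_hom S (q d) f" "\<forall>j\<le>4 * g. f (corner_loop d j) = u j"
    by (elim exE conjE) (rule that)
  define F where "F w = f (loop_of w)" for w
  have F: "word_hom V E F" unfolding F_def[abs_def] by (rule loop_hom_loop_of[OF f(1)])
  \<comment> \<open>\<open>loop_of\<close> returns some representative, homotopic to the corner loop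
    but not equal to it.\<close>
  have Fu: "F (word_of (corner_loop d j)) = u j" if "j \<le> 4 * g" for j
  proof -
    note c = corner_loop_in[OF d that]
    have "path_htpy S (corner_loop d j) (loop_of (word_of (corner_loop d j)))"
      by (rule theta_inj[OF c loop_of(1)[OF word_of(1)[OF c]]])
        (simp only: loop_of(2)[OF word_of(1)[OF c]] word_of(2)[OF c])
    then have "f (corner_loop d j) = f (loop_of (word_of (corner_loop d j)))"
      using f(1) c unfolding loop_hom_def by blast
    then show ?thesis using f(2) that unfolding F_def by simp
  qed
  have "F (a_word i) = A i \<and> F (b_word i) = B i" if i: "i < g" for i
  proof -
    have "4 * i \<le> 4 * g" "4 * i + 1 \<le> 4 * g" "4 * i + 2 \<le> 4 * g" using i by simp_all
    note Fu[OF this(1)] Fu[OF this(2)] Fu[OF this(3)]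
    then show ?thesis using u(2) i by (simp only: ab_word(3,4)[OF i F])
  qed
  then show "\<exists>f. word_hom V E f \<and> (\<forall>i<g. f (a_word i) = A i \<and> f (b_word i) = B i)"
    using F by (intro exI[of _ F]) simp
next
  fix f f' :: "_ \<Rightarrow> 'n" and w
  assume f: "word_hom V E f" "word_hom V E f'" and e: "\<forall>i<g. f (a_word i) = f' (a_word i) \<and> f (b_word i) = f' (b_word i)"
    and w: "w \<in> words0 V"
  have "f (word_of (corner_loop d j)) = f' (word_of (corner_loop d j))" if j: "j < 4 * g" for j
  proof (rule surface_labels_unique[OF word_hom_labels[OF f(1)] word_hom_labels[OF f(2)] _ _ j])
    fix i assume i: "i < g"
    show "- f (word_of (corner_loop d (4 * i))) + f (word_of (corner_loop d (4 * i + 1))) =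
        - f' (word_of (corner_loop d (4 * i))) + f' (word_of (corner_loop d (4 * i + 1)))"
      using e i unfolding ab_word(3)[OF i f(1), symmetric] ab_word(3)[OF i f(2), symmetric] by blast
    show "- f (word_of (corner_loop d (4 * i + 1))) + f (word_of (corner_loop d (4 * i + 2))) =
        - f' (word_of (corner_loop d (4 * i + 1))) + f' (word_of (corner_loop d (4 * i + 2)))"
      using e i unfolding ab_word(4)[OF i f(1), symmetric] ab_word(4)[OF i f(2), symmetric] by blast
  qed
  then have "f (word_of (loop_of w)) = f' (word_of (loop_of w))"
    by (rule loop_hom_unique[OF d word_hom_word_of[OF f(1)] word_hom_word_of[OF f(2)] _ loop_of(1)[OF w]])
  then show "f w = f' w"
    using word_homD(2)[OF f(1) w word_of_loop_of[OF w]] word_homD(2)[OF f(2) w word_of_loop_of[OF w]] by simp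
qed

end

theorem surface_group_not_bb_group:
  assumes g2: "2 \<le> g" and S: "orientable_closed_surface g S" and x: "x \<in> topspace S" and G: "simplicial_graph V E"
  shows "\<not> fundamental_group S x \<cong> bb_group V E"
proof
  assume "fundamental_group S x \<cong> bb_group V E"
  then obtain \<theta> where theta: "\<theta> \<in> iso (fundamental_group S x) (bb_group V E)"
    unfolding is_iso_def by blast
  obtain q where q: "quotient_map (top_of_set (cball 0 1)) S q"
    "\<forall>z\<in>cball 0 1. \<forall>w\<in>cball 0 1. q z = q w \<longleftrightarrow> equivclp (side_glue g) z w"
    using S unfolding orientable_closed_surface_def by blast
  interpret surface g S q by unfold_locales (use g2 q in auto)
  obtain d where d: "d \<in> cball 0 1" "x = q d" using x unfolding top_S by auto
  interpret surface_iso g S q d V E \<theta> by unfold_locales (use d theta in auto)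
  interpret bb_surface V E g a_word b_word
    by unfold_locales (use G g2 surface_model_words in auto)
  show False by (rule contradiction)
qed

section \<open>Linear, quadratic and cubic functionals on Lie terms\<close>

primrec lin :: "('x \<Rightarrow> 'k::field) \<Rightarrow> ('k, 'x) lie_term \<Rightarrow> 'k" where
  "lin \<alpha> (LGen x) = \<alpha> x"
| "lin \<alpha> LZero = 0"
| "lin \<alpha> (LAdd s t) = lin \<alpha> s + lin \<alpha> t"
| "lin \<alpha> (LSmul c t) = c * lin \<alpha> t"
| "lin \<alpha> (LBr s t) = 0"

text \<open>The central entry of the evaluation in the Heisenberg Lie algebra, where \<alpha> and
  \<beta> are the entries next to the diagonal.\<close>

primrec quad :: "('x \<Rightarrow> 'k::field) \<Rightarrow> ('x \<Rightarrow> 'k) \<Rightarrow> ('k, 'x) lie_term \<Rightarrow> 'k" where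
  "quad \<alpha> \<beta> (LGen x) = 0"
| "quad \<alpha> \<beta> LZero = 0"
| "quad \<alpha> \<beta> (LAdd s t) = quad \<alpha> \<beta> s + quad \<alpha> \<beta> t"
| "quad \<alpha> \<beta> (LSmul c t) = c * quad \<alpha> \<beta> t"
| "quad \<alpha> \<beta> (LBr s t) = lin \<alpha> s * lin \<beta> t - lin \<alpha> t * lin \<beta> s"

text \<open>
  The corner entry of the strictly upper triangular \<open>4 \<times> 4\<close> matrix to which a term evaluates when
  the generator \<open>x\<close> is mapped to the matrix with entries \<open>\<alpha> x\<close>, \<open>\<beta> x\<close>, \<open>\<gamma> x\<close> next to the diagonal.
\<close>

primrec cub :: "('x \<Rightarrow> 'k::field) \<Rightarrow> ('x \<Rightarrow> 'k) \<Rightarrow> ('x \<Rightarrow> 'k) \<Rightarrow> ('k, 'x) lie_term \<Rightarrow> 'k" where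
  "cub \<alpha> \<beta> \<gamma> (LGen x) = 0"
| "cub \<alpha> \<beta> \<gamma> LZero = 0"
| "cub \<alpha> \<beta> \<gamma> (LAdd s t) = cub \<alpha> \<beta> \<gamma> s + cub \<alpha> \<beta> \<gamma> t"
| "cub \<alpha> \<beta> \<gamma> (LSmul c t) = c * cub \<alpha> \<beta> \<gamma> t"
| "cub \<alpha> \<beta> \<gamma> (LBr s t) = lin \<alpha> s * quad \<beta> \<gamma> t - lin \<alpha> t * quad \<beta> \<gamma> s
    + quad \<alpha> \<beta> s * lin \<gamma> t - quad \<alpha> \<beta> t * lin \<gamma> s"

lemma lin_eq:
  assumes "lie_eq X R s t" and "\<And>r. r \<in> R \<Longrightarrow> lin \<alpha> r = 0"
  shows "lin \<alpha> s = lin \<alpha> t"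
  using assms by (induction rule: lie_eq.induct) (simp_all add: algebra_simps)

text \<open>Two forms with coefficients correspond to two Heisenberg algebras with a common centre.
  It is then enough that the combination kills the relators, even if neither form does.\<close>

lemma quad_eq:
  assumes "lie_eq X R s t"
    and "\<And>r. r \<in> R \<Longrightarrow> lin \<alpha> r = 0 \<and> lin \<beta> r = 0 \<and> lin \<gamma> r = 0 \<and> lin \<delta> r = 0"
    and "\<And>r. r \<in> R \<Longrightarrow> a * quad \<alpha> \<beta> r + b * quad \<gamma> \<delta> r = 0"
  shows "a * quad \<alpha> \<beta> s + b * quad \<gamma> \<delta> s = a * quad \<alpha> \<beta> t + b * quad \<gamma> \<delta> t"
  using assms(1)
proof (induction rule: lie_eq.induct)
  case (br_cong s s' t t')
  have "lin \<epsilon> s = lin \<epsilon> s' \<and> lin \<epsilon> t = lin \<epsilon> t'" if "\<epsilon> \<in> {\<alpha>, \<beta>, \<gamma>, \<delta>}" for \<epsilon>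
    using that lin_eq[OF br_cong(1), of \<epsilon>] lin_eq[OF br_cong(2), of \<epsilon>] assms(2) by blast
  then show ?case by simp
next
  case (add_cong s s' t t')
  then have "a * quad \<alpha> \<beta> s + b * quad \<gamma> \<delta> s + (a * quad \<alpha> \<beta> t + b * quad \<gamma> \<delta> t) =
    a * quad \<alpha> \<beta> s' + b * quad \<gamma> \<delta> s' + (a * quad \<alpha> \<beta> t' + b * quad \<gamma> \<delta> t')" by simp
  then show ?case by (simp add: algebra_simps)
next
  case (smul_cong t t' c)
  then have "c * (a * quad \<alpha> \<beta> t + b * quad \<gamma> \<delta> t) = c * (a * quad \<alpha> \<beta> t' + b * quad \<gamma> \<delta> t')" by simp
  then show ?case by (simp add: algebra_simps)
qed (use assms(3) in \<open>simp_all add: algebra_simps\<close>)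

text \<open>The corner entry of a bracket involves the two neighbouring products, so these have to
  be invariant first.\<close>

lemma cub_eq:
  assumes "lie_eq X R s t"
    and R: "\<And>r. r \<in> R \<Longrightarrow> lin \<alpha> r = 0 \<and> lin \<beta> r = 0 \<and> lin \<gamma> r = 0"
      "\<And>r. r \<in> R \<Longrightarrow> quad \<alpha> \<beta> r = 0 \<and> quad \<beta> \<gamma> r = 0" "\<And>r. r \<in> R \<Longrightarrow> cub \<alpha> \<beta> \<gamma> r = 0"
  shows "cub \<alpha> \<beta> \<gamma> s = cub \<alpha> \<beta> \<gamma> t"
  using assms(1)
proof (induction rule: lie_eq.induct)
  case (br_cong s s' t t')
  have "lin \<epsilon> s = lin \<epsilon> s' \<and> lin \<epsilon> t = lin \<epsilon> t'" if "\<epsilon> \<in> {\<alpha>, \<beta>, \<gamma>}" for \<epsilon>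
    using that lin_eq[OF br_cong(1), of \<epsilon>] lin_eq[OF br_cong(2), of \<epsilon>] R(1) by blast
  moreover have "quad \<alpha> \<beta> s = quad \<alpha> \<beta> s' \<and> quad \<beta> \<gamma> s = quad \<beta> \<gamma> s'"
    using quad_eq[OF br_cong(1), of \<alpha> \<beta> \<alpha> \<beta> 1 0] quad_eq[OF br_cong(1), of \<beta> \<gamma> \<beta> \<gamma> 1 0] R(1,2) by simp
  moreover have "quad \<alpha> \<beta> t = quad \<alpha> \<beta> t' \<and> quad \<beta> \<gamma> t = quad \<beta> \<gamma> t'"
    using quad_eq[OF br_cong(2), of \<alpha> \<beta> \<alpha> \<beta> 1 0] quad_eq[OF br_cong(2), of \<beta> \<gamma> \<beta> \<gamma> 1 0] R(1,2) by simp
  ultimately show ?case by simp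
qed (use R(3) in \<open>simp_all add: algebra_simps\<close>)

lemma homogeneous_functionals:
  assumes "homogeneous (\<lambda>_. 1) n t"
  shows "n \<noteq> 1 \<Longrightarrow> lin \<alpha> t = 0" and "n \<noteq> 2 \<Longrightarrow> quad \<alpha> \<beta> t = 0" and "n \<noteq> 3 \<Longrightarrow> cub \<alpha> \<beta> \<gamma> t = 0"
proof -
  have l: "n \<noteq> 1 \<Longrightarrow> lin \<alpha> t = 0" if "homogeneous (\<lambda>_. 1) n t" for n t and \<alpha> :: "'a \<Rightarrow> 'b"
    using that by (induction rule: homogeneous.induct) auto
  have q: "n \<noteq> 2 \<Longrightarrow> quad \<alpha> \<beta> t = 0" if "homogeneous (\<lambda>_. 1) n t" for n t and \<alpha> \<beta> :: "'a \<Rightarrow> 'b"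
    using that
  proof (induction rule: homogeneous.induct)
    case (5 m s n t)
    then have "m \<noteq> 1 \<or> n \<noteq> 1" by auto
    then show ?case using l[OF 5(1)] l[OF 5(2)] by auto
  qed auto
  show "n \<noteq> 1 \<Longrightarrow> lin \<alpha> t = 0" "n \<noteq> 2 \<Longrightarrow> quad \<alpha> \<beta> t = 0" by (erule l[OF assms] q[OF assms])+
  show "n \<noteq> 3 \<Longrightarrow> cub \<alpha> \<beta> \<gamma> t = 0" using assms
  proof (induction rule: homogeneous.induct)
    case (5 m s n t)
    have "lin \<alpha> s * quad \<beta> \<gamma> t = 0 \<and> quad \<alpha> \<beta> s * lin \<gamma> t = 0"
      using 5(5) l[OF 5(1)] l[OF 5(2)] q[OF 5(1)] q[OF 5(2)] by (cases "m = 1"; cases "n = 1") auto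
    moreover have "lin \<alpha> t * quad \<beta> \<gamma> s = 0 \<and> quad \<alpha> \<beta> t * lin \<gamma> s = 0"
      using 5(5) l[OF 5(1)] l[OF 5(2)] q[OF 5(1)] q[OF 5(2)] by (cases "m = 1"; cases "n = 1") auto
    ultimately show ?case by auto
  qed auto
qed

lemma lin_sum:
  "finite I \<Longrightarrow> lin (\<lambda>x. \<Sum>i\<in>I. c i * \<alpha> i x) t = (\<Sum>i\<in>I. c i * lin (\<alpha> i) t)"
  by (induction t) (simp_all add: sum.distrib sum_distrib_left algebra_simps)

lemma lin_cong: "t \<in> lie_terms X \<Longrightarrow> (\<And>x. x \<in> X \<Longrightarrow> \<alpha> x = \<beta> x) \<Longrightarrow> lin \<alpha> t = lin \<beta> t"
  by (induction t) auto

lemma quad_cong: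
  "t \<in> lie_terms X \<Longrightarrow> (\<And>x. x \<in> X \<Longrightarrow> \<alpha> x = \<alpha>' x) \<Longrightarrow> (\<And>x. x \<in> X \<Longrightarrow> \<beta> x = \<beta>' x) \<Longrightarrow>
    quad \<alpha> \<beta> t = quad \<alpha>' \<beta>' t"
proof (induction t)
  case (LBr s t)
  then show ?case using lin_cong[of _ X \<alpha> \<alpha>'] lin_cong[of _ X \<beta> \<beta>'] by simp
qed auto

lemma quad_sum_right:
  "finite I \<Longrightarrow> quad \<alpha> (\<lambda>x. \<Sum>i\<in>I. c i * \<beta> i x) t = (\<Sum>i\<in>I. c i * quad \<alpha> (\<beta> i) t)"
  by (induction t) (simp_all add: lin_sum sum.distrib sum_distrib_left sum_distrib_right sum_subtractf algebra_simps)

lemma quad_swap: "quad \<alpha> \<beta> t = - quad \<beta> \<alpha> t"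
  by (induction t) (simp_all add: algebra_simps)

lemma quad_self: "quad \<alpha> \<alpha> t = 0"
  by (induction t) (simp_all add: algebra_simps)

definition delta :: "'x \<Rightarrow> 'x \<Rightarrow> 'k::field"
  where "delta x y = (if y = x then 1 else 0)"


section \<open>Presented Lie algebras\<close>

text \<open>Holds for every presentation, with arbitrary relators
  (\<open>presented_lie_module\<close>), and supports evaluation of terms of degree at most 2. The
  decomposition into degrees that \<open>graded_lie_algebra\<close> contains is not part of
  it.\<close>

locale lie_module = module field_ring L
  for L :: "('k::field, 'a, 'm) graded_lie_scheme" (structure) +
  assumes bracket_in: "\<And>x y. \<lbrakk>x \<in> carrier L; y \<in> carrier L\<rbrakk> \<Longrightarrow> bracket L x y \<in> carrier L"
    and bracket_add: "\<And>x y z. \<lbrakk>x \<in> carrier L; y \<in> carrier L; z \<in> carrier L\<rbrakk> \<Longrightarrow>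
        bracket L (x \<oplus> y) z = bracket L x z \<oplus> bracket L y z"
      "\<And>x y z. \<lbrakk>x \<in> carrier L; y \<in> carrier L; z \<in> carrier L\<rbrakk> \<Longrightarrow>
        bracket L x (y \<oplus> z) = bracket L x y \<oplus> bracket L x z"
    and bracket_smult: "\<And>c x y. \<lbrakk>x \<in> carrier L; y \<in> carrier L\<rbrakk> \<Longrightarrow>
        bracket L (c \<odot>\<^bsub>L\<^esub> x) y = c \<odot>\<^bsub>L\<^esub> bracket L x y"
      "\<And>c x y. \<lbrakk>x \<in> carrier L; y \<in> carrier L\<rbrakk> \<Longrightarrow>
        bracket L x (c \<odot>\<^bsub>L\<^esub> y) = c \<odot>\<^bsub>L\<^esub> bracket L x y"
    and bracket_same: "\<And>x. x \<in> carrier L \<Longrightarrow> bracket L x x = \<zero>"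
begin

lemma smult_simps:
  "x \<in> carrier L \<Longrightarrow> (a + b) \<odot>\<^bsub>L\<^esub> x = a \<odot>\<^bsub>L\<^esub> x \<oplus> b \<odot>\<^bsub>L\<^esub> x"
  "x \<in> carrier L \<Longrightarrow> y \<in> carrier L \<Longrightarrow> a \<odot>\<^bsub>L\<^esub> (x \<oplus> y) = a \<odot>\<^bsub>L\<^esub> x \<oplus> a \<odot>\<^bsub>L\<^esub> y"
  "x \<in> carrier L \<Longrightarrow> a \<odot>\<^bsub>L\<^esub> (b \<odot>\<^bsub>L\<^esub> x) = (a * b) \<odot>\<^bsub>L\<^esub> x"
  "x \<in> carrier L \<Longrightarrow> 1 \<odot>\<^bsub>L\<^esub> x = x"
  "x \<in> carrier L \<Longrightarrow> a \<odot>\<^bsub>L\<^esub> x \<in> carrier L"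
  "x \<in> carrier L \<Longrightarrow> 0 \<odot>\<^bsub>L\<^esub> x = \<zero>"
  "a \<odot>\<^bsub>L\<^esub> \<zero> = \<zero>"
  using smult_l_distr[of a b x] smult_r_distr[of a x y] smult_assoc1[of a b x] smult_one[of x]
    smult_closed[of a x] smult_l_null[of x] smult_r_null[of a] by simp_all

lemma bracket_zero: "x \<in> carrier L \<Longrightarrow> bracket L \<zero> x = \<zero>" "x \<in> carrier L \<Longrightarrow> bracket L x \<zero> = \<zero>"
  using bracket_smult(1)[of \<zero> x 0] bracket_smult(2)[of x \<zero> 0] by (simp_all add: smult_simps bracket_in)

lemma smult_neg: "x \<in> carrier L \<Longrightarrow> x \<oplus> (- 1) \<odot>\<^bsub>L\<^esub> x = \<zero>"
  using smult_simps(1)[of x 1 "- 1"] by (simp add: smult_simps)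

lemma minus_eq_iff:
  assumes "x \<in> carrier L" "y \<in> carrier L"
  shows "x \<oplus> (- 1) \<odot>\<^bsub>L\<^esub> y = \<zero> \<longleftrightarrow> x = y"
proof
  assume e: "x \<oplus> (- 1) \<odot>\<^bsub>L\<^esub> y = \<zero>"
  have "x = x \<oplus> (y \<oplus> (- 1) \<odot>\<^bsub>L\<^esub> y)" using assms by (simp add: smult_neg)
  also have "\<dots> = (x \<oplus> (- 1) \<odot>\<^bsub>L\<^esub> y) \<oplus> y" using assms by (simp add: a_ac smult_simps(5))
  also have "\<dots> = y" using assms e by simp
  finally show "x = y" .
qed (use assms in \<open>simp add: smult_neg\<close>)

lemma bracket_anti:
  assumes "x \<in> carrier L" "y \<in> carrier L"
  shows "bracket L x y = (- 1) \<odot>\<^bsub>L\<^esub> bracket L y x"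
proof -
  have "bracket L (x \<oplus> y) (x \<oplus> y) = bracket L x y \<oplus> bracket L y x"
    using assms bracket_add(1)[of x y "x \<oplus> y"] bracket_add(2)[of x x y] bracket_add(2)[of y x y]
    by (simp only: a_closed bracket_same[of x] bracket_same[of y] bracket_in r_zero l_zero)
  then have "bracket L x y \<oplus> bracket L y x = \<zero>" using assms bracket_same[of "x \<oplus> y"] by simp
  then have "bracket L x y \<oplus> (- 1) \<odot>\<^bsub>L\<^esub> ((- 1) \<odot>\<^bsub>L\<^esub> bracket L y x) = \<zero>"
    using assms by (simp add: smult_simps bracket_in)
  then show ?thesis using assms by (subst (asm) minus_eq_iff) (auto simp: smult_simps bracket_in)
qed

primrec lin_comb :: "('x \<Rightarrow> 'a) \<Rightarrow> 'x list \<Rightarrow> ('x \<Rightarrow> 'k) \<Rightarrow> 'a" where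
  "lin_comb f [] a = \<zero>"
| "lin_comb f (x # xs) a = a x \<odot>\<^bsub>L\<^esub> f x \<oplus> lin_comb f xs a"

text \<open>Normal form in degree 2: coefficients times brackets of an earlier with a later
  generator of the list.\<close>

primrec quad_comb :: "('x \<Rightarrow> 'a) \<Rightarrow> 'x list \<Rightarrow> ('x \<Rightarrow> 'x \<Rightarrow> 'k) \<Rightarrow> 'a" where
  "quad_comb f [] c = \<zero>"
| "quad_comb f (x # xs) c = bracket L (f x) (lin_comb f xs (c x)) \<oplus> quad_comb f xs c"

lemma lin_comb_simps:
  assumes "\<And>x. x \<in> set xs \<Longrightarrow> f x \<in> carrier L"
  shows "lin_comb f xs a \<in> carrier L"
    and "lin_comb f xs (\<lambda>x. a x + b x) = lin_comb f xs a \<oplus> lin_comb f xs b"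
    and "lin_comb f xs (\<lambda>x. c * a x) = c \<odot>\<^bsub>L\<^esub> lin_comb f xs a"
    and "lin_comb f xs (\<lambda>_. 0) = \<zero>"
proof -
  show c: "lin_comb f xs a \<in> carrier L" for a using assms by (induction xs) (simp_all add: smult_simps)
  have d: "lin_comb f xs a \<in> carrier L" if "\<And>x. x \<in> set xs \<Longrightarrow> f x \<in> carrier L" for a xs
    using that by (induction xs) (simp_all add: smult_simps)
  show "lin_comb f xs (\<lambda>x. a x + b x) = lin_comb f xs a \<oplus> lin_comb f xs b"
    using assms by (induction xs) (simp_all add: smult_simps a_ac d)
  show "lin_comb f xs (\<lambda>x. c * a x) = c \<odot>\<^bsub>L\<^esub> lin_comb f xs a"
    using assms by (induction xs) (simp_all add: smult_simps d)
  show "lin_comb f xs (\<lambda>_. 0) = \<zero>"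
    using assms by (induction xs) (simp_all add: smult_simps)
qed

lemma lin_comb_cong: "(\<And>x. x \<in> set xs \<Longrightarrow> a x = b x) \<Longrightarrow> lin_comb f xs a = lin_comb f xs b"
  by (induction xs) simp_all

lemma lin_comb_delta:
  assumes "\<And>x. x \<in> set xs \<Longrightarrow> f x \<in> carrier L" "distinct xs" "x \<in> set xs"
  shows "lin_comb f xs (\<lambda>y. delta y x) = f x"
  using assms
proof (induction xs)
  case (Cons y xs)
  show ?case
  proof (cases "x = y")
    case True
    then have "lin_comb f xs (\<lambda>y. delta y x) = lin_comb f xs (\<lambda>_. 0)"
      using Cons.prems by (intro lin_comb_cong) (auto simp: delta_def)
    then show ?thesis using True Cons.prems lin_comb_simps(4)[of xs f] by (simp add: smult_simps delta_def)
  next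
    case False
    then show ?thesis using Cons lin_comb_simps(1)[of xs f] by (simp add: smult_simps delta_def)
  qed
qed simp

lemma quad_comb_simps:
  assumes "\<And>x. x \<in> set xs \<Longrightarrow> f x \<in> carrier L"
  shows "quad_comb f xs c \<in> carrier L"
    and "quad_comb f xs (\<lambda>x y. c x y + d x y) = quad_comb f xs c \<oplus> quad_comb f xs d"
    and "quad_comb f xs (\<lambda>x y. e * c x y) = e \<odot>\<^bsub>L\<^esub> quad_comb f xs c"
    and "quad_comb f xs (\<lambda>_ _. 0) = \<zero>"
proof -
  have d: "quad_comb f xs a \<in> carrier L" if "\<And>x. x \<in> set xs \<Longrightarrow> f x \<in> carrier L" for a xs
    using that by (induction xs) (simp_all add: bracket_in lin_comb_simps)
  then show "quad_comb f xs c \<in> carrier L" using assms .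
  show "quad_comb f xs (\<lambda>x y. c x y + d x y) = quad_comb f xs c \<oplus> quad_comb f xs d"
    using assms by (induction xs) (simp_all add: lin_comb_simps bracket_add bracket_in a_ac d)
  show "quad_comb f xs (\<lambda>x y. e * c x y) = e \<odot>\<^bsub>L\<^esub> quad_comb f xs c"
    using assms by (induction xs) (simp_all add: lin_comb_simps bracket_smult bracket_in smult_simps d)
  show "quad_comb f xs (\<lambda>_ _. 0) = \<zero>"
    using assms by (induction xs) (simp_all add: lin_comb_simps bracket_zero)
qed

lemma quad_comb_cong:
  "(\<And>x y. x \<in> set xs \<Longrightarrow> y \<in> set xs \<Longrightarrow> c x y = d x y) \<Longrightarrow> quad_comb f xs c = quad_comb f xs d"
  by (induction xs) (simp_all cong: lin_comb_cong)

lemma bracket_lin_comb: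
  assumes "\<And>x. x \<in> set xs \<Longrightarrow> f x \<in> carrier L"
  shows "bracket L (lin_comb f xs a) (lin_comb f xs b) = quad_comb f xs (\<lambda>x y. a x * b y - a y * b x)"
  using assms
proof (induction xs)
  case (Cons x xs)
  let ?x = "f x" and ?A = "lin_comb f xs a" and ?B = "lin_comb f xs b"
  have c: "?x \<in> carrier L" "?A \<in> carrier L" "?B \<in> carrier L" using Cons.prems by (simp_all add: lin_comb_simps)
  have "lin_comb f xs (\<lambda>y. a x * b y - a y * b x) = lin_comb f xs (\<lambda>y. a x * b y + (- b x) * a y)"
    by (rule lin_comb_cong) simp
  also have "\<dots> = a x \<odot>\<^bsub>L\<^esub> ?B \<oplus> (- b x) \<odot>\<^bsub>L\<^esub> ?A"
    using Cons.prems lin_comb_simps(2)[of xs f "\<lambda>y. a x * b y" "\<lambda>y. (- b x) * a y"]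
      lin_comb_simps(3)[of xs f "a x" b] lin_comb_simps(3)[of xs f "- b x" a] by (simp only: list.set_intros(2))
  finally have e: "bracket L ?x (lin_comb f xs (\<lambda>y. a x * b y - a y * b x)) =
      a x \<odot>\<^bsub>L\<^esub> bracket L ?x ?B \<oplus> (- b x) \<odot>\<^bsub>L\<^esub> bracket L ?x ?A"
    using c by (simp add: bracket_add bracket_smult smult_simps)
  have "bracket L ?A ?x = (- 1) \<odot>\<^bsub>L\<^esub> bracket L ?x ?A" by (rule bracket_anti[OF c(2,1)])
  then have "bracket L (lin_comb f (x # xs) a) (lin_comb f (x # xs) b) =
      (a x \<odot>\<^bsub>L\<^esub> bracket L ?x ?B \<oplus> (- b x) \<odot>\<^bsub>L\<^esub> bracket L ?x ?A) \<oplus> bracket L ?A ?B"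
    using c by (simp add: bracket_add bracket_smult smult_simps(3,5,7) bracket_same bracket_in a_ac)
  then show ?case unfolding e[symmetric] using Cons by simp
qed (simp add: bracket_zero)

lemma lie_eval_in: "\<lbrakk>\<And>x. x \<in> X \<Longrightarrow> f x \<in> carrier L; t \<in> lie_terms X\<rbrakk> \<Longrightarrow> lie_eval L f t \<in> carrier L"
  by (induction t) (simp_all add: smult_simps bracket_in)

lemma lie_eval_degree_0:
  assumes "homogeneous (\<lambda>_. 1) n t" "n = 0" "t \<in> lie_terms X" "\<And>x. x \<in> X \<Longrightarrow> f x \<in> carrier L"
  shows "lie_eval L f t = \<zero>"
  using assms(1-3) by (induction rule: homogeneous.induct) (simp_all add: smult_simps bracket_zero)

lemma lie_eval_degree_1:
  assumes xs: "\<And>x. x \<in> set xs \<Longrightarrow> f x \<in> carrier L" "distinct xs"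
    and "homogeneous (\<lambda>_. 1) n t" "n = 1" "t \<in> lie_terms (set xs)"
  shows "lie_eval L f t = lin_comb f xs (\<lambda>x. lin (delta x) t)"
  using assms(3-5)
proof (induction rule: homogeneous.induct)
  case (5 m s n t)
  have ein: "lie_eval L f t \<in> carrier L" if "t \<in> lie_terms (set xs)" for t
    by (rule lie_eval_in[OF xs(1) that])
  have e0: "n = 0 \<Longrightarrow> t \<in> lie_terms (set xs) \<Longrightarrow> lie_eval L f t = \<zero>" if "homogeneous (\<lambda>_. 1) n t" for n t
    by (rule lie_eval_degree_0[OF that _ _ xs(1)])
  from 5 have "m = 0 \<or> n = 0" by auto
  then have "lie_eval L f (LBr s t) = \<zero>"
    using e0[OF 5(1)] e0[OF 5(2)] ein 5(6) by (auto simp: bracket_zero)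
  moreover have "lin_comb f xs (\<lambda>_. 0) = \<zero>" by (rule lin_comb_simps(4), rule xs(1))
  ultimately show ?case by simp
qed (simp_all add: lin_comb_delta[OF xs] lin_comb_simps[OF xs(1)])

text \<open>Generators have degree 1, so terms of degree 0 evaluate to zero and a nontrivial bracket
  of degree 2 has two linear factors. Hence the antisymmetric coefficient matrix of a term
  determines its value.\<close>

lemma lie_eval_degree_2:
  assumes xs: "\<And>x. x \<in> set xs \<Longrightarrow> f x \<in> carrier L" "distinct xs"
    and "homogeneous (\<lambda>_. 1) n t" "n = 2" "t \<in> lie_terms (set xs)"
  shows "lie_eval L f t = quad_comb f xs (\<lambda>x y. quad (delta x) (delta y) t)"
  using assms(3-5)
proof (induction rule: homogeneous.induct)
  case (5 m s n t)
  have ein: "lie_eval L f t \<in> carrier L" if "t \<in> lie_terms (set xs)" for t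
    by (rule lie_eval_in[OF xs(1) that])
  have e0: "n = 0 \<Longrightarrow> t \<in> lie_terms (set xs) \<Longrightarrow> lie_eval L f t = \<zero>" if "homogeneous (\<lambda>_. 1) n t" for n t
    by (rule lie_eval_degree_0[OF that _ _ xs(1)])
  consider "m = 1" "n = 1" | "m = 0" | "n = 0" using 5(5) by linarith
  then show ?case
  proof cases
    case 1
    have "lie_eval L f (LBr s t) = bracket L (lin_comb f xs (\<lambda>x. lin (delta x) s)) (lin_comb f xs (\<lambda>x. lin (delta x) t))"
      using lie_eval_degree_1[OF xs 5(1) 1(1)] lie_eval_degree_1[OF xs 5(2) 1(2)] 5(6) by simp
    also have "\<dots> = quad_comb f xs (\<lambda>x y. lin (delta x) s * lin (delta y) t - lin (delta y) s * lin (delta x) t)"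
      by (rule bracket_lin_comb[OF xs(1)])
    also have "\<dots> = quad_comb f xs (\<lambda>x y. quad (delta x) (delta y) (LBr s t))"
      by (rule quad_comb_cong) (simp add: mult.commute)
    finally show ?thesis .
  next
    case 2
    then have "lie_eval L f (LBr s t) = \<zero>"
      using e0[OF 5(1)] ein 5(6) by (simp add: bracket_zero)
    moreover have "lin \<alpha> s = 0" for \<alpha> :: "_ \<Rightarrow> 'k" using homogeneous_functionals(1)[OF 5(1)] 2 by simp
    moreover have "quad_comb f xs (\<lambda>_ _. 0) = \<zero>" by (rule quad_comb_simps(4), rule xs(1))
    ultimately show ?thesis by simp
  next
    case 3
    then have "lie_eval L f (LBr s t) = \<zero>"
      using e0[OF 5(2)] ein 5(6) by (simp add: bracket_zero)
    moreover have "lin \<alpha> t = 0" for \<alpha> :: "_ \<Rightarrow> 'k" using homogeneous_functionals(1)[OF 5(2)] 3 by simp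
    moreover have "quad_comb f xs (\<lambda>_ _. 0) = \<zero>" by (rule quad_comb_simps(4), rule xs(1))
    ultimately show ?thesis by simp
  qed
qed (simp_all add: quad_comb_simps[OF xs(1)])

end

lemma lie_class_eqI: "lie_eq X R s t \<Longrightarrow> lie_class X R s = lie_class X R t"
  using lie_class_eq_iff lie_eq_terms by blast

lemma presented_lie_zero: "\<zero>\<^bsub>presented_lie X d R\<^esub> = lie_class X R LZero"
  by (simp add: presented_lie_def)

lemma presented_lie_module: "lie_module (presented_lie X d R)"
proof -
  let ?L = "presented_lie X d R"
  note p = presented_lie_class presented_lie_zero presented_lie_carrier
  have c: "\<exists>t\<in>lie_terms X. A = lie_class X R t" if "A \<in> carrier ?L" for A
    using that by (auto simp: presented_lie_carrier)
  have 1: "abelian_group ?L"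
  proof (rule abelian_groupI)
    fix A B C assume "A \<in> carrier ?L" "B \<in> carrier ?L" "C \<in> carrier ?L"
    then obtain s t u where e: "s \<in> lie_terms X" "t \<in> lie_terms X" "u \<in> lie_terms X"
      "A = lie_class X R s" "B = lie_class X R t" "C = lie_class X R u" using c by metis
    show "A \<oplus>\<^bsub>?L\<^esub> B \<oplus>\<^bsub>?L\<^esub> C = A \<oplus>\<^bsub>?L\<^esub> (B \<oplus>\<^bsub>?L\<^esub> C)"
      using e(1-3) unfolding e(4-6) by (simp add: p(1)) (rule lie_class_eqI, rule lie_eq.add_assoc)
  next
    fix A B assume "A \<in> carrier ?L" "B \<in> carrier ?L"
    then obtain s t where e: "s \<in> lie_terms X" "t \<in> lie_terms X" "A = lie_class X R s" "B = lie_class X R t"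
      using c by metis
    show "A \<oplus>\<^bsub>?L\<^esub> B \<in> carrier ?L" using e by (simp add: p(1)) (simp add: p)
    show "A \<oplus>\<^bsub>?L\<^esub> B = B \<oplus>\<^bsub>?L\<^esub> A"
      using e(1,2) unfolding e(3,4) by (simp add: p(1)) (rule lie_class_eqI, rule lie_eq.add_comm)
  next
    fix A assume "A \<in> carrier ?L"
    then obtain s where e: "s \<in> lie_terms X" "A = lie_class X R s" using c by metis
    show "\<zero>\<^bsub>?L\<^esub> \<oplus>\<^bsub>?L\<^esub> A = A"
      using e(1) unfolding e(2) by (simp add: p(1,4)) (rule lie_class_eqI, rule lie_eq.add_zero)
    have "lie_class X R (LSmul (- 1) s) \<in> carrier ?L" using e by (simp add: p)
    moreover have "lie_class X R (LSmul (- 1) s) \<oplus>\<^bsub>?L\<^esub> A = \<zero>\<^bsub>?L\<^esub>"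
      using e(1) unfolding e(2) by (simp add: p(1,4)) (rule lie_class_eqI, rule lie_eq.add_neg)
    ultimately show "\<exists>B\<in>carrier ?L. B \<oplus>\<^bsub>?L\<^esub> A = \<zero>\<^bsub>?L\<^esub>" by blast
  qed (simp add: p)
  have 2: "module field_ring ?L"
  proof (intro Module.module.intro Module.module_axioms.intro cring_field_ring 1)
    fix a b :: 'a and A assume "A \<in> carrier ?L"
    then obtain s where e: "s \<in> lie_terms X" "A = lie_class X R s" using c by metis
    show "a \<odot>\<^bsub>?L\<^esub> A \<in> carrier ?L" using e by (simp add: p(2)) (simp add: p)
    show "(a \<oplus>\<^bsub>field_ring\<^esub> b) \<odot>\<^bsub>?L\<^esub> A = a \<odot>\<^bsub>?L\<^esub> A \<oplus>\<^bsub>?L\<^esub> b \<odot>\<^bsub>?L\<^esub> A"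
      using e(1) unfolding e(2) by (simp add: p(1,2)) (rule lie_class_eqI, rule lie_eq.smul_add_left)
    show "(a \<otimes>\<^bsub>field_ring\<^esub> b) \<odot>\<^bsub>?L\<^esub> A = a \<odot>\<^bsub>?L\<^esub> (b \<odot>\<^bsub>?L\<^esub> A)"
      using e(1) unfolding e(2) by (simp add: p(1,2)) (rule lie_class_eqI, rule lie_eq.smul_smul)
    show "\<one>\<^bsub>field_ring\<^esub> \<odot>\<^bsub>?L\<^esub> A = A"
      using e(1) unfolding e(2) by (simp add: p(1,2)) (rule lie_class_eqI, rule lie_eq.smul_one)
  next
    fix a :: 'a and A B assume "A \<in> carrier ?L" "B \<in> carrier ?L"
    then obtain s t where e: "s \<in> lie_terms X" "t \<in> lie_terms X" "A = lie_class X R s" "B = lie_class X R t"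
      using c by metis
    show "a \<odot>\<^bsub>?L\<^esub> (A \<oplus>\<^bsub>?L\<^esub> B) = a \<odot>\<^bsub>?L\<^esub> A \<oplus>\<^bsub>?L\<^esub> a \<odot>\<^bsub>?L\<^esub> B"
      using e(1,2) unfolding e(3,4) by (simp add: p(1,2)) (rule lie_class_eqI, rule lie_eq.smul_add_right)
  qed
  show ?thesis
  proof (intro lie_module.intro lie_module_axioms.intro 2)
    fix A B C assume "A \<in> carrier ?L" "B \<in> carrier ?L" "C \<in> carrier ?L"
    then obtain s t u where e: "s \<in> lie_terms X" "t \<in> lie_terms X" "u \<in> lie_terms X"
      "A = lie_class X R s" "B = lie_class X R t" "C = lie_class X R u" using c by metis
    show "bracket ?L (A \<oplus>\<^bsub>?L\<^esub> B) C = bracket ?L A C \<oplus>\<^bsub>?L\<^esub> bracket ?L B C"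
      using e(1-3) unfolding e(4-6) by (simp add: p(1,3)) (rule lie_class_eqI, rule lie_eq.br_add_left)
    show "bracket ?L A (B \<oplus>\<^bsub>?L\<^esub> C) = bracket ?L A B \<oplus>\<^bsub>?L\<^esub> bracket ?L A C"
      using e(1-3) unfolding e(4-6) by (simp add: p(1,3)) (rule lie_class_eqI, rule lie_eq.br_add_right)
  next
    fix a :: 'a and A B assume "A \<in> carrier ?L" "B \<in> carrier ?L"
    then obtain s t where e: "s \<in> lie_terms X" "t \<in> lie_terms X" "A = lie_class X R s" "B = lie_class X R t"
      using c by metis
    show "bracket ?L A B \<in> carrier ?L" using e by (simp add: p(3)) (simp add: p)
    show "bracket ?L (a \<odot>\<^bsub>?L\<^esub> A) B = a \<odot>\<^bsub>?L\<^esub> bracket ?L A B"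
      using e(1,2) unfolding e(3,4) by (simp add: p(2,3)) (rule lie_class_eqI, rule lie_eq.br_smul_left)
    show "bracket ?L A (a \<odot>\<^bsub>?L\<^esub> B) = a \<odot>\<^bsub>?L\<^esub> bracket ?L A B"
      using e(1,2) unfolding e(3,4) by (simp add: p(2,3)) (rule lie_class_eqI, rule lie_eq.br_smul_right)
  next
    fix A assume "A \<in> carrier ?L"
    then obtain s where e: "s \<in> lie_terms X" "A = lie_class X R s" using c by metis
    show "bracket ?L A A = \<zero>\<^bsub>?L\<^esub>"
      using e(1) unfolding e(2) by (simp add: p(3,4)) (rule lie_class_eqI, rule lie_eq.br_self)
  qed
qed

lemma presented_lie_eval:
  "t \<in> lie_terms X \<Longrightarrow> lie_eval (presented_lie X d R) (\<lambda>x. lie_class X R (LGen x)) t = lie_class X R t"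
  by (induction t) (simp_all add: presented_lie_class presented_lie_zero)

section \<open>Substitution in terms\<close>

primrec lie_subst :: "('x \<Rightarrow> ('k, 'y) lie_term) \<Rightarrow> ('k, 'x) lie_term \<Rightarrow> ('k, 'y) lie_term" where
  "lie_subst f (LGen x) = f x"
| "lie_subst f LZero = LZero"
| "lie_subst f (LAdd s t) = LAdd (lie_subst f s) (lie_subst f t)"
| "lie_subst f (LSmul c t) = LSmul c (lie_subst f t)"
| "lie_subst f (LBr s t) = LBr (lie_subst f s) (lie_subst f t)"

lemma lie_subst_terms:
  "t \<in> lie_terms X \<Longrightarrow> (\<And>x. x \<in> X \<Longrightarrow> f x \<in> lie_terms Y) \<Longrightarrow> lie_subst f t \<in> lie_terms Y"
  by (induction t) auto

lemma lie_subst_eq: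
  assumes "lie_eq X R s t" and f: "\<And>x. x \<in> X \<Longrightarrow> f x \<in> lie_terms Y"
    and R: "\<And>r. r \<in> R \<Longrightarrow> r \<in> lie_terms X \<Longrightarrow> lie_eq Y S (lie_subst f r) LZero"
  shows "lie_eq Y S (lie_subst f s) (lie_subst f t)"
  using assms(1)
proof (induction rule: lie_eq.induct)
  case (sym s t)
  show ?case by (rule lie_eq.sym[OF sym.IH])
next
  case (trans s t u)
  show ?case by (rule lie_eq.trans[OF trans.IH])
next
  case (add_neg t)
  then have "lie_subst f t \<in> lie_terms Y" using lie_subst_terms[of _ X f Y] f by blast
  then show ?case using lie_eq.add_neg by simp
qed (use lie_subst_terms[of _ X f Y] f R in \<open>auto intro: lie_eq.intros(1,4-)\<close>)

lemma lie_subst_homogeneous: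
  assumes "homogeneous d n t" "t \<in> lie_terms X" "\<And>x. x \<in> X \<Longrightarrow> homogeneous e (d x) (f x)"
  shows "homogeneous e n (lie_subst f t)"
  using assms by (induction rule: homogeneous.induct) (auto intro: homogeneous.intros)

section \<open>Isomorphisms and free products\<close>

lemma graded_lie_iso_trans:
  assumes "L \<cong>\<^sub>L M" "M \<cong>\<^sub>L N"
  shows "L \<cong>\<^sub>L N"
proof -
  obtain f g where f: "f \<in> graded_lie_hom L M" "bij_betw f (carrier L) (carrier M)" "\<And>n. f ` deg L n = deg M n"
    and g: "g \<in> graded_lie_hom M N" "bij_betw g (carrier M) (carrier N)" "\<And>n. g ` deg M n = deg N n"
    using assms unfolding graded_lie_iso_def by metis
  have fc: "f x \<in> carrier M" if "x \<in> carrier L" for x using f(1) that by (auto simp: graded_lie_hom_def)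
  have d: "(g \<circ> f) ` deg L n = deg N n" for n by (simp only: image_comp[symmetric] f(3) g(3))
  moreover have "g \<circ> f \<in> graded_lie_hom L N"
    unfolding graded_lie_hom_def mem_Collect_eq
  proof (intro conjI)
    show "\<forall>n. (g \<circ> f) ` deg L n \<subseteq> deg N n" using d by blast
  qed (use f(1) g(1) fc in \<open>auto simp: graded_lie_hom_def\<close>)
  ultimately show ?thesis unfolding graded_lie_iso_def using bij_betw_trans[OF f(2) g(2)] by blast
qed

lemma lie_subst_inverse:
  assumes "\<And>x. x \<in> X \<Longrightarrow> lie_eq X R (lie_subst \<tau> (\<sigma> x)) (LGen x)" "t \<in> lie_terms X"
  shows "lie_eq X R (lie_subst \<tau> (lie_subst \<sigma> t)) t"
  using assms(2) by (induction t) (auto intro: assms(1) lie_eq.add_cong lie_eq.smul_cong lie_eq.br_cong lie_eq.refl)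

lemma presented_lie_smult:
  "t \<in> lie_terms X \<Longrightarrow> c \<odot>\<^bsub>presented_lie X d R\<^esub> lie_class X R t = lie_class X R (LSmul c t)"
  by (rule presented_lie_class(2)[where s = LZero]) simp_all

lemma lie_subst_class:
  assumes "t \<in> lie_terms X" "\<And>x. x \<in> X \<Longrightarrow> f x \<in> lie_terms Y"
  shows "lie_class Y S (lie_subst f t) = lie_eval (presented_lie Y d S) (\<lambda>x. lie_class Y S (f x)) t"
proof -
  have m: "lie_subst f s \<in> lie_terms Y" if "s \<in> lie_terms X" for s by (rule lie_subst_terms[OF that assms(2)])
  show ?thesis using assms(1)
    by (induction t) (simp_all add: m presented_lie_class(1,3)[symmetric, where d = d]
        presented_lie_smult[symmetric, where d = d] presented_lie_zero)
qed

text \<open>Two substitutions that respect the relators and are inverse to each other modulo them.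
  Homogeneity in both directions gives surjectivity in each degree.\<close>

lemma presented_lie_iso:
  assumes \<sigma>: "\<And>x. x \<in> X \<Longrightarrow> \<sigma> x \<in> lie_terms Y" "\<And>x. x \<in> X \<Longrightarrow> homogeneous e (d x) (\<sigma> x)"
    and \<tau>: "\<And>y. y \<in> Y \<Longrightarrow> \<tau> y \<in> lie_terms X" "\<And>y. y \<in> Y \<Longrightarrow> homogeneous d (e y) (\<tau> y)"
    and R: "\<And>r. r \<in> R \<Longrightarrow> r \<in> lie_terms X \<Longrightarrow> lie_eq Y S (lie_subst \<sigma> r) LZero"
    and S: "\<And>r. r \<in> S \<Longrightarrow> r \<in> lie_terms Y \<Longrightarrow> lie_eq X R (lie_subst \<tau> r) LZero"
    and \<tau>\<sigma>: "\<And>x. x \<in> X \<Longrightarrow> lie_eq X R (lie_subst \<tau> (\<sigma> x)) (LGen x)"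
    and \<sigma>\<tau>: "\<And>y. y \<in> Y \<Longrightarrow> lie_eq Y S (lie_subst \<sigma> (\<tau> y)) (LGen y)"
  shows "presented_lie X d R \<cong>\<^sub>L presented_lie Y e S"
proof -
  define h where "h A = lie_class Y S (lie_subst \<sigma> (SOME t. t \<in> lie_terms X \<and> lie_class X R t = A))" for A
  have s\<sigma>: "lie_subst \<sigma> t \<in> lie_terms Y" if "t \<in> lie_terms X" for t by (rule lie_subst_terms[OF that \<sigma>(1)])
  have s\<tau>: "lie_subst \<tau> t \<in> lie_terms X" if "t \<in> lie_terms Y" for t by (rule lie_subst_terms[OF that \<tau>(1)])
  have h: "h (lie_class X R t) = lie_class Y S (lie_subst \<sigma> t)" if t: "t \<in> lie_terms X" for t
  proof -
    have "\<exists>s. s \<in> lie_terms X \<and> lie_class X R s = lie_class X R t" using t by blast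
    from someI_ex[OF this] have s: "(SOME s. s \<in> lie_terms X \<and> lie_class X R s = lie_class X R t) \<in> lie_terms X"
      "lie_class X R (SOME s. s \<in> lie_terms X \<and> lie_class X R s = lie_class X R t) = lie_class X R t" by blast+
    have "lie_eq X R (SOME s. s \<in> lie_terms X \<and> lie_class X R s = lie_class X R t) t"
      using s(2) unfolding lie_class_eq_iff[OF s(1)] .
    then show ?thesis unfolding h_def by (intro lie_class_eqI lie_subst_eq[OF _ \<sigma>(1) R])
  qed
  have d: "h ` deg (presented_lie X d R) n = deg (presented_lie Y e S) n" for n
  proof (intro equalityI subsetI)
    fix A assume "A \<in> h ` deg (presented_lie X d R) n"
    then obtain t where t: "t \<in> lie_terms X" "homogeneous d n t" "A = lie_class Y S (lie_subst \<sigma> t)"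
      by (auto simp: presented_lie_carrier h)
    then show "A \<in> deg (presented_lie Y e S) n"
      using s\<sigma>[OF t(1)] lie_subst_homogeneous[OF t(2,1) \<sigma>(2)] by (auto simp: presented_lie_carrier)
  next
    fix A assume "A \<in> deg (presented_lie Y e S) n"
    then obtain t where t: "t \<in> lie_terms Y" "homogeneous e n t" "A = lie_class Y S t"
      by (auto simp: presented_lie_carrier)
    have "A = h (lie_class X R (lie_subst \<tau> t))"
      unfolding h[OF s\<tau>[OF t(1)]] t(3) by (rule lie_class_eqI[OF lie_eq.sym[OF lie_subst_inverse[OF \<sigma>\<tau> t(1)]]])
    then show "A \<in> h ` deg (presented_lie X d R) n"
      using s\<tau>[OF t(1)] lie_subst_homogeneous[OF t(2,1) \<tau>(2)] by (auto simp: presented_lie_carrier)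
  qed
  have "h \<in> graded_lie_hom (presented_lie X d R) (presented_lie Y e S)"
    using d s\<sigma> by (auto simp: graded_lie_hom_def presented_lie_carrier(1) presented_lie_class(1,3) presented_lie_smult h)
  moreover have "bij_betw h (carrier (presented_lie X d R)) (carrier (presented_lie Y e S))"
    unfolding bij_betw_def presented_lie_carrier(1)
  proof (intro conjI)
    show "inj_on h (lie_class X R ` lie_terms X)"
    proof (rule inj_onI)
    fix A B assume "A \<in> lie_class X R ` lie_terms X" "B \<in> lie_class X R ` lie_terms X" "h A = h B"
    then obtain s t where st: "s \<in> lie_terms X" "t \<in> lie_terms X" "A = lie_class X R s" "B = lie_class X R t"
      "lie_class Y S (lie_subst \<sigma> s) = lie_class Y S (lie_subst \<sigma> t)" by (auto simp: h)
    then have "lie_eq Y S (lie_subst \<sigma> s) (lie_subst \<sigma> t)" using lie_class_eq_iff[OF s\<sigma>[OF st(1)]] by blast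
    then have "lie_eq X R (lie_subst \<tau> (lie_subst \<sigma> s)) (lie_subst \<tau> (lie_subst \<sigma> t))" by (rule lie_subst_eq[OF _ \<tau>(1) S])
    then have "lie_eq X R s t"
      using lie_subst_inverse[OF \<tau>\<sigma> st(1)] lie_subst_inverse[OF \<tau>\<sigma> st(2)] by (meson lie_eq.sym lie_eq.trans)
    then show "A = B" unfolding st(3,4) by (rule lie_class_eqI)
    qed
    show "h ` lie_class X R ` lie_terms X = lie_class Y S ` lie_terms Y"
    proof (intro equalityI subsetI)
    fix A assume "A \<in> h ` lie_class X R ` lie_terms X"
    then show "A \<in> lie_class Y S ` lie_terms Y" using s\<sigma> by (auto simp: h)
  next
    fix A assume "A \<in> lie_class Y S ` lie_terms Y"
    then obtain t where t: "t \<in> lie_terms Y" "A = lie_class Y S t" by blast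
    have "A = h (lie_class X R (lie_subst \<tau> t))"
      unfolding h[OF s\<tau>[OF t(1)]] t(2) by (rule lie_class_eqI[OF lie_eq.sym[OF lie_subst_inverse[OF \<sigma>\<tau> t(1)]]])
    then show "A \<in> h ` lie_class X R ` lie_terms X" using s\<tau>[OF t(1)] by blast
    qed
  qed
  ultimately show ?thesis unfolding graded_lie_iso_def using d by blast
qed

text \<open>The abelian Lie algebra \<open>k \<times> k\<close> in degree \<open>1\<close>, transported along an injection \<open>\<iota>\<close>.\<close>

definition plane :: "('k \<times> 'k \<Rightarrow> 'a) \<Rightarrow> ('k::field, 'a) graded_lie"
  where "plane \<iota> = \<lparr>carrier = range \<iota>, monoid.mult = undefined, one = undefined, ring.zero = \<iota> 0,
    ring.add = (\<lambda>x y. \<iota> (inv_into UNIV \<iota> x + inv_into UNIV \<iota> y)),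
    module.smult = (\<lambda>c x. \<iota> (c * fst (inv_into UNIV \<iota> x), c * snd (inv_into UNIV \<iota> x))),
    bracket = (\<lambda>_ _. \<iota> 0), deg = (\<lambda>n. if n = 1 then range \<iota> else {\<iota> 0})\<rparr>"

context
  fixes \<iota> :: "'k::field \<times> 'k \<Rightarrow> 'a"
  assumes \<iota>: "inj \<iota>"
begin

lemma plane_simps:
  "carrier (plane \<iota>) = range \<iota>" "\<zero>\<^bsub>plane \<iota>\<^esub> = \<iota> 0" "\<iota> p \<oplus>\<^bsub>plane \<iota>\<^esub> \<iota> q = \<iota> (p + q)"
  "c \<odot>\<^bsub>plane \<iota>\<^esub> \<iota> p = \<iota> (c * fst p, c * snd p)" "bracket (plane \<iota>) x y = \<iota> 0"
  "deg (plane \<iota>) n = (if n = 1 then range \<iota> else {\<iota> 0})"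
  by (simp_all add: plane_def inv_f_f[OF \<iota>])

lemma plane_group: "abelian_group (plane \<iota>)"
proof (rule abelian_groupI)
  fix x assume "x \<in> carrier (plane \<iota>)"
  then obtain p where p: "x = \<iota> p" by (auto simp: plane_simps)
  have "\<iota> (- p) \<oplus>\<^bsub>plane \<iota>\<^esub> x = \<zero>\<^bsub>plane \<iota>\<^esub>" by (simp add: plane_simps p)
  then show "\<exists>y\<in>carrier (plane \<iota>). y \<oplus>\<^bsub>plane \<iota>\<^esub> x = \<zero>\<^bsub>plane \<iota>\<^esub>" by (intro bexI[of _ "\<iota> (- p)"]) (simp_all add: plane_simps(1))
qed (auto simp: plane_simps ac_simps)

lemma plane_module: "Module.module field_ring (plane \<iota>)"
  using cring_field_ring plane_group
  by (intro Module.module.intro Module.module_axioms.intro) (auto simp: plane_simps algebra_simps)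

lemma plane_finsum:
  assumes "\<And>n. f n \<in> deg (plane \<iota>) n"
  shows "{n. f n \<noteq> \<zero>\<^bsub>plane \<iota>\<^esub>} \<subseteq> {1}" "finsum (plane \<iota>) f {n. f n \<noteq> \<zero>\<^bsub>plane \<iota>\<^esub>} = f 1"
proof -
  interpret abelian_group "plane \<iota>" by (rule plane_group)
  have z: "f n = \<zero>\<^bsub>plane \<iota>\<^esub>" if "n \<noteq> 1" for n using assms[of n] that by (simp add: plane_simps)
  show s: "{n. f n \<noteq> \<zero>\<^bsub>plane \<iota>\<^esub>} \<subseteq> {1}" using z by blast
  have f1: "f 1 \<in> carrier (plane \<iota>)" using assms[of 1] by (simp add: plane_simps)
  show "finsum (plane \<iota>) f {n. f n \<noteq> \<zero>\<^bsub>plane \<iota>\<^esub>} = f 1"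
  proof (cases "f 1 = \<zero>\<^bsub>plane \<iota>\<^esub>")
    case True
    then have "{n. f n \<noteq> \<zero>\<^bsub>plane \<iota>\<^esub>} = {}" using s by blast
    then show ?thesis using True by (simp only: finsum_empty)
  next
    case False
    then have "{n. f n \<noteq> \<zero>\<^bsub>plane \<iota>\<^esub>} = {1}" using s by blast
    then show ?thesis using finsum_insert[of "{}" 1 f] f1 by simp
  qed
qed

lemma plane_graded: "graded_lie_algebra (plane \<iota>)"
proof (intro graded_lie_algebra.intro graded_lie_algebra_axioms.intro plane_module)
  fix n
  have neg: "\<ominus>\<^bsub>plane \<iota>\<^esub> (\<iota> p) = \<iota> (- p)" for p
    by (rule abelian_group.minus_equality[OF plane_group]) (simp_all add: plane_simps)
  show "submodule (deg (plane \<iota>) n) field_ring (plane \<iota>)"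
    by (rule Module.module.submoduleI[OF plane_module])
      (auto simp: plane_simps neg zero_prod_def split: if_splits)
next
  fix x assume x: "x \<in> carrier (plane \<iota>)"
  show "\<exists>!f. (\<forall>n. f n \<in> deg (plane \<iota>) n) \<and> finite {n. f n \<noteq> \<zero>\<^bsub>plane \<iota>\<^esub>} \<and>
      x = finsum (plane \<iota>) f {n. f n \<noteq> \<zero>\<^bsub>plane \<iota>\<^esub>}" (is "\<exists>!f. ?P f")
  proof (rule ex1I)
    let ?f = "\<lambda>n::nat. if n = 1 then x else \<iota> 0"
    have d: "?f n \<in> deg (plane \<iota>) n" for n using x by (simp add: plane_simps)
    show "?P ?f"
      using plane_finsum[OF d] d finite_subset[OF plane_finsum(1)[OF d]] by simp
    fix f assume P: "?P f"
    then have d': "f n \<in> deg (plane \<iota>) n" for n by blast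
    have "x = f 1" using P plane_finsum(2)[OF d'] by simp
    moreover have "f n = \<iota> 0" if "n \<noteq> 1" for n using d'[of n] that by (simp add: plane_simps)
    ultimately show "f = ?f" by auto
  qed
qed (simp_all add: plane_simps zero_prod_def[symmetric])

lemma plane_dimension: "has_dimension (plane \<iota>) 2"
proof -
  interpret abelian_group "plane \<iota>" by (rule plane_group)
  let ?a = "\<iota> (1, 0)" and ?b = "\<iota> (0, 1)"
  have ab: "?a \<noteq> ?b" by (simp add: inj_eq[OF \<iota>])
  have sum: "finsum (plane \<iota>) (\<lambda>b. c b \<odot>\<^bsub>plane \<iota>\<^esub> b) {?a, ?b} = \<iota> (c ?a, c ?b)" for c
    using ab by (simp add: finsum_insert plane_simps zero_prod_def Pi_def)
  have "lie_basis (plane \<iota>) {?a, ?b}"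
    unfolding lie_basis_def
  proof (intro conjI ballI)
    fix x assume "x \<in> carrier (plane \<iota>)"
    then obtain r s where x: "x = \<iota> (r, s)" by (auto simp: plane_simps)
    show "\<exists>!c. (\<forall>b. b \<notin> {?a, ?b} \<longrightarrow> c b = 0) \<and> x = finsum (plane \<iota>) (\<lambda>b. c b \<odot>\<^bsub>plane \<iota>\<^esub> b) {?a, ?b}"
      unfolding sum x
    proof (rule ex1I)
      show "(\<forall>b. b \<notin> {?a, ?b} \<longrightarrow> (if b = ?a then r else if b = ?b then s else 0) = 0) \<and>
          \<iota> (r, s) = \<iota> (if ?a = ?a then r else if ?a = ?b then s else 0, if ?b = ?a then r else if ?b = ?b then s else 0)"
        using ab by auto
      fix c assume "(\<forall>b. b \<notin> {?a, ?b} \<longrightarrow> c b = 0) \<and> \<iota> (r, s) = \<iota> (c ?a, c ?b)"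
      then have "\<forall>b. b \<notin> {?a, ?b} \<longrightarrow> c b = 0" "r = c ?a" "s = c ?b" using injD[OF \<iota>] by blast+
      then show "c = (\<lambda>b. if b = ?a then r else if b = ?b then s else 0)" by auto
    qed
  qed (auto simp: plane_simps)
  then show ?thesis unfolding has_dimension_def using ab by (intro exI[of _ "{?a, ?b}"]) simp
qed

end

text \<open>The multiplication table turned into equations: within the presented algebra the named
  generators add, scale and bracket like the elements that they name.\<close>

lemma table_rules:
  assumes i: "\<forall>n. \<forall>x\<in>deg M n. i (n, x) \<in> G" and S: "table_relators i M \<subseteq> S"
  defines "g n x \<equiv> lie_class G S (LGen (i (n, x)))"
  shows "\<lbrakk>x \<in> deg M n; y \<in> deg M n; x \<oplus>\<^bsub>M\<^esub> y \<in> deg M n\<rbrakk> \<Longrightarrow> g n x \<oplus>\<^bsub>presented_lie G e S\<^esub> g n y = g n (x \<oplus>\<^bsub>M\<^esub> y)"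
    and "\<lbrakk>x \<in> deg M n; c \<odot>\<^bsub>M\<^esub> x \<in> deg M n\<rbrakk> \<Longrightarrow> c \<odot>\<^bsub>presented_lie G e S\<^esub> g n x = g n (c \<odot>\<^bsub>M\<^esub> x)"
    and "\<lbrakk>x \<in> deg M l; y \<in> deg M n; bracket M x y \<in> deg M (l + n)\<rbrakk> \<Longrightarrow>
      bracket (presented_lie G e S) (g l x) (g n y) = g (l + n) (bracket M x y)"
proof -
  interpret F: lie_module "presented_lie G e S" by (rule presented_lie_module)
  have m: "lie_class G S s = lie_class G S t" if "lie_minus s t \<in> table_relators i M" "s \<in> lie_terms G" "t \<in> lie_terms G" for s t
  proof -
    have "lie_eq G S (lie_minus s t) LZero" using that S by (intro lie_eq.relator) (auto simp: lie_minus_def)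
    then have "lie_class G S (LAdd s (LSmul (- 1) t)) = lie_class G S LZero" unfolding lie_minus_def by (rule lie_class_eqI)
    then have "lie_class G S s \<oplus>\<^bsub>presented_lie G e S\<^esub> (- 1) \<odot>\<^bsub>presented_lie G e S\<^esub> lie_class G S t = \<zero>\<^bsub>presented_lie G e S\<^esub>"
      using that by (simp add: presented_lie_class(1) presented_lie_smult presented_lie_zero)
    then show ?thesis using that by (subst (asm) F.minus_eq_iff) (simp_all add: presented_lie_carrier)
  qed
  show "\<lbrakk>x \<in> deg M n; y \<in> deg M n; x \<oplus>\<^bsub>M\<^esub> y \<in> deg M n\<rbrakk> \<Longrightarrow> g n x \<oplus>\<^bsub>presented_lie G e S\<^esub> g n y = g n (x \<oplus>\<^bsub>M\<^esub> y)"
  proof -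
    assume *: "x \<in> deg M n" "y \<in> deg M n" "x \<oplus>\<^bsub>M\<^esub> y \<in> deg M n"
    have "lie_minus (LAdd (LGen (i (n, x))) (LGen (i (n, y)))) (LGen (i (n, x \<oplus>\<^bsub>M\<^esub> y))) \<in> table_relators i M" unfolding table_relators_def using * by blast
    from m[OF this] show ?thesis unfolding g_def using * i by (simp add: presented_lie_class(1,3) presented_lie_smult)
  qed
  show "\<lbrakk>x \<in> deg M n; c \<odot>\<^bsub>M\<^esub> x \<in> deg M n\<rbrakk> \<Longrightarrow> c \<odot>\<^bsub>presented_lie G e S\<^esub> g n x = g n (c \<odot>\<^bsub>M\<^esub> x)"
  proof -
    assume *: "x \<in> deg M n" "c \<odot>\<^bsub>M\<^esub> x \<in> deg M n"
    have "lie_minus (LSmul c (LGen (i (n, x)))) (LGen (i (n, c \<odot>\<^bsub>M\<^esub> x))) \<in> table_relators i M" unfolding table_relators_def using * by blast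
    from m[OF this] show ?thesis unfolding g_def using * i by (simp add: presented_lie_class(1,3) presented_lie_smult)
  qed
  show "\<lbrakk>x \<in> deg M l; y \<in> deg M n; bracket M x y \<in> deg M (l + n)\<rbrakk> \<Longrightarrow>
      bracket (presented_lie G e S) (g l x) (g n y) = g (l + n) (bracket M x y)"
  proof -
    assume *: "x \<in> deg M l" "y \<in> deg M n" "bracket M x y \<in> deg M (l + n)"
    have "lie_minus (LBr (LGen (i (l, x))) (LGen (i (n, y)))) (LGen (i (l + n, bracket M x y))) \<in> table_relators i M" unfolding table_relators_def using * by blast
    from m[OF this] show ?thesis unfolding g_def using * i by (simp add: presented_lie_class(1,3) presented_lie_smult)
  qed
qed

primrec lin_term :: "'x list \<Rightarrow> ('x \<Rightarrow> 'k) \<Rightarrow> ('k, 'x) lie_term" where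
  "lin_term [] a = LZero"
| "lin_term (x # xs) a = LAdd (LSmul (a x) (LGen x)) (lin_term xs a)"

lemma lin_term_in: "set xs \<subseteq> X \<Longrightarrow> lin_term xs a \<in> lie_terms X"
  by (induction xs) auto

lemma lin_term_homogeneous: "homogeneous (\<lambda>_. 1) 1 (lin_term xs a)"
  using homogeneous.intros(1)[of "\<lambda>_. 1 :: nat"] by (induction xs) (auto intro!: homogeneous.intros(2-4))

lemma (in lie_module) lin_term_eval: "lie_eval L f (lin_term xs a) = lin_comb f xs a"
  by (induction xs) simp_all

lemma lie_eval_subst: "lie_eval L f (lie_subst s t) = lie_eval L (\<lambda>x. lie_eval L f (s x)) t"
  by (induction t) simp_all

lemma (in lie_module) lin_comb_cong_fun: "(\<And>x. x \<in> set xs \<Longrightarrow> f x = g x) \<Longrightarrow> lin_comb f xs a = lin_comb g xs a"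
  by (induction xs) simp_all

lemma (in lie_module) add_neg_cancel:
  "x \<in> carrier L \<Longrightarrow> y \<in> carrier L \<Longrightarrow> (x \<oplus> y) \<oplus> (- 1) \<odot>\<^bsub>L\<^esub> y = x"
  "x \<in> carrier L \<Longrightarrow> y \<in> carrier L \<Longrightarrow> (x \<oplus> (- 1) \<odot>\<^bsub>L\<^esub> y) \<oplus> y = x"
  using smult_neg[of y] a_comm[of y "(- 1) \<odot>\<^bsub>L\<^esub> y"] by (simp_all add: a_assoc smult_simps(5))

section \<open>Bestvina-Brady Lie algebras with a quadratic relator\<close>

declare One_nat_def [simp del]

lemma lin_subst: "lin F (lie_subst u t) = lin (\<lambda>x. lin F (u x)) t"
  by (induction t) simp_all

lemma quad_subst:
  "quad F G (lie_subst u t) = quad (\<lambda>x. lin F (u x)) (\<lambda>x. lin G (u x)) t + lin (\<lambda>x. quad F G (u x)) t"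
  by (induction t) (simp_all add: lin_subst algebra_simps)

lemma bb_lie_hom_class:
  assumes "t \<in> lie_terms V"
  shows "bb_lie_hom V E (lie_class V (raag_lie_relators E) t) = lin (\<lambda>_. 1) (t :: ('k::field, 'v) lie_term)"
proof -
  let ?h = "bb_lie_hom V E :: ('k, 'v) lie_term set \<Rightarrow> 'k" and ?L = "raag_lie V E :: ('k, _) graded_lie"
    and ?c = "lie_class V (raag_lie_relators E) :: ('k, 'v) lie_term \<Rightarrow> _"
  interpret lie_module ?L unfolding raag_lie_def by (rule presented_lie_module)
  note p = presented_lie_class[where d = "\<lambda>_. 1" and R = "raag_lie_relators E" and X = V, folded raag_lie_def]
  have car: "?c s \<in> carrier ?L" if "s \<in> lie_terms V" for s
    using that by (simp add: raag_lie_def presented_lie_carrier)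
  have H: "?h \<in> graded_lie_hom ?L ground_lie" by (rule bb_lie_hom(1))
  have h: "A \<in> carrier ?L \<Longrightarrow> B \<in> carrier ?L \<Longrightarrow> ?h (A \<oplus>\<^bsub>?L\<^esub> B) = ?h A + ?h B"
    "A \<in> carrier ?L \<Longrightarrow> ?h (c \<odot>\<^bsub>?L\<^esub> A) = c * ?h A"
    "A \<in> carrier ?L \<Longrightarrow> B \<in> carrier ?L \<Longrightarrow> ?h (bracket ?L A B) = 0" for A B c
    using H by (simp_all add: graded_lie_hom_def ground_lie_simps)
  show ?thesis using assms
  proof (induction t)
    case LZero
    have "?c LZero \<in> carrier ?L" by (rule car) simp
    then have "?h (0 \<odot>\<^bsub>?L\<^esub> ?c LZero) = 0" using h(2) by simp
    then show ?case by (simp add: smult_simps(6)[OF \<open>?c LZero \<in> carrier ?L\<close>]) (simp add: raag_lie_def presented_lie_zero)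
  qed (use bb_lie_hom(2)[of _ V E] in \<open>simp_all add: p[symmetric] h car\<close>)
qed

lemma bb_lie_simps:
  "carrier (bb_lie V E :: ('k::field, _) graded_lie) =
    lie_class V (raag_lie_relators E) ` {t \<in> lie_terms V. lin (\<lambda>_. 1) t = 0}"
  "x \<oplus>\<^bsub>bb_lie V E\<^esub> y = x \<oplus>\<^bsub>raag_lie V E\<^esub> y"
  "c \<odot>\<^bsub>bb_lie V E\<^esub> x = c \<odot>\<^bsub>raag_lie V E\<^esub> x"
  "bracket (bb_lie V E) x y = bracket (raag_lie V E) x y"
  "deg (bb_lie V E) n = deg (raag_lie V E) n \<inter> carrier (bb_lie V E)"
proof -
  have "carrier (bb_lie V E :: ('k, _) graded_lie) =
      {A \<in> lie_class V (raag_lie_relators E) ` lie_terms V. bb_lie_hom V E A = 0}"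
    by (simp add: bb_lie_def Let_def a_kernel_def' raag_lie_def presented_lie_carrier ground_lie_simps)
  also have "\<dots> = lie_class V (raag_lie_relators E) ` {t \<in> lie_terms V. lin (\<lambda>_. 1) t = 0}"
    unfolding Compr_image_eq by (rule arg_cong[where f = "(`) _"]) (auto simp: bb_lie_hom_class)
  finally show "carrier (bb_lie V E :: ('k, _) graded_lie) = \<dots>" .
qed (simp_all add: bb_lie_def Let_def)

lemma sum_cyclic:
  assumes "0 < m" shows "(\<Sum>i<m. f (Suc i mod m)) = (\<Sum>i<m. f i :: 'a::comm_monoid_add)"
proof -
  obtain n where m: "m = Suc n" using assms by (cases m) auto
  have "(\<Sum>i<m. f (Suc i mod m)) = (\<Sum>i<n. f (Suc i)) + f 0" unfolding m by simp
  also have "\<dots> = (\<Sum>i<m. f i)" unfolding m sum.lessThan_Suc_shift by (rule add.commute)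
  finally show ?thesis .
qed

text \<open>\<open>\<phi>\<close> is the isomorphism onto the one-relator algebra. Functionals live
  on terms, so both directions are lifted to terms: \<open>T\<close> takes the kernel to terms over
  \<open>X\<close>, and \<open>u\<close> takes generators in \<open>X\<close> to kernel terms of
  degree 1.\<close>

locale one_relator_bb =
  fixes V :: "'v set" and E :: "'v set set" and X :: "'x set" and r :: "('k::field, 'x) lie_term"
    and \<phi> :: "('k, 'v) lie_term set \<Rightarrow> ('k, 'x) lie_term set"
  assumes finite_V: "finite V" and graph: "simplicial_graph V E" and finite_X: "finite X"
    and r_in: "r \<in> lie_terms X" and r_hom: "homogeneous (\<lambda>_. 1) 2 r" and r_nz: "\<not> lie_eq X {} r LZero"
    and phi: "\<phi> \<in> graded_lie_hom (bb_lie V E) (presented_lie X (\<lambda>_. 1) {r})"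
    and bij: "bij_betw \<phi> (carrier (bb_lie V E)) (carrier (presented_lie X (\<lambda>_. 1) {r}))"
    and phi_deg: "\<And>n. \<phi> ` deg (bb_lie V E) n = deg (presented_lie X (\<lambda>_. 1) {r}) n"
begin

abbreviation eqV :: "('k, 'v) lie_term \<Rightarrow> ('k, 'v) lie_term \<Rightarrow> bool" where "eqV \<equiv> lie_eq V (raag_lie_relators E)"
abbreviation "eqX \<equiv> lie_eq X {r}"
abbreviation clV :: "('k, 'v) lie_term \<Rightarrow> ('k, 'v) lie_term set" where "clV \<equiv> lie_class V (raag_lie_relators E)"
abbreviation "clX \<equiv> lie_class X {r}"
abbreviation "P \<equiv> presented_lie X (\<lambda>_. 1) {r}"
abbreviation "L \<equiv> raag_lie V E :: ('k, ('k, 'v) lie_term set) graded_lie"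

definition KT :: "('k, 'v) lie_term set" where "KT = {t \<in> lie_terms V. lin (\<lambda>_. 1) t = 0}"

lemma KT_simps [simp]:
  "LZero \<in> KT" "s \<in> KT \<Longrightarrow> t \<in> KT \<Longrightarrow> LAdd s t \<in> KT" "s \<in> KT \<Longrightarrow> LSmul c s \<in> KT"
  "LBr s' t' \<in> KT \<longleftrightarrow> s' \<in> lie_terms V \<and> t' \<in> lie_terms V"
  by (simp_all add: KT_def)

lemma KT_terms: "s \<in> KT \<Longrightarrow> s \<in> lie_terms V" by (simp add: KT_def)

sublocale LV: lie_module L unfolding raag_lie_def by (rule presented_lie_module)
sublocale LX: lie_module P by (rule presented_lie_module)

lemma clV_in: "s \<in> lie_terms V \<Longrightarrow> clV s \<in> carrier L"
  by (simp add: raag_lie_def presented_lie_carrier)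

lemma clV_simps:
  "clV LZero = \<zero>\<^bsub>L\<^esub>"
  "s \<in> lie_terms V \<Longrightarrow> t \<in> lie_terms V \<Longrightarrow> clV (LAdd s t) = clV s \<oplus>\<^bsub>L\<^esub> clV t"
  "s \<in> lie_terms V \<Longrightarrow> clV (LSmul c s) = c \<odot>\<^bsub>L\<^esub> clV s"
  "s \<in> lie_terms V \<Longrightarrow> t \<in> lie_terms V \<Longrightarrow> clV (LBr s t) = bracket L (clV s) (clV t)"
  by (simp_all add: raag_lie_def presented_lie_class presented_lie_zero)

lemma clX_simps:
  "clX LZero = \<zero>\<^bsub>P\<^esub>"
  "s \<in> lie_terms X \<Longrightarrow> t \<in> lie_terms X \<Longrightarrow> clX (LAdd s t) = clX s \<oplus>\<^bsub>P\<^esub> clX t"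
  "s \<in> lie_terms X \<Longrightarrow> clX (LSmul c s) = c \<odot>\<^bsub>P\<^esub> clX s"
  "s \<in> lie_terms X \<Longrightarrow> t \<in> lie_terms X \<Longrightarrow> clX (LBr s t) = bracket P (clX s) (clX t)"
  by (simp_all add: presented_lie_class presented_lie_zero)

lemma eqV_iff: "s \<in> lie_terms V \<Longrightarrow> eqV s t \<longleftrightarrow> clV s = clV t"
  by (rule lie_class_eq_iff[THEN HOL.sym])

lemma eqX_iff: "s \<in> lie_terms X \<Longrightarrow> eqX s t \<longleftrightarrow> clX s = clX t"
  by (rule lie_class_eq_iff[THEN HOL.sym])

lemma bb_carrier: "carrier (bb_lie V E :: ('k, ('k, 'v) lie_term set) graded_lie) = clV ` KT"
  unfolding bb_lie_simps(1) KT_def by (rule HOL.refl)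

lemma phi_simps:
  "s \<in> KT \<Longrightarrow> t \<in> KT \<Longrightarrow> \<phi> (clV (LAdd s t)) = \<phi> (clV s) \<oplus>\<^bsub>P\<^esub> \<phi> (clV t)"
  "s \<in> KT \<Longrightarrow> \<phi> (clV (LSmul c s)) = c \<odot>\<^bsub>P\<^esub> \<phi> (clV s)"
  "s \<in> KT \<Longrightarrow> t \<in> KT \<Longrightarrow> \<phi> (clV (LBr s t)) = bracket P (\<phi> (clV s)) (\<phi> (clV t))"
  "s \<in> KT \<Longrightarrow> \<phi> (clV s) \<in> carrier P"
  using phi unfolding graded_lie_hom_def bb_carrier bb_lie_simps(2-4)
  by (auto simp: clV_simps KT_terms)

lemma phi_zero: "\<phi> (clV LZero) = \<zero>\<^bsub>P\<^esub>"
proof -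
  have "clV LZero = clV (LSmul 0 LZero)" by (simp add: clV_simps LV.smult_simps)
  then show ?thesis using phi_simps(2)[of LZero 0] phi_simps(4)[of LZero] by (simp add: LX.smult_simps)
qed

definition T :: "('k, 'v) lie_term \<Rightarrow> ('k, 'x) lie_term"
  where "T s = (SOME t. t \<in> lie_terms X \<and> clX t = \<phi> (clV s))"

lemma T: assumes "s \<in> KT" shows "T s \<in> lie_terms X" "clX (T s) = \<phi> (clV s)"
proof -
  have "\<exists>t. t \<in> lie_terms X \<and> clX t = \<phi> (clV s)"
    using phi_simps(4)[OF assms] by (auto simp: presented_lie_carrier)
  from someI_ex[OF this] show "T s \<in> lie_terms X" "clX (T s) = \<phi> (clV s)" unfolding T_def by blast+
qed

lemma phi_inj: "s \<in> KT \<Longrightarrow> t \<in> KT \<Longrightarrow> \<phi> (clV s) = \<phi> (clV t) \<Longrightarrow> eqV s t"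
  using bij unfolding bij_betw_def bb_carrier inj_on_def by (auto simp: eqV_iff KT_terms)

lemma T_rules:
  "s \<in> KT \<Longrightarrow> eqV s t \<Longrightarrow> t \<in> KT \<Longrightarrow> eqX (T s) (T t)"
  "s \<in> KT \<Longrightarrow> t \<in> KT \<Longrightarrow> eqX (T (LAdd s t)) (LAdd (T s) (T t))"
  "s \<in> KT \<Longrightarrow> eqX (T (LSmul c s)) (LSmul c (T s))"
  "s \<in> KT \<Longrightarrow> t \<in> KT \<Longrightarrow> eqX (T (LBr s t)) (LBr (T s) (T t))"
     apply (simp add: eqX_iff T eqV_iff KT_terms)
    apply (subst eqX_iff, simp add: T, simp only: T clX_simps phi_simps KT_simps)
   apply (subst eqX_iff, simp add: T, simp only: T clX_simps phi_simps KT_simps)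
  apply (subst eqX_iff, simp add: T KT_terms, simp only: T clX_simps phi_simps KT_simps KT_terms)
  done

definition u :: "'x \<Rightarrow> ('k, 'v) lie_term"
  where "u x = (SOME s. s \<in> KT \<and> homogeneous (\<lambda>_. 1) 1 s \<and> \<phi> (clV s) = clX (LGen x))"

lemma u:
  assumes "x \<in> X"
  shows "u x \<in> KT" "homogeneous (\<lambda>_. 1) 1 (u x)" "\<phi> (clV (u x)) = clX (LGen x)"
proof -
  have "homogeneous (\<lambda>_. 1) 1 (LGen x)" using homogeneous.intros(1)[of "\<lambda>_. 1" x] by simp
  then have "clX (LGen x) \<in> deg P 1" using assms by (auto simp: presented_lie_carrier)
  then have "clX (LGen x) \<in> \<phi> ` (deg L 1 \<inter> clV ` KT)" unfolding phi_deg[symmetric] bb_lie_simps(5) bb_carrier .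
  then obtain A where A: "A \<in> deg L 1" "A \<in> clV ` KT" "clX (LGen x) = \<phi> A" by blast
  then obtain s t where s: "s \<in> lie_terms V" "homogeneous (\<lambda>_. 1) 1 s" "A = clV s" and t: "t \<in> KT" "A = clV t"
    by (auto simp: raag_lie_def presented_lie_carrier)
  \<comment> \<open>The degree provides a homogeneous representative \<open>s\<close>, the kernel
    another representative \<open>t\<close>. Invariance of \<open>lin\<close> under the relations
    shows that \<open>s\<close> lies in \<open>KT\<close> as well.\<close>
  have "eqV s t" using s t by (simp add: eqV_iff)
  then have "lin (\<lambda>_. 1) s = lin (\<lambda>_. 1) t" by (rule lin_eq) (auto simp: raag_lie_relators_def)
  then have "s \<in> KT" using s t by (simp add: KT_def)
  then have "\<exists>s. s \<in> KT \<and> homogeneous (\<lambda>_. 1) 1 s \<and> \<phi> (clV s) = clX (LGen x)" using s A by metis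
  from someI_ex[OF this] show "u x \<in> KT" "homogeneous (\<lambda>_. 1) 1 (u x)" "\<phi> (clV (u x)) = clX (LGen x)"
    unfolding u_def by blast+
qed

lemma subst_u: "t \<in> lie_terms X \<Longrightarrow> lie_subst u t \<in> KT \<and> \<phi> (clV (lie_subst u t)) = clX t"
  by (induction t) (simp_all add: u phi_zero phi_simps clX_simps KT_terms)

lemma subst_T: "s \<in> KT \<Longrightarrow> eqV s (lie_subst u (T s))"
  using subst_u[OF T(1)] T(2) by (intro phi_inj) auto

lemma subst_r: "eqV (lie_subst u r) LZero"
proof -
  have "eqX r LZero" by (rule lie_eq.relator) (use r_in in auto)
  then have "clX r = \<zero>\<^bsub>P\<^esub>" using r_in by (simp add: eqX_iff clX_simps)
  then show ?thesis using subst_u[OF r_in] phi_zero by (intro phi_inj) auto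
qed

lemma lin_T: "s \<in> KT \<Longrightarrow> lin (\<lambda>x. lin F (u x)) (T s) = lin F s"
proof -
  assume s: "s \<in> KT"
  have "lin F s = lin F (lie_subst u (T s))"
    by (rule lin_eq[OF subst_T[OF s]]) (auto simp: raag_lie_relators_def)
  then show ?thesis by (simp add: lin_subst)
qed

text \<open>The condition on edges says that \<open>F\<close> and \<open>G\<close> define a
  Heisenberg representation of the RAAG Lie algebra, and there the substituted relator vanishes. The
  linear part of the substitution formula drops out because \<open>r\<close> has degree 2.\<close>

lemma quad_r:
  assumes "\<And>v w. {v, w} \<in> E \<Longrightarrow> F v * G w = F w * G v"
  shows "quad (\<lambda>x. lin F (u x)) (\<lambda>x. lin G (u x)) r = 0"
proof -
  have "1 * quad F G (lie_subst u r) + 0 * quad F G (lie_subst u r) = 1 * quad F G LZero + 0 * quad F G LZero"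
    by (rule quad_eq[OF subst_r]) (auto simp: raag_lie_relators_def intro: assms)
  then show ?thesis using homogeneous_functionals(1)[OF r_hom, of "\<lambda>x. quad F G (u x)"] by (simp add: quad_subst)
qed

lemma lin_r: "lin \<alpha> r = 0"
  using homogeneous_functionals(1)[OF r_hom] by simp

text \<open>Linear functionals on the one-relator algebra, as functions on terms. Composed with
  \<open>T\<close> they become functionals on the kernel.\<close>

definition linf :: "(('k, 'x) lie_term \<Rightarrow> 'k) \<Rightarrow> bool"
  where "linf G \<longleftrightarrow> (\<forall>s t. G (LAdd s t) = G s + G t) \<and> (\<forall>c s. G (LSmul c s) = c * G s) \<and>
    (\<forall>s t. eqX s t \<longrightarrow> G s = G t)"

text \<open>\<open>lin\<close> and \<open>cub\<close> kill the relator for reasons of degree. A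
  cubic functional therefore only requires that the two neighbouring products vanish on the
  relator.\<close>

lemma linf_functionals:
  "linf (lin \<alpha>)"
  "a * quad \<alpha> \<beta> r + b * quad \<gamma> \<delta> r = 0 \<Longrightarrow> linf (\<lambda>t. a * quad \<alpha> \<beta> t + b * quad \<gamma> \<delta> t)"
  "quad \<alpha> \<beta> r = 0 \<Longrightarrow> linf (quad \<alpha> \<beta>)"
  "quad \<alpha> \<beta> r = 0 \<Longrightarrow> quad \<beta> \<gamma> r = 0 \<Longrightarrow> linf (cub \<alpha> \<beta> \<gamma>)"
proof -
  show "linf (lin \<alpha>)" unfolding linf_def using lin_eq[of X "{r}" _ _ \<alpha>] lin_r by auto
  have q: "linf (\<lambda>t. a * quad \<alpha> \<beta> t + b * quad \<gamma> \<delta> t)" if "a * quad \<alpha> \<beta> r + b * quad \<gamma> \<delta> r = 0" for a b \<alpha> \<beta> \<gamma> \<delta>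
    unfolding linf_def
  proof (intro conjI allI impI)
    fix s t assume "eqX s t"
    then show "a * quad \<alpha> \<beta> s + b * quad \<gamma> \<delta> s = a * quad \<alpha> \<beta> t + b * quad \<gamma> \<delta> t"
      by (rule quad_eq) (use that lin_r in auto)
  qed (simp_all add: algebra_simps)
  then show "linf (\<lambda>t. a * quad \<alpha> \<beta> t + b * quad \<gamma> \<delta> t)" if "a * quad \<alpha> \<beta> r + b * quad \<gamma> \<delta> r = 0" using that .
  show "linf (quad \<alpha> \<beta>)" if "quad \<alpha> \<beta> r = 0" using q[of 1 \<alpha> \<beta> 0 \<alpha> \<beta>] that by simp
  show "linf (cub \<alpha> \<beta> \<gamma>)" if "quad \<alpha> \<beta> r = 0" "quad \<beta> \<gamma> r = 0"
    unfolding linf_def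
  proof (intro conjI allI impI)
    fix s t assume "eqX s t"
    then show "cub \<alpha> \<beta> \<gamma> s = cub \<alpha> \<beta> \<gamma> t"
      by (rule cub_eq) (use that lin_r homogeneous_functionals(3)[OF r_hom] in auto)
  qed simp_all
qed

lemma linfD:
  assumes "linf G"
  shows "s \<in> KT \<Longrightarrow> eqV s t \<Longrightarrow> t \<in> KT \<Longrightarrow> G (T s) = G (T t)"
    and "s \<in> KT \<Longrightarrow> t \<in> KT \<Longrightarrow> G (T (LAdd s t)) = G (T s) + G (T t)"
    and "s \<in> KT \<Longrightarrow> G (T (LSmul c s)) = c * G (T s)"
    and "s \<in> KT \<Longrightarrow> t \<in> KT \<Longrightarrow> G (T (LBr s t)) = G (LBr (T s) (T t))"
  using assms T_rules(1,2,4)[of s t] T_rules(3)[of s c] unfolding linf_def by metis+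

lemma linf_zero: assumes "linf G" shows "G (T LZero) = 0"
proof -
  have "eqV LZero (LSmul 0 LZero)" by (simp add: eqV_iff clV_simps LV.smult_simps)
  then show ?thesis using linfD(1)[OF assms, of LZero "LSmul 0 LZero"] linfD(3)[OF assms, of LZero 0] by simp
qed

abbreviation pr :: "'v \<Rightarrow> 'v \<Rightarrow> ('k, 'v) lie_term"
  where "pr v0 v \<equiv> LAdd (LGen v) (LSmul (- 1) (LGen v0))"

lemma pr_in: "v0 \<in> V \<Longrightarrow> v \<in> V \<Longrightarrow> pr v0 v \<in> KT"
  by (simp add: KT_def)

abbreviation Q :: "('x \<Rightarrow> 'k) \<Rightarrow> ('x \<Rightarrow> 'k) \<Rightarrow> 'k" where "Q \<alpha> \<beta> \<equiv> quad \<alpha> \<beta> r"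

text \<open>Otherwise the normal form in degree 2 would make \<open>r\<close> zero already in the
  free Lie algebra.\<close>

lemma Q_nonzero: "\<exists>i\<in>X. \<exists>j\<in>X. Q (delta i) (delta j) \<noteq> 0"
proof (rule ccontr)
  assume n: "\<not> ?thesis"
  let ?F = "presented_lie X (\<lambda>_. 1) {} :: ('k, ('k, 'x) lie_term set) graded_lie"
  interpret F: lie_module ?F by (rule presented_lie_module)
  obtain xs where xs: "distinct xs" "set xs = X" using finite_distinct_list[OF finite_X] by blast
  have c: "lie_class X {} (LGen x) \<in> carrier ?F" if "x \<in> set xs" for x
    using that xs by (simp add: presented_lie_carrier)
  have "lie_class X {} r = lie_eval ?F (\<lambda>x. lie_class X {} (LGen x)) r"
    by (rule presented_lie_eval[OF r_in, THEN HOL.sym])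
  also have "\<dots> = F.quad_comb (\<lambda>x. lie_class X {} (LGen x)) xs (\<lambda>x y. Q (delta x) (delta y))"
    by (rule F.lie_eval_degree_2[OF c xs(1) r_hom HOL.refl]) (use r_in xs in auto)
  also have "\<dots> = F.quad_comb (\<lambda>x. lie_class X {} (LGen x)) xs (\<lambda>_ _. 0)"
    by (rule F.quad_comb_cong) (use n xs in blast)
  also have "\<dots> = \<zero>\<^bsub>?F\<^esub>" by (rule F.quad_comb_simps(4)[OF c])
  finally have "lie_eq X {} r LZero" using lie_class_eq_iff[OF r_in, of "{}" LZero] by (simp add: presented_lie_zero)
  then show False using r_nz by simp
qed

lemma V_nonempty: "V \<noteq> {}"
proof
  assume V: "V = {}"
  obtain x where x: "x \<in> X" using Q_nonzero by blast
  have "s \<in> lie_terms V \<Longrightarrow> clV s = \<zero>\<^bsub>L\<^esub>" for s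
  proof (induction s)
    case (LGen x)
    then show ?case using V by simp
  qed (simp_all add: clV_simps LV.smult_simps LV.bracket_zero)
  then have "eqV (u x) LZero" using u(1)[OF x] by (simp add: eqV_iff KT_terms clV_simps)
  then have "lin (\<lambda>_. 1) (T (u x)) = lin (\<lambda>_. 1) (T LZero)"
    by (intro linfD(1)[OF linf_functionals(1)] u(1)[OF x]) auto
  moreover have "eqX (T (u x)) (LGen x)" using T[OF u(1)[OF x]] u(3)[OF x] by (simp add: eqX_iff)
  then have "lin (\<lambda>_. 1) (T (u x)) = (1 :: 'k)" using linf_functionals(1)[of "\<lambda>_. 1"] unfolding linf_def by fastforce
  ultimately show False using linf_zero[OF linf_functionals(1)[of "\<lambda>_. 1"]] by simp
qed

text \<open>Degree 1 of the kernel is spanned by the differences \<open>pr v0 v\<close>, so a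
  functional on \<open>X\<close> is given by values at vertices. This is the Lie counterpart of
  \<open>rat_hom_eval\<close>.\<close>

lemma lin_T_degree_1:
  assumes v0: "v0 \<in> V" and t: "homogeneous (\<lambda>_. 1) 1 t" "t \<in> KT"
  shows "lin \<alpha> (T t) = lin (\<lambda>v. lin \<alpha> (T (pr v0 v))) t"
proof -
  let ?F = "\<lambda>v. lin \<alpha> (T (pr v0 v))" and ?l = "lin (\<lambda>_. 1 :: 'k)"
  note g = linfD[OF linf_functionals(1)[of \<alpha>]] linf_zero[OF linf_functionals(1)[of \<alpha>]]
  have v0c: "clV (LGen v0) \<in> carrier L" using v0 by (intro clV_in) simp
  \<comment> \<open>Subterms need not lie in the kernel. Each is corrected by a multiple of
    \<open>v0\<close>, so that \<open>T\<close> can be applied throughout the induction.\<close>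
  have nk: "LAdd s (LSmul (- ?l s) (LGen v0)) \<in> KT" if "s \<in> lie_terms V" for s
    using that v0 by (simp add: KT_def)
  have *: "lin \<alpha> (T (LAdd s (LSmul (- ?l s) (LGen v0)))) = lin ?F s"
    if "homogeneous (\<lambda>_. 1) n s" "n = 1" "s \<in> lie_terms V" for n s
    using that
  proof (induction rule: homogeneous.induct)
    case (2 n)
    have "eqV (LAdd LZero (LSmul (- ?l LZero) (LGen v0))) LZero"
      using v0 v0c by (simp add: eqV_iff clV_simps LV.smult_simps)
    then show ?case using g(1)[OF nk[of LZero]] g(5) by simp
  next
    case (3 n s t)
    then have m: "s \<in> lie_terms V" "t \<in> lie_terms V" by simp_all
    have e: "- (?l s + ?l t) = - ?l s + - ?l t" by simp
    have "eqV (LAdd (LAdd s t) (LSmul (- ?l s + - ?l t) (LGen v0)))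
        (LAdd (LAdd s (LSmul (- ?l s) (LGen v0))) (LAdd t (LSmul (- ?l t) (LGen v0))))"
      using m v0 v0c clV_in[OF m(1)] clV_in[OF m(2)]
      by (subst eqV_iff, simp, simp only: clV_simps lie_terms_simps LV.smult_simps, simp add: LV.a_ac LV.smult_simps)
    then show ?case using g(1)[OF nk[of "LAdd s t"]] g(2)[OF nk[OF m(1)] nk[OF m(2)]] nk[OF m(1)] nk[OF m(2)] 3 m
      by (simp only: lin.simps e KT_simps lie_terms_simps)
  next
    case (4 n t c)
    then have m: "t \<in> lie_terms V" by simp
    have e: "- (c * ?l t) = c * (- ?l t)" by simp
    have "eqV (LAdd (LSmul c t) (LSmul (c * (- ?l t)) (LGen v0))) (LSmul c (LAdd t (LSmul (- ?l t) (LGen v0))))"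
      using m v0 v0c clV_in[OF m]
      by (subst eqV_iff, simp, simp only: clV_simps lie_terms_simps LV.smult_simps)
    then show ?case using g(1)[OF nk[of "LSmul c t"]] g(3)[OF nk[OF m], of c] nk[OF m] 4 m
      by (simp only: lin.simps e KT_simps lie_terms_simps)
  next
    case (5 m s n t)
    then have m: "s \<in> lie_terms V" "t \<in> lie_terms V" "m = 0 \<or> n = 0" by auto
    have z: "clV s = \<zero>\<^bsub>L\<^esub>" if "homogeneous (\<lambda>_. 1) 0 s" "s \<in> lie_terms V" for s
    proof -
      have "lie_eval L (\<lambda>x. clV (LGen x)) s = \<zero>\<^bsub>L\<^esub>"
        by (rule LV.lie_eval_degree_0[OF that(1) HOL.refl that(2)]) (rule clV_in, simp)
      then show ?thesis using presented_lie_eval[OF that(2), of "\<lambda>_. 1" "raag_lie_relators E"] by (simp add: raag_lie_def)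
    qed
    have "clV (LBr s t) = \<zero>\<^bsub>L\<^esub>"
      using m(3) z[of s] z[of t] 5(1,2) m(1,2) clV_in by (auto simp: clV_simps LV.bracket_zero)
    then have "eqV (LAdd (LBr s t) (LSmul (- ?l (LBr s t)) (LGen v0))) LZero"
      using m(1,2) v0 v0c by (subst eqV_iff) (simp_all add: clV_simps LV.smult_simps)
    then show ?case using g(1)[OF nk[of "LBr s t"]] g(5) m(1,2) by simp
  qed simp
  have "eqV t (LAdd t (LSmul (- ?l t) (LGen v0)))"
    using t(2) v0 v0c clV_in[OF KT_terms[OF t(2)]] by (simp add: eqV_iff clV_simps LV.smult_simps KT_def)
  then have "lin \<alpha> (T t) = lin \<alpha> (T (LAdd t (LSmul (- ?l t) (LGen v0))))"
    by (rule g(1)[OF t(2) _ nk[OF KT_terms[OF t(2)]]])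
  then show ?thesis using *[OF t(1) HOL.refl KT_terms[OF t(2)]] by simp
qed

lemma vertex_functional: "\<exists>F. \<forall>x\<in>X. \<alpha> x = lin F (u x)"
proof -
  obtain v0 where v0: "v0 \<in> V" using V_nonempty by blast
  have "\<alpha> x = lin (\<lambda>v. lin \<alpha> (T (pr v0 v))) (u x)" if x: "x \<in> X" for x
  proof -
    have "eqX (T (u x)) (LGen x)" using T[OF u(1)[OF x]] u(3)[OF x] by (simp add: eqX_iff)
    then have "lin \<alpha> (T (u x)) = \<alpha> x" using linf_functionals(1)[of \<alpha>] unfolding linf_def by fastforce
    then show ?thesis using lin_T_degree_1[OF v0 u(2,1)[OF x], of \<alpha>] by simp
  qed
  then show ?thesis by blast
qed

definition R :: "'v \<Rightarrow> 'v \<Rightarrow> 'k"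
  where "R v w = Q (\<lambda>x. lin (delta v) (u x)) (\<lambda>x. lin (delta w) (u x))"

lemma R_edge: "R v w \<noteq> 0 \<Longrightarrow> {v, w} \<in> E"
proof (rule ccontr)
  assume R: "R v w \<noteq> 0" and n: "{v, w} \<notin> E"
  have "v \<noteq> w" using R by (auto simp: R_def quad_self)
  have "R v w = 0" unfolding R_def
  proof (rule quad_r)
    fix a b assume "{a, b} \<in> E"
    then have "\<not> (a = v \<and> b = w)" "\<not> (b = v \<and> a = w)" using n by (auto simp: insert_commute)
    then show "delta v a * delta w b = (delta v b * delta w a :: 'k)" by (auto simp: delta_def)
  qed
  with R show False by simp
qed

lemma lin_expand: "t \<in> lie_terms V \<Longrightarrow> lin F t = (\<Sum>v\<in>V. F v * lin (delta v) (t :: ('k, 'v) lie_term))"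
proof -
  assume t: "t \<in> lie_terms V"
  have "lin F t = lin (\<lambda>x. \<Sum>v\<in>V. F v * delta v x) t"
    by (rule lin_cong[OF t]) (simp add: delta_def finite_V if_distrib cong: if_cong)
  then show ?thesis by (simp add: lin_sum finite_V)
qed

lemma Q_expand: "Q \<alpha> (\<lambda>x. lin F (u x)) = (\<Sum>v\<in>V. F v * Q \<alpha> (\<lambda>x. lin (delta v) (u x)))"
proof -
  have "Q \<alpha> (\<lambda>x. lin F (u x)) = Q \<alpha> (\<lambda>x. \<Sum>v\<in>V. F v * lin (delta v) (u x))"
    by (rule quad_cong[OF r_in]) (simp_all add: lin_expand[OF KT_terms[OF u(1)]])
  then show ?thesis by (simp add: quad_sum_right finite_V)
qed

lemma cycle_exists:
  "\<exists>xs. distinct xs \<and> 3 \<le> length xs \<and> set xs \<subseteq> V \<and>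
    (\<forall>i<length xs. {xs ! i, xs ! (Suc i mod length xs)} \<in> E)"
proof -
  have swap: "R w v = - R v w" for v w unfolding R_def by (rule quad_swap)
  have row: "(\<Sum>w\<in>V. R v w) = 0" for v
  proof -
    have "(\<Sum>w\<in>V. R v w) = Q (\<lambda>x. lin (delta v) (u x)) (\<lambda>x. lin (\<lambda>_. 1) (u x))"
      unfolding R_def Q_expand[where F = "\<lambda>_. 1"] by simp
    \<comment> \<open>The zero functional is written as an empty linear combination, to which
      \<open>quad_sum_right\<close> applies.\<close>
    also have "\<dots> = Q (\<lambda>x. lin (delta v) (u x)) (\<lambda>_. \<Sum>i\<in>({} :: nat set). 0 * 0)"
      by (rule quad_cong[OF r_in]) (use u(1) in \<open>simp_all add: KT_def\<close>)
    also have "\<dots> = 0" unfolding quad_sum_right[OF finite.emptyI] by simp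
    finally show ?thesis .
  qed
  have "\<exists>a b. R a b \<noteq> 0"
  proof (rule ccontr)
    assume n: "\<not> ?thesis"
    obtain i j where ij: "i \<in> X" "j \<in> X" "Q (delta i) (delta j) \<noteq> 0" using Q_nonzero by blast
    obtain F G where FG: "\<forall>x\<in>X. delta i x = lin F (u x)" "\<forall>x\<in>X. delta j x = lin G (u x)"
      using vertex_functional by metis
    have z: "Q (\<lambda>x. lin (delta v) (u x)) (\<lambda>x. lin G (u x)) = 0" for v
      unfolding Q_expand[of _ G] using n by (simp add: R_def)
    have z': "Q (\<lambda>x. lin G (u x)) (\<lambda>x. lin (delta v) (u x)) = 0" for v
      using quad_swap[of "\<lambda>x. lin G (u x)" "\<lambda>x. lin (delta v) (u x)" r] z[of v] by simp
    have "Q (delta i) (delta j) = Q (\<lambda>x. lin F (u x)) (\<lambda>x. lin G (u x))"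
      by (rule quad_cong[OF r_in]) (use FG in auto)
    also have "\<dots> = - Q (\<lambda>x. lin G (u x)) (\<lambda>x. lin F (u x))" by (rule quad_swap)
    also have "\<dots> = 0" unfolding Q_expand[of _ F] z' by simp
    finally show False using ij by simp
  qed
  then obtain a b where ab: "R a b \<noteq> 0" by blast
  have "\<exists>xs. distinct xs \<and> 3 \<le> length xs \<and> set xs \<subseteq> V \<and>
      (\<forall>i<length xs. R (xs ! i) (xs ! (Suc i mod length xs)) \<noteq> 0)"
  proof (rule antisymmetric_cycle[OF finite_V _ swap _ row ab])
    show "R v w = 0" if "v \<notin> V" for v w
      using that R_edge[of v w] graph unfolding simplicial_graph_def by blast
    show "R v v = 0" for v by (simp add: R_def quad_self)
  qed
  then show ?thesis using R_edge by blast
qed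

end

section \<open>Relations from a cycle in the graph\<close>

context one_relator_bb
begin

text \<open>For adjacent \<open>a\<close> and \<open>b\<close> the bracket of the differences is a
  difference of two brackets with \<open>v0\<close>; this is the form that telescopes around a
  cycle.\<close>

lemma pr_bracket:
  assumes V: "v0 \<in> V" "a \<in> V" "b \<in> V"
  shows "eqV (LBr (LGen v0) (pr v0 a)) (LBr (LGen v0) (LGen a))"
    and "eqV (LBr (pr v0 a) (LGen v0)) (LSmul (- 1) (LBr (LGen v0) (LGen a)))"
    and "{a, b} \<in> E \<Longrightarrow> eqV (LBr (pr v0 a) (pr v0 b))
      (LAdd (LBr (LGen v0) (LGen a)) (LSmul (- 1) (LBr (LGen v0) (LGen b))))"
proof -
  have c: "clV (LGen v0) \<in> carrier L" "clV (LGen a) \<in> carrier L" "clV (LGen b) \<in> carrier L"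
    using V by (simp_all add: clV_in)
  note b = LV.bracket_anti[OF c(2,1)]
  note s = clV_simps LV.bracket_add LV.bracket_smult LV.bracket_same LV.smult_simps LV.bracket_in
  show "eqV (LBr (LGen v0) (pr v0 a)) (LBr (LGen v0) (LGen a))"
    using V c by (simp add: eqV_iff s)
  show "eqV (LBr (pr v0 a) (LGen v0)) (LSmul (- 1) (LBr (LGen v0) (LGen a)))"
    using V c by (simp add: eqV_iff s b)
  assume "{a, b} \<in> E"
  then have "eqV (LBr (LGen a) (LGen b)) LZero"
    using V by (intro lie_eq.relator) (auto simp: raag_lie_relators_def)
  then have "bracket L (clV (LGen a)) (clV (LGen b)) = \<zero>\<^bsub>L\<^esub>"
    using V by (simp add: eqV_iff clV_simps)
  then show "eqV (LBr (pr v0 a) (pr v0 b)) (LAdd (LBr (LGen v0) (LGen a)) (LSmul (- 1) (LBr (LGen v0) (LGen b))))"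
    using V c by (simp add: eqV_iff s b LV.a_ac)
qed

end

locale bb_cycle = one_relator_bb V E X r \<phi>
  for V :: "'v set" and E X and r :: "('k::field, 'x) lie_term" and \<phi> +
  fixes xs :: "'v list"
  assumes distinct: "distinct xs" and len: "3 \<le> length xs" and xs_V: "set xs \<subseteq> V"
    and edge: "\<And>i. i < length xs \<Longrightarrow> {xs ! i, xs ! (Suc i mod length xs)} \<in> E"
begin

abbreviation "m \<equiv> length xs"
abbreviation S where "S i \<equiv> Suc i mod m"
abbreviation "v0 \<equiv> xs ! 0"
abbreviation p where "p i \<equiv> pr v0 (xs ! i)"
definition e :: "('x \<Rightarrow> 'k) \<Rightarrow> nat \<Rightarrow> 'k" where "e \<alpha> i = lin \<alpha> (T (p i))"
text \<open>\<open>v0\<close> lies outside the kernel, but its brackets lie inside, so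
  \<open>T\<close> applies to them.\<close>

definition B :: "nat \<Rightarrow> ('k, 'v) lie_term" where "B i = LBr (LGen v0) (LGen (xs ! i))"
definition K :: "('x \<Rightarrow> 'k) \<Rightarrow> ('x \<Rightarrow> 'k) \<Rightarrow> 'k"
  where "K \<alpha> \<beta> = (\<Sum>i<m. e \<alpha> i * e \<beta> (S i) - e \<alpha> (S i) * e \<beta> i)"
definition vf :: "('v \<Rightarrow> 'k) \<Rightarrow> 'x \<Rightarrow> 'k" where "vf F = (\<lambda>x. lin F (u x))"

lemma m_pos: "0 < m" using len by linarith

lemma S_less: "S i < m" using m_pos by simp

lemma xs_in: "i < m \<Longrightarrow> xs ! i \<in> V" using xs_V by (auto dest: nth_mem)

lemma p_in: "i < m \<Longrightarrow> p i \<in> KT" using m_pos by (intro pr_in xs_in)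

lemma B_in: "i < m \<Longrightarrow> B i \<in> KT" using xs_in m_pos by (simp add: B_def)

lemma step:
  assumes G: "linf G" and i: "i < m"
  shows "G (LBr (T (p i)) (T (p (S i)))) = G (T (B i)) - G (T (B (S i)))"
proof -
  note V = xs_in[OF m_pos] xs_in[OF i] xs_in[OF S_less]
  have k: "LAdd (B i) (LSmul (- 1) (B (S i))) \<in> KT" by (intro KT_simps B_in i S_less)
  have "G (LBr (T (p i)) (T (p (S i)))) = G (T (LBr (p i) (p (S i))))"
    by (rule linfD(4)[OF G, THEN HOL.sym]) (intro p_in i S_less)+
  also have "\<dots> = G (T (LAdd (B i) (LSmul (- 1) (B (S i)))))"
    unfolding B_def by (rule linfD(1)[OF G _ pr_bracket(3)[OF V edge[OF i]] k[unfolded B_def]])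
      (intro KT_simps(4)[THEN iffD2] conjI KT_terms p_in i S_less)
  also have "\<dots> = G (T (B i)) - G (T (B (S i)))"
    using linfD(2)[OF G B_in[OF i] KT_simps(3)[OF B_in[OF S_less]], of "- 1"] linfD(3)[OF G B_in[OF S_less], of "- 1"] by simp
  finally show ?thesis .
qed

lemma cycle_sum:
  assumes G: "linf G" shows "(\<Sum>i<m. G (LBr (T (p i)) (T (p (S i))))) = 0"
proof -
  have "(\<Sum>i<m. G (LBr (T (p i)) (T (p (S i))))) = (\<Sum>i<m. G (T (B i)) - G (T (B (S i))))"
    by (rule sum.cong[OF HOL.refl]) (rule step[OF G], simp)
  also have "\<dots> = 0" unfolding sum_subtractf using sum_cyclic[OF m_pos, of "\<lambda>i. G (T (B i))"] by simp
  finally show ?thesis .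
qed

text \<open>With these coefficients the combination of the two forms vanishes on the relator, so it
  descends to the algebra and may be summed around the cycle.\<close>

lemma Q_K: "Q \<alpha>' \<beta>' * K \<alpha> \<beta> = Q \<alpha> \<beta> * K \<alpha>' \<beta>'"
proof -
  have "linf (\<lambda>t. Q \<alpha>' \<beta>' * quad \<alpha> \<beta> t + (- Q \<alpha> \<beta>) * quad \<alpha>' \<beta>' t)"
    by (rule linf_functionals(2)) simp
  from cycle_sum[OF this] have "Q \<alpha>' \<beta>' * K \<alpha> \<beta> + (- Q \<alpha> \<beta>) * K \<alpha>' \<beta>' = 0"
    unfolding K_def e_def sum_distrib_left sum.distrib[symmetric] by simp
  then show ?thesis by simp
qed

lemma e_vf: assumes "i < m" shows "e (vf F) i = F (xs ! i) - F v0"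
  unfolding e_def vf_def lin_T[OF p_in[OF assms]] by simp

lemma nth_eq: "i < m \<Longrightarrow> j < m \<Longrightarrow> xs ! i = xs ! j \<longleftrightarrow> i = j"
  using distinct by (simp add: nth_eq_iff_index_eq)

lemma S_cases: "i < m \<Longrightarrow> S i = (if Suc i = m then 0 else Suc i)"
  by auto

lemma K_delta: "K (vf (delta (xs ! 1))) (vf (delta (xs ! 2))) = 1"
proof -
  have m: "1 < m" "2 < m" using len by auto
  have e: "e (vf (delta (xs ! j))) i = (if i = j then 1 else 0)" if "i < m" "j < m" "j \<noteq> 0" for i j
    using that m_pos by (simp add: e_vf delta_def nth_eq)
  have "K (vf (delta (xs ! 1))) (vf (delta (xs ! 2))) = (\<Sum>i<m. if i = 1 then 1 else 0)"
    unfolding K_def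
  proof (rule sum.cong[OF HOL.refl])
    fix i assume "i \<in> {..<m}"
    then have i: "i < m" by simp
    show "e (vf (delta (xs ! 1))) i * e (vf (delta (xs ! 2))) (S i) -
        e (vf (delta (xs ! 1))) (S i) * e (vf (delta (xs ! 2))) i = (if i = 1 then 1 else 0)"
      unfolding e[OF i m(1) one_neq_zero] e[OF i m(2) zero_neq_numeral[THEN HOL.not_sym]]
        e[OF S_less m(1) one_neq_zero] e[OF S_less m(2) zero_neq_numeral[THEN HOL.not_sym]]
      unfolding S_cases[OF i]
      using len by auto
  qed
  also have "\<dots> = 1" using m(1) by simp
  finally show ?thesis .
qed

lemma Q_eq: "Q \<alpha> \<beta> = Q (vf (delta (xs ! 1))) (vf (delta (xs ! 2))) * K \<alpha> \<beta>"
  using Q_K[of "vf (delta (xs ! 1))" "vf (delta (xs ! 2))" \<alpha> \<beta>] K_delta by simp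

lemma T_B0: "linf G \<Longrightarrow> G (T (B 0)) = 0"
proof -
  assume G: "linf G"
  have "eqV (B 0) LZero" unfolding B_def by (rule lie_eq.br_self) (use xs_in[OF m_pos] in simp)
  from linfD(1)[OF G B_in[OF m_pos] this] show ?thesis using linf_zero[OF G] by simp
qed

text \<open>The Jacobi identity for \<open>v0\<close> and two consecutive differences
  \<open>p i\<close>, \<open>p (S i)\<close>. One term telescopes as in degree 2; the other two are
  brackets of kernel elements, on which the cubic functional splits into linear and quadratic
  values.\<close>

lemma cub_step:
  assumes \<alpha>: "\<alpha> = vf F" and \<gamma>: "\<gamma> = vf H" and q: "Q \<alpha> \<beta> = 0" "Q \<beta> \<gamma> = 0"
  defines "C i \<equiv> cub \<alpha> \<beta> \<gamma> (T (LBr (LGen v0) (B i)))"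
    and "x i \<equiv> quad \<alpha> \<beta> (T (B i))" and "y i \<equiv> quad \<beta> \<gamma> (T (B i))"
  assumes i: "i < m"
  shows "C i - C (S i) = e \<alpha> i * y (S i) - x (S i) * e \<gamma> i - e \<alpha> (S i) * y i + x i * e \<gamma> (S i)"
proof -
  let ?v = "LGen v0" and ?p = "p i" and ?q = "p (S i)" and ?G = "cub \<alpha> \<beta> \<gamma>"
  have G: "linf ?G" by (rule linf_functionals(4)[OF q])
  note X = linf_functionals(3)[OF q(1)] and Y = linf_functionals(3)[OF q(2)]
  note V = xs_in[OF m_pos] xs_in[OF i] xs_in[OF S_less]
  have v: "?v \<in> lie_terms V" using V by simp
  note pq = p_in[OF i] p_in[OF S_less] and b = B_in[OF i] B_in[OF S_less]
  note t = pq[THEN KT_terms] b[THEN KT_terms] v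
  note [trans] = lie_eq.trans
  have "eqV (LBr ?v (LBr ?p ?q)) (LBr ?v (LAdd (B i) (LSmul (- 1) (B (S i)))))"
    unfolding B_def by (rule lie_eq.br_cong[OF lie_eq.refl[OF v] pr_bracket(3)[OF V edge[OF i]]])
  also have "eqV \<dots> (LAdd (LBr ?v (B i)) (LBr ?v (LSmul (- 1) (B (S i)))))"
    by (rule lie_eq.br_add_right) (use t in simp_all)
  also have "eqV \<dots> (LAdd (LBr ?v (B i)) (LSmul (- 1) (LBr ?v (B (S i)))))"
    by (rule lie_eq.add_cong[OF lie_eq.refl lie_eq.br_smul_right]) (use t in simp_all)
  finally have "?G (T (LBr ?v (LBr ?p ?q))) = ?G (T (LAdd (LBr ?v (B i)) (LSmul (- 1) (LBr ?v (B (S i))))))"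
    by (rule linfD(1)[OF G, rotated]) (use t in \<open>simp_all only: KT_simps lie_terms_simps\<close>)
  also have "\<dots> = C i - C (S i)"
    using linfD(2)[OF G, of "LBr ?v (B i)" "LSmul (- 1) (LBr ?v (B (S i)))"] linfD(3)[OF G, of "LBr ?v (B (S i))" "- 1"] t
    unfolding C_def by (simp only: KT_simps lie_terms_simps) simp
  finally have 1: "?G (T (LBr ?v (LBr ?p ?q))) = C i - C (S i)" .
  have "eqV (LAdd (LBr ?v (LBr ?p ?q)) (LAdd (LBr ?p (LBr ?q ?v)) (LBr ?q (LBr ?v ?p)))) LZero"
    using t by (intro lie_eq.br_jacobi)
  then have "?G (T (LAdd (LBr ?v (LBr ?p ?q)) (LAdd (LBr ?p (LBr ?q ?v)) (LBr ?q (LBr ?v ?p))))) = 0"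
    unfolding linf_zero[OF G, symmetric]
    by (rule linfD(1)[OF G, rotated]) (use t in \<open>simp_all only: KT_simps lie_terms_simps\<close>)
  moreover have "LBr ?v (LBr ?p ?q) \<in> KT" "LBr ?p (LBr ?q ?v) \<in> KT" "LBr ?q (LBr ?v ?p) \<in> KT" "LBr ?q ?v \<in> KT" "LBr ?v ?p \<in> KT"
    using t by (simp_all only: KT_simps lie_terms_simps)
  note k = this
  ultimately have 2: "?G (T (LBr ?v (LBr ?p ?q))) + (?G (LBr (T ?p) (T (LBr ?q ?v))) + ?G (LBr (T ?q) (T (LBr ?v ?p)))) = 0"
    using linfD(2)[OF G k(1) KT_simps(2)[OF k(2,3)]] linfD(2)[OF G k(2,3)] linfD(4)[OF G pq(1) k(4)] linfD(4)[OF G pq(2) k(5)] by simp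
  have l: "lin \<alpha> (T (LBr ?q ?v)) = 0" "lin \<gamma> (T (LBr ?q ?v)) = 0" "lin \<alpha> (T (LBr ?v ?p)) = 0" "lin \<gamma> (T (LBr ?v ?p)) = 0"
    unfolding \<alpha> \<gamma> vf_def lin_T[OF k(4)] lin_T[OF k(5)] by simp_all
  have q1: "G' (T (LBr ?q ?v)) = - G' (T (B (S i)))" if "linf G'" for G'
    using linfD(1)[OF that k(4), of "LSmul (- 1) (B (S i))"] pr_bracket(2)[OF V(1,3,2)] linfD(3)[OF that b(2), of "- 1"] KT_simps(3)[OF b(2), of "- 1"]
    by (simp add: B_def)
  have q2: "G' (T (LBr ?v ?p)) = G' (T (B i))" if "linf G'" for G'
    using linfD(1)[OF that k(5), of "B i"] pr_bracket(1)[OF V(1,2,3)] b(1)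
    by (simp add: B_def)
  have 3: "?G (LBr (T ?p) (T (LBr ?q ?v))) = - (e \<alpha> i * y (S i)) + x (S i) * e \<gamma> i"
    unfolding cub.simps l q1[OF X] q1[OF Y] by (simp add: e_def x_def y_def)
  have 4: "?G (LBr (T ?q) (T (LBr ?v ?p))) = e \<alpha> (S i) * y i - x i * e \<gamma> (S i)"
    unfolding cub.simps l q2[OF X] q2[OF Y] by (simp add: e_def x_def y_def)
  show ?thesis using 2 unfolding 1 3 4 eq_neg_iff_add_eq_0[symmetric] by (simp only:) simp
qed

theorem length_3: "m = 3"
proof (rule ccontr)
  assume "m \<noteq> 3"
  then have m: "4 \<le> m" using len by simp
  \<comment> \<open>The triple from the group case: consecutive products vanish on the cycle, since
    in the second one the contributions of the vertices 1 and 3 cancel.\<close>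
  define F1 where "F1 v = (if v = xs ! 3 then - 1 else 0 :: 'k)" for v
  define F2 where "F2 v = (if v = xs ! 1 \<or> v = xs ! 3 then 1 else 0 :: 'k)" for v
  define F3 where "F3 v = (if v = xs ! 2 then 1 else 0 :: 'k)" for v
  let ?\<alpha> = "vf F1" and ?\<beta> = "vf F2" and ?\<gamma> = "vf F3"
  have i4: "0 < m" "1 < m" "2 < m" "3 < m" using m by auto
  have ea: "e ?\<alpha> i = (if i = 3 then - 1 else 0)" and eb: "e ?\<beta> i = (if i = 1 \<or> i = 3 then 1 else 0)"
    and ec: "e ?\<gamma> i = (if i = 2 then 1 else 0)" if "i < m" for i
    using that i4 by (simp_all add: e_vf F1_def F2_def F3_def nth_eq)
  have "K ?\<alpha> ?\<beta> = 0" unfolding K_def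
  proof (rule sum.neutral, rule ballI)
    fix i assume "i \<in> {..<m}"
    then have i: "i < m" by simp
    show "e ?\<alpha> i * e ?\<beta> (S i) - e ?\<alpha> (S i) * e ?\<beta> i = 0"
      unfolding ea[OF i] eb[OF i] ea[OF S_less] eb[OF S_less] unfolding S_cases[OF i] using m by auto
  qed
  then have q1: "Q ?\<alpha> ?\<beta> = 0" unfolding Q_eq[of ?\<alpha> ?\<beta>] by simp
  have "K ?\<beta> ?\<gamma> = (\<Sum>i<m. (if i = 1 then 1 else 0) - (if i = 2 then 1 else 0))" unfolding K_def
  proof (rule sum.cong[OF HOL.refl])
    fix i assume "i \<in> {..<m}"
    then have i: "i < m" by simp
    show "e ?\<beta> i * e ?\<gamma> (S i) - e ?\<beta> (S i) * e ?\<gamma> i = (if i = 1 then 1 else 0) - (if i = 2 then 1 else 0)"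
      unfolding ec[OF i] eb[OF i] ec[OF S_less] eb[OF S_less] unfolding S_cases[OF i] using m by auto
  qed
  also have "\<dots> = 0" unfolding sum_subtractf using i4 by simp
  finally have q2: "Q ?\<beta> ?\<gamma> = 0" unfolding Q_eq[of ?\<beta> ?\<gamma>] by simp
  define x where "x i = quad ?\<alpha> ?\<beta> (T (B i))" for i
  define y where "y i = quad ?\<beta> ?\<gamma> (T (B i))" for i
  have xs: "x (Suc i) = x i - (e ?\<alpha> i * e ?\<beta> (Suc i) - e ?\<alpha> (Suc i) * e ?\<beta> i)"
    and ys: "y (Suc i) = y i - (e ?\<beta> i * e ?\<gamma> (Suc i) - e ?\<beta> (Suc i) * e ?\<gamma> i)" if "Suc i < m" for i
    using step[OF linf_functionals(3)[OF q1], of i] step[OF linf_functionals(3)[OF q2], of i] that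
    by (simp_all add: x_def y_def e_def)
  have x: "x i = 0" if "i < m" for i using that
  proof (induction i)
    case 0
    show ?case unfolding x_def by (rule T_B0[OF linf_functionals(3)[OF q1]])
  next
    case (Suc i)
    have l: "i < m" using Suc.prems by simp
    show ?case unfolding xs[OF Suc.prems] Suc.IH[OF l] ea[OF l] eb[OF l] ea[OF Suc.prems] eb[OF Suc.prems] by auto
  qed
  have y: "y i = (if i = 2 then - 1 else 0)" if "i < m" for i using that
  proof (induction i)
    case 0
    show ?case unfolding y_def using T_B0[OF linf_functionals(3)[OF q2]] by simp
  next
    case (Suc i)
    have l: "i < m" using Suc.prems by simp
    show ?case unfolding ys[OF Suc.prems] Suc.IH[OF l] ec[OF l] eb[OF l] ec[OF Suc.prems] eb[OF Suc.prems] by auto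
  qed
  define C where "C i = cub ?\<alpha> ?\<beta> ?\<gamma> (T (LBr (LGen v0) (B i)))" for i
  \<comment> \<open>Only \<open>i = 2\<close> contributes, from the value -1 of the first functional
    at 3 and the value -1 of \<open>y\<close> at 2, whereas a cyclic sum of differences is
    zero.\<close>
  have "(\<Sum>i<m. C i - C (S i)) = (\<Sum>i<m. if i = 2 then - 1 else 0)"
  proof (rule sum.cong[OF HOL.refl])
    fix i assume "i \<in> {..<m}"
    then have i: "i < m" by simp
    have "C i - C (S i) = e ?\<alpha> i * y (S i) - x (S i) * e ?\<gamma> i - e ?\<alpha> (S i) * y i + x i * e ?\<gamma> (S i)"
      unfolding C_def x_def y_def by (rule cub_step[OF HOL.refl HOL.refl q1 q2 i])
    then show "C i - C (S i) = (if i = 2 then - 1 else 0)"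
      unfolding x[OF i] x[OF S_less] y[OF i] y[OF S_less] ea[OF i] ea[OF S_less] unfolding S_cases[OF i] using m by auto
  qed
  moreover have "(\<Sum>i<m. C i - C (S i)) = 0"
    unfolding sum_subtractf using sum_cyclic[OF m_pos, of C] by simp
  ultimately show False using i4 by simp
qed

text \<open>On a triangle with \<open>p 0 = 0\<close> the cyclic sum reduces to the single term of
  the edge from 1 to 2, a determinant of two linear functionals.\<close>

lemma Q_decomposable:
  "Q \<alpha> \<beta> = Q (vf (delta (xs ! 1))) (vf (delta (xs ! 2))) * (e \<alpha> 1 * e \<beta> 2 - e \<alpha> 2 * e \<beta> 1)"
proof -
  have e0: "e \<alpha> 0 = 0" for \<alpha>
  proof -
    have "eqV (p 0) LZero"
      using xs_in[OF m_pos] clV_in[of "LGen v0"] by (simp add: eqV_iff clV_simps LV.smult_neg)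
    from linfD(1)[OF linf_functionals(1) p_in[OF m_pos] this] show ?thesis
      using linf_zero[OF linf_functionals(1)] unfolding e_def by simp
  qed
  have "K \<alpha> \<beta> = e \<alpha> 1 * e \<beta> 2 - e \<alpha> 2 * e \<beta> 1"
  proof -
    have s: "{..<3} = {0, 1, 2 :: nat}" "Suc 0 mod 3 = 1" "Suc 1 mod 3 = 2" "Suc 2 mod 3 = 0" by auto
    have d: "1 \<noteq> (2 :: nat)" "0 \<noteq> (1 :: nat)" "0 \<noteq> (2 :: nat)" by simp_all
    show ?thesis unfolding K_def length_3 s(1) using d by (simp add: s(2-) e0 flip: One_nat_def numeral_2_eq_2, (simp add: numeral_2_eq_2)?)
  qed
  then show ?thesis unfolding Q_eq[of \<alpha> \<beta>] by (rule arg_cong)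
qed

end

text \<open>The Pluecker relation with a nonzero coefficient as pivot: the two linear factors are
  the column of \<open>j\<close> and the row of \<open>i\<close>.\<close>

theorem (in one_relator_bb) relator_decomposable:
  "\<exists>i\<in>X. \<exists>j\<in>X. Q (delta i) (delta j) \<noteq> 0 \<and> (\<forall>x y. Q (delta x) (delta y) * Q (delta i) (delta j) =
    Q (delta x) (delta j) * Q (delta i) (delta y) - Q (delta y) (delta j) * Q (delta i) (delta x))"
proof -
  obtain xs where xs: "distinct xs" "3 \<le> length xs" "set xs \<subseteq> V"
    "\<And>i. i < length xs \<Longrightarrow> {xs ! i, xs ! (Suc i mod length xs)} \<in> E"
    using cycle_exists by blast
  interpret bb_cycle V E X r \<phi> xs by unfold_locales (use xs in auto)
  obtain i j where "i \<in> X" "j \<in> X" "Q (delta i) (delta j) \<noteq> 0" using Q_nonzero by blast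
  moreover have "Q (delta x) (delta y) * Q (delta i) (delta j) =
      Q (delta x) (delta j) * Q (delta i) (delta y) - Q (delta y) (delta j) * Q (delta i) (delta x)" for x y
    unfolding Q_decomposable[of "delta x"] Q_decomposable[of "delta i"] Q_decomposable[of "delta y"]
    by (simp add: algebra_simps)
  ultimately show ?thesis by blast
qed

section \<open>Splitting off the plane\<close>

lemma (in lie_module) decomposable_eval:
  assumes xs: "\<And>x. x \<in> set xs \<Longrightarrow> f x \<in> carrier L" "distinct xs"
    and r: "homogeneous (\<lambda>_. 1) 2 r" "r \<in> lie_terms (set xs)"
    and q: "\<And>x y. quad (delta x) (delta y) r = q * (a x * b y - a y * b x)"
  shows "lie_eval L f r = q \<odot>\<^bsub>L\<^esub> bracket L (lin_comb f xs a) (lin_comb f xs b)"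
proof -
  have "lie_eval L f r = quad_comb f xs (\<lambda>x y. quad (delta x) (delta y) r)"
    by (rule lie_eval_degree_2[OF xs r(1) HOL.refl r(2)])
  also have "\<dots> = q \<odot>\<^bsub>L\<^esub> quad_comb f xs (\<lambda>x y. a x * b y - a y * b x)"
    unfolding q by (rule quad_comb_simps(3)[OF xs(1)])
  also have "quad_comb f xs (\<lambda>x y. a x * b y - a y * b x) = bracket L (lin_comb f xs a) (lin_comb f xs b)"
    by (rule bracket_lin_comb[OF xs(1), THEN HOL.sym])
  finally show ?thesis .
qed

lemma (in lie_module) bracket_combine:
  assumes "x \<in> carrier L" "y \<in> carrier L" "bracket L x y = \<zero>"
  shows "bracket L (a \<odot>\<^bsub>L\<^esub> x \<oplus> b \<odot>\<^bsub>L\<^esub> y) (c \<odot>\<^bsub>L\<^esub> x \<oplus> d \<odot>\<^bsub>L\<^esub> y) = \<zero>"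
proof -
  have "bracket L y x = \<zero>" using bracket_anti[OF assms(2,1)] assms(3) by (simp add: smult_simps)
  then show ?thesis using assms by (simp add: bracket_add bracket_smult bracket_same smult_simps bracket_in)
qed

lemma lie_subst_LGen: "lie_subst LGen t = t"
  by (induction t) simp_all

lemma lie_eq_mono:
  assumes "lie_eq Y {} s t" "Y \<subseteq> X" shows "lie_eq X R s t"
proof -
  have "lie_eq X R (lie_subst LGen s) (lie_subst LGen t)" by (rule lie_subst_eq[OF assms(1)]) (use assms(2) in auto)
  then show ?thesis by (simp add: lie_subst_LGen)
qed

text \<open>The linear factors \<open>\<xi>\<close> and \<open>\<eta>\<close> of the relator replace
  \<open>i\<close> and \<open>j\<close> as generators. In the new generators the relator is a
  nonzero multiple of their bracket, so they span the plane and the remaining generators are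
  free.\<close>

lemma one_relator_free_product:
  fixes X :: "'x set" and r :: "('k::field, 'x) lie_term" and \<iota> :: "'k \<times> 'k \<Rightarrow> 'a"
  assumes X: "finite X" and r: "r \<in> lie_terms X" "homogeneous (\<lambda>_. 1) 2 r" and ij: "i \<in> X" "j \<in> X"
    and q0: "quad (delta i) (delta j) r \<noteq> 0"
    and dec: "\<And>x y. quad (delta x) (delta y) r * quad (delta i) (delta j) r =
      quad (delta x) (delta j) r * quad (delta i) (delta y) r - quad (delta y) (delta j) r * quad (delta i) (delta x) r"
    and \<iota>: "inj \<iota>"
  shows "presented_lie X (\<lambda>_. 1) {r} \<cong>\<^sub>L free_product (plane \<iota>) (free_lie (X - {i, j}))"
proof -
  define q where "q = quad (delta i) (delta j) r"
  \<comment> \<open>Division by the pivot gives \<open>a\<close> and \<open>b\<close> the values of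
    the identity matrix at \<open>i\<close> and \<open>j\<close>. Hence \<open>\<xi>\<close> is
    \<open>i\<close> plus a combination of \<open>Y\<close>, and \<open>\<eta>\<close> is
    \<open>j\<close> plus a combination of \<open>Y\<close>.\<close>
  define a where "a x = quad (delta x) (delta j) r / q" for x
  define b where "b x = quad (delta i) (delta x) r / q" for x
  have ne: "i \<noteq> j" using q0 quad_self by metis
  have qn: "q \<noteq> 0" using q0 by (simp add: q_def)
  have ab: "a i = 1" "a j = 0" "b i = 0" "b j = 1"
    using qn by (simp_all add: a_def b_def quad_self) (simp_all add: q_def)
  have dq: "quad (delta x) (delta y) r = q * (a x * b y - a y * b x)" for x y
  proof -
    have "q * (a x * b y - a y * b x) = (quad (delta x) (delta y) r * q) / q"
      unfolding dec[of x y, folded q_def] a_def b_def using qn by (simp add: divide_simps)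
    then show ?thesis using qn by simp
  qed
  define Y where "Y = X - {i, j}"
  obtain ys where ys: "distinct ys" "set ys = Y" using finite_distinct_list[of Y] X by (auto simp: Y_def)
  let ?xs = "i # j # ys"
  have xs: "distinct ?xs" "set ?xs = X" using ys ne ij by (auto simp: Y_def)
  have YX: "Y \<subseteq> X" by (auto simp: Y_def)
  have r': "r \<in> lie_terms (set ?xs)" using r(1) xs(2) by simp
  let ?A = "plane \<iota>" and ?B = "free_lie Y :: ('k, ('k, 'x) lie_term set) graded_lie"
  define G where "G = free_product_gens ?A ?B"
  define S where "S = free_product_relators ?A ?B"
  define e where "e = (case_sum fst fst :: nat \<times> 'a + nat \<times> ('k, 'x) lie_term set \<Rightarrow> nat)"
  let ?P = "presented_lie X (\<lambda>_. 1) {r}" and ?F = "presented_lie G e S"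
  interpret P: lie_module ?P by (rule presented_lie_module)
  interpret F: lie_module ?F by (rule presented_lie_module)
  define cX where "cX = lie_class X {r}"
  define cY where "cY = (lie_class Y {} :: ('k, 'x) lie_term \<Rightarrow> _)"
  define cF where "cF = lie_class G S"
  define hY where "hY n t \<longleftrightarrow> t \<in> lie_terms Y \<and> homogeneous (\<lambda>_. 1) n t" for n and t :: "('k, 'x) lie_term"
  have degA: "deg ?A n = (if n = 1 then range \<iota> else {\<iota> 0})" for n by (rule plane_simps(6)[OF \<iota>])
  have degB: "deg ?B n = cY ` {t. hY n t}" for n by (simp add: free_lie_def presented_lie_carrier cY_def hY_def)
  have G: "Inl (n, x) \<in> G \<longleftrightarrow> x \<in> deg ?A n" "Inr (n, y) \<in> G \<longleftrightarrow> y \<in> deg ?B n" for n x y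
    by (auto simp: G_def free_product_gens_def homogeneous_elements_def)
  have SA: "table_relators Inl ?A \<subseteq> S" and SB: "table_relators Inr ?B \<subseteq> S"
    by (auto simp: S_def free_product_relators_def)
  have cX_in: "cX t \<in> carrier ?P" if "t \<in> lie_terms X" for t using that by (simp add: cX_def presented_lie_carrier)
  have cF_in: "cF t \<in> carrier ?F" if "t \<in> lie_terms G" for t using that by (simp add: cF_def presented_lie_carrier)
  have hYs: "hY n s \<Longrightarrow> hY n t \<Longrightarrow> hY n (LAdd s t)" "hY n s \<Longrightarrow> hY n (LSmul c s)" "hY l s \<Longrightarrow> hY n t \<Longrightarrow> hY (l + n) (LBr s t)"
    "hY n LZero" "y \<in> Y \<Longrightarrow> hY 1 (LGen y)" for l n s t c y
    unfolding hY_def using homogeneous.intros(1)[of "\<lambda>_. 1 :: nat" y] by (auto intro: homogeneous.intros(2-))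
  have cYs: "cY s \<oplus>\<^bsub>?B\<^esub> cY t = cY (LAdd s t)" "c \<odot>\<^bsub>?B\<^esub> cY s = cY (LSmul c s)" "bracket ?B (cY s) (cY t) = cY (LBr s t)"
    if "s \<in> lie_terms Y" "t \<in> lie_terms Y" for s t c
    unfolding free_lie_def cY_def by (rule presented_lie_class(1,3)[OF that] presented_lie_smult[OF that(1)])+
  define g1 where "g1 n x = cF (LGen (Inl (n, x)))" for n x
  define g2 where "g2 n y = cF (LGen (Inr (n, y)))" for n y
  have g1_in: "x \<in> deg ?A n \<Longrightarrow> g1 n x \<in> carrier ?F" and g2_in: "hY n t \<Longrightarrow> g2 n (cY t) \<in> carrier ?F" for n x t
    unfolding g1_def g2_def by (intro cF_in; simp add: G degB)+
  have GA: "\<forall>n. \<forall>x\<in>deg ?A n. Inl (n, x) \<in> G" and GB: "\<forall>n. \<forall>x\<in>deg ?B n. Inr (n, x) \<in> G" using G by blast+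
  note T1 = table_rules[of ?A Inl G S, OF GA SA, where e = e, folded cF_def, folded g1_def]
  note T2 = table_rules[of ?B Inr G S, OF GB SB, where e = e, folded cF_def, folded g2_def]
  have mB: "hY n t \<Longrightarrow> cY t \<in> deg ?B n" for n t unfolding degB by blast
  have hT: "hY n t \<Longrightarrow> t \<in> lie_terms Y" for n t by (simp add: hY_def)
  have g2_rules: "hY n s \<Longrightarrow> hY n t \<Longrightarrow> g2 n (cY (LAdd s t)) = g2 n (cY s) \<oplus>\<^bsub>?F\<^esub> g2 n (cY t)"
    "hY n s \<Longrightarrow> g2 n (cY (LSmul c s)) = c \<odot>\<^bsub>?F\<^esub> g2 n (cY s)"
    "hY l s \<Longrightarrow> hY n t \<Longrightarrow> g2 (l + n) (cY (LBr s t)) = bracket ?F (g2 l (cY s)) (g2 n (cY t))" for n l s t c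
  proof -
    show "g2 n (cY (LAdd s t)) = g2 n (cY s) \<oplus>\<^bsub>?F\<^esub> g2 n (cY t)" if h: "hY n s" "hY n t"
      using T2(1)[OF mB[OF h(1)] mB[OF h(2)]] mB[OF hYs(1)[OF h]] by (simp add: cYs hT[OF h(1)] hT[OF h(2)])
    show "g2 n (cY (LSmul c s)) = c \<odot>\<^bsub>?F\<^esub> g2 n (cY s)" if h: "hY n s"
      using T2(2)[OF mB[OF h], of c] mB[OF hYs(2)[OF h], of c] by (simp add: cYs(2)[OF hT[OF h] hT[OF h]])
    show "g2 (l + n) (cY (LBr s t)) = bracket ?F (g2 l (cY s)) (g2 n (cY t))" if h: "hY l s" "hY n t"
      using T2(3)[OF mB[OF h(1)] mB[OF h(2)]] mB[OF hYs(3)[OF h]] by (simp add: cYs hT[OF h(1)] hT[OF h(2)])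
  qed
  \<comment> \<open>Zero has a separate generator in each degree; the scaling relator with factor 0
    shows that all of them vanish.\<close>
  have g2_zero: "g2 n (cY LZero) = \<zero>\<^bsub>?F\<^esub>" for n
  proof -
    have "lie_eq Y {} (LSmul 0 LZero) (LZero :: ('k, 'x) lie_term)"
    proof -
      interpret B: lie_module "presented_lie Y (\<lambda>_. 1) {} :: ('k, ('k, 'x) lie_term set) graded_lie" by (rule presented_lie_module)
      show ?thesis by (subst lie_class_eq_iff[THEN HOL.sym])
          (simp_all add: presented_lie_smult[symmetric, where d = "\<lambda>_. 1"] presented_lie_zero[symmetric, where d = "\<lambda>_. 1"] B.smult_simps)
    qed
    then have "cY (LSmul 0 LZero) = cY LZero" unfolding cY_def by (rule lie_class_eqI)
    then have "g2 n (cY LZero) = 0 \<odot>\<^bsub>?F\<^esub> g2 n (cY LZero)" using g2_rules(2)[OF hYs(4), of n 0] by simp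
    then show ?thesis using g2_in[OF hYs(4), of n] by (simp add: F.smult_simps)
  qed
  have z: "\<iota> 0 \<in> deg ?A n" for n by (simp add: degA)
  have d1: "\<iota> p \<in> deg ?A 1" for p by (simp add: degA)
  note pl = plane_simps[OF \<iota>]
  have g1_zero: "g1 n (\<iota> 0) = \<zero>\<^bsub>?F\<^esub>" for n
  proof -
    have "0 \<odot>\<^bsub>?F\<^esub> g1 n (\<iota> 0) = g1 n (\<iota> 0)" using T1(2)[OF z, of 0 n] z[of n] by (simp add: pl(4) zero_prod_def)
    then show ?thesis using g1_in[OF z, of n] by (simp add: F.smult_simps)
  qed
  define E1 where "E1 = g1 1 (\<iota> (1, 0))"
  define E2 where "E2 = g1 1 (\<iota> (0, 1))"
  have E: "E1 \<in> carrier ?F" "E2 \<in> carrier ?F" unfolding E1_def E2_def by (intro g1_in d1)+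
  have g1_comb: "g1 1 (\<iota> (c, d)) = c \<odot>\<^bsub>?F\<^esub> E1 \<oplus>\<^bsub>?F\<^esub> d \<odot>\<^bsub>?F\<^esub> E2" for c d
  proof -
    have "c \<odot>\<^bsub>?F\<^esub> E1 = g1 1 (\<iota> (c, 0))" "d \<odot>\<^bsub>?F\<^esub> E2 = g1 1 (\<iota> (0, d))"
      unfolding E1_def E2_def using T1(2)[OF d1, of c] T1(2)[OF d1, of d] d1 by (simp_all add: pl(4))
    then show ?thesis using T1(1)[OF d1 d1, of "(c, 0)" "(0, d)"] d1 by (simp add: pl(3))
  qed
  have E_br: "bracket ?F E1 E2 = \<zero>\<^bsub>?F\<^esub>"
  proof -
    have "bracket ?F E1 E2 = g1 (1 + 1) (\<iota> 0)"
      unfolding E1_def E2_def using T1(3)[OF d1 d1, of "(1, 0)" "(0, 1)"] z by (simp add: pl(5))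
    then show ?thesis by (simp add: g1_zero)
  qed
  define s0 :: "'x \<Rightarrow> ('k, nat \<times> 'a + nat \<times> ('k, 'x) lie_term set) lie_term"
    where "s0 y = LGen (Inr (1, cY (LGen y)))" for y
  define w where "w c = lie_subst s0 (lin_term ys c)" for c
  \<comment> \<open>The inverse change of variables: \<open>i\<close> is the first basis vector of
    the plane minus the \<open>Y\<close>-part of \<open>\<xi>\<close>, and likewise \<open>j\<close>
    with \<open>\<eta>\<close>.\<close>
  define \<sigma> where "\<sigma> x = (if x = i then lie_minus (LGen (Inl (1, \<iota> (1, 0)))) (w a)
    else if x = j then lie_minus (LGen (Inl (1, \<iota> (0, 1)))) (w b) else s0 x)" for x
  have gen: "LGen (Inl (1, \<iota> p)) \<in> lie_terms G" "homogeneous e 1 (LGen (Inl (1, \<iota> p)))" for p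
    using d1 homogeneous.intros(1)[of e "Inl (1, \<iota> p)"] by (simp_all add: G e_def)
  have s0: "s0 y \<in> lie_terms G" "homogeneous e 1 (s0 y)" if "y \<in> Y" for y
    using mB[OF hYs(5)[OF that]] homogeneous.intros(1)[of e "Inr (1, cY (LGen y))"] by (simp_all add: s0_def G e_def)
  have lt: "lin_term ys c \<in> lie_terms Y" for c using ys by (intro lin_term_in) simp
  have w: "w c \<in> lie_terms G" "homogeneous e 1 (w c)" for c
    unfolding w_def by (rule lie_subst_terms[OF lt], erule s0(1))
      (rule lie_subst_homogeneous[OF lin_term_homogeneous lt], erule s0(2))
  have \<sigma>: "\<sigma> x \<in> lie_terms G" "homogeneous e 1 (\<sigma> x)" if "x \<in> X" for x
  proof -
    have y: "x \<in> Y" if "x \<noteq> i" "x \<noteq> j" using that \<open>x \<in> X\<close> by (simp add: Y_def)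
    show "\<sigma> x \<in> lie_terms G" using gen w s0 y by (auto simp: \<sigma>_def lie_minus_def)
    have "homogeneous e 1 (lie_minus (LGen (Inl (1, \<iota> p))) (w c))" for p c
      unfolding lie_minus_def by (rule homogeneous.intros(3)[OF gen(2) homogeneous.intros(4)[OF w(2)]])
    then show "homogeneous e 1 (\<sigma> x)" using s0(2) y by (simp add: \<sigma>_def)
  qed
  have s\<sigma>: "lie_subst \<sigma> t \<in> lie_terms G" if "t \<in> lie_terms X" for t
    by (rule lie_subst_terms[OF that]) (erule \<sigma>(1))
  define f where "f x = cF (\<sigma> x)" for x
  have f_in: "f x \<in> carrier ?F" if "x \<in> X" for x unfolding f_def by (rule cF_in[OF \<sigma>(1)[OF that]])
  have fY: "f y = g2 1 (cY (LGen y))" if "y \<in> Y" for y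
    using that by (simp add: f_def \<sigma>_def s0_def g2_def Y_def)
  have cFw: "cF (w c) = F.lin_comb f ys c" for c
  proof -
    have "cF (w c) = F.lin_comb (\<lambda>y. cF (s0 y)) ys c"
      unfolding w_def F.lin_term_eval[symmetric] cF_def by (rule lie_subst_class[OF lt], erule s0(1))
    also have "\<dots> = F.lin_comb f ys c"
      by (rule F.lin_comb_cong_fun) (use ys in \<open>simp add: fY s0_def g2_def\<close>)
    finally show ?thesis .
  qed
  have W_in: "F.lin_comb f ys c \<in> carrier ?F" for c by (rule F.lin_comb_simps(1)) (use f_in ys YX in auto)
  have f_ij: "f i = E1 \<oplus>\<^bsub>?F\<^esub> (- 1) \<odot>\<^bsub>?F\<^esub> F.lin_comb f ys a" "f j = E2 \<oplus>\<^bsub>?F\<^esub> (- 1) \<odot>\<^bsub>?F\<^esub> F.lin_comb f ys b"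
    using ne w gen unfolding f_def[of i] f_def[of j] \<sigma>_def lie_minus_def cFw[symmetric] E1_def E2_def g1_def
    by (simp_all add: cF_def presented_lie_class(1) presented_lie_smult)
  have comb: "F.lin_comb f ?xs a = E1" "F.lin_comb f ?xs b = E2"
    using E W_in f_in[OF ij(1)] f_in[OF ij(2)]
    by (simp_all add: ab F.smult_simps) (simp_all add: f_ij F.add_neg_cancel)
  define \<xi> where "\<xi> = lin_term ?xs a"
  define \<eta> where "\<eta> = lin_term ?xs b"
  have \<xi>\<eta>: "\<xi> \<in> lie_terms X" "\<eta> \<in> lie_terms X" "homogeneous (\<lambda>_. 1) 1 \<xi>" "homogeneous (\<lambda>_. 1) 1 \<eta>"
    unfolding \<xi>_def \<eta>_def by (intro lin_term_in lin_term_homogeneous; simp add: xs(2)[simplified])+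
  define rep where "rep n y = (SOME t. hY n t \<and> cY t = y)" for n y
  have rep: "hY n (rep n y)" "cY (rep n y) = y" if "y \<in> deg ?B n" for n y
  proof -
    have "\<exists>t. hY n t \<and> cY t = y" using that unfolding degB by blast
    from someI_ex[OF this] show "hY n (rep n y)" "cY (rep n y) = y" unfolding rep_def by blast+
  qed
  \<comment> \<open>Vectors of the plane go to combinations of \<open>\<xi>\<close> and
    \<open>\<eta>\<close>; outside degree 1 the plane contains only zero. Elements of the free
    factor go to a homogeneous representative of their class.\<close>
  define \<tau> :: "nat \<times> 'a + nat \<times> ('k, 'x) lie_term set \<Rightarrow> ('k, 'x) lie_term" where "\<tau> = case_sum
    (\<lambda>(n, x). if n = 1 then LAdd (LSmul (fst (inv_into UNIV \<iota> x)) \<xi>) (LSmul (snd (inv_into UNIV \<iota> x)) \<eta>) else LZero)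
    (\<lambda>(n, y). rep n y)"
  have \<tau>_simps: "\<tau> (Inl (n, \<iota> p)) = (if n = 1 then LAdd (LSmul (fst p) \<xi>) (LSmul (snd p) \<eta>) else LZero)"
    "\<tau> (Inr (n, y)) = rep n y" for n p y by (simp_all add: \<tau>_def inv_f_f[OF \<iota>])
  have Gc: "(\<exists>n p. g = Inl (n, \<iota> p) \<and> \<iota> p \<in> deg ?A n) \<or> (\<exists>n y. g = Inr (n, y) \<and> y \<in> deg ?B n)" if "g \<in> G" for g
  proof (cases g)
    case (Inl h)
    obtain n x where h: "h = (n, x)" by (cases h)
    then have x: "x \<in> deg ?A n" using that Inl G by simp
    then obtain p where "x = \<iota> p" by (auto simp: degA split: if_splits)
    then show ?thesis using Inl h x by blast
  next
    case (Inr h)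
    then show ?thesis using that G by (cases h) auto
  qed
  have hX: "hY n t \<Longrightarrow> t \<in> lie_terms X" for n t using YX by (auto simp: hY_def lie_terms_def)
  have \<tau>: "\<tau> g \<in> lie_terms X" "homogeneous (\<lambda>_. 1) (e g) (\<tau> g)" if "g \<in> G" for g
    using Gc[OF that] \<xi>\<eta> hX[OF rep(1)] rep(1)
    by (auto simp: \<tau>_simps e_def hY_def intro!: homogeneous.intros(2-4))
  have s\<tau>: "lie_subst \<tau> t \<in> lie_terms X" if "t \<in> lie_terms G" for t
    by (rule lie_subst_terms[OF that]) (erule \<tau>(1))
  define k where "k g = cX (\<tau> g)" for g
  define \<Xi> where "\<Xi> = cX \<xi>"
  define H where "H = cX \<eta>"
  have \<Xi>H: "\<Xi> \<in> carrier ?P" "H \<in> carrier ?P" unfolding \<Xi>_def H_def by (intro cX_in \<xi>\<eta>)+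
  have k1: "k (Inl (n, \<iota> p)) = (if n = 1 then fst p \<odot>\<^bsub>?P\<^esub> \<Xi> \<oplus>\<^bsub>?P\<^esub> snd p \<odot>\<^bsub>?P\<^esub> H else \<zero>\<^bsub>?P\<^esub>)" for n p
    using \<xi>\<eta> by (simp add: k_def \<tau>_simps cX_def \<Xi>_def H_def presented_lie_class(1) presented_lie_smult presented_lie_zero)
  have k2: "k (Inr (n, cY t)) = cX t" if t: "hY n t" for n t
  proof -
    note R = rep[OF mB[OF t]]
    have "lie_eq Y {} (rep n (cY t)) t"
      using R(2) lie_class_eq_iff[OF hT[OF R(1)]] unfolding cY_def by blast
    from lie_eq_mono[OF this YX] show ?thesis unfolding k_def \<tau>_simps cX_def by (rule lie_class_eqI)
  qed
  have cX_eval: "cX t = lie_eval ?P (\<lambda>x. cX (LGen x)) t" if "t \<in> lie_terms X" for t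
    unfolding cX_def presented_lie_eval[OF that] ..
  have cXg: "cX (LGen x) \<in> carrier ?P" if "x \<in> X" for x using that by (intro cX_in) simp
  have \<Xi>H_comb: "\<Xi> = P.lin_comb (\<lambda>x. cX (LGen x)) ?xs a" "H = P.lin_comb (\<lambda>x. cX (LGen x)) ?xs b"
    unfolding \<Xi>_def H_def cX_eval[OF \<xi>\<eta>(1)] cX_eval[OF \<xi>\<eta>(2)] unfolding \<xi>_def \<eta>_def by (rule P.lin_term_eval)+
  have \<Xi>H_br: "bracket ?P \<Xi> H = \<zero>\<^bsub>?P\<^esub>"
  proof -
    have "lie_eq X {r} r LZero" by (rule lie_eq.relator) (use r in auto)
    then have "cX r = \<zero>\<^bsub>?P\<^esub>" unfolding cX_def presented_lie_zero by (rule lie_class_eqI)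
    moreover have "cX r = q \<odot>\<^bsub>?P\<^esub> bracket ?P \<Xi> H"
      unfolding cX_eval[OF r(1)] \<Xi>H_comb by (rule P.decomposable_eval[OF _ xs(1) r(2) r' dq]) (use cXg xs(2) in auto)
    ultimately have "inverse q \<odot>\<^bsub>?P\<^esub> (q \<odot>\<^bsub>?P\<^esub> bracket ?P \<Xi> H) = \<zero>\<^bsub>?P\<^esub>" by (simp add: P.smult_simps)
    then show ?thesis using qn \<Xi>H by (simp add: P.smult_simps P.bracket_in)
  qed
  have kc: "k g \<in> carrier ?P" if "g \<in> G" for g unfolding k_def by (rule cX_in[OF \<tau>(1)[OF that]])
  have cX\<tau>: "cX (lie_subst \<tau> t) = lie_eval ?P k t" if "t \<in> lie_terms G" for t
    unfolding cX_def k_def[abs_def] by (rule lie_subst_class[OF that], erule \<tau>(1))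
  have cF\<sigma>: "cF (lie_subst \<sigma> t) = lie_eval ?F f t" if "t \<in> lie_terms X" for t
    unfolding cF_def f_def[abs_def] by (rule lie_subst_class[OF that], erule \<sigma>(1))
  have min: "lie_eval ?P k (lie_minus s (LGen g)) = \<zero>\<^bsub>?P\<^esub>" if "lie_eval ?P k s = k g" "k g \<in> carrier ?P" for s g
    using that by (simp add: lie_minus_def P.smult_neg)
  have k1c: "k (Inl (n, \<iota> p)) \<in> carrier ?P" for n p using \<Xi>H by (simp add: k1 P.smult_simps)
  have Ar: "\<exists>p. x = \<iota> p" if "x \<in> deg ?A n" for x n
  proof -
    have "deg ?A n \<subseteq> range \<iota>" by (simp add: degA)
    with that show ?thesis by blast
  qed
  have relS: "lie_eval ?P k s = \<zero>\<^bsub>?P\<^esub>" if "s \<in> S" for s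
  proof -
    have "s \<in> table_relators Inl ?A \<or> s \<in> table_relators Inr ?B" using that by (simp add: S_def free_product_relators_def)
    then consider
        (1) n x y where "s = lie_minus (LAdd (LGen (Inl (n, x))) (LGen (Inl (n, y)))) (LGen (Inl (n, x \<oplus>\<^bsub>?A\<^esub> y)))" "x \<in> deg ?A n" "y \<in> deg ?A n"
      | (2) c n x where "s = lie_minus (LSmul c (LGen (Inl (n, x)))) (LGen (Inl (n, c \<odot>\<^bsub>?A\<^esub> x)))" "x \<in> deg ?A n"
      | (3) l n x y where "s = lie_minus (LBr (LGen (Inl (l, x))) (LGen (Inl (n, y)))) (LGen (Inl (l + n, bracket ?A x y)))" "x \<in> deg ?A l" "y \<in> deg ?A n"
      | (4) n x y where "s = lie_minus (LAdd (LGen (Inr (n, x))) (LGen (Inr (n, y)))) (LGen (Inr (n, x \<oplus>\<^bsub>?B\<^esub> y)))" "x \<in> deg ?B n" "y \<in> deg ?B n"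
      | (5) c n x where "s = lie_minus (LSmul c (LGen (Inr (n, x)))) (LGen (Inr (n, c \<odot>\<^bsub>?B\<^esub> x)))" "x \<in> deg ?B n"
      | (6) l n x y where "s = lie_minus (LBr (LGen (Inr (l, x))) (LGen (Inr (n, y)))) (LGen (Inr (l + n, bracket ?B x y)))" "x \<in> deg ?B l" "y \<in> deg ?B n"
      unfolding table_relators_def by blast
    then show ?thesis
    proof cases
      case 1
      obtain p p' where p: "x = \<iota> p" "y = \<iota> p'" using Ar[OF 1(2)] Ar[OF 1(3)] by blast
      show ?thesis unfolding 1(1) p pl(3)
        by (rule min[OF _ k1c]) (use \<Xi>H in \<open>simp add: k1 P.smult_simps P.a_ac\<close>)
    next
      case 2
      obtain p where p: "x = \<iota> p" using Ar[OF 2(2)] by blast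
      show ?thesis unfolding 2(1) p pl(4)
        by (rule min[OF _ k1c]) (use \<Xi>H in \<open>simp add: k1 P.smult_simps\<close>)
    next
      case 3
      obtain p p' where p: "x = \<iota> p" "y = \<iota> p'" using Ar[OF 3(2)] Ar[OF 3(3)] by blast
      have "bracket ?P (k (Inl (l, x))) (k (Inl (n, y))) = \<zero>\<^bsub>?P\<^esub>"
        using \<Xi>H P.bracket_combine[OF \<Xi>H \<Xi>H_br] k1c[of l p] k1c[of n p'] by (auto simp: k1 p P.bracket_zero P.smult_simps)
      moreover have "k (Inl (l + n, \<iota> 0)) = \<zero>\<^bsub>?P\<^esub>" using \<Xi>H by (simp add: k1 P.smult_simps)
      ultimately show ?thesis unfolding 3(1) pl(5) by (intro min k1c) simp
    next
      case 4
      obtain t t' where t: "x = cY t" "y = cY t'" "hY n t" "hY n t'" using 4 by (auto simp: degB)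
      show ?thesis unfolding 4(1) t(1,2) cYs[OF hT[OF t(3)] hT[OF t(4)]]
        by (rule min) (simp_all add: k2 t hYs hX[OF t(3)] hX[OF t(4)] cX_in, simp add: cX_def presented_lie_class(1) hX[OF t(3)] hX[OF t(4)])
    next
      case 5
      obtain t where t: "x = cY t" "hY n t" using 5 by (auto simp: degB)
      show ?thesis unfolding 5(1) t(1) cYs[OF hT[OF t(2)] hT[OF t(2)]]
        by (rule min) (simp_all add: k2 t hYs hX[OF t(2)] cX_in, simp add: cX_def presented_lie_smult hX[OF t(2)])
    next
      case 6
      obtain t t' where t: "x = cY t" "y = cY t'" "hY l t" "hY n t'" using 6 by (auto simp: degB)
      show ?thesis unfolding 6(1) t(1,2) cYs[OF hT[OF t(3)] hT[OF t(4)]]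
        by (rule min) (simp_all add: k2 t hYs hX[OF t(3)] hX[OF t(4)] cX_in, simp add: cX_def presented_lie_class(3) hX[OF t(3)] hX[OF t(4)])
    qed
  qed
  \<comment> \<open>A generator of the free product that names the class of \<open>t\<close> is the
    value of \<open>t\<close> on the generators of degree 1. So the elements of \<open>Y\<close>
    generate all of the second factor.\<close>
  have evY: "lie_eval ?F f t = g2 n (cY t)" if "homogeneous (\<lambda>_. 1) n t" "t \<in> lie_terms Y" for n t
    using that
  proof (induction rule: homogeneous.induct)
    case (1 x)
    then show ?case by (simp add: fY)
  qed (simp_all add: g2_zero g2_rules hY_def)
  have "?P \<cong>\<^sub>L ?F"
  proof (rule presented_lie_iso[where \<sigma> = \<sigma> and \<tau> = \<tau>])
    fix s assume "s \<in> {r}"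
    then have s: "s = r" by simp
    have "cF (lie_subst \<sigma> r) = q \<odot>\<^bsub>?F\<^esub> bracket ?F (F.lin_comb f ?xs a) (F.lin_comb f ?xs b)"
      unfolding cF\<sigma>[OF r(1)] by (rule F.decomposable_eval[OF _ xs(1) r(2) r' dq]) (use f_in xs(2) in auto)
    also have "\<dots> = cF LZero" unfolding comb E_br by (simp add: F.smult_simps) (simp add: presented_lie_zero cF_def)
    finally show "lie_eq G S (lie_subst \<sigma> s) LZero"
      unfolding s cF_def lie_class_eq_iff[OF s\<sigma>[OF r(1)]] .
  next
    fix s assume s: "s \<in> S" "s \<in> lie_terms G"
    have "cX (lie_subst \<tau> s) = cX LZero" unfolding cX\<tau>[OF s(2)] relS[OF s(1)] by (simp add: presented_lie_zero cX_def)
    then show "lie_eq X {r} (lie_subst \<tau> s) LZero"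
      unfolding cX_def lie_class_eq_iff[OF s\<tau>[OF s(2)]] .
  next
    fix x assume x: "x \<in> X"
    have wk: "lie_eval ?P k (w c) = P.lin_comb (\<lambda>x. cX (LGen x)) ys c" for c
    proof -
      have "lie_eval ?P k (w c) = P.lin_comb (\<lambda>y. lie_eval ?P k (s0 y)) ys c"
        unfolding w_def lie_eval_subst P.lin_term_eval ..
      also have "\<dots> = P.lin_comb (\<lambda>x. cX (LGen x)) ys c"
        by (rule P.lin_comb_cong_fun) (use ys hYs(5) in \<open>simp add: s0_def k2\<close>)
      finally show ?thesis .
    qed
    have W: "P.lin_comb (\<lambda>x. cX (LGen x)) ys c \<in> carrier ?P" for c
      by (rule P.lin_comb_simps(1)) (use cXg ys YX in auto)
    have "lie_eval ?P k (\<sigma> x) = cX (LGen x)"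
    proof -
      consider "x = i" | "x = j" | "x \<in> Y" using x by (auto simp: Y_def)
      then show ?thesis
      proof cases
        case 1
        have "\<Xi> = cX (LGen i) \<oplus>\<^bsub>?P\<^esub> P.lin_comb (\<lambda>x. cX (LGen x)) ys a"
          using W cXg[OF ij(1)] cXg[OF ij(2)] unfolding \<Xi>H_comb by (simp add: ab P.smult_simps)
        then show ?thesis using W cXg[OF ij(1)] \<Xi>H by (simp add: 1 \<sigma>_def lie_minus_def k1 P.smult_simps wk P.add_neg_cancel)
      next
        case 2
        have "H = cX (LGen j) \<oplus>\<^bsub>?P\<^esub> P.lin_comb (\<lambda>x. cX (LGen x)) ys b"
          using W cXg[OF ij(1)] cXg[OF ij(2)] unfolding \<Xi>H_comb by (simp add: ab P.smult_simps)
        then show ?thesis using W cXg[OF ij(2)] \<Xi>H ne by (simp add: 2 \<sigma>_def lie_minus_def k1 P.smult_simps wk P.add_neg_cancel)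
      next
        case 3
        then have "x \<noteq> i" "x \<noteq> j" by (auto simp: Y_def)
        then show ?thesis using k2[OF hYs(5)[OF 3]] by (simp add: \<sigma>_def s0_def)
      qed
    qed
    then have "cX (lie_subst \<tau> (\<sigma> x)) = cX (LGen x)" unfolding cX\<tau>[OF \<sigma>(1)[OF x]] .
    then show "lie_eq X {r} (lie_subst \<tau> (\<sigma> x)) (LGen x)"
      unfolding cX_def lie_class_eq_iff[OF s\<tau>[OF \<sigma>(1)[OF x]]] .
  next
    fix g assume g: "g \<in> G"
    have "lie_eval ?F f (\<tau> g) = cF (LGen g)"
      using Gc[OF g]
    proof (elim disjE exE conjE)
      fix n p assume n: "g = Inl (n, \<iota> p)" "\<iota> p \<in> deg ?A n"
      show ?thesis
      proof (cases "n = 1")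
        case True
        then show ?thesis using g1_comb[of "fst p" "snd p"]
          by (simp add: n \<tau>_simps \<xi>_def \<eta>_def F.lin_term_eval g1_def[symmetric] comb del: F.lin_comb.simps lin_term.simps)
      next
        case False
        then have "\<iota> p = \<iota> 0" using n(2) by (simp add: degA)
        then show ?thesis using False g1_zero[of n] by (simp add: n \<tau>_simps g1_def[symmetric])
      qed
    next
      fix n y assume n: "g = Inr (n, y)" "y \<in> deg ?B n"
      have "lie_eval ?F f (rep n y) = g2 n (cY (rep n y))"
        using rep(1)[OF n(2)] unfolding hY_def by (intro evY) auto
      then show ?thesis using rep(2)[OF n(2)] by (simp add: n \<tau>_simps g2_def)
    qed
    then have "cF (lie_subst \<sigma> (\<tau> g)) = cF (LGen g)" unfolding cF\<sigma>[OF \<tau>(1)[OF g]] .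
    then show "lie_eq G S (lie_subst \<sigma> (\<tau> g)) (LGen g)"
      unfolding cF_def lie_class_eq_iff[OF s\<sigma>[OF \<tau>(1)[OF g]]] .
  qed (use \<sigma> \<tau> in auto)
  then show ?thesis unfolding free_product_def G_def S_def e_def Y_def .
qed

theorem bb_lie_free_product:
  fixes V :: "'v set"
  assumes V: "finite V" "simplicial_graph V E"
    and q: "quadratic_one_relator (bb_lie V E :: ('k::field, ('k, 'v) lie_term set) graded_lie)"
  shows "\<exists>(A :: ('k, ('k, 'v) lie_term set) graded_lie) (Y :: nat set).
    graded_lie_algebra A \<and> abelian_lie A \<and> has_dimension A 2 \<and>
    (bb_lie V E :: ('k, ('k, 'v) lie_term set) graded_lie) \<cong>\<^sub>L free_product A (free_lie Y)"
proof -
  let ?L = "bb_lie V E :: ('k, ('k, 'v) lie_term set) graded_lie"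
  obtain X :: "nat set" and r :: "('k, nat) lie_term" where r: "finite X" "r \<in> lie_terms X" "homogeneous (\<lambda>_. 1) 2 r"
    "\<not> lie_eq X {} r LZero" "?L \<cong>\<^sub>L presented_lie X (\<lambda>_. 1) {r}"
    using q unfolding quadratic_one_relator_def by blast
  then obtain \<phi> where phi: "\<phi> \<in> graded_lie_hom ?L (presented_lie X (\<lambda>_. 1) {r})"
    "bij_betw \<phi> (carrier ?L) (carrier (presented_lie X (\<lambda>_. 1) {r}))"
    "\<And>n. \<phi> ` deg ?L n = deg (presented_lie X (\<lambda>_. 1) {r}) n"
    unfolding graded_lie_iso_def by blast
  interpret one_relator_bb V E X r \<phi> by unfold_locales (use V r phi in auto)
  obtain i j where ij: "i \<in> X" "j \<in> X" "Q (delta i) (delta j) \<noteq> 0"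
    "\<And>x y. Q (delta x) (delta y) * Q (delta i) (delta j) =
      Q (delta x) (delta j) * Q (delta i) (delta y) - Q (delta y) (delta j) * Q (delta i) (delta x)"
    using relator_decomposable by blast
  \<comment> \<open>An injection of the coordinate plane into the carrier type that the statement
    prescribes: a pair is coded by a singleton.\<close>
  define \<iota> :: "'k \<times> 'k \<Rightarrow> ('k, 'v) lie_term set"
    where "\<iota> p = {LAdd (LSmul (fst p) LZero) (LSmul (snd p) LZero)}" for p
  have \<iota>: "inj \<iota>" by (rule injI) (simp add: \<iota>_def prod_eq_iff)
  have "?L \<cong>\<^sub>L free_product (plane \<iota>) (free_lie (X - {i, j}))"
    by (rule graded_lie_iso_trans[OF r(5) one_relator_free_product[OF r(1-3) ij \<iota>]])
  moreover have "abelian_lie (plane \<iota>)" by (simp add: abelian_lie_def plane_simps[OF \<iota>])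
  ultimately show ?thesis using plane_graded[OF \<iota>] plane_dimension[OF \<iota>] by blast
qed

theorem corollary3p1:
  shows "(\<forall>(V :: 'v set) E.
      finite V \<and> simplicial_graph V E \<and>
      quadratic_one_relator (bb_lie V E :: ('k::field, ('k, 'v) lie_term set) graded_lie) \<longrightarrow>
      (\<exists>(A :: ('k, ('k, 'v) lie_term set) graded_lie) (Y :: nat set).
        graded_lie_algebra A \<and> abelian_lie A \<and> has_dimension A 2 \<and>
        (bb_lie V E :: ('k, ('k, 'v) lie_term set) graded_lie) \<cong>\<^sub>L free_product A (free_lie Y)))
    \<and> (\<forall>g (S :: 's topology) x (W :: 'w set) F.
      2 \<le> g \<and> orientable_closed_surface g S \<and> x \<in> topspace S \<and> simplicial_graph W F \<longrightarrow>
      \<not> fundamental_group S x \<cong> bb_group W F)"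
proof (intro conjI allI impI)
  fix V :: "'v set" and E
  assume "finite V \<and> simplicial_graph V E \<and>
    quadratic_one_relator (bb_lie V E :: ('k::field, ('k, 'v) lie_term set) graded_lie)"
  then show "\<exists>(A :: ('k, ('k, 'v) lie_term set) graded_lie) (Y :: nat set).
      graded_lie_algebra A \<and> abelian_lie A \<and> has_dimension A 2 \<and>
      (bb_lie V E :: ('k, ('k, 'v) lie_term set) graded_lie) \<cong>\<^sub>L free_product A (free_lie Y)"
    by (intro bb_lie_free_product) simp_all
next
  fix g and S :: "'s topology" and x and W :: "'w set" and F
  assume "2 \<le> g \<and> orientable_closed_surface g S \<and> x \<in> topspace S \<and> simplicial_graph W F"
  then have g: "2 \<le> g" "orientable_closed_surface g S" "x \<in> topspace S" "simplicial_graph W F"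
    by simp_all
  show "\<not> fundamental_group S x \<cong> bb_group W F"
    by (rule surface_group_not_bb_group[OF g])
qed

end
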